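(* Let $N\ge 3$, let $\ell$ be a positive integer, $1<p<\frac{N}{N-2}$, $y_i\in\mathbb{R}^N$, $\mu_i>0$ for $i=1,\ldots,\ell$, and $\lambda_{ij}=\lambda_{ji}<0$ for $i\ne j$. Assume that $y_i\ne y_j$ if $i\ne j$. Let $\varepsilon_n>0$, $\varepsilon_n\to0$, and let $\mathbf v_n=(v_{n,1},\ldots,v_{n,\ell})$ be a nonnegative least energy solution of the system $$\begin{cases}-\Delta v_i+v_i=\mu_iQ_\varepsilon(x-y_i)|v_i|^{2p-2}v_i+\sum_{j\ne i}\lambda_{ij}|v_j|^p|v_i|^{p-2}v_i,\\ v_i\in H^1(\mathbb{R}^N),\quad v_i\neq 0,\quad i=1,\ldots,\ell,\end{cases}$$ with $\varepsilon=\varepsilon_n$. Set $w_{n,i}(x):=\varepsilon_n^{\frac1{p-1}}v_{n,i}(\varepsilon_nx+y_i)$. Then, after passing to a subsequence, for every $i=1,\ldots,\ell$, $w_{n,i}\to w_i$ strongly in $E$, where $w_i$ is a positive least energy solution of the equation $$-\Delta w=\mu_iQ_1(x)|w|^{2p-2}w,\qquad w\in E,\quad w\ne0.$$ As a consequence (along this subsequence), for any $\delta>0$ and every $i=1,\ldots,\ell$, $$\lim_{n\to\infty}\frac{\int_{|x-y_i|\le\delta}(|\nabla v_{n,i}|^2+v_{n,i}^2)}{\int_{\mathbb{R}^N}(|\nabla v_{n,i}|^2+v_{n,i}^2)}=1\qquad\text{and}\qquad\lim_{n\to\infty}\frac{\int_{|x-y_i|\le\delta}|v_{n,i}|^{2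p}}{\int_{\mathbb{R}^N}|v_{n,i}|^{2p}}=1.$$
   Context: For $\varepsilon>0$, $Q_\varepsilon(x):=1$ if $|x|<\varepsilon$ and $Q_\varepsilon(x):=-1$ if $|x|\ge\varepsilon$. For $1<p<2$ the expression $|t|^{p-2}t$ is taken to be $0$ at $t=0$. $E:=D^{1,2}(\mathbb{R}^N)\cap L^{2p}(\mathbb{R}^N)$ is the Banach space with norm $\|u\|_E^2:=\|u\|^2+|u|_{2p}^2$, where $\|u\|^2:=\int_{\mathbb{R}^N}|\nabla u|^2$ and $|u|_{2p}^{2p}:=\int_{\mathbb{R}^N}|u|^{2p}$. Solutions of the system are weak solutions, i.e. critical points with all components nontrivial of the functional on $(H^1(\mathbb{R}^N))^\ell$ $$I_\varepsilon(\mathbf v):=\frac12\sum_{i=1}^\ell\int_{\mathbb{R}^N}(|\nabla v_i|^2+v_i^2)-\frac1{2p}\sum_{i=1}^\ell\int_{\mathbb{R}^N}\mu_iQ_\varepsilon(x-y_i)|v_i|^{2p}-\frac1{2p}\sum_{i\ne j}\int_{\mathbb{R}^N}\lambda_{ij}|v_j|^p|v_i|^p$$ (the last sum is over ordered pairs $(i,j)$ with $i\neq j$). A solution is nonnegative if $v_i\ge0$ for all $i$. A least energy solution of the system is a solution at which $I_\varepsilon$ attains its infimum over the Nehari-type set $$\Big\{\mathbf v\in (H^1(\mathbb{R}^N))^\ell: v_i\ne0,\ \int_{\mathbb{R}^N}(|\nabla v_i|^2+v_i^2)=\int_{\mathbb{R}^N}\mu_iQ_\varepsilon(x-y_i)|v_i|^{2p}+\sum_{j\ne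 i}\int_{\mathbb{R}^N}\lambda_{ij}|v_j|^p|v_i|^p\ \text{ for all } i\Big\}.$$ Solutions of the single equation are the nontrivial critical points of $J_i:E\to\mathbb{R}$, $J_i(w):=\frac12\|w\|^2-\frac1{2p}\int_{\mathbb{R}^N}\mu_iQ_1(x)|w|^{2p}$; a least energy solution of it is a solution $w$ with $J_i(w)=\inf_{\mathcal{M}_i}J_i$, where $\mathcal{M}_i:=\{w\in E:w\ne0,\ J_i'(w)w=0\}$. *)

theory Defs
  imports "HOL-Analysis.Analysis" "HOL-Library.Function_Algebras"
begin

instantiation "fun" :: (type, real_vector) real_vector
begin

definition scaleR_fun :: "real \<Rightarrow> ('a \<Rightarrow> 'b) \<Rightarrow> 'a \<Rightarrow> 'b"
  where "scaleR_fun c f = (\<lambda>x. c *\<^sub>R f x)"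

instance
  by standard (auto simp: scaleR_fun_def fun_eq_iff scaleR_add_right scaleR_add_left)

end

text \<open>
  Elements of Lebesgue and Sobolev spaces are represented by Borel measurable functions; every
  almost-everywhere class has such a representative.  Accordingly, statements such as
  ``nontrivial'', ``nonnegative'' and ``positive'' are read almost everywhere.
\<close>

definition partial_deriv :: "'n \<Rightarrow> (real ^ 'n \<Rightarrow> real) \<Rightarrow> real ^ 'n \<Rightarrow> real"
  where "partial_deriv k f x = frechet_derivative f (at x) (axis k 1)"

primrec C_k :: "nat \<Rightarrow> (real ^ 'n \<Rightarrow> real) \<Rightarrow> bool" where
  "C_k 0 f \<longleftrightarrow> continuous_on UNIV f"
| "C_k (Suc m) f \<longleftrightarrow> (\<forall>x. f differentiable (at x)) \<and> (\<forall>k. C_k m (partial_deriv k f))"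

definition test_functions :: "(real ^ 'n \<Rightarrow> real) set"
  where "test_functions = {\<phi>. (\<forall>m. C_k m \<phi>) \<and> compact (closure {x. \<phi> x \<noteq> 0})}"

definition locally_integrable :: "(real ^ 'n \<Rightarrow> 'b::{banach, second_countable_topology}) \<Rightarrow> bool"
  where "locally_integrable f \<longleftrightarrow> (\<forall>K. compact K \<longrightarrow> set_integrable lborel K f)"

definition has_weak_gradient :: "(real ^ 'n \<Rightarrow> real) \<Rightarrow> (real ^ 'n \<Rightarrow> real ^ 'n) \<Rightarrow> bool"
  where "has_weak_gradient u G \<longleftrightarrow> locally_integrable u \<and> locally_integrable G \<and>
    (\<forall>\<phi>\<in>test_functions. \<forall>k.
      (\<integral>x. u x * partial_deriv k \<phi> x \<partial>lborel) = - (\<integral>x. G x $ k * \<phi> x \<partial>lborel))"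

text \<open>Weak gradients are unique up to null sets, so the choice does not affect integrals.\<close>

definition weak_grad :: "(real ^ 'n \<Rightarrow> real) \<Rightarrow> real ^ 'n \<Rightarrow> real ^ 'n"
  where "weak_grad u = (SOME G. has_weak_gradient u G)"

definition has_L2_gradient :: "(real ^ 'n \<Rightarrow> real) \<Rightarrow> bool"
  where "has_L2_gradient u \<longleftrightarrow>
    (\<exists>G. has_weak_gradient u G) \<and> integrable lborel (\<lambda>x. (norm (weak_grad u x))\<^sup>2)"

definition nontrivial :: "(real ^ 'n \<Rightarrow> real) \<Rightarrow> bool"
  where "nontrivial u \<longleftrightarrow> \<not> (AE x in lborel. u x = 0)"

definition Lq :: "real \<Rightarrow> (real ^ 'n \<Rightarrow> real) set"
  where "Lq q = {u \<in> borel_measurable lborel. integrable lborel (\<lambda>x. \<bar>u x\<bar> powr q)}"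

definition Lq_norm :: "real \<Rightarrow> (real ^ 'n \<Rightarrow> real) \<Rightarrow> real"
  where "Lq_norm q u = (\<integral>x. \<bar>u x\<bar> powr q \<partial>lborel) powr (1 / q)"

definition H1 :: "(real ^ 'n \<Rightarrow> real) set"
  where "H1 = {u \<in> Lq 2. has_L2_gradient u}"

definition H1_norm :: "(real ^ 'n \<Rightarrow> real) \<Rightarrow> real"
  where "H1_norm u = sqrt (\<integral>x. ((norm (weak_grad u x))\<^sup>2 + (u x)\<^sup>2) \<partial>lborel)"

definition H1_prod :: "('l::finite \<Rightarrow> real ^ 'n \<Rightarrow> real) set"
  where "H1_prod = {v. \<forall>i. v i \<in> H1}"

definition H1_prod_norm :: "('l::finite \<Rightarrow> real ^ 'n \<Rightarrow> real) \<Rightarrow> real"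
  where "H1_prod_norm v = sqrt (\<Sum>i\<in>UNIV. (H1_norm (v i))\<^sup>2)"

text \<open>
  For \<open>N \<ge> 3\<close>, \<open>D12\<close> consists of the functions in \<open>L\<close> to the critical Sobolev exponent
  \<open>2 N / (N - 2)\<close> whose weak gradient is square integrable.
\<close>

definition D12 :: "(real ^ 'n \<Rightarrow> real) set"
  where "D12 = {u \<in> Lq (2 * real CARD('n) / (real CARD('n) - 2)). has_L2_gradient u}"

definition D12_norm :: "(real ^ 'n \<Rightarrow> real) \<Rightarrow> real"
  where "D12_norm u = sqrt (\<integral>x. (norm (weak_grad u x))\<^sup>2 \<partial>lborel)"

definition E_space :: "real \<Rightarrow> (real ^ 'n \<Rightarrow> real) set"
  where "E_space p = D12 \<inter> Lq (2 * p)"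

definition E_norm :: "real \<Rightarrow> (real ^ 'n \<Rightarrow> real) \<Rightarrow> real"
  where "E_norm p u = sqrt ((D12_norm u)\<^sup>2 + (Lq_norm (2 * p) u)\<^sup>2)"

text \<open>
  Membership is part of convergence, since \<open>E_norm\<close> has no meaning outside \<open>E_space\<close>
  (a Bochner integral that does not exist is \<open>0\<close>).
\<close>

definition tendsto_in_E ::
    "real \<Rightarrow> (nat \<Rightarrow> real ^ 'n \<Rightarrow> real) \<Rightarrow> (real ^ 'n \<Rightarrow> real) \<Rightarrow> bool"
  where "tendsto_in_E p u w \<longleftrightarrow> (\<forall>n. u n \<in> E_space p) \<and> w \<in> E_space p \<and>
    (\<lambda>n. E_norm p (u n - w)) \<longlonglongrightarrow> 0"

text \<open>
  \<open>L\<close> is the Frechet derivative at \<open>u\<close> of the functional \<open>F\<close> on the space \<open>X\<close> normed by \<open>nrm\<close>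
  (as a space of representatives, \<open>X\<close> is a linear subspace of the functions, and \<open>nrm\<close> a
  seminorm vanishing exactly on the functions that are \<open>0\<close> almost everywhere).
\<close>

definition has_Frechet_derivative ::
    "'v::real_vector set \<Rightarrow> ('v \<Rightarrow> real) \<Rightarrow> ('v \<Rightarrow> real) \<Rightarrow> 'v \<Rightarrow> ('v \<Rightarrow> real) \<Rightarrow> bool"
  where "has_Frechet_derivative X nrm F u L \<longleftrightarrow> u \<in> X \<and>
    (\<forall>h\<in>X. \<forall>k\<in>X. L (h + k) = L h + L k) \<and>
    (\<forall>c. \<forall>h\<in>X. L (c *\<^sub>R h) = c * L h) \<and>
    (\<exists>C. \<forall>h\<in>X. \<bar>L h\<bar> \<le> C * nrm h) \<and>
    (\<forall>\<eta>>0. \<exists>\<delta>>0. \<forall>h\<in>X. nrm h < \<delta> \<longrightarrow> \<bar>F (u + h) - F u - L h\<bar> \<le> \<eta> * nrm h)"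

definition critical_point ::
    "'v::real_vector set \<Rightarrow> ('v \<Rightarrow> real) \<Rightarrow> ('v \<Rightarrow> real) \<Rightarrow> 'v \<Rightarrow> bool"
  where "critical_point X nrm F u \<longleftrightarrow> has_Frechet_derivative X nrm F u (\<lambda>h. 0)"

definition attains_inf_on :: "('v \<Rightarrow> real) \<Rightarrow> 'v set \<Rightarrow> 'v \<Rightarrow> bool"
  where "attains_inf_on F S u \<longleftrightarrow> u \<in> S \<and> (\<forall>w\<in>S. F u \<le> F w)"

definition Q :: "real \<Rightarrow> real ^ 'n \<Rightarrow> real"
  where "Q \<epsilon> x = (if norm x < \<epsilon> then 1 else -1)"

definition I_func ::
    "real \<Rightarrow> ('l::finite \<Rightarrow> real) \<Rightarrow> ('l \<Rightarrow> 'l \<Rightarrow> real) \<Rightarrow> ('l \<Rightarrow> real ^ 'n) \<Rightarrow> real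
      \<Rightarrow> ('l \<Rightarrow> real ^ 'n \<Rightarrow> real) \<Rightarrow> real"
  where "I_func p \<mu> lam y \<epsilon> v =
    1 / 2 * (\<Sum>i\<in>UNIV. \<integral>x. ((norm (weak_grad (v i) x))\<^sup>2 + (v i x)\<^sup>2) \<partial>lborel)
    - 1 / (2 * p) * (\<Sum>i\<in>UNIV. \<integral>x. \<mu> i * Q \<epsilon> (x - y i) * \<bar>v i x\<bar> powr (2 * p) \<partial>lborel)
    - 1 / (2 * p) * (\<Sum>i\<in>UNIV. \<Sum>j\<in>UNIV - {i}.
        \<integral>x. lam i j * \<bar>v j x\<bar> powr p * \<bar>v i x\<bar> powr p \<partial>lborel)"

definition solves_system ::
    "real \<Rightarrow> ('l::finite \<Rightarrow> real) \<Rightarrow> ('l \<Rightarrow> 'l \<Rightarrow> real) \<Rightarrow> ('l \<Rightarrow> real ^ 'n) \<Rightarrow> real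
      \<Rightarrow> ('l \<Rightarrow> real ^ 'n \<Rightarrow> real) \<Rightarrow> bool"
  where "solves_system p \<mu> lam y \<epsilon> v \<longleftrightarrow>
    critical_point H1_prod H1_prod_norm (I_func p \<mu> lam y \<epsilon>) v \<and> (\<forall>i. nontrivial (v i))"

definition Nehari_system ::
    "real \<Rightarrow> ('l::finite \<Rightarrow> real) \<Rightarrow> ('l \<Rightarrow> 'l \<Rightarrow> real) \<Rightarrow> ('l \<Rightarrow> real ^ 'n) \<Rightarrow> real
      \<Rightarrow> ('l \<Rightarrow> real ^ 'n \<Rightarrow> real) set"
  where "Nehari_system p \<mu> lam y \<epsilon> = {v \<in> H1_prod. \<forall>i. nontrivial (v i) \<and>
    (\<integral>x. ((norm (weak_grad (v i) x))\<^sup>2 + (v i x)\<^sup>2) \<partial>lborel) =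
      (\<integral>x. \<mu> i * Q \<epsilon> (x - y i) * \<bar>v i x\<bar> powr (2 * p) \<partial>lborel)
      + (\<Sum>j\<in>UNIV - {i}. \<integral>x. lam i j * \<bar>v j x\<bar> powr p * \<bar>v i x\<bar> powr p \<partial>lborel)}"

definition least_energy_system ::
    "real \<Rightarrow> ('l::finite \<Rightarrow> real) \<Rightarrow> ('l \<Rightarrow> 'l \<Rightarrow> real) \<Rightarrow> ('l \<Rightarrow> real ^ 'n) \<Rightarrow> real
      \<Rightarrow> ('l \<Rightarrow> real ^ 'n \<Rightarrow> real) \<Rightarrow> bool"
  where "least_energy_system p \<mu> lam y \<epsilon> v \<longleftrightarrow> solves_system p \<mu> lam y \<epsilon> v \<and>
    attains_inf_on (I_func p \<mu> lam y \<epsilon>) (Nehari_system p \<mu> lam y \<epsilon>) v"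

definition J_func :: "real \<Rightarrow> real \<Rightarrow> (real ^ 'n \<Rightarrow> real) \<Rightarrow> real"
  where "J_func p m w = 1 / 2 * (D12_norm w)\<^sup>2
    - 1 / (2 * p) * (\<integral>x. m * Q 1 x * \<bar>w x\<bar> powr (2 * p) \<partial>lborel)"

definition solves_limit :: "real \<Rightarrow> real \<Rightarrow> (real ^ 'n \<Rightarrow> real) \<Rightarrow> bool"
  where "solves_limit p m w \<longleftrightarrow>
    critical_point (E_space p) (E_norm p) (J_func p m) w \<and> nontrivial w"

definition Nehari_limit :: "real \<Rightarrow> real \<Rightarrow> (real ^ 'n \<Rightarrow> real) set"
  where "Nehari_limit p m = {w \<in> E_space p. nontrivial w \<and>
    (\<exists>L. has_Frechet_derivative (E_space p) (E_norm p) (J_func p m) w L \<and> L w = 0)}"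

definition least_energy_limit :: "real \<Rightarrow> real \<Rightarrow> (real ^ 'n \<Rightarrow> real) \<Rightarrow> bool"
  where "least_energy_limit p m w \<longleftrightarrow> solves_limit p m w \<and>
    attains_inf_on (J_func p m) (Nehari_limit p m) w"

end

theory Submission
 imports Defs "HOL-Library.Diagonal_Subsequence"
begin

text \<open>Rescaling turns the system into the single equation with weight \<open>\<mu> Q\<^sub>1\<close>, a mass term \<open>\<epsilon>\<^sup>2 w\<close> and repulsive
 interactions. Since the interactions are repulsive, each rescaled component satisfies \<open>\<parallel>w\<parallel>\<^sup>2 \<le> \<integral>\<mu> Q\<^sub>1 |w|\<^sup>2\<^sup>p\<close>, so projecting
 it onto the natural constraint of the limit equation bounds its energy from below by the least level \<open>c\<^sub>i\<close>. Conversely,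
 near-minimizers of the limit problem, cut off to compact support, shrink around the distinct points \<open>y\<^sub>i\<close>, do not interact
 and bound the sum of the energies from above by \<open>\<Sum>c\<^sub>i + o(1)\<close>. Hence every component is a minimizing sequence with
 vanishing mass term. Because \<open>2p\<close> is subcritical, a subsequence is precompact in \<open>L\<^sup>2\<^sup>p\<close> on the unit ball, the only region
 where \<open>Q\<^sub>1\<close> is positive; the parallelogram identity and Clarkson's inequality then upgrade this to strong convergence in \<open>E\<close>.
 Minimizers are critical points, and testing the equation with \<open>\<phi>\<^sup>2 / (w + d)\<close>, \<open>d \<rightarrow> 0\<close>, shows that they are positive. The
 concentration ratios are tails of convergent integrals after rescaling.\<close>

text \<open>Apart from the algebraic rules, every estimate on weak gradients comes from one source:
  u(x + z) - u(x) is an integral of the gradient along the segment from x to x + z, so a translation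
  by z costs at most |z| times the gradient in L^2. The chain rule, the Sobolev inequality, local
  compactness and positivity are all drawn from it. Projection onto the natural constraint occurs
  only through the homogeneous inequality c^(p-1) \<open>qmass\<close> <=
  \<open>dirichlet\<close>^p. It holds off the constraint as well, hence at midpoints and along
  lines, where it also takes the place of a Lagrange multiplier. Limits are obtained as Cauchy
  limits, never as weak limits. The obstacle is the exterior of the unit ball: there is no
  compactness there, but the weight is negative, so that averaging two functions lowers their
  exterior mass and any persistent oscillation would violate the projection inequality. Functions in
  E need not be square integrable, whereas competitors for the system lie in H^1. The cutoffs that
  bridge the gap rely on the invariance under dilation of the L^N norm of a gradient, N being the
  dimension.\<close>

lemmas L1_add = Bochner_Integration.integrable_add
lemmas L1_bound = Bochner_Integration.integrable_bound
lemmas L1_diff = Bochner_Integration.integrable_diff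
lemmas L1_sum = Bochner_Integration.integrable_sum
lemmas LINT_add = Bochner_Integration.integral_add
lemmas LINT_cong = Bochner_Integration.integral_cong
lemmas LINT_mono = Bochner_Integration.integral_mono
lemmas LINT_sum = Bochner_Integration.integral_sum

section \<open>Smooth bump functions\<close>

lemma partial_deriv_eq:
 assumes "(f has_derivative f') (at x)"
 shows "partial_deriv k f x = f' (axis k 1)"
 using frechet_derivative_at[OF assms] by (simp add: partial_deriv_def)

lemma C_k_continuous: "C_k m f ==> continuous_on UNIV f"
 by (cases m) (auto intro!: differentiable_imp_continuous_on simp: differentiable_on_def)

lemma C_k_Suc_D: "C_k (Suc m) f ==> C_k m f"
proof (induction m arbitrary: f)
 case 0
 then show ?case using C_k_continuous[of "Suc 0" f] by simp
qed auto

lemma C_k_const [simp]: "C_k m (%x. c)"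
proof (induction m arbitrary: c)
 case (Suc m)
 have "partial_deriv k (%x. c) = (%x. 0)" for k :: 'a
  by (rule ext) (simp add: partial_deriv_eq[OF has_derivative_const])
 then show ?case using Suc by simp
qed (simp add: continuous_intros)

lemma C_k_add: "C_k m f ==> C_k m g ==> C_k m (%x. f x + g x)"
proof (induction m arbitrary: f g)
 case (Suc m)
 have *: "partial_deriv k (%x. f x + g x) = (%x. partial_deriv k f x + partial_deriv k g x)" for k
 proof
  fix x
  have "((%x. f x + g x) has_derivative
    (%h. frechet_derivative f (at x) h + frechet_derivative g (at x) h)) (at x)"
   using Suc.prems by (intro has_derivative_add) (auto simp: frechet_derivative_works[symmetric])
  from partial_deriv_eq[OF this]
  show "partial_deriv k (%x. f x + g x) x = partial_deriv k f x + partial_deriv k g x"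
   by (simp add: partial_deriv_def)
 qed
 show ?case using Suc by (auto simp: *)
qed (auto intro: continuous_intros)

lemma partial_deriv_mult:
 assumes "f differentiable (at x)" "g differentiable (at x)"
 shows "partial_deriv k (%x. f x * g x) x = f x * partial_deriv k g x + partial_deriv k f x * g x"
proof -
 have "((%x. f x * g x) has_derivative
   (%h. f x * frechet_derivative g (at x) h + frechet_derivative f (at x) h * g x)) (at x)"
  using assms by (intro has_derivative_mult) (auto simp: frechet_derivative_works[symmetric])
 from partial_deriv_eq[OF this] show ?thesis by (simp add: partial_deriv_def)
qed

lemma C_k_mult: "C_k m f ==> C_k m g ==> C_k m (%x. f x * g x)"
proof (induction m arbitrary: f g)
 case (Suc m)
 have *: "partial_deriv k (%x. f x * g x) =
   (%x. f x * partial_deriv k g x + partial_deriv k f x * g x)" for k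
  using Suc.prems by (intro ext partial_deriv_mult) auto
 have "C_k m f" "C_k m g" using Suc.prems C_k_Suc_D by blast+
 then show ?case using Suc by (auto simp: * intro!: C_k_add)
qed (auto intro: continuous_intros)

lemma C_k_prod: "finite A ==> (!!i. i \<in> A ==> C_k m (f i)) ==> C_k m (%x. \<Prod>i\<in>A. f i x)"
 by (induction A rule: finite_induct) (auto intro: C_k_mult)

lemma partial_deriv_affine:
 assumes "f differentiable (at (a *\<^sub>R x + b))"
 shows "partial_deriv k (%x. f (a *\<^sub>R x + b)) x = a * partial_deriv k f (a *\<^sub>R x + b)"
proof -
 have 1: "(f has_derivative frechet_derivative f (at (a *\<^sub>R x + b))) (at (a *\<^sub>R x + b))"
  using assms by (simp add: frechet_derivative_works[symmetric])
 have 2: "((%x. a *\<^sub>R x + b) has_derivative (%h. a *\<^sub>R h)) (at x)"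
  by (auto intro!: derivative_eq_intros)
 from partial_deriv_eq[OF has_derivative_compose[OF 2 1]]
 show ?thesis
  using linear_scale[OF linear_frechet_derivative[OF assms]] by (simp add: partial_deriv_def)
qed

lemma C_k_affine: "C_k m f ==> C_k m (%x. f (a *\<^sub>R x + b))"
proof (induction m arbitrary: f)
 case 0
 then have "continuous_on UNIV (f \<circ> (%x. a *\<^sub>R x + b))"
  by (intro continuous_on_compose continuous_intros) (auto intro: continuous_on_subset)
 then show ?case by (simp add: o_def)
next
 case (Suc m)
 have *: "partial_deriv k (%x. f (a *\<^sub>R x + b)) = (%x. a * partial_deriv k f (a *\<^sub>R x + b))" for k
  using Suc.prems by (intro ext partial_deriv_affine) auto
 have "(%x. f (a *\<^sub>R x + b)) differentiable (at x)" for x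
  using Suc.prems differentiable_chain_at[of "%x. a *\<^sub>R x + b" x f]
  by (auto simp: o_def)
 then show ?case using Suc.IH Suc.prems by (auto simp: * intro!: C_k_mult)
qed

text \<open>The whole sequence of successive derivatives is carried along: differentiating
  \<open>F j (g x)\<close> produces \<open>F (Suc j) (g x)\<close> times a partial derivative of
  \<open>g\<close>, so the induction on \<open>m\<close> closes only with \<open>j\<close>
  arbitrary.\<close>

lemma C_k_compose:
 fixes F :: "nat => real => real"
 assumes F: "!!j t. (F j has_real_derivative F (Suc j) t) (at t)" and g: "!!m. C_k m g"
 shows "C_k m (%x. F j (g x))"
proof (induction m arbitrary: j)
 case 0
 have "continuous_on UNIV (F j)"
  using F DERIV_isCont continuous_at_imp_continuous_on by blast
 then show ?case using C_k_continuous[OF g[of 0]]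
  by (auto intro: continuous_on_compose2)
next
 case (Suc m)
 have D: "((%x. F j (g x)) has_derivative (%h. frechet_derivative g (at x) h * F (Suc j) (g x))) (at x)" for x
 proof -
  have "(g has_derivative frechet_derivative g (at x)) (at x)"
   using g[of "Suc 0"] by (simp add: frechet_derivative_works[symmetric])
  moreover have "(F j has_derivative (%h. h * F (Suc j) (g x))) (at (g x))"
   using F[of j "g x"] by (simp add: has_field_derivative_def mult_commute_abs)
  ultimately show ?thesis by (rule has_derivative_compose)
 qed
 then have *: "partial_deriv k (%x. F j (g x)) = (%x. partial_deriv k g x * F (Suc j) (g x))" for k
  by (intro ext) (simp add: partial_deriv_eq[OF D] partial_deriv_def)
 have "C_k m (partial_deriv k g)" for k using g[of "Suc m"] by simp
 then show ?case using D Suc by (auto simp: * differentiable_def intro!: C_k_mult)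
qed

lemma C_k_nth: "C_k m (%x. x $ i)"
proof (cases m)
 case (Suc n)
 have D: "((%x. x $ i) has_derivative (%h. h $ i)) (at x)" for x :: "real ^ 'a"
  by (simp add: bounded_linear_vec_nth bounded_linear_imp_has_derivative)
 have "partial_deriv k (%x::real^'a. x $ i) = (%x. (axis k 1 :: real^'a) $ i)" for k
  by (intro ext) (simp add: partial_deriv_eq[OF D])
 then show ?thesis using D by (auto simp: Suc differentiable_def)
qed (simp add: continuous_intros)

text \<open>The functions \<open>t \<mapsto> P(1/t) exp(-1/t)\<close>, extended by \<open>0\<close> to \<open>t \<le> 0\<close>, are stable under
 differentiation.\<close>

definition flat_exp :: "real poly => real => real"
 where "flat_exp P t = (if t > 0 then poly P (1 / t) * exp (- (1 / t)) else 0)"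

lemma tendsto_poly_times_exp: "((%s. poly P s * exp (- s)) \<longlongrightarrow> (0::real)) at_top"
proof -
 have "((%s. \<Sum>i\<le>degree P. coeff P i * (s ^ i / exp s)) \<longlongrightarrow> (\<Sum>i\<le>degree P. coeff P i * 0)) at_top"
  by (intro tendsto_sum tendsto_mult tendsto_const tendsto_power_div_exp_0)
 then show ?thesis
  by (simp add: poly_altdef exp_minus sum_distrib_right divide_inverse mult.assoc)
qed

text \<open>With s = 1/t, the chain rule yields the polynomial factor s^2 (P(s) - P'(s)), which is
  the one in the statement. At t = 0 the right difference quotient is s P(s) exp(-s), and the
  exponential wins.\<close>

lemma flat_exp_deriv:
 "(flat_exp P has_real_derivative flat_exp ([:0, 0, 1:] * (P - pderiv P)) t) (at t)"
proof -
 consider "t > 0" | "t < 0" | "t = 0" by linarith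
 then show ?thesis
 proof cases
  case 1
  have "((%t. poly P (1 / t) * exp (- (1 / t))) has_real_derivative
    flat_exp ([:0, 0, 1:] * (P - pderiv P)) t) (at t)"
   using 1
   by (auto intro!: derivative_eq_intros DERIV_chain'[OF _ poly_DERIV]
     simp: flat_exp_def field_simps power2_eq_square)
  then show ?thesis
   by (rule DERIV_cong_ev[THEN iffD1, OF refl _ refl, rotated])
    (use 1 in \<open>auto simp: flat_exp_def intro: eventually_mono[OF eventually_nhds_in_open[of "{0<..}" t]]\<close>)
 next
  case 2
  have "((%t. 0) has_real_derivative flat_exp ([:0, 0, 1:] * (P - pderiv P)) t) (at t)"
   using 2 by (simp add: flat_exp_def)
  then show ?thesis
   by (rule DERIV_cong_ev[THEN iffD1, OF refl _ refl, rotated])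
    (use 2 in \<open>auto simp: flat_exp_def intro: eventually_mono[OF eventually_nhds_in_open[of "{..<0}" t]]\<close>)
 next
  case 3
  have "((%h. poly ([:0, 1:] * P) (1 / h) * exp (- (1 / h))) \<longlongrightarrow> 0) (at_right 0)"
   using filterlim_compose[OF tendsto_poly_times_exp[of "[:0, 1:] * P"] filterlim_inverse_at_top_right]
   by (simp add: divide_inverse)
  then have R: "((%h. flat_exp P h / h) \<longlongrightarrow> 0) (at_right 0)"
   by (rule tendsto_cong[THEN iffD1, rotated])
    (auto simp: flat_exp_def eventually_at_right_field intro!: exI[of _ 1])
  have L: "((%h. flat_exp P h / h) \<longlongrightarrow> 0) (at_left 0)"
   by (rule tendsto_eventually) (auto simp: flat_exp_def eventually_at_left_field intro!: exI[of _ "-1"])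
  have "((%h. flat_exp P h / h) \<longlongrightarrow> 0) (at 0)"
   using L R by (simp add: filterlim_split_at)
  then show ?thesis using 3 by (simp add: DERIV_def flat_exp_def)
 qed
qed

definition smooth_step :: "real => real"
 where "smooth_step t = (if t > 0 then exp (- (1 / t)) else 0)"

lemma C_k_smooth_step:
 assumes "!!m. C_k m g"
 shows "C_k m (%x. smooth_step (g x))"
proof -
 define F where "F j = flat_exp (((%P. [:0, 0, 1:] * (P - pderiv P)) ^^ j) 1)" for j
 have "C_k m (%x. F 0 (g x))"
  by (rule C_k_compose[OF _ assms]) (simp only: F_def funpow.simps o_apply flat_exp_deriv)
 then show ?thesis by (simp add: F_def flat_exp_def smooth_step_def cong: if_cong)
qed

text \<open>For positive \<open>m\<close>, the factor \<open>m\<close> steepens the walls without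
  moving the zero set. All bumps of one box are therefore dominated by its indicator, which is what
  dominated convergence needs.\<close>

definition box_bump :: "nat => real ^ 'n => real ^ 'n => real ^ 'n => real"
 where "box_bump m a b x = (\<Prod>i\<in>UNIV. smooth_step (real m * (x $ i - a $ i))
  * smooth_step (real m * (b $ i - x $ i)))"

lemma C_k_box_bump: "C_k k (box_bump m a b)"
proof -
 have 1: "C_k k (%x. real m * (x $ i - a $ i))" for k i
  using C_k_mult[OF C_k_const C_k_add[OF C_k_nth C_k_const], of k "real m" i "- a $ i"] by simp
 have 2: "C_k k (%x. real m * (b $ i - x $ i))" for k i
  using C_k_mult[OF C_k_const C_k_add[OF C_k_const C_k_mult[OF C_k_const C_k_nth]], of k "real m" "b $ i" "-1" i]
  by simp
 show ?thesis unfolding box_bump_def[abs_def]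
  by (intro C_k_prod finite C_k_mult C_k_smooth_step 1 2)
qed

lemma smooth_step_bounds: "0 <= smooth_step t" "smooth_step t <= 1"
 by (auto simp: smooth_step_def)

lemma box_bump_bounds: "0 <= box_bump m a b x" "box_bump m a b x <= 1"
 unfolding box_bump_def
 by (auto intro!: prod_nonneg prod_le_1 mult_le_one simp: smooth_step_bounds)

lemma box_bump_pos: "m > 0 ==> x \<in> box a b ==> 0 < box_bump m a b x"
 unfolding box_bump_def by (auto intro!: prod_pos simp: mem_box_cart smooth_step_def)

lemma box_bump_outside: "x \<notin> box a b ==> box_bump m a b x = 0"
proof -
 assume "x \<notin> box a b"
 then obtain i where "x $ i <= a $ i \<or> b $ i <= x $ i" by (auto simp: mem_box_cart not_less)
 then have "smooth_step (real m * (x $ i - a $ i)) * smooth_step (real m * (b $ i - x $ i)) = 0"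
  by (auto simp: smooth_step_def zero_less_mult_iff)
 then show ?thesis by (auto simp: box_bump_def intro!: prod_zero)
qed

lemma box_bump_test [simp]: "box_bump m a b \<in> test_functions"
proof -
 have "{x. box_bump m a b x ~= 0} \<subseteq> cbox a b"
  using box_bump_outside[of _ a b m] box_subset_cbox[of a b] by blast
 then have "bounded (closure {x. box_bump m a b x ~= 0})"
  using bounded_subset[OF bounded_cbox] by (intro bounded_closure) auto
 then show ?thesis by (simp add: test_functions_def C_k_box_bump compact_eq_bounded_closed)
qed

lemma box_bump_tendsto: "(%m. box_bump m a b x) \<longlonglongrightarrow> indicator (box a b) x"
proof (cases "x \<in> box a b")
 case True
 have S: "(%m. smooth_step (real m * t)) \<longlonglongrightarrow> 1" if "t > 0" for t
 proof -
  have "(%m. exp (- (1 / (real m * t)))) \<longlonglongrightarrow> exp (- 0)"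
   using that by (intro tendsto_intros tendsto_divide_0[OF tendsto_const] filterlim_at_top_imp_at_infinity
     filterlim_at_top_mult_tendsto_pos[OF tendsto_const that] filterlim_real_sequentially)
  then have "(%m. exp (- (1 / (real m * t)))) \<longlonglongrightarrow> 1" by simp
  then show ?thesis
   by (rule tendsto_cong[THEN iffD1, rotated])
    (auto simp: smooth_step_def that intro!: eventually_mono[OF eventually_gt_at_top[of 0]])
 qed
 have "(%m. box_bump m a b x) \<longlonglongrightarrow> (\<Prod>i\<in>(UNIV::'a set). 1 * 1)"
  unfolding box_bump_def using True
  by (intro tendsto_prod tendsto_mult S) (auto simp: mem_box_cart)
 then show ?thesis using True by simp
qed (simp add: box_bump_outside)

section \<open>Test functions: bounds, supports, closure properties, directional derivatives\<close>

lemma test_functionD: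
 assumes "\<phi> \<in> test_functions"
 shows "C_k m \<phi>" "\<phi> differentiable (at x)" "continuous_on UNIV \<phi>" "\<phi> \<in> borel_measurable borel"
proof -
 show *: "C_k m \<phi>" for m using assms by (simp add: test_functions_def)
 show "\<phi> differentiable (at x)" using *[of "Suc 0"] by simp
 show c: "continuous_on UNIV \<phi>" using C_k_continuous *[of 0] by blast
 show "\<phi> \<in> borel_measurable borel" using c by (rule borel_measurable_continuous_onI)
qed

lemma test_function_support:
 assumes "\<phi> \<in> test_functions"
 obtains r where "r > 0" "!!x. norm x > r ==> \<phi> x = 0"
proof -
 have "bounded (closure {x. \<phi> x ~= 0})"
  using assms by (auto simp: test_functions_def compact_imp_bounded)
 then obtain r where "r > 0" "!!x. x \<in> closure {x. \<phi> x ~= 0} ==> norm x <= r"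
  by (auto simp: bounded_pos)
 moreover have "x \<in> closure {x. \<phi> x ~= 0}" if "\<phi> x ~= 0" for x
  using that by (meson closure_subset mem_Collect_eq subsetD)
 ultimately show ?thesis using that[of r] by force
qed

lemma test_functionI:
 assumes "!!m. C_k m \<phi>" "!!x. norm x > r ==> \<phi> x = 0"
 shows "\<phi> \<in> test_functions"
proof -
 have "{x. \<phi> x ~= 0} \<subseteq> cball 0 r" using assms(2) by (auto simp: not_less[symmetric])
 then have "bounded (closure {x. \<phi> x ~= 0})"
  using bounded_subset[OF bounded_cball] by (intro bounded_closure) auto
 then show ?thesis using assms(1) by (simp add: test_functions_def compact_eq_bounded_closed)
qed

lemma test_function_bounded:
 assumes "\<phi> \<in> test_functions"
 obtains B where "B > 0" "!!x. \<bar>\<phi> x\<bar> <= B"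
proof -
 obtain r where r: "r > 0" "!!x. norm x > r ==> \<phi> x = 0"
  using test_function_support[OF assms] by blast
 have "compact (\<phi> ` cball 0 r)"
  using test_functionD(3)[OF assms] by (intro compact_continuous_image) (auto intro: continuous_on_subset)
 then obtain B where B: "B > 0" "!!x. norm x <= r ==> \<bar>\<phi> x\<bar> <= B"
  using compact_imp_bounded bounded_pos[of "\<phi> ` cball 0 r"] by auto
 have "\<bar>\<phi> x\<bar> <= B" for x
  using r(2)[of x] B(2)[of x] B(1) by (cases "norm x > r") auto
 then show ?thesis using that B(1) by blast
qed

lemma test_function_mult:
 assumes "\<phi> \<in> test_functions" "!!m. C_k m g"
 shows "(%x. g x * \<phi> x) \<in> test_functions"
proof -
 obtain r where "!!x. norm x > r ==> \<phi> x = 0" using test_function_support[OF assms(1)] by blast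
 then show ?thesis
  by (intro test_functionI[where r=r] C_k_mult assms test_functionD(1)[OF assms(1)]) auto
qed

lemma test_function_affine:
 assumes "\<phi> \<in> test_functions" "a ~= 0"
 shows "(%x. \<phi> (a *\<^sub>R x + b)) \<in> test_functions"
proof -
 obtain r where r: "!!x. norm x > r ==> \<phi> x = 0" using test_function_support[OF assms(1)] by blast
 have "\<phi> (a *\<^sub>R x + b) = 0" if "norm x > (r + norm b) / \<bar>a\<bar>" for x
 proof (rule r)
  have "r + norm b < \<bar>a\<bar> * norm x" using that assms(2) by (simp add: field_simps)
  also have "... <= norm (a *\<^sub>R x + b) + norm b"
   using norm_triangle_ineq4[of "a *\<^sub>R x + b" b] by simp
  finally show "r < norm (a *\<^sub>R x + b)" by simp
 qed
 then show ?thesis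
  by (intro test_functionI C_k_affine test_functionD(1)[OF assms(1)])
qed

lemma test_function_partial:
 assumes "\<phi> \<in> test_functions"
 shows "partial_deriv k \<phi> \<in> test_functions"
proof -
 obtain r where r: "!!x. norm x > r ==> \<phi> x = 0" using test_function_support[OF assms] by blast
 have "partial_deriv k \<phi> x = 0" if "norm x > r" for x
 proof -
  have "open {y :: real^'a. r < norm y}" by (intro open_Collect_less continuous_intros)
  then have "(\<phi> has_derivative (%_. 0)) (at x)"
   using r that
   by (intro has_derivative_transform_within_open[of "%_. 0" "%_. 0" x UNIV "{y. r < norm y}" \<phi>]) auto
  then show ?thesis by (simp add: partial_deriv_eq)
 qed
 moreover have "C_k m (partial_deriv k \<phi>)" for m
  using test_functionD(1)[OF assms, of "Suc m"] by simp
 ultimately show ?thesis by (intro test_functionI)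
qed

text \<open>The directional derivative is kept as a finite sum of partial derivatives, so that the
  defining identity of a weak gradient, which speaks of coordinates, applies term by term.\<close>

definition dir_deriv :: "real ^ 'n => (real ^ 'n => real) => real ^ 'n => real"
 where "dir_deriv z \<phi> x = (\<Sum>k\<in>UNIV. z $ k * partial_deriv k \<phi> x)"

lemma has_derivative_dir_deriv:
 assumes "\<phi> differentiable (at x)"
 shows "(\<phi> has_derivative (%h. dir_deriv h \<phi> x)) (at x)"
proof -
 have lin: "linear (frechet_derivative \<phi> (at x))" using assms by (rule linear_frechet_derivative)
 have "frechet_derivative \<phi> (at x) h = dir_deriv h \<phi> x" for h
 proof -
  have "h = (\<Sum>k\<in>UNIV. h $ k *\<^sub>R axis k 1)"
   by (simp add: vec_eq_iff axis_def if_distrib[of "(*) _"] cong: if_cong)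
  then have "frechet_derivative \<phi> (at x) h = frechet_derivative \<phi> (at x) (\<Sum>k\<in>UNIV. h $ k *\<^sub>R axis k 1)"
   by simp
  also have "... = dir_deriv h \<phi> x"
   by (simp add: linear_sum[OF lin] linear_scale[OF lin] dir_deriv_def partial_deriv_def)
  finally show ?thesis .
 qed
 then have "frechet_derivative \<phi> (at x) = (%h. dir_deriv h \<phi> x)" by blast
 then show ?thesis using assms by (simp add: frechet_derivative_works)
qed

lemma dir_deriv_continuous:
 "\<phi> \<in> test_functions ==> continuous_on UNIV (dir_deriv z \<phi>)"
 unfolding dir_deriv_def[abs_def]
 by (intro continuous_intros test_functionD test_function_partial)

lemma dir_deriv_bound:
 assumes "\<phi> \<in> test_functions"
 obtains B where "B > 0" "!!z x. \<bar>dir_deriv z \<phi> x\<bar> <= B * norm z"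
proof -
 have "\<exists>B>0. \<forall>x. \<bar>partial_deriv k \<phi> x\<bar> <= B" for k
  using test_function_bounded[OF test_function_partial[OF assms]] by metis
 then obtain b where b: "!!k. b k > 0" "!!k x. \<bar>partial_deriv k \<phi> x\<bar> <= b k" by metis
 have "\<bar>dir_deriv z \<phi> x\<bar> <= sum b UNIV * norm z" for z x
 proof -
  have "\<bar>dir_deriv z \<phi> x\<bar> <= (\<Sum>k\<in>UNIV. norm z * b k)"
   unfolding dir_deriv_def
   by (rule order_trans[OF sum_abs]) (auto intro!: sum_mono mult_mono b component_le_norm_cart simp: abs_mult)
  then show ?thesis by (simp add: sum_distrib_left mult.commute)
 qed
 moreover have "sum b UNIV > 0" by (intro sum_pos b) auto
 ultimately show ?thesis using that by blast
qed

text \<open>The segment integral is written over the whole line with an indicator so that it can be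
  interchanged with integrals over space by Fubini's theorem.\<close>

lemma test_function_FTC:
 assumes "\<phi> \<in> test_functions"
 shows "\<phi> (x + z) - \<phi> x = (LINT s|lborel. indicator {0..1} s * dir_deriv z \<phi> (x + s *\<^sub>R z))"
proof -
 have "((%s. \<phi> (x + s *\<^sub>R z)) has_vector_derivative dir_deriv z \<phi> (x + s *\<^sub>R z)) (at s within {0..1})" for s
 proof -
  have "((%s. x + s *\<^sub>R z) has_derivative (%h. h *\<^sub>R z)) (at s within {0..1})"
   by (auto intro!: derivative_eq_intros)
  from has_derivative_compose[OF this has_derivative_dir_deriv[OF test_functionD(2)[OF assms]]]
  have "((%s. \<phi> (x + s *\<^sub>R z)) has_derivative (%h. dir_deriv (h *\<^sub>R z) \<phi> (x + s *\<^sub>R z))) (at s within {0..1})" .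
  then show ?thesis
   by (simp add: has_vector_derivative_def dir_deriv_def sum_distrib_left mult.assoc)
 qed
 moreover have "continuous_on {0..1} (%s. dir_deriv z \<phi> (x + s *\<^sub>R z))"
  by (rule continuous_on_compose2[OF dir_deriv_continuous[OF assms]]) (auto intro!: continuous_intros)
 ultimately have "(LINT s|lborel. indicator {0..1} s *\<^sub>R dir_deriv z \<phi> (x + s *\<^sub>R z)) = \<phi> (x + 1 *\<^sub>R z) - \<phi> (x + 0 *\<^sub>R z)"
  by (intro integral_FTC_atLeastAtMost) auto
 then show ?thesis by simp
qed

lemma test_function_Lipschitz:
 assumes "\<phi> \<in> test_functions"
 obtains B where "B > 0" "!!z x. \<bar>\<phi> (x + z) - \<phi> x\<bar> <= B * norm z"
proof -
 obtain B where B: "B > 0" "!!z x. \<bar>dir_deriv z \<phi> x\<bar> <= B * norm z" using dir_deriv_bound[OF assms] by blast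
 have "\<bar>\<phi> (x + z) - \<phi> x\<bar> <= B * norm z" for x z
 proof -
  have "integrable lborel (%s. indicator {0..1} s * dir_deriv z \<phi> (x + s *\<^sub>R z))"
   using borel_integrable_atLeastAtMost'[of 0 1 "%s. dir_deriv z \<phi> (x + s *\<^sub>R z)"]
    continuous_on_compose2[OF dir_deriv_continuous[OF assms], of "{0..1}" "%s. x + s *\<^sub>R z"]
   by (force simp: set_integrable_def intro!: continuous_intros)
  then have "(LINT s|lborel. \<bar>indicator {0..1} s * dir_deriv z \<phi> (x + s *\<^sub>R z)\<bar>)
    <= (LINT s|lborel. indicator {0..1::real} s * (B * norm z))"
  proof (rule LINT_mono[OF integrable_abs])
   show "integrable lborel (%s. indicator {0..1::real} s * (B * norm z))" by simp
  qed (use B in \<open>auto simp: indicator_def\<close>)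
  then have "\<bar>\<phi> (x + z) - \<phi> x\<bar> <= (LINT s|lborel. indicator {0..1::real} s * (B * norm z))"
   unfolding test_function_FTC[OF assms] by (rule order_trans[OF integral_abs_bound])
  also have "... = B * norm z" by simp
  finally show ?thesis .
 qed
 then show ?thesis using that B(1) by blast
qed

section \<open>Shifts of variables and local integrability\<close>

lemma cball_borel [measurable]: "cball a r \<in> sets borel"
 by simp

lemma nn_integral_shift:
 fixes z :: "'a::euclidean_space"
 assumes "f \<in> borel_measurable borel"
 shows "(\<integral>\<^sup>+x. f (x + z) \<partial>lborel) = (\<integral>\<^sup>+x. f x \<partial>lborel)"
proof -
 have "(\<integral>\<^sup>+x. f x \<partial>distr lborel borel ((+) z)) = (\<integral>\<^sup>+x. f (z + x) \<partial>lborel)"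
  using assms by (intro nn_integral_distr) auto
 then show ?thesis by (simp add: lborel_distr_plus add.commute)
qed

lemma integral_shift:
 fixes z :: "'a::euclidean_space" and f :: "_ => real"
 assumes "f \<in> borel_measurable borel"
 shows "(LINT x|lborel. f (x + z)) = (LINT x|lborel. f x)"
proof -
 have "(\<integral>x. f x \<partial>distr lborel borel ((+) z)) = (LINT x|lborel. f (z + x))"
  using assms by (intro integral_distr) auto
 then show ?thesis by (simp add: lborel_distr_plus add.commute)
qed

lemma locally_integrable_measurable:
 assumes "locally_integrable f"
 shows "f \<in> borel_measurable borel"
proof (rule borel_measurable_LIMSEQ_metric)
 show "(%x. indicator (cball 0 (real n)) x *\<^sub>R f x) \<in> borel_measurable borel" for n
 proof -
  have "set_integrable lborel (cball 0 (real n)) f" using assms by (simp add: locally_integrable_def)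
  then show ?thesis by (auto simp: set_integrable_def dest: borel_measurable_integrable)
 qed
 show "(%n. indicator (cball 0 (real n)) x *\<^sub>R f x) \<longlonglongrightarrow> f x" for x
 proof (rule tendsto_eventually, rule eventually_sequentiallyI)
  fix n assume "nat \<lceil>norm x\<rceil> <= n"
  then have "norm x <= real n" by linarith
  then show "indicator (cball 0 (real n)) x *\<^sub>R f x = f x" by simp
 qed
qed

lemma locally_integrableI:
 assumes "f \<in> borel_measurable borel" "!!r. (\<integral>\<^sup>+x. ennreal (norm (f x)) * indicator (cball 0 r) x \<partial>lborel) < \<infinity>"
 shows "locally_integrable f"
 unfolding locally_integrable_def set_integrable_def
proof (intro allI impI)
 fix K :: "(real^'a) set" assume K: "compact K"
 obtain r where r: "K \<subseteq> cball 0 r"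
  using compact_imp_bounded[OF K] by (auto simp: bounded_iff subset_eq)
 have [measurable]: "K \<in> sets borel" using K by (simp add: compact_imp_closed)
 note [measurable] = assms(1)
 have "(\<integral>\<^sup>+x. ennreal (norm (indicator K x *\<^sub>R f x)) \<partial>lborel)
   <= (\<integral>\<^sup>+x. ennreal (norm (f x)) * indicator (cball 0 r) x \<partial>lborel)"
  using r by (intro nn_integral_mono) (auto simp: indicator_def)
 also have "... < \<infinity>" by fact
 finally show "integrable lborel (%x. indicator K x *\<^sub>R f x)"
  by (intro integrableI_bounded) measurable
qed

lemma locally_integrable_nn:
 assumes "locally_integrable f"
 shows "(\<integral>\<^sup>+x. ennreal (norm (f x)) * indicator (cball 0 r) x \<partial>lborel) < \<infinity>"
proof -
 have "integrable lborel (%x. indicator (cball 0 r) x *\<^sub>R f x)"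
  using assms by (simp add: locally_integrable_def set_integrable_def)
 then have "(\<integral>\<^sup>+x. ennreal (norm (indicator (cball 0 r) x *\<^sub>R f x)) \<partial>lborel) < \<infinity>"
  by (simp add: integrable_iff_bounded)
 also have "(\<integral>\<^sup>+x. ennreal (norm (indicator (cball 0 r) x *\<^sub>R f x)) \<partial>lborel)
   = (\<integral>\<^sup>+x. ennreal (norm (f x)) * indicator (cball 0 r) x \<partial>lborel)"
  by (intro nn_integral_cong) (auto simp: indicator_def)
 finally show ?thesis .
qed

lemma locally_integrable_bound:
 fixes g :: "real ^ 'n => 'a::{banach, second_countable_topology}"
  and f :: "real ^ 'n => 'b::{banach, second_countable_topology}"
 assumes "locally_integrable g" "f \<in> borel_measurable borel" "!!x. norm (f x) <= C * norm (g x) + D" "C >= 0" "D >= 0"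
 shows "locally_integrable f"
proof (rule locally_integrableI[OF assms(2)])
 fix r
 note [measurable] = assms(2) locally_integrable_measurable[OF assms(1)]
 have "(\<integral>\<^sup>+x. ennreal (norm (f x)) * indicator (cball 0 r) x \<partial>lborel)
  <= (\<integral>\<^sup>+x. ennreal C * (ennreal (norm (g x)) * indicator (cball 0 r) x) + ennreal D * indicator (cball 0 r) x \<partial>lborel)"
  using assms(3-5)
  by (intro nn_integral_mono) (auto simp: indicator_def ennreal_mult[symmetric] ennreal_plus[symmetric] simp del: ennreal_plus)
 also have "... = ennreal C * (\<integral>\<^sup>+x. ennreal (norm (g x)) * indicator (cball 0 r) x \<partial>lborel)
   + ennreal D * emeasure lborel (cball (0 :: real ^ 'n) r)"
  by (subst nn_integral_add, measurable) (simp add: nn_integral_cmult nn_integral_cmult_indicator)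
 also have "... < \<infinity>"
  using locally_integrable_nn[OF assms(1)] emeasure_lborel_cball_finite
  by (auto simp: ennreal_mult_less_top)
 finally show "(\<integral>\<^sup>+x. ennreal (norm (f x)) * indicator (cball 0 r) x \<partial>lborel) < \<infinity>" .
qed

lemma locally_integrable_add:
 assumes "locally_integrable f" "locally_integrable g"
 shows "locally_integrable (%x. f x + g x)"
 using assms unfolding locally_integrable_def by (auto intro: set_integral_add)

lemma locally_integrable_shift:
 assumes "locally_integrable f"
 shows "locally_integrable (%x. f (x + z))"
proof (rule locally_integrableI)
 note [measurable] = locally_integrable_measurable[OF assms]
 show "(%x. f (x + z)) \<in> borel_measurable borel" by measurable
 fix r
 have "(\<integral>\<^sup>+x. ennreal (norm (f (x + z))) * indicator (cball 0 r) x \<partial>lborel)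
   <= (\<integral>\<^sup>+x. ennreal (norm (f (x + z))) * indicator (cball 0 (r + norm z)) (x + z) \<partial>lborel)"
 proof (intro nn_integral_mono)
  fix x :: "real ^ 'a"
  have "indicator (cball 0 r) x <= (indicator (cball 0 (r + norm z)) (x + z) :: ennreal)"
   using norm_triangle_ineq[of x z] by (auto simp: indicator_def)
  then show "ennreal (norm (f (x + z))) * indicator (cball 0 r) x
    <= ennreal (norm (f (x + z))) * indicator (cball 0 (r + norm z)) (x + z)"
   by (rule mult_left_mono) simp
 qed
 also have "... = (\<integral>\<^sup>+x. ennreal (norm (f x)) * indicator (cball 0 (r + norm z)) x \<partial>lborel)"
  by (rule nn_integral_shift[where f="%x. ennreal (norm (f x)) * indicator (cball 0 (r + norm z)) x"]) simp
 also have "... < \<infinity>" by (rule locally_integrable_nn[OF assms])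
 finally show "(\<integral>\<^sup>+x. ennreal (norm (f (x + z))) * indicator (cball 0 r) x \<partial>lborel) < \<infinity>" .
qed

lemma integrable_mult_compact_support:
 fixes u :: "real ^ 'n => real"
 assumes "locally_integrable u" "\<phi> \<in> borel_measurable borel" "!!x. \<bar>\<phi> x\<bar> <= B" "!!x. norm x > r ==> \<phi> x = 0"
 shows "integrable lborel (%x. u x * \<phi> x)"
proof (rule L1_bound)
 note [measurable] = assms(2) locally_integrable_measurable[OF assms(1)]
 have "integrable lborel (%x. indicator (cball 0 r) x *\<^sub>R u x)"
  using assms(1) by (simp add: locally_integrable_def set_integrable_def)
 then show "integrable lborel (%x. B * (indicator (cball 0 r) x *\<^sub>R u x))" by simp
 show "(%x. u x * \<phi> x) \<in> borel_measurable lborel" by measurable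
 have "norm (u x * \<phi> x) <= norm (B * (indicator (cball 0 r) x *\<^sub>R u x))" for x
 proof (cases "norm x > r")
  case False
  then show ?thesis using assms(3)[of x] mult_left_mono[of "\<bar>\<phi> x\<bar>" "\<bar>B\<bar>" "\<bar>u x\<bar>"]
   by (simp add: abs_mult mult.commute)
 qed (simp add: assms(4))
 then show "AE x in lborel. norm (u x * \<phi> x) <= norm (B * (indicator (cball 0 r) x *\<^sub>R u x))" by simp
qed

lemma integrable_mult_test:
 assumes "locally_integrable u" "\<phi> \<in> test_functions"
 shows "integrable lborel (%x. u x * \<phi> x)"
proof -
 obtain r where r: "!!x. norm x > r ==> \<phi> x = 0" using test_function_support[OF assms(2)] by blast
 obtain B where B: "!!x. \<bar>\<phi> x\<bar> <= B" using test_function_bounded[OF assms(2)] by blast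
 show ?thesis
  by (rule integrable_mult_compact_support[OF assms(1) test_functionD(4)[OF assms(2)] B r])
qed

section \<open>Weak gradients\<close>

text \<open>Boxes generate the Borel sets and are stable under intersection, so a Dynkin class
  argument carries vanishing integrals from boxes to all Borel sets. The hypothesis
  \<open>total\<close> is what makes the class closed under complements.\<close>

lemma AE_zero_if_box_integrals_zero:
 fixes f :: "real ^ 'n => real"
 assumes f: "integrable lborel f" and total: "(LINT x|lborel. f x) = 0"
  and box: "!!a b. (LINT x|lborel. indicator (box a b) x *\<^sub>R f x) = 0"
 shows "AE x in lborel. f x = 0"
proof (rule sigma_finite_measure.density_zero[OF sigma_finite_lborel f])
 fix A :: "(real^'n) set" assume A: "A \<in> sets lborel"
 have si: "set_integrable lborel A f" if "A \<in> sets borel" for A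
  unfolding set_integrable_def using f that by (intro integrable_mult_indicator) auto
 have borel: "sets borel = sigma_sets UNIV (range (%(a, b). box a b :: (real^'n) set))"
  by (subst borel_eq_box) (rule sets_measure_of, simp)
 have Int: "Int_stable (range (%(a, b). box a b :: (real^'n) set))"
  by (auto intro!: Int_stableI) (auto simp: box_Int_box)
 have "A \<in> sigma_sets UNIV (range (%(a, b). box a b))"
  using A borel by simp
 then show "set_lebesgue_integral lborel A f = 0"
 proof (induction rule: sigma_sets_induct_disjoint
   [OF Int, where \<Omega> = UNIV, unfolded Pow_UNIV, OF subset_UNIV, consumes 1, case_names basic empty compl union])
  case (basic A) then show ?case using box by (auto simp: set_lebesgue_integral_def)
 next
  case empty show ?case by (simp add: set_lebesgue_integral_def)
 next
  case (compl A)
  then have "A \<in> sets borel" using borel by simp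
  then have "set_lebesgue_integral lborel (A \<union> (UNIV - A)) f
    = set_lebesgue_integral lborel A f + set_lebesgue_integral lborel (UNIV - A) f"
   using si by (intro set_integral_Un) auto
  then show ?case using compl total by (simp add: set_lebesgue_integral_def)
 next
  case (union A)
  then have *: "A i \<in> sets borel" for i using borel by auto
  have "set_lebesgue_integral lborel (\<Union>i. A i) f = (\<Sum>i. set_lebesgue_integral lborel (A i) f)"
  proof (rule lebesgue_integral_countable_add)
   show "A i \<inter> A j = {}" if "i ~= j" for i j
    using union(1) that by (rule disjoint_family_onD[OF _ UNIV_I UNIV_I])
   show "set_integrable lborel (\<Union>i. A i) f" by (rule si) (use * in blast)
  qed (use * in simp)
  then show ?case by (simp only: union(3) suminf_zero)
 qed
qed

text \<open>Box indicators are pointwise limits of the bumps, which reduces the claim to boxes.\<close>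

lemma fundamental_lemma:
 fixes F :: "real ^ 'n => real"
 assumes F: "locally_integrable F" and zero: "!!\<psi>. \<psi> \<in> test_functions ==> (LINT x|lborel. F x * \<psi> x) = 0"
 shows "AE x in lborel. F x = 0"
proof -
 note [measurable] = locally_integrable_measurable[OF F] test_functionD(4)[OF box_bump_test]
 have int: "integrable lborel (%x. indicator (box a b) x *\<^sub>R F x)" for a b
 proof -
  have "integrable lborel (%x. indicator (cbox a b) x *\<^sub>R F x)"
   using F by (auto simp: locally_integrable_def set_integrable_def)
  then show ?thesis
  proof (rule L1_bound)
   show "AE x in lborel. norm (indicator (box a b) x *\<^sub>R F x) <= norm (indicator (cbox a b) x *\<^sub>R F x)"
    using box_subset_cbox[of a b] by (intro AE_I2) (auto split: split_indicator)
  qed measurable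
 qed
 have box0: "(LINT x|lborel. indicator (box a b) x *\<^sub>R F x) = 0" for a b
 proof -
  have "(%m. \<integral>x. box_bump m a b x * F x \<partial>lborel) \<longlonglongrightarrow> (LINT x|lborel. indicator (box a b) x * F x)"
  proof (rule integral_dominated_convergence)
   show "integrable lborel (%x. \<bar>indicator (box a b) x *\<^sub>R F x\<bar>)" using int by (rule integrable_abs)
   show "AE x in lborel. (%m. box_bump m a b x * F x) \<longlonglongrightarrow> indicator (box a b) x * F x"
    by (intro AE_I2 tendsto_intros box_bump_tendsto)
   show "AE x in lborel. norm (box_bump m a b x * F x) <= \<bar>indicator (box a b) x *\<^sub>R F x\<bar>" for m
   proof (intro AE_I2)
    fix x show "norm (box_bump m a b x * F x) <= \<bar>indicator (box a b) x *\<^sub>R F x\<bar>"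
     using box_bump_outside[of x a b m] box_bump_bounds[of m a b x]
     by (cases "x \<in> box a b") (auto simp: abs_mult intro!: mult_left_le_one_le)
   qed
  qed measurable
  moreover have "(LINT x|lborel. box_bump m a b x * F x) = 0" for m
   using zero[OF box_bump_test] by (simp add: mult.commute)
  ultimately show ?thesis by (simp add: LIMSEQ_const_iff)
 qed
 \<comment> \<open>Restricting \<open>F\<close> to a large box makes it integrable on the whole
   space; a box intersected with this one is again a box, so \<open>box0\<close> supplies all
   required integrals.\<close>
 have "AE x in lborel. indicator (box (- (real n *\<^sub>R One)) (real n *\<^sub>R One)) x *\<^sub>R F x = 0" for n :: nat
 proof (rule AE_zero_if_box_integrals_zero[OF int box0])
  fix a b :: "real ^ 'n"
  obtain c d :: "real ^ 'n" where cd: "box a b \<inter> box (- (real n *\<^sub>R One)) (real n *\<^sub>R One) = box c d"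
   by (simp only: box_Int_box)
  have "indicator (box a b) x *\<^sub>R indicator (box (- (real n *\<^sub>R One)) (real n *\<^sub>R One)) x *\<^sub>R F x
    = indicator (box c d) x *\<^sub>R F x" for x
   unfolding cd[symmetric] by (simp only: indicator_inter_arith scaleR_scaleR real_scaleR_def mult.assoc)
  then show "(LINT x|lborel. indicator (box a b) x *\<^sub>R indicator (box (- (real n *\<^sub>R One)) (real n *\<^sub>R One)) x *\<^sub>R F x) = 0"
   using box0 by (simp only:)
 qed
 then have "AE x in lborel. \<forall>n::nat. indicator (box (- (real n *\<^sub>R One)) (real n *\<^sub>R One)) x *\<^sub>R F x = 0"
  unfolding AE_all_countable by blast
 then show ?thesis
 proof (rule AE_mp, intro AE_I2 impI)
  fix x assume *: "\<forall>n::nat. indicator (box (- (real n *\<^sub>R One)) (real n *\<^sub>R One)) x *\<^sub>R F x = 0"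
  have "x \<in> (\<Union>n::nat. box (- (real n *\<^sub>R One)) (real n *\<^sub>R One))"
   unfolding UN_box_eq_UNIV by simp
  then obtain n :: nat where "x \<in> box (- (real n *\<^sub>R One)) (real n *\<^sub>R One)" by (elim UN_E)
  then show "F x = 0" using *[rule_format, of n] by (simp only: indicator_simps scaleR_one)
 qed
qed

section \<open>Weak gradients and integrals along segments\<close>

lemma weak_gradientD:
 assumes "has_weak_gradient u G"
 shows "locally_integrable u" "locally_integrable G" "u \<in> borel_measurable borel" "G \<in> borel_measurable borel"
 using assms by (auto simp: has_weak_gradient_def intro: locally_integrable_measurable)

lemma locally_integrable_inner:
 assumes "locally_integrable G"
 shows "locally_integrable (%x. G x \<bullet> z)"
proof (rule locally_integrable_bound[OF assms])
 note [measurable] = locally_integrable_measurable[OF assms]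
 show "(%x. G x \<bullet> z) \<in> borel_measurable borel" by measurable
 show "norm (G x \<bullet> z) <= norm z * norm (G x) + 0" for x
  using Cauchy_Schwarz_ineq2[of "G x" z] by (simp add: mult.commute)
qed auto

lemma locally_integrable_nth:
 fixes G :: "real ^ 'n => real ^ 'm"
 assumes "locally_integrable G"
 shows "locally_integrable (%x. G x $ k)"
 using locally_integrable_inner[OF assms, of "axis k 1"] by (simp add: inner_axis)

lemma weak_gradient_dir:
 assumes "has_weak_gradient u G" "\<phi> \<in> test_functions"
 shows "(LINT x|lborel. u x * dir_deriv z \<phi> x) = - (LINT x|lborel. (G x \<bullet> z) * \<phi> x)"
proof -
 note li = weak_gradientD[OF assms(1)]
 have "(LINT x|lborel. u x * dir_deriv z \<phi> x) = (LINT x|lborel. (\<Sum>k\<in>UNIV. z $ k * (u x * partial_deriv k \<phi> x)))"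
  by (simp add: dir_deriv_def sum_distrib_left mult_ac)
 also have "... = (\<Sum>k\<in>UNIV. z $ k * (LINT x|lborel. u x * partial_deriv k \<phi> x))"
  by (subst LINT_sum)
   (auto intro!: integrable_mult_test li test_function_partial assms)
 also have "... = - (\<Sum>k\<in>UNIV. z $ k * (LINT x|lborel. G x $ k * \<phi> x))"
  using assms by (simp add: has_weak_gradient_def sum_negf)
 also have "(\<Sum>k\<in>UNIV. z $ k * (LINT x|lborel. G x $ k * \<phi> x))
   = (LINT x|lborel. (\<Sum>k\<in>UNIV. z $ k * (G x $ k * \<phi> x)))"
  by (subst LINT_sum)
   (auto intro!: integrable_mult_test locally_integrable_nth li assms)
 also have "... = (LINT x|lborel. (G x \<bullet> z) * \<phi> x)"
  by (simp add: inner_vec_def sum_distrib_right sum_distrib_left mult_ac)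
 finally show ?thesis .
qed

text \<open>By Tonelli's theorem it is enough to bound each slice in \<open>x\<close> by a constant,
  because the parameter \<open>s\<close> is confined to an interval of length 1.\<close>

lemma integrable_pair_strip:
 fixes h :: "real ^ 'n => real => real"
 assumes "case_prod h \<in> borel_measurable (lborel \<Otimes>\<^sub>M lborel)" "C < \<infinity>"
  and "!!s. (\<integral>\<^sup>+x. ennreal \<bar>h x s\<bar> \<partial>lborel) <= C * indicator {0..1} s"
 shows "integrable (lborel \<Otimes>\<^sub>M lborel) (case_prod h)"
proof (rule integrableI_bounded[OF assms(1)])
 note [measurable] = assms(1)
 have "(\<integral>\<^sup>+p. ennreal (norm (case_prod h p)) \<partial>(lborel \<Otimes>\<^sub>M lborel))
   = (\<integral>\<^sup>+s. (\<integral>\<^sup>+x. ennreal \<bar>h x s\<bar> \<partial>lborel) \<partial>lborel)"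
  by (subst lborel_pair.nn_integral_snd[symmetric]) (auto simp: case_prod_unfold)
 also have "... <= (\<integral>\<^sup>+s. C * indicator {0..1::real} s \<partial>lborel)"
  by (intro nn_integral_mono assms(3))
 also have "... = C" by (subst nn_integral_cmult_indicator) auto
 also note \<open>C < \<infinity>\<close>
 finally show "(\<integral>\<^sup>+p. ennreal (norm (case_prod h p)) \<partial>(lborel \<Otimes>\<^sub>M lborel)) < \<infinity>" .
qed

lemma norm_shift_unit_le:
 fixes x z :: "'a::real_normed_vector"
 assumes "0 <= s" "s <= 1" "norm x <= r"
 shows "norm (x + s *\<^sub>R z) <= r + norm z"
proof -
 have "norm (s *\<^sub>R z) <= norm z" using assms by (simp add: mult_left_le_one_le)
 then show ?thesis using norm_triangle_ineq[of x "s *\<^sub>R z"] assms(3) by linarith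
qed

text \<open>Justifies the interchange of integrals when the shift acts on the gradient;
  \<open>integrable_pair_shift2\<close> is the counterpart with the shift on the derivative of the
  test function.\<close>

lemma integrable_pair_shift:
 fixes g \<psi> :: "real ^ 'n => real"
 assumes g: "locally_integrable g" and [measurable]: "\<psi> \<in> borel_measurable borel"
  and B: "!!x. \<bar>\<psi> x\<bar> <= B" and r: "!!x. norm x > r ==> \<psi> x = 0"
 shows "integrable (lborel \<Otimes>\<^sub>M lborel) (%(x, s). \<psi> x * (indicator {0..1::real} s * g (x + s *\<^sub>R z)))"
proof (rule integrable_pair_strip)
 note [measurable] = locally_integrable_measurable[OF g]
 let ?K = "\<integral>\<^sup>+x. ennreal (norm (g x)) * indicator (cball 0 (r + norm z)) x \<partial>lborel"
 show "(%(x, s). \<psi> x * (indicator {0..1::real} s * g (x + s *\<^sub>R z))) \<in> borel_measurable (lborel \<Otimes>\<^sub>M lborel)"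
  by measurable
 show "ennreal B * ?K < \<infinity>"
  using locally_integrable_nn[OF g] by (auto simp: ennreal_mult_less_top)
 fix s :: real
 show "(\<integral>\<^sup>+x. ennreal \<bar>\<psi> x * (indicator {0..1::real} s * g (x + s *\<^sub>R z))\<bar> \<partial>lborel) <= ennreal B * ?K * indicator {0..1} s"
 proof (cases "0 <= s \<and> s <= 1")
  case True
  have "ennreal \<bar>\<psi> x * g (x + s *\<^sub>R z)\<bar>
    <= ennreal B * (ennreal (norm (g (x + s *\<^sub>R z))) * indicator (cball 0 (r + norm z)) (x + s *\<^sub>R z))" for x
  proof (cases "norm x > r")
   case False
   then have "norm (x + s *\<^sub>R z) <= r + norm z" using True by (intro norm_shift_unit_le) auto
   then show ?thesis using B[of x]
    by (auto simp: abs_mult ennreal_mult'[symmetric] intro!: ennreal_leI mult_right_mono)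
  qed (simp add: r)
  then have "(\<integral>\<^sup>+x. ennreal \<bar>\<psi> x * g (x + s *\<^sub>R z)\<bar> \<partial>lborel)
    <= (\<integral>\<^sup>+x. ennreal B * (ennreal (norm (g (x + s *\<^sub>R z))) * indicator (cball 0 (r + norm z)) (x + s *\<^sub>R z)) \<partial>lborel)"
   by (intro nn_integral_mono) auto
  also have "... = (\<integral>\<^sup>+x. ennreal B * (ennreal (norm (g x)) * indicator (cball 0 (r + norm z)) x) \<partial>lborel)"
   by (rule nn_integral_shift[where f="%x. ennreal B * (ennreal (norm (g x)) * indicator (cball 0 (r + norm z)) x)"]) simp
  also have "... = ennreal B * ?K" by (rule nn_integral_cmult) simp
  finally show ?thesis using True by simp
 qed simp
qed

lemma integrable_pair_shift2:
 fixes u D :: "real ^ 'n => real"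
 assumes u: "locally_integrable u" and [measurable]: "D \<in> borel_measurable borel"
  and B: "!!x. \<bar>D x\<bar> <= B" and r: "!!x. norm x > r ==> D x = 0"
 shows "integrable (lborel \<Otimes>\<^sub>M lborel) (%(x, s). u x * (indicator {0..1::real} s * D (x - s *\<^sub>R z)))"
proof (rule integrable_pair_strip)
 note [measurable] = locally_integrable_measurable[OF u]
 let ?K = "\<integral>\<^sup>+x. ennreal (norm (u x)) * indicator (cball 0 (r + norm z)) x \<partial>lborel"
 show "(%(x, s). u x * (indicator {0..1::real} s * D (x - s *\<^sub>R z))) \<in> borel_measurable (lborel \<Otimes>\<^sub>M lborel)"
  by measurable
 show "ennreal B * ?K < \<infinity>"
  using locally_integrable_nn[OF u] by (auto simp: ennreal_mult_less_top)
 fix s :: real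
 show "(\<integral>\<^sup>+x. ennreal \<bar>u x * (indicator {0..1::real} s * D (x - s *\<^sub>R z))\<bar> \<partial>lborel) <= ennreal B * ?K * indicator {0..1} s"
 proof (cases "0 <= s \<and> s <= 1")
  case True
  have "ennreal \<bar>u x * D (x - s *\<^sub>R z)\<bar> <= ennreal B * (ennreal (norm (u x)) * indicator (cball 0 (r + norm z)) x)" for x
  proof (cases "norm (x - s *\<^sub>R z) > r")
   case False
   then have "norm (x - s *\<^sub>R z + s *\<^sub>R z) <= r + norm z" using True by (intro norm_shift_unit_le) auto
   then show ?thesis using mult_left_mono[OF B[of "x - s *\<^sub>R z"], of "\<bar>u x\<bar>"]
    by (auto simp: abs_mult ennreal_mult''[symmetric] mult.commute intro!: ennreal_leI)
  qed (simp add: r)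
  then have "(\<integral>\<^sup>+x. ennreal \<bar>u x * D (x - s *\<^sub>R z)\<bar> \<partial>lborel)
    <= (\<integral>\<^sup>+x. ennreal B * (ennreal (norm (u x)) * indicator (cball 0 (r + norm z)) x) \<partial>lborel)"
   by (intro nn_integral_mono) auto
  also have "... = ennreal B * ?K" by (rule nn_integral_cmult) simp
  finally show ?thesis using True by simp
 qed simp
qed

lemma dir_deriv_shift:
 assumes "\<phi> \<in> test_functions"
 shows "dir_deriv z (%x. \<phi> (x - a)) x = dir_deriv z \<phi> (x - a)"
 using partial_deriv_affine[of \<phi> 1 x "- a"] test_functionD(2)[OF assms] by (simp add: dir_deriv_def)

lemma test_function_shift: "\<phi> \<in> test_functions ==> (%x. \<phi> (x - a)) \<in> test_functions"
 using test_function_affine[of \<phi> 1 "- a"] by simp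

lemma dir_deriv_support:
 assumes "\<psi> \<in> test_functions"
 obtains r where "!!x. norm x > r ==> dir_deriv z \<psi> x = 0"
proof -
 have "\<exists>r. \<forall>x. norm x > r --> partial_deriv k \<psi> x = 0" for k
  using test_function_support[OF test_function_partial[OF assms, of k]] by metis
 then obtain \<rho> where \<rho>: "!!k x. norm x > \<rho> k ==> partial_deriv k \<psi> x = 0" by metis
 have "dir_deriv z \<psi> x = 0" if x: "norm x > Max (range \<rho>)" for x
 proof -
  have "norm x > \<rho> k" for k using x Max_ge[of "range \<rho>" "\<rho> k"] by simp
  then show ?thesis unfolding dir_deriv_def by (simp add: \<rho>)
 qed
 then show ?thesis using that by blast
qed

text \<open>Both sides have the same integral against every test function, by Fubini and a shift of variables.\<close>

lemma weak_gradient_line_integral: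
 fixes u :: "real ^ 'n => real"
 assumes uG: "has_weak_gradient u G"
 shows "AE x in lborel. u (x + z) - u x = (LINT s|lborel. indicator {0..1} s * (G (x + s *\<^sub>R z) \<bullet> z))"
proof -
 note li = weak_gradientD[OF uG]
 note [measurable] = li(3,4)
 define g where "g x = G x \<bullet> z" for x
 have g: "locally_integrable g" unfolding g_def[abs_def] by (rule locally_integrable_inner[OF li(2)])
 note [measurable] = locally_integrable_measurable[OF g]
 define F where "F x = (LINT s|lborel. indicator {0..1} s * g (x + s *\<^sub>R z))" for x
 have F: "locally_integrable F"
 proof (rule locally_integrableI)
  show "F \<in> borel_measurable borel" unfolding F_def[abs_def]
   by (rule lborel.borel_measurable_lebesgue_integral) measurable
  fix r
  have "integrable (lborel \<Otimes>\<^sub>M lborel) (%(x, s). indicator (cball 0 r) x * (indicator {0..1::real} s * g (x + s *\<^sub>R z)))"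
   by (rule integrable_pair_shift[OF g, where B=1 and r=r]) (auto simp: indicator_def)
  from lborel_pair.integrable_fst[OF this]
  have "integrable lborel (%x. indicator (cball 0 r) x * F x)" by (simp add: F_def)
  then show "(\<integral>\<^sup>+x. ennreal (norm (F x)) * indicator (cball 0 r) x \<partial>lborel) < \<infinity>"
   by (auto simp: integrable_iff_bounded abs_mult ennreal_mult ennreal_indicator mult.commute)
 qed
 have "AE x in lborel. u (x + z) - u x - F x = 0"
 proof (rule fundamental_lemma)
  have neg: "locally_integrable (%x. - f x)" if "locally_integrable f" for f :: "real ^ 'n => real"
   using that by (auto simp: locally_integrable_def set_integrable_def)
  show "locally_integrable (%x. u (x + z) - u x - F x)"
   using locally_integrable_add[OF locally_integrable_add[OF locally_integrable_shift[OF li(1)] neg[OF li(1)]] neg[OF F]]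
   by simp
  fix \<psi> :: "real ^ 'n => real" assume \<psi>: "\<psi> \<in> test_functions"
  note [measurable] = test_functionD(4)[OF \<psi>]
  obtain r where r: "!!x. norm x > r ==> \<psi> x = 0" using test_function_support[OF \<psi>] by blast
  obtain B where B: "!!x. \<bar>\<psi> x\<bar> <= B" using test_function_bounded[OF \<psi>] by blast
  define D where "D = dir_deriv z \<psi>"
  have D_meas [measurable]: "D \<in> borel_measurable borel"
   unfolding D_def by (rule borel_measurable_continuous_onI[OF dir_deriv_continuous[OF \<psi>]])
  obtain B' where bd: "!!w x. \<bar>dir_deriv w \<psi> x\<bar> <= B' * norm w" using dir_deriv_bound[OF \<psi>] by metis
  have B': "\<bar>D x\<bar> <= B' * norm z" for x using bd[of z x] unfolding D_def .
  obtain r' where r': "!!x. norm x > r' ==> D x = 0"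
   using dir_deriv_support[OF \<psi>, of z] unfolding D_def by metis
  have "(LINT x|lborel. F x * \<psi> x) = (LINT x|lborel. (LINT s|lborel. \<psi> x * (indicator {0..1} s * g (x + s *\<^sub>R z))))"
   by (simp add: F_def mult.commute)
  also have "... = (LINT s|lborel. (LINT x|lborel. \<psi> x * (indicator {0..1} s * g (x + s *\<^sub>R z))))"
   by (rule lborel_pair.Fubini_integral[symmetric]) (rule integrable_pair_shift[OF g _ B r], simp)
  \<comment> \<open>For fixed \<open>s\<close> the shift is moved onto the test function; the weak
    gradient identity in direction \<open>z\<close> then trades \<open>G\<close> for
    \<open>u\<close> and \<open>\<psi>\<close> for its directional derivative.\<close>
  also have "... = (LINT s|lborel. (LINT x|lborel. - (u x * (indicator {0..1} s * D (x - s *\<^sub>R z)))))"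
  proof (rule LINT_cong[OF refl])
   fix s :: real
   have "(LINT x|lborel. \<psi> x * (indicator {0..1} s * g (x + s *\<^sub>R z)))
     = (LINT x|lborel. \<psi> (x + s *\<^sub>R z - s *\<^sub>R z) * (indicator {0..1} s * g (x + s *\<^sub>R z)))" by simp
   also have "... = (LINT x|lborel. \<psi> (x - s *\<^sub>R z) * (indicator {0..1} s * g x))"
    by (rule integral_shift[where f="%x. \<psi> (x - s *\<^sub>R z) * (indicator {0..1} s * g x)"]) simp
   also have "... = indicator {0..1} s * (LINT x|lborel. (G x \<bullet> z) * \<psi> (x - s *\<^sub>R z))"
    by (simp add: g_def mult_ac flip: integral_mult_right_zero)
   also have "... = - (indicator {0..1} s * (LINT x|lborel. u x * D (x - s *\<^sub>R z)))"
    using weak_gradient_dir[OF uG test_function_shift[OF \<psi>], of z "s *\<^sub>R z"]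
    by (simp add: dir_deriv_shift[OF \<psi>] D_def)
   also have "... = (LINT x|lborel. - (u x * (indicator {0..1} s * D (x - s *\<^sub>R z))))"
    by (simp add: mult_ac flip: integral_mult_right_zero)
   finally show "(LINT x|lborel. \<psi> x * (indicator {0..1} s * g (x + s *\<^sub>R z)))
    = (LINT x|lborel. - (u x * (indicator {0..1} s * D (x - s *\<^sub>R z))))" .
  qed
  also have "... = - (LINT x|lborel. (LINT s|lborel. u x * (indicator {0..1} s * D (x - s *\<^sub>R z))))"
   using lborel_pair.Fubini_integral[OF integrable_pair_shift2[OF li(1) D_meas B' r', where z=z]] by simp
  \<comment> \<open>After the second interchange the inner integral over \<open>s\<close> is the
    fundamental theorem of calculus for \<open>\<psi>\<close> with step \<open>- z\<close>.\<close>
  also have "... = - (LINT x|lborel. u x * (\<psi> x - \<psi> (x - z)))"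
  proof -
   have "(LINT s|lborel. indicator {0..1} s * D (x - s *\<^sub>R z)) = \<psi> x - \<psi> (x - z)" for x
    using test_function_FTC[OF \<psi>, of x "- z"]
    by (simp add: D_def dir_deriv_def sum_negf minus_equation_iff[of "_ - _"])
   then show ?thesis by simp
  qed
  also have "... = (LINT x|lborel. u x * \<psi> (x - z)) - (LINT x|lborel. u x * \<psi> x)"
   using integrable_mult_test[OF li(1) \<psi>] integrable_mult_test[OF li(1) test_function_shift[OF \<psi>, of z]]
   by (simp add: right_diff_distrib)
  also have "(LINT x|lborel. u x * \<psi> (x - z)) = (LINT x|lborel. u (x + z) * \<psi> x)"
   using integral_shift[of "%x. u x * \<psi> (x - z)" z] by simp
  finally show "(LINT x|lborel. (u (x + z) - u x - F x) * \<psi> x) = 0"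
   using integrable_mult_test[OF li(1) \<psi>] integrable_mult_test[OF F \<psi>]
    integrable_mult_test[OF locally_integrable_shift[OF li(1)] \<psi>, of z]
   by (simp add: left_diff_distrib)
 qed
 then show ?thesis by (simp add: F_def g_def)
qed

text \<open>Cauchy-Schwarz on an interval of length 1, obtained from the nonnegative variance of
  \<open>g\<close> about its mean. If the right-hand side is infinite there is nothing to show;
  otherwise \<open>g\<close> is integrable because |t| <= 1 + t^2.\<close>

lemma square_integral_unit_interval_le:
 fixes g :: "real => real"
 assumes [measurable]: "g \<in> borel_measurable borel"
 shows "ennreal ((LINT s|lborel. indicator {0..1} s * g s)^2) <= (\<integral>\<^sup>+s. ennreal ((g s)^2) * indicator {0..1} s \<partial>lborel)"
proof (cases "(\<integral>\<^sup>+s. ennreal ((g s)^2) * indicator {0..1} s \<partial>lborel) = \<infinity>")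
 case False
 define h where "h s = indicator {0..1} s * g s" for s :: real
 define m where "m = (LINT s|lborel. h s)"
 define c where "c s = (indicator {0..1} s :: real)" for s :: real
 have [measurable]: "h \<in> borel_measurable borel" "c \<in> borel_measurable borel"
  unfolding h_def[abs_def] c_def[abs_def] by measurable
 have sq: "ennreal ((h s)^2) = ennreal ((g s)^2) * indicator {0..1} s" for s
  by (simp add: h_def indicator_def)
 have h2: "integrable lborel (%s. (h s)^2)"
  using False by (intro integrableI_nonneg) (auto simp: sq less_top)
 have c: "integrable lborel c" "(LINT s|lborel. c s) = 1" by (auto simp: c_def[abs_def])
 have h1: "integrable lborel h"
 proof (rule L1_bound[OF L1_add[OF c(1) h2]])
  have "\<bar>t\<bar> <= 1 + t^2" for t :: real
   using zero_le_power2[of "\<bar>t\<bar> - 1/2"] by (simp add: power2_diff power_divide)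
  then have "\<bar>h s\<bar> <= c s + (h s)^2" for s
   by (auto simp: h_def c_def indicator_def)
  then show "AE s in lborel. norm (h s) <= norm (c s + (h s)^2)"
   unfolding real_norm_def by (intro AE_I2 order_trans[OF _ abs_ge_self])
 qed measurable
 have "0 <= (LINT s|lborel. (h s - m * c s)^2)" by simp
 also have "(%s. (h s - m * c s)^2) = (%s. (h s)^2 - (2 * m) * h s + m^2 * c s)"
  by (auto simp: fun_eq_iff h_def c_def indicator_def power2_eq_square algebra_simps)
 also have "(LINT s|lborel. (h s)^2 - (2 * m) * h s + m^2 * c s) = (LINT s|lborel. (h s)^2) - (2 * m) * m + m^2 * 1"
  using h1 h2 c by (simp add: m_def)
 finally have "m^2 <= (LINT s|lborel. (h s)^2)" by (simp add: power2_eq_square)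
 then have "ennreal (m^2) <= ennreal (LINT s|lborel. (h s)^2)" by (rule ennreal_leI)
 also have "... = (\<integral>\<^sup>+s. ennreal ((g s)^2) * indicator {0..1} s \<partial>lborel)"
  using nn_integral_eq_integral[OF h2] by (simp add: sq)
 finally show ?thesis by (simp add: m_def h_def)
qed simp

definition sq_int :: "(real ^ 'n) set => (real ^ 'n => 'b::real_normed_vector) => ennreal"
 where "sq_int S f = (\<integral>\<^sup>+x. ennreal ((norm (f x))^2) * indicator S x \<partial>lborel)"

text \<open>Cauchy-Schwarz along each segment, followed by Tonelli and a shift of variables. The set
  \<open>S'\<close> has to contain all segments that start in \<open>S\<close>; the whole space
  gives the global estimate \<open>L2_translation\<close>, and balls give the local version behind
  the positivity proof.\<close>

lemma translation_estimate:
 fixes u :: "real ^ 'n => real"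
 assumes uG: "has_weak_gradient u G" and [measurable]: "S \<in> sets borel" "S' \<in> sets borel"
  and S: "!!x s. x \<in> S ==> 0 <= s ==> s <= 1 ==> x + s *\<^sub>R z \<in> S'"
 shows "sq_int S (%x. u (x + z) - u x) <= ennreal ((norm z)^2) * sq_int S' G"
proof -
 note [measurable] = weak_gradientD(3,4)[OF uG]
 let ?c = "%s. indicator {0..1::real} s :: ennreal"
 let ?f = "%x s. ennreal ((G (x + s *\<^sub>R z) \<bullet> z)^2) * ?c s * indicator S x"
 have "sq_int S (%x. u (x + z) - u x) <= (\<integral>\<^sup>+x. (\<integral>\<^sup>+s. ?f x s \<partial>lborel) \<partial>lborel)"
  unfolding sq_int_def
 proof (rule nn_integral_mono_AE)
  show "AE x in lborel. ennreal ((norm (u (x + z) - u x))^2) * indicator S x <= (\<integral>\<^sup>+s. ?f x s \<partial>lborel)"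
   using weak_gradient_line_integral[OF uG, of z]
  proof eventually_elim
   case (elim x)
   have "ennreal ((norm (u (x + z) - u x))^2) <= (\<integral>\<^sup>+s. ennreal ((G (x + s *\<^sub>R z) \<bullet> z)^2) * ?c s \<partial>lborel)"
    unfolding elim real_norm_def power2_abs by (rule square_integral_unit_interval_le) measurable
   then have "ennreal ((norm (u (x + z) - u x))^2) * indicator S x
     <= (\<integral>\<^sup>+s. ennreal ((G (x + s *\<^sub>R z) \<bullet> z)^2) * ?c s \<partial>lborel) * indicator S x"
    by (rule mult_right_mono) simp
   also have "... = (\<integral>\<^sup>+s. ?f x s \<partial>lborel)" by (subst nn_integral_multc) auto
   finally show ?case .
  qed
 qed
 also have "... = (\<integral>\<^sup>+s. (\<integral>\<^sup>+x. ?f x s \<partial>lborel) \<partial>lborel)"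
  by (rule lborel_pair.Fubini') measurable
 also have "... <= (\<integral>\<^sup>+s. (ennreal ((norm z)^2) * sq_int S' G) * ?c s \<partial>lborel)"
 proof (rule nn_integral_mono)
  fix s :: real
  show "(\<integral>\<^sup>+x. ?f x s \<partial>lborel) <= (ennreal ((norm z)^2) * sq_int S' G) * ?c s"
  proof (cases "0 <= s \<and> s <= 1")
   case True
   have "ennreal ((G (x + s *\<^sub>R z) \<bullet> z)^2) * indicator S x
    <= ennreal ((norm z)^2) * (ennreal ((norm (G (x + s *\<^sub>R z)))^2) * indicator S' (x + s *\<^sub>R z))" for x
   proof (cases "x \<in> S")
    case x: True
    have "(G (x + s *\<^sub>R z) \<bullet> z)^2 <= (norm z)^2 * (norm (G (x + s *\<^sub>R z)))^2"
     using power_mono[OF Cauchy_Schwarz_ineq2[of "G (x + s *\<^sub>R z)" z], of 2]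
     by (simp add: power_mult_distrib mult.commute)
    then show ?thesis using S[OF x] True x by (simp add: ennreal_mult'[symmetric] ennreal_leI)
   qed simp
   then have "(\<integral>\<^sup>+x. ?f x s \<partial>lborel)
     <= (\<integral>\<^sup>+x. ennreal ((norm z)^2) * (ennreal ((norm (G (x + s *\<^sub>R z)))^2) * indicator S' (x + s *\<^sub>R z)) \<partial>lborel)"
    using True by (intro nn_integral_mono) simp
   also have "... = (\<integral>\<^sup>+x. ennreal ((norm z)^2) * (ennreal ((norm (G x))^2) * indicator S' x) \<partial>lborel)"
    by (rule nn_integral_shift[where f="%x. ennreal ((norm z)^2) * (ennreal ((norm (G x))^2) * indicator S' x)"]) simp
   also have "... = ennreal ((norm z)^2) * sq_int S' G" unfolding sq_int_def by (rule nn_integral_cmult) simp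
   finally show ?thesis using True by simp
  qed simp
 qed
 also have "... = ennreal ((norm z)^2) * sq_int S' G"
  by (subst nn_integral_cmult_indicator) auto
 finally show ?thesis .
qed

section \<open>Uniqueness and calculus of square integrable weak gradients\<close>

lemma weak_gradient_unique:
 fixes u :: "real ^ 'n => real"
 assumes "has_weak_gradient u G" "has_weak_gradient u H"
 shows "AE x in lborel. G x = H x"
proof -
 have "AE x in lborel. G x $ k - H x $ k = 0" for k
 proof (rule fundamental_lemma)
  note li = locally_integrable_nth[OF weak_gradientD(2)[OF assms(1)], of k]
   locally_integrable_nth[OF weak_gradientD(2)[OF assms(2)], of k]
  have "locally_integrable (%x. - H x $ k)"
   using li(2) by (auto simp: locally_integrable_def set_integrable_def)
  then show "locally_integrable (%x. G x $ k - H x $ k)"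
   using locally_integrable_add[OF li(1), of "%x. - H x $ k"] by simp
  fix \<psi> :: "real ^ 'n => real" assume \<psi>: "\<psi> \<in> test_functions"
  show "(LINT x|lborel. (G x $ k - H x $ k) * \<psi> x) = 0"
   using assms \<psi> integrable_mult_test[OF li(1) \<psi>] integrable_mult_test[OF li(2) \<psi>]
   by (simp add: has_weak_gradient_def left_diff_distrib)
 qed
 then have "AE x in lborel. \<forall>k\<in>UNIV. G x $ k - H x $ k = 0"
  by (intro AE_finite_allI) auto
 then show ?thesis by eventually_elim (simp add: vec_eq_iff)
qed

text \<open>Relational counterpart of \<open>has_L2_gradient\<close>: the gradient is named
  explicitly, so that rules of calculus can be stated without the choice operator inside
  \<open>weak_grad\<close>.\<close>

definition L2_gradient :: "(real ^ 'n => real) => (real ^ 'n => real ^ 'n) => bool"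
 where "L2_gradient u G \<longleftrightarrow> has_weak_gradient u G \<and> integrable lborel (%x. (norm (G x))^2)"

lemma L2_gradientD:
 assumes "L2_gradient u G"
 shows "has_weak_gradient u G" "integrable lborel (%x. (norm (G x))^2)"
  "locally_integrable u" "u \<in> borel_measurable borel" "G \<in> borel_measurable borel"
 using assms weak_gradientD by (auto simp: L2_gradient_def)

lemma weak_grad_AE:
 assumes "has_weak_gradient u G"
 shows "AE x in lborel. weak_grad u x = G x"
proof -
 have "has_weak_gradient u (weak_grad u)"
  unfolding weak_grad_def by (rule someI[of "has_weak_gradient u", OF assms])
 then show ?thesis using assms by (rule weak_gradient_unique)
qed

lemma has_weak_gradient_weak_grad: "has_weak_gradient u G ==> has_weak_gradient u (weak_grad u)"
 unfolding weak_grad_def by (rule someI[of "has_weak_gradient u"])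

lemma L2_gradient_imp:
 assumes "L2_gradient u G"
 shows "has_L2_gradient u"
proof -
 note [measurable] = L2_gradientD(5)[OF assms]
  weak_gradientD(4)[OF has_weak_gradient_weak_grad[OF L2_gradientD(1)[OF assms]]]
 have "AE x in lborel. (norm (weak_grad u x))^2 = (norm (G x))^2"
  using weak_grad_AE[OF L2_gradientD(1)[OF assms]] by eventually_elim simp
 then have "integrable lborel (%x. (norm (weak_grad u x))^2) \<longleftrightarrow> integrable lborel (%x. (norm (G x))^2)"
  by (intro integrable_cong_AE) auto
 then show ?thesis using assms by (auto simp: has_L2_gradient_def L2_gradient_def)
qed

lemma L2_gradient_weak_grad:
 assumes "has_L2_gradient u"
 shows "L2_gradient u (weak_grad u)"
 using assms has_weak_gradient_weak_grad by (auto simp: has_L2_gradient_def L2_gradient_def)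

lemma D12_norm_sq:
 assumes "L2_gradient u G"
 shows "(D12_norm u)^2 = (LINT x|lborel. (norm (G x))^2)"
proof -
 note [measurable] = L2_gradientD(5)[OF assms]
  weak_gradientD(4)[OF has_weak_gradient_weak_grad[OF L2_gradientD(1)[OF assms]]]
 have "(LINT x|lborel. (norm (weak_grad u x))^2) = (LINT x|lborel. (norm (G x))^2)"
  using weak_grad_AE[OF L2_gradientD(1)[OF assms]] by (intro integral_cong_AE) auto
 then show ?thesis by (simp add: D12_norm_def)
qed

lemma integrable_square_inner:
 fixes G H :: "'a => 'b::euclidean_space"
 assumes [measurable]: "G \<in> borel_measurable M" "H \<in> borel_measurable M"
  and "integrable M (%x. (norm (G x))^2)" "integrable M (%x. (norm (H x))^2)"
 shows "integrable M (%x. G x \<bullet> H x)"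
proof (rule L1_bound[OF L1_add[OF assms(3,4)]])
 have "\<bar>G x \<bullet> H x\<bar> <= (norm (G x))^2 + (norm (H x))^2" for x
  using Cauchy_Schwarz_ineq2[of "G x" "H x"] sum_squares_bound[of "norm (G x)" "norm (H x)"]
   mult_nonneg_nonneg[of "norm (G x)" "norm (H x)"] by linarith
 then show "AE x in M. norm (G x \<bullet> H x) <= norm ((norm (G x))^2 + (norm (H x))^2)" by simp
qed measurable

lemma norm_lincomb_sq:
 fixes x y :: "'a::real_inner"
 shows "(norm (a *\<^sub>R x + b *\<^sub>R y))^2 = a^2 * (norm x)^2 + 2 * a * b * (x \<bullet> y) + b^2 * (norm y)^2"
 unfolding power2_norm_eq_inner by (simp add: inner_simps inner_commute[of y x] power2_eq_square algebra_simps)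

lemma L2_gradient_lincomb:
 assumes u: "L2_gradient u G" and v: "L2_gradient v H"
 shows "L2_gradient (%x. a * u x + b * v x) (%x. a *\<^sub>R G x + b *\<^sub>R H x)"
proof -
 note D = L2_gradientD[OF u] L2_gradientD[OF v]
 note li = weak_gradientD(1,2)[OF D(1)] weak_gradientD(1,2)[OF D(6)]
 have sc: "locally_integrable (%x. c *\<^sub>R f x)" if "locally_integrable f"
  for c and f :: "real ^ 'a => 'b::{banach, second_countable_topology}"
  using that set_integrable_scaleR_right unfolding locally_integrable_def by blast
 have "integrable lborel (%x. (norm (a *\<^sub>R G x + b *\<^sub>R H x))^2)"
  unfolding norm_lincomb_sq
  using D integrable_square_inner[of G lborel H]
  by (intro L1_add integrable_mult_right) auto
 moreover have "has_weak_gradient (%x. a * u x + b * v x) (%x. a *\<^sub>R G x + b *\<^sub>R H x)"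
  unfolding has_weak_gradient_def
 proof (intro conjI ballI allI)
  show "locally_integrable (%x. a * u x + b * v x)"
   using locally_integrable_add[OF sc[OF li(1), of a] sc[OF li(3), of b]] by simp
  show "locally_integrable (%x. a *\<^sub>R G x + b *\<^sub>R H x)"
   using locally_integrable_add[OF sc[OF li(2)] sc[OF li(4)]] .
  fix \<phi> :: "real ^ 'a => real" and k assume \<phi>: "\<phi> \<in> test_functions"
  note i = integrable_mult_test[OF li(1) test_function_partial[OF \<phi>, of k]]
   integrable_mult_test[OF li(3) test_function_partial[OF \<phi>, of k]]
   integrable_mult_test[OF locally_integrable_nth[OF li(2), of k] \<phi>]
   integrable_mult_test[OF locally_integrable_nth[OF li(4), of k] \<phi>]
  have "(LINT x|lborel. (a * u x + b * v x) * partial_deriv k \<phi> x)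
    = a * (LINT x|lborel. u x * partial_deriv k \<phi> x) + b * (LINT x|lborel. v x * partial_deriv k \<phi> x)"
   using i by (simp add: distrib_right mult.assoc)
  also have "... = - (a * (LINT x|lborel. G x $ k * \<phi> x) + b * (LINT x|lborel. H x $ k * \<phi> x))"
   using D(1,6) \<phi> by (simp add: has_weak_gradient_def)
  also have "... = - (LINT x|lborel. (a *\<^sub>R G x + b *\<^sub>R H x) $ k * \<phi> x)"
   using i by (simp add: distrib_right mult.assoc)
  finally show "(LINT x|lborel. (a * u x + b * v x) * partial_deriv k \<phi> x)
   = - (LINT x|lborel. (a *\<^sub>R G x + b *\<^sub>R H x) $ k * \<phi> x)" .
 qed
 ultimately show ?thesis by (simp add: L2_gradient_def)
qed

lemma nn_integral_affine:
 fixes b :: "'a::euclidean_space"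
 assumes "f \<in> borel_measurable borel" "a > 0"
 shows "(\<integral>\<^sup>+x. f x \<partial>lborel) = ennreal (a ^ DIM('a)) * (\<integral>\<^sup>+x. f (a *\<^sub>R x + b) \<partial>lborel)"
proof -
 note [measurable] = assms(1)
 have "(\<integral>\<^sup>+x. f x \<partial>lborel) = (\<integral>\<^sup>+x. f x \<partial>density (distr lborel borel (%x. b + a *\<^sub>R x)) (%_. \<bar>a\<bar> ^ DIM('a)))"
  using lborel_affine[of a b] assms by simp
 also have "... = (\<integral>\<^sup>+x. ennreal (\<bar>a\<bar> ^ DIM('a)) * f x \<partial>distr lborel borel (%x. b + a *\<^sub>R x))"
  by (rule nn_integral_density) (auto simp: assms)
 also have "... = ennreal (a ^ DIM('a)) * (\<integral>\<^sup>+x. f x \<partial>distr lborel borel (%x. b + a *\<^sub>R x))"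
  using assms by (subst nn_integral_cmult) auto
 also have "... = ennreal (a ^ DIM('a)) * (\<integral>\<^sup>+x. f (a *\<^sub>R x + b) \<partial>lborel)"
  by (subst nn_integral_distr) (auto simp: add.commute)
 finally show ?thesis .
qed

lemma integral_affine:
 fixes b :: "'a::euclidean_space" and f :: "'a => real"
 assumes "f \<in> borel_measurable borel" "a > 0"
 shows "(LINT x|lborel. f x) = a ^ DIM('a) * (LINT x|lborel. f (a *\<^sub>R x + b))"
proof -
 note [measurable] = assms(1)
 have "(LINT x|lborel. f x) = (\<integral>x. f x \<partial>density (distr lborel borel (%x. b + a *\<^sub>R x)) (%_. ennreal (\<bar>a\<bar> ^ DIM('a))))"
  using lborel_affine[of a b] assms by (simp add: ennreal_power)
 also have "... = (\<integral>x. \<bar>a\<bar> ^ DIM('a) *\<^sub>R f x \<partial>distr lborel borel (%x. b + a *\<^sub>R x))"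
  by (rule integral_density) (auto simp: assms)
 also have "... = a ^ DIM('a) * (LINT x|lborel. f (a *\<^sub>R x + b))"
  using assms by (subst integral_distr) (auto simp: add.commute)
 finally show ?thesis .
qed

lemma integrable_affine:
 fixes b :: "'a::euclidean_space" and f :: "'a => real"
 assumes "integrable lborel f" "a > 0"
 shows "integrable lborel (%x. f (a *\<^sub>R x + b))"
proof -
 have [measurable]: "f \<in> borel_measurable borel" using assms(1) by auto
 have "ennreal (a ^ DIM('a)) * (\<integral>\<^sup>+x. ennreal (norm (f (a *\<^sub>R x + b))) \<partial>lborel) < \<infinity>"
  using assms nn_integral_affine[of "%x. ennreal (norm (f x))" a b] by (simp add: integrable_iff_bounded)
 then show ?thesis
  using assms(2) by (auto simp: integrable_iff_bounded ennreal_mult_less_top)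
qed

lemma L2_gradient_affine:
 fixes u :: "real ^ 'n => real"
 assumes u: "L2_gradient u G" and a: "a > 0"
 shows "L2_gradient (%x. u (a *\<^sub>R x + b)) (%x. a *\<^sub>R G (a *\<^sub>R x + b))"
proof -
 note D = L2_gradientD[OF u]
 note li = weak_gradientD(1,2)[OF D(1)]
 note [measurable] = D(4,5)
 have aff: "locally_integrable (%x. f (a *\<^sub>R x + b))" if f: "locally_integrable f"
  for f :: "real ^ 'n => 'b::{banach, second_countable_topology}"
 proof (rule locally_integrableI)
  note [measurable] = locally_integrable_measurable[OF f]
  show "(%x. f (a *\<^sub>R x + b)) \<in> borel_measurable borel" by measurable
  fix r
  have "(\<integral>\<^sup>+x. ennreal (norm (f (a *\<^sub>R x + b))) * indicator (cball 0 r) x \<partial>lborel)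
    <= (\<integral>\<^sup>+x. ennreal (norm (f (a *\<^sub>R x + b))) * indicator (cball 0 (a * r + norm b)) (a *\<^sub>R x + b) \<partial>lborel)"
  proof (intro nn_integral_mono mult_left_mono)
   fix x :: "real ^ 'n"
   have "norm (a *\<^sub>R x + b) <= a * r + norm b" if "norm x <= r"
   proof -
    have "norm (a *\<^sub>R x) <= a * r" using mult_left_mono[OF that, of a] a by simp
    then show ?thesis using norm_triangle_ineq[of "a *\<^sub>R x" b] by linarith
   qed
   then show "indicator (cball 0 r) x <= (indicator (cball 0 (a * r + norm b)) (a *\<^sub>R x + b) :: ennreal)"
    by (auto simp: indicator_def)
  qed simp
  moreover have "ennreal (a ^ DIM(real ^ 'n)) * (\<integral>\<^sup>+x. ennreal (norm (f (a *\<^sub>R x + b)))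
    * indicator (cball 0 (a * r + norm b)) (a *\<^sub>R x + b) \<partial>lborel) < \<infinity>"
   using locally_integrable_nn[OF f, of "a * r + norm b"]
    nn_integral_affine[of "%x. ennreal (norm (f x)) * indicator (cball 0 (a * r + norm b)) x" a b] a
   by simp
  ultimately show "(\<integral>\<^sup>+x. ennreal (norm (f (a *\<^sub>R x + b))) * indicator (cball 0 r) x \<partial>lborel) < \<infinity>"
   using a by (auto simp: ennreal_mult_less_top intro: le_less_trans)
 qed
 have "integrable lborel (%x. (norm (a *\<^sub>R G (a *\<^sub>R x + b)))^2)"
  using integrable_affine[OF D(2) a, of b] by (simp add: power_mult_distrib)
 moreover have "has_weak_gradient (%x. u (a *\<^sub>R x + b)) (%x. a *\<^sub>R G (a *\<^sub>R x + b))"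
  unfolding has_weak_gradient_def
 proof (intro conjI ballI allI)
  show "locally_integrable (%x. u (a *\<^sub>R x + b))" by (rule aff[OF li(1)])
  show "locally_integrable (%x. a *\<^sub>R G (a *\<^sub>R x + b))"
   using aff[OF li(2)] set_integrable_scaleR_right unfolding locally_integrable_def by blast
  fix \<phi> :: "real ^ 'n => real" and k assume \<phi>: "\<phi> \<in> test_functions"
  \<comment> \<open>Composition with the inverse affine map gives a test function with
    \<open>\<psi> (a *\<^sub>R x + b) = \<phi> x\<close>. The factor 1/a in its derivative becomes
    the factor \<open>a\<close> of the new gradient, and the Jacobian cancels from both
    sides.\<close>
  define \<psi> where "\<psi> x = \<phi> ((1 / a) *\<^sub>R x + (- (1 / a)) *\<^sub>R b)" for x
  have \<psi>: "\<psi> \<in> test_functions"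
   unfolding \<psi>_def[abs_def] using a by (intro test_function_affine \<phi>) auto
  have inv: "(1 / a) *\<^sub>R (a *\<^sub>R x + b) + (- (1 / a)) *\<^sub>R b = x" for x
   using a by (simp add: scaleR_add_right)
  have \<psi>1: "\<psi> (a *\<^sub>R x + b) = \<phi> x" for x unfolding \<psi>_def inv ..
  have \<psi>2: "partial_deriv k \<psi> (a *\<^sub>R x + b) = (1 / a) * partial_deriv k \<phi> x" for x
   unfolding \<psi>_def[abs_def] by (subst partial_deriv_affine[OF test_functionD(2)[OF \<phi>]]) (simp only: inv)
  note [measurable] = test_functionD(4)[OF \<psi>] test_functionD(4)[OF test_function_partial[OF \<psi>]]
   locally_integrable_measurable[OF locally_integrable_nth[OF li(2)]]
  define c where "c = a ^ DIM(real ^ 'n)"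
  have c: "c > 0" using a by (simp add: c_def)
  have "c * (LINT x|lborel. u (a *\<^sub>R x + b) * partial_deriv k \<psi> (a *\<^sub>R x + b)) = (LINT x|lborel. u x * partial_deriv k \<psi> x)"
   unfolding c_def by (rule integral_affine[symmetric, where f="%x. u x * partial_deriv k \<psi> x"]) (auto simp: a)
  also have "... = - (LINT x|lborel. G x $ k * \<psi> x)"
   using D(1) \<psi> by (simp add: has_weak_gradient_def)
  also have "... = - (c * (LINT x|lborel. G (a *\<^sub>R x + b) $ k * \<psi> (a *\<^sub>R x + b)))"
   unfolding c_def using a by (subst integral_affine[where f="%x. G x $ k * \<psi> x" and a=a and b=b]) auto
  finally have "(LINT x|lborel. u (a *\<^sub>R x + b) * ((1 / a) * partial_deriv k \<phi> x))
    = - (LINT x|lborel. G (a *\<^sub>R x + b) $ k * \<phi> x)"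
   using c unfolding \<psi>1 \<psi>2 by (simp only: mult_minus_right[symmetric] mult_left_cancel)
  moreover have "(LINT x|lborel. u (a *\<^sub>R x + b) * ((1 / a) * partial_deriv k \<phi> x))
    = (1 / a) * (LINT x|lborel. u (a *\<^sub>R x + b) * partial_deriv k \<phi> x)"
   by (subst integral_mult_right_zero[symmetric]) (simp add: mult_ac)
  ultimately show "(LINT x|lborel. u (a *\<^sub>R x + b) * partial_deriv k \<phi> x)
    = - (LINT x|lborel. (a *\<^sub>R G (a *\<^sub>R x + b)) $ k * \<phi> x)"
   using a by (simp add: mult.assoc field_simps)
 qed
 ultimately show ?thesis by (simp add: L2_gradient_def)
qed

definition grad :: "(real ^ 'n => real) => real ^ 'n => real ^ 'n"
 where "grad \<phi> x = (\<chi> k. partial_deriv k \<phi> x)"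

lemma grad_bounded:
 assumes "\<phi> \<in> test_functions"
 obtains B where "B > 0" "!!x. norm (grad \<phi> x) <= B"
proof -
 obtain B where B: "B > 0" "!!z x. \<bar>dir_deriv z \<phi> x\<bar> <= B * norm z" using dir_deriv_bound[OF assms] by metis
 have "norm (grad \<phi> x) <= B" for x
 proof (cases "grad \<phi> x = 0")
  case False
  have "(norm (grad \<phi> x))^2 = dir_deriv (grad \<phi> x) \<phi> x"
   unfolding power2_norm_eq_inner by (simp add: dir_deriv_def inner_vec_def grad_def)
  also have "... <= B * norm (grad \<phi> x)" using B(2)[of "grad \<phi> x" x] by simp
  finally show ?thesis using False by (simp add: power2_eq_square)
 qed (use B in simp)
 then show ?thesis using that B(1) by blast
qed

lemma grad_measurable: "\<phi> \<in> test_functions ==> grad \<phi> \<in> borel_measurable borel"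
 unfolding grad_def[abs_def]
 by (intro borel_measurable_continuous_onI continuous_on_vec_lambda test_functionD(3) test_function_partial)

text \<open>A product of two test functions is a test function, so the identity for \<open>u\<close>
  may be tested with it and the rule reduces to the classical product rule for \<open>\<phi>\<close>
  and \<open>\<psi>\<close>.\<close>

lemma weak_gradient_mult_test:
 assumes u: "has_weak_gradient u G" and \<phi>: "\<phi> \<in> test_functions"
 shows "has_weak_gradient (%x. \<phi> x * u x) (%x. \<phi> x *\<^sub>R G x + u x *\<^sub>R grad \<phi> x)"
 unfolding has_weak_gradient_def
proof (intro conjI ballI allI)
 note D = weak_gradientD[OF u]
 note [measurable] = D(3,4) grad_measurable[OF \<phi>] test_functionD(4)[OF \<phi>]
 obtain B where B: "B > 0" "!!x. norm (grad \<phi> x) <= B" using grad_bounded[OF \<phi>] by metis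
 obtain C where C: "C > 0" "!!x. \<bar>\<phi> x\<bar> <= C" using test_function_bounded[OF \<phi>] by metis
 show "locally_integrable (%x. \<phi> x * u x)"
  using C by (intro locally_integrable_bound[OF D(1), where C=C and D=0]) (auto simp: abs_mult mult_right_mono)
 show "locally_integrable (%x. \<phi> x *\<^sub>R G x + u x *\<^sub>R grad \<phi> x)"
 proof (rule locally_integrable_add)
  show "locally_integrable (%x. \<phi> x *\<^sub>R G x)"
   using C by (intro locally_integrable_bound[OF D(2), where C=C and D=0]) (auto simp: mult_right_mono)
  show "locally_integrable (%x. u x *\<^sub>R grad \<phi> x)"
   using B by (intro locally_integrable_bound[OF D(1), where C=B and D=0])
    (auto simp: mult.commute[of B] mult_left_mono)
 qed
 fix \<psi> :: "real ^ 'a => real" and k assume \<psi>: "\<psi> \<in> test_functions"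
 have p: "(%x. \<phi> x * \<psi> x) \<in> test_functions"
  by (rule test_function_mult[OF \<psi> test_functionD(1)[OF \<phi>]])
 have 1: "(%x. partial_deriv k \<phi> x * \<psi> x) \<in> test_functions" "(%x. \<phi> x * partial_deriv k \<psi> x) \<in> test_functions"
  by (intro test_function_mult test_functionD(1) test_function_partial \<phi> \<psi>)+
 have "(LINT x|lborel. u x * partial_deriv k (%x. \<phi> x * \<psi> x) x) = - (LINT x|lborel. G x $ k * (\<phi> x * \<psi> x))"
  using u p by (simp add: has_weak_gradient_def)
 moreover have "partial_deriv k (%x. \<phi> x * \<psi> x) x = \<phi> x * partial_deriv k \<psi> x + partial_deriv k \<phi> x * \<psi> x" for x
  by (rule partial_deriv_mult) (auto intro: test_functionD \<phi> \<psi>)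
 ultimately have "(LINT x|lborel. u x * (\<phi> x * partial_deriv k \<psi> x))
   = - (LINT x|lborel. G x $ k * (\<phi> x * \<psi> x)) - (LINT x|lborel. u x * (partial_deriv k \<phi> x * \<psi> x))"
  using integrable_mult_test[OF D(1) 1(1)] integrable_mult_test[OF D(1) 1(2)] by (simp add: distrib_left)
 also have "... = - (LINT x|lborel. G x $ k * (\<phi> x * \<psi> x) + u x * (partial_deriv k \<phi> x * \<psi> x))"
  using integrable_mult_test[OF D(1) 1(1)] integrable_mult_test[OF locally_integrable_nth[OF D(2), of k] p]
  by simp
 also have "... = - (LINT x|lborel. (\<phi> x *\<^sub>R G x + u x *\<^sub>R grad \<phi> x) $ k * \<psi> x)"
  by (simp add: grad_def algebra_simps)
 finally show "(LINT x|lborel. \<phi> x * u x * partial_deriv k \<psi> x)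
   = - (LINT x|lborel. (\<phi> x *\<^sub>R G x + u x *\<^sub>R grad \<phi> x) $ k * \<psi> x)"
  by (simp add: mult_ac)
qed

lemma L2_translation:
 fixes u :: "real ^ 'n => real"
 assumes "L2_gradient u G"
 shows "integrable lborel (%x. (u (x + z) - u x)^2)"
  and "(LINT x|lborel. (u (x + z) - u x)^2) <= (norm z)^2 * (LINT x|lborel. (norm (G x))^2)"
proof -
 note D = L2_gradientD[OF assms]
 note [measurable] = D(4,5)
 have "(\<integral>\<^sup>+x. ennreal ((u (x + z) - u x)^2) \<partial>lborel) <= ennreal ((norm z)^2) * (\<integral>\<^sup>+x. ennreal ((norm (G x))^2) \<partial>lborel)"
  using translation_estimate[OF D(1), of UNIV UNIV z] by (simp add: sq_int_def)
 also have "... = ennreal ((norm z)^2 * (LINT x|lborel. (norm (G x))^2))"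
  using nn_integral_eq_integral[OF D(2)] by (simp add: ennreal_mult')
 finally have *: "(\<integral>\<^sup>+x. ennreal ((u (x + z) - u x)^2) \<partial>lborel) <= ennreal ((norm z)^2 * (LINT x|lborel. (norm (G x))^2))" .
 show i: "integrable lborel (%x. (u (x + z) - u x)^2)"
  using * by (intro integrableI_nonneg) (auto simp: less_top[symmetric] top_unique)
 show "(LINT x|lborel. (u (x + z) - u x)^2) <= (norm z)^2 * (LINT x|lborel. (norm (G x))^2)"
  using * nn_integral_eq_integral[OF i] by simp
qed

text \<open>The support radius is enlarged by 1 because a shift of length at most 1 moves the
  support by at most that much. A common constant serves both bounds.\<close>

lemma test_function_cutoff_Lipschitz:
 fixes \<phi> :: "real ^ 'n => real"
 assumes "\<phi> \<in> test_functions"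
 obtains L r where "L > 0" "r > 0" "!!x z. norm z <= 1 ==> \<bar>\<phi> (x - z) - \<phi> x\<bar> <= L * norm z * indicator (cball 0 r) x"
  "!!x. \<bar>\<phi> x\<bar> <= L * indicator (cball 0 r) x"
proof -
 obtain B where B: "B > 0" "!!z x. \<bar>\<phi> (x + z) - \<phi> x\<bar> <= B * norm z" using test_function_Lipschitz[OF assms] by metis
 obtain C where C: "C > 0" "!!x. \<bar>\<phi> x\<bar> <= C" using test_function_bounded[OF assms] by metis
 obtain r where r: "r > 0" "!!x. norm x > r ==> \<phi> x = 0" using test_function_support[OF assms] by metis
 have 1: "\<bar>\<phi> (x - z) - \<phi> x\<bar> <= (B + C) * norm z * indicator (cball 0 (r + 1)) x" if z: "norm z <= 1" for x z
 proof (cases "norm x > r + 1")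
  case True
  then have "norm (x - z) > r" using norm_triangle_ineq2[of x z] z by simp
  then show ?thesis using r(2)[of x] r(2)[of "x - z"] True by simp
 next
  case False
  have "\<bar>\<phi> (x - z) - \<phi> x\<bar> <= B * norm z" using B(2)[of x "- z"] by simp
  also have "... <= (B + C) * norm z" using C(1) by (intro mult_right_mono) auto
  finally show ?thesis using False by simp
 qed
 have 2: "\<bar>\<phi> x\<bar> <= (B + C) * indicator (cball 0 (r + 1)) x" for x
  using C(2)[of x] r B(1) by (cases "norm x > r + 1") (auto simp: indicator_def)
 show ?thesis using that[of "B + C" "r + 1", OF _ _ 1 2] B C r by auto
qed

lemma difference_quotient_tendsto:
 assumes "\<phi> \<in> test_functions"
 shows "(%n. (\<phi> x - \<phi> (x - (1 / real (Suc n)) *\<^sub>R axis k 1)) * real (Suc n)) \<longlonglongrightarrow> partial_deriv k \<phi> x"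
proof -
 have "((%t. x + t *\<^sub>R axis k 1) has_derivative (%h. h *\<^sub>R axis k 1)) (at 0)"
  by (auto intro!: derivative_eq_intros)
 moreover have "(\<phi> has_derivative frechet_derivative \<phi> (at (x + 0 *\<^sub>R axis k 1))) (at (x + 0 *\<^sub>R axis k 1))"
  using test_functionD(2)[OF assms] by (simp add: frechet_derivative_works[symmetric])
 ultimately have "((%t. \<phi> (x + t *\<^sub>R axis k 1)) has_derivative (%h. frechet_derivative \<phi> (at x) (h *\<^sub>R axis k 1))) (at 0)"
  by (auto dest: has_derivative_compose)
 moreover have "frechet_derivative \<phi> (at x) (h *\<^sub>R axis k 1) = partial_deriv k \<phi> x * h" for h
  using linear_scale[OF linear_frechet_derivative[OF test_functionD(2)[OF assms]]]
  by (simp add: partial_deriv_def)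
 ultimately have "((%t. \<phi> (x + t *\<^sub>R axis k 1)) has_real_derivative partial_deriv k \<phi> x) (at 0)"
  by (simp add: has_field_derivative_def)
 then have lim: "((%h. (\<phi> (x + h *\<^sub>R axis k 1) - \<phi> x) / h) \<longlongrightarrow> partial_deriv k \<phi> x) (at 0)"
  by (simp add: DERIV_def)
 have "(%n. - (1 / real (Suc n))) \<longlonglongrightarrow> - 0"
  by (intro tendsto_minus LIMSEQ_Suc[OF lim_1_over_n])
 then have "filterlim (%n. - (1 / real (Suc n))) (at 0) sequentially"
  by (auto simp: filterlim_at)
 from filterlim_compose[OF lim this] show ?thesis by (simp add: algebra_simps)
qed

text \<open>The increment of \<open>u\<close> is an average over \<open>s\<close> of shifted
  gradients; each shift is moved onto \<open>\<psi>\<close>, where the last hypothesis controls its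
  effect uniformly in \<open>s\<close>. Only measurability of \<open>\<psi>\<close> is assumed,
  since the chain rule applies this to a product containing \<open>g' (u x)\<close>.\<close>

lemma weak_gradient_dominated_bound:
 fixes u :: "real ^ 'n => real"
 assumes "L2_gradient u G" and [measurable]: "\<psi> \<in> borel_measurable borel"
  and B: "!!x. \<bar>\<psi> x\<bar> <= B" and r: "!!x. norm x > r ==> \<psi> x = 0"
  and C: "!!s. 0 <= s ==> s <= 1 ==> (LINT x|lborel. \<bar>\<psi> (x - s *\<^sub>R z) - \<psi> x\<bar> * \<bar>G x \<bullet> z\<bar>) <= C"
 shows "\<bar>(LINT x|lborel. \<psi> x * (u (x + z) - u x)) - (LINT x|lborel. \<psi> x * (G x \<bullet> z))\<bar> <= C"
proof -
 note D = L2_gradientD[OF assms(1)]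
 define g where "g x = G x \<bullet> z" for x
 have g: "locally_integrable g"
  unfolding g_def[abs_def] by (rule locally_integrable_inner[OF weak_gradientD(2)[OF D(1)]])
 note [measurable] = D(4,5) locally_integrable_measurable[OF g]
 define J where "J = (LINT x|lborel. \<psi> x * g x)"
 define H where "H s = (LINT x|lborel. \<psi> x * g (x + s *\<^sub>R z))" for s
 have ii: "integrable lborel (%x. g x * \<psi> x)"
  by (rule integrable_mult_compact_support[OF g _ B r]) simp
 have close: "\<bar>H s - J\<bar> <= C" if s: "0 <= s" "s <= 1" for s
 proof -
  have "H s = (LINT x|lborel. \<psi> (x + s *\<^sub>R z - s *\<^sub>R z) * g (x + s *\<^sub>R z))" by (simp add: H_def)
  also have "... = (LINT x|lborel. \<psi> (x - s *\<^sub>R z) * g x)"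
   by (rule integral_shift[where f="%x. \<psi> (x - s *\<^sub>R z) * g x"]) simp
  finally have Hs: "H s = (LINT x|lborel. g x * \<psi> (x - s *\<^sub>R z))" by (simp add: mult.commute)
  have i2: "integrable lborel (%x. g x * \<psi> (x - s *\<^sub>R z))"
  proof (rule integrable_mult_compact_support[OF g _ B])
   fix x :: "real ^ 'n" assume "norm x > r + norm z"
   then have "\<not> norm (x - s *\<^sub>R z) <= r"
    using norm_shift_unit_le[OF s, of "x - s *\<^sub>R z" r z] by auto
   then show "\<psi> (x - s *\<^sub>R z) = 0" using r by simp
  qed simp
  have "H s - J = (LINT x|lborel. (\<psi> (x - s *\<^sub>R z) - \<psi> x) * g x)"
   using ii i2 by (simp add: Hs J_def right_diff_distrib mult.commute[of _ "g _"])
  then have "\<bar>H s - J\<bar> <= (LINT x|lborel. \<bar>(\<psi> (x - s *\<^sub>R z) - \<psi> x) * g x\<bar>)"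
   by (simp only: integral_abs_bound)
  also have "... <= C" using C[OF s] by (simp add: abs_mult g_def)
  finally show ?thesis .
 qed
 have pair: "integrable (lborel \<Otimes>\<^sub>M lborel) (%(x, s). \<psi> x * (indicator {0..1::real} s * g (x + s *\<^sub>R z)))"
  by (rule integrable_pair_shift[OF g _ B r]) simp
 have "(LINT x|lborel. \<psi> x * (u (x + z) - u x))
   = (LINT x|lborel. (LINT s|lborel. \<psi> x * (indicator {0..1} s * g (x + s *\<^sub>R z))))"
 proof (rule integral_cong_AE)
  show "(%x. \<integral>s. \<psi> x * (indicator {0..1} s * g (x + s *\<^sub>R z)) \<partial>lborel) \<in> borel_measurable lborel"
   by (rule lborel.borel_measurable_lebesgue_integral) measurable
  show "AE x in lborel. \<psi> x * (u (x + z) - u x) = (LINT s|lborel. \<psi> x * (indicator {0..1} s * g (x + s *\<^sub>R z)))"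
   using weak_gradient_line_integral[OF D(1), of z] by eventually_elim (simp add: g_def)
 qed measurable
 also have "... = (LINT s|lborel. (LINT x|lborel. \<psi> x * (indicator {0..1} s * g (x + s *\<^sub>R z))))"
  by (rule lborel_pair.Fubini_integral[symmetric, OF pair])
 also have "... = (LINT s|lborel. indicator {0..1} s * H s)"
  by (rule LINT_cong[OF refl]) (simp add: H_def mult_ac flip: integral_mult_right_zero)
 finally have eq: "(LINT x|lborel. \<psi> x * (u (x + z) - u x)) = (LINT s|lborel. indicator {0..1} s * H s)" .
 have iH: "integrable lborel (%s. indicator {0..1} s * H s)"
  using lborel_pair.integrable_snd[OF pair] by (simp add: H_def mult_ac flip: integral_mult_right_zero)
 have i1: "integrable lborel (indicator {0..1::real} :: real => real)" by simp
 have "(LINT s|lborel. indicator {0..1} s * H s) - J = (LINT s|lborel. indicator {0..1} s * H s - indicator {0..1} s * J)"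
  using iH by simp
 then have "\<bar>(LINT s|lborel. indicator {0..1} s * H s) - J\<bar> <= (LINT s|lborel. \<bar>indicator {0..1} s * H s - indicator {0..1} s * J\<bar>)"
  by (simp only: integral_abs_bound)
 also have "... <= (LINT s|lborel. indicator {0..1::real} s * C)"
 proof (rule LINT_mono)
  show "integrable lborel (%s. \<bar>indicator {0..1} s * H s - indicator {0..1} s * J\<bar>)"
   by (intro integrable_abs L1_diff iH integrable_mult_left i1)
  show "integrable lborel (%s. indicator {0..1::real} s * C)" by (intro integrable_mult_left i1)
 qed (use close in \<open>auto simp: indicator_def\<close>)
 finally show ?thesis by (simp add: eq J_def g_def)
qed

text \<open>Difference quotients: by the translation estimate, the quadratic remainder in the Taylor expansion
 of \<open>g\<close> along a step of length \<open>t\<close> contributes \<open>O(t\<^sup>2)\<close> to the integral.\<close>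

theorem weak_gradient_chain:
 fixes u :: "real ^ 'n => real" and g g' :: "real => real"
 assumes u: "L2_gradient u G"
  and g: "!!t. (g has_real_derivative g' t) (at t)"
  and M: "!!t. \<bar>g' t\<bar> <= M" and Lip: "!!a b. \<bar>g' a - g' b\<bar> <= M * \<bar>a - b\<bar>"
 shows "L2_gradient (%x. g (u x)) (%x. g' (u x) *\<^sub>R G x)"
proof -
 note D = L2_gradientD[OF u]
 note li = weak_gradientD(1,2)[OF D(1)]
 have "continuous_on UNIV g" using g DERIV_isCont continuous_at_imp_continuous_on by blast
 then have [measurable]: "g \<in> borel_measurable borel" by (rule borel_measurable_continuous_onI)
 have M0: "M >= 0" using M[of 0] by linarith
 have "continuous_on UNIV g'"
 proof (rule lipschitz_on_continuous_on[OF lipschitz_onI[where L=M]])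
  fix x y :: real show "dist (g' x) (g' y) <= M * dist x y" using Lip[of x y] by (simp add: dist_real_def)
 qed (rule M0)
 then have [measurable]: "g' \<in> borel_measurable borel" by (rule borel_measurable_continuous_onI)
 note [measurable] = D(4,5)
 have gL: "\<bar>g a - g b\<bar> <= M * \<bar>a - b\<bar>" for a b
  using field_differentiable_bound[of UNIV g g' M b a] g M by (auto simp: abs_minus_commute)
 have taylor: "\<bar>g b - g a - g' a * (b - a)\<bar> <= M * (b - a)^2" for a b
 proof -
  have "\<bar>(%t. g t - g' a * t) b - (%t. g t - g' a * t) a\<bar> <= (M * \<bar>b - a\<bar>) * \<bar>b - a\<bar>"
  proof (rule field_differentiable_bound[of "closed_segment a b" "%t. g t - g' a * t" "%t. g' t - g' a", simplified real_norm_def])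
   fix t assume "t \<in> closed_segment a b"
   then have "\<bar>t - a\<bar> <= \<bar>b - a\<bar>" using dist_in_closed_segment[of t a b] by (auto simp: dist_real_def)
   then show "\<bar>g' t - g' a\<bar> <= M * \<bar>b - a\<bar>"
    using Lip[of t a] M0 by (meson mult_left_mono order_trans)
  qed (auto intro!: derivative_eq_intros DERIV_subset[OF g])
  then show ?thesis by (simp add: algebra_simps power2_eq_square abs_mult_self_eq)
 qed
 have "integrable lborel (%x. (norm (g' (u x) *\<^sub>R G x))^2)"
 proof (rule L1_bound)
  show "integrable lborel (%x. M^2 * (norm (G x))^2)" using D(2) by simp
  have "(norm (g' (u x) *\<^sub>R G x))^2 <= M^2 * (norm (G x))^2" for x
   using power_mono[OF M abs_ge_zero, of "u x" 2] by (simp add: power_mult_distrib mult_right_mono)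
  then show "AE x in lborel. norm ((norm (g' (u x) *\<^sub>R G x))^2) <= norm (M^2 * (norm (G x))^2)" by simp
 qed measurable
 moreover have "has_weak_gradient (%x. g (u x)) (%x. g' (u x) *\<^sub>R G x)"
  unfolding has_weak_gradient_def
 proof (intro conjI ballI allI)
  show lg: "locally_integrable (%x. g (u x))"
  proof (rule locally_integrable_bound[OF li(1), where C=M and D="\<bar>g 0\<bar>"])
   show "norm (g (u x)) <= M * norm (u x) + \<bar>g 0\<bar>" for x using gL[of "u x" 0] by simp
  qed (use M0 in auto)
  show "locally_integrable (%x. g' (u x) *\<^sub>R G x)"
   using M M0 by (intro locally_integrable_bound[OF li(2), where C=M and D=0]) (auto simp: mult_right_mono)
  fix \<phi> :: "real ^ 'n => real" and k :: 'n assume \<phi>: "\<phi> \<in> test_functions"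
  note [measurable] = test_functionD(4)[OF \<phi>]
  obtain L r where L: "L > 0" "r > 0"
   and L1: "!!x z. norm z <= 1 ==> \<bar>\<phi> (x - z) - \<phi> x\<bar> <= L * norm z * indicator (cball 0 r) x"
   and L2: "!!x. \<bar>\<phi> x\<bar> <= L * indicator (cball 0 r) x"
   using test_function_cutoff_Lipschitz[OF \<phi>] by metis
  define e :: "real ^ 'n" where "e = axis k 1"
  have ne: "norm e = 1" by (simp add: e_def norm_axis_1)
  define f where "f x = g' (u x) * \<phi> x" for x
  have [measurable]: "f \<in> borel_measurable borel" unfolding f_def[abs_def] by measurable
  have L3: "\<bar>\<phi> x\<bar> <= L" for x using L2[of x] L(1) by (cases "norm x <= r") (auto simp: indicator_def)
  have \<phi>0: "\<phi> x = 0" if "norm x > r" for x using L2[of x] that by (simp add: indicator_def)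
  have f0: "f x = 0" if "norm x > r" for x using \<phi>0[OF that] by (simp add: f_def)
  have fB: "\<bar>f x\<bar> <= M * L" for x unfolding f_def abs_mult using M L3 M0 by (intro mult_mono) auto
  define DD where "DD = (LINT x|lborel. (norm (G x))^2)"
  define K where "K = (LINT x|lborel. indicator (cball 0 r) x * norm (G x))"
  have iK: "integrable lborel (%x. indicator (cball 0 r) x * norm (G x))"
   using li(2) integrable_norm[of lborel "%x. indicator (cball 0 r) x *\<^sub>R G x"]
   by (simp add: locally_integrable_def set_integrable_def)
  define A where "A t = (LINT x|lborel. g (u x) * (\<phi> x - \<phi> (x - t *\<^sub>R e)))" for t
  define J where "J = (LINT x|lborel. f x * (G x \<bullet> e))"
  \<comment> \<open>The first two terms bound the change of \<open>f\<close> under a shift, the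
    first through the factor \<open>\<phi>\<close> and the second through \<open>g' (u x)\<close>;
    the third is the Taylor remainder of \<open>g\<close>.\<close>
  define C where "C = M * L * K + M * L * DD + L * M * DD"
  have main: "\<bar>A t + t * J\<bar> <= t^2 * C" if t: "0 < t" "t <= 1" for t
  proof -
   define z where "z = t *\<^sub>R e"
   have nz: "norm z = t" using t by (simp add: z_def ne)
   have i1: "integrable lborel (%x. g (u x) * \<phi> x)" by (rule integrable_mult_test[OF lg \<phi>])
   have i2: "integrable lborel (%x. g (u x) * \<phi> (x - z))" by (rule integrable_mult_test[OF lg test_function_shift[OF \<phi>]])
   have i3: "integrable lborel (%x. g (u (x + z)) * \<phi> x)"
    by (rule integrable_mult_test[OF locally_integrable_shift[OF lg, of z] \<phi>])
   have i4: "integrable lborel (%x. (u (x + z) - u x) * f x)"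
    using locally_integrable_add[OF locally_integrable_shift[OF li(1), of z], of "%x. - u x"] li(1)
    by (intro integrable_mult_compact_support[OF _ _ fB f0]) (auto simp: locally_integrable_def set_integrable_def)
   have "A t = (LINT x|lborel. g (u x) * \<phi> x) - (LINT x|lborel. g (u x) * \<phi> (x - z))"
    using i1 i2 by (simp add: A_def z_def right_diff_distrib)
   \<comment> \<open>Discrete integration by parts: a shift of variables moves the increment from
     \<open>\<phi>\<close> to \<open>g (u x)\<close>.\<close>
   also have "(LINT x|lborel. g (u x) * \<phi> (x - z)) = (LINT x|lborel. g (u (x + z)) * \<phi> x)"
    using integral_shift[of "%x. g (u x) * \<phi> (x - z)" z] by simp
   finally have A: "A t = - (LINT x|lborel. (g (u (x + z)) - g (u x)) * \<phi> x)"
    using i1 i3 by (simp add: left_diff_distrib)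
   define R where "R x = (g (u (x + z)) - g (u x)) * \<phi> x - (u (x + z) - u x) * f x" for x
   have iR: "integrable lborel R"
    unfolding R_def[abs_def] using i1 i3 i4 by (simp add: left_diff_distrib[of "g _"])
   have "A t + (LINT x|lborel. (u (x + z) - u x) * f x) = - (LINT x|lborel. R x)"
    unfolding A R_def using i1 i3 i4 by (simp add: left_diff_distrib[of "g _"])
   moreover have "\<bar>\<integral>x. R x \<partial>lborel\<bar> <= t^2 * (L * M * DD)"
   proof -
    have Rb: "\<bar>R x\<bar> <= L * M * (u (x + z) - u x)^2" for x
    proof -
     have "R x = (g (u (x + z)) - g (u x) - g' (u x) * (u (x + z) - u x)) * \<phi> x"
      by (simp add: R_def f_def algebra_simps)
     then have "\<bar>R x\<bar> <= (M * (u (x + z) - u x)^2) * L"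
      using taylor L3 L(1) M0 by (auto simp: abs_mult intro!: mult_mono)
     then show ?thesis by (simp add: mult_ac)
    qed
    have "\<bar>\<integral>x. R x \<partial>lborel\<bar> <= (LINT x|lborel. \<bar>R x\<bar>)" by (rule integral_abs_bound)
    also have "... <= (LINT x|lborel. L * M * (u (x + z) - u x)^2)"
     using L2_translation(1)[OF u] Rb iR by (intro LINT_mono integrable_abs) auto
    also have "... <= L * M * (t^2 * DD)"
     using L2_translation(2)[OF u, of z] L(1) M0 by (simp add: nz DD_def mult_left_mono)
    finally show ?thesis by (simp add: mult_ac)
   qed
   moreover have "\<bar>(LINT x|lborel. f x * (u (x + z) - u x)) - (LINT x|lborel. f x * (G x \<bullet> z))\<bar> <= t^2 * (M * L * K + M * L * DD)"
   proof (rule weak_gradient_dominated_bound[OF u _ fB f0])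
    fix s :: real assume s: "0 <= s" "s <= 1"
    define y where "y = s *\<^sub>R z"
    have "norm y <= t" using s t nz mult_right_mono[of s 1 t] by (simp add: y_def)
    then have ny: "norm y <= t" "norm y <= 1" using t by auto
    have b: "\<bar>f (x - y) - f x\<bar> * \<bar>G x \<bullet> z\<bar> <=
      t^2 * (M * L * (indicator (cball 0 r) x * norm (G x))) + L * M * ((u (x + - y) - u x)^2 / 2 + t^2 * (norm (G x))^2 / 2)" for x
    proof -
     have "f (x - y) - f x = g' (u (x - y)) * (\<phi> (x - y) - \<phi> x) + (g' (u (x - y)) - g' (u x)) * \<phi> x"
      by (simp add: f_def algebra_simps)
     then have "\<bar>f (x - y) - f x\<bar> <= \<bar>g' (u (x - y))\<bar> * \<bar>\<phi> (x - y) - \<phi> x\<bar> + \<bar>g' (u (x - y)) - g' (u x)\<bar> * \<bar>\<phi> x\<bar>"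
      unfolding abs_mult[symmetric] by (simp only: abs_triangle_ineq)
     also have "... <= M * (L * t * indicator (cball 0 r) x) + M * \<bar>u (x - y) - u x\<bar> * L"
     proof (intro add_mono mult_mono M Lip L3)
      show "\<bar>\<phi> (x - y) - \<phi> x\<bar> <= L * t * indicator (cball 0 r) x"
       by (rule order_trans[OF L1[OF ny(2)]]) (use ny(1) L(1) in \<open>auto intro!: mult_right_mono mult_left_mono\<close>)
     qed (use M0 in auto)
     finally have 1: "\<bar>f (x - y) - f x\<bar> <= M * (L * t * indicator (cball 0 r) x) + M * \<bar>u (x - y) - u x\<bar> * L" .
     have 2: "\<bar>G x \<bullet> z\<bar> <= t * norm (G x)" using Cauchy_Schwarz_ineq2[of "G x" z] by (simp add: nz mult.commute)
     have "\<bar>f (x - y) - f x\<bar> * \<bar>G x \<bullet> z\<bar>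
       <= (M * (L * t * indicator (cball 0 r) x) + M * \<bar>u (x - y) - u x\<bar> * L) * (t * norm (G x))"
      using t by (intro mult_mono 1 2) (auto intro!: add_nonneg_nonneg mult_nonneg_nonneg simp: M0 L(1) less_imp_le)
     also have "... = t^2 * (M * L * (indicator (cball 0 r) x * norm (G x))) + L * M * (\<bar>u (x - y) - u x\<bar> * (t * norm (G x)))"
      by (simp add: algebra_simps power2_eq_square)
     also have "\<bar>u (x - y) - u x\<bar> * (t * norm (G x)) <= (u (x + - y) - u x)^2 / 2 + t^2 * (norm (G x))^2 / 2"
      using sum_squares_bound[of "\<bar>u (x - y) - u x\<bar>" "t * norm (G x)"] by (simp add: power_mult_distrib)
     finally show ?thesis using M0 L(1) by (simp add: mult_left_mono)
    qed
    have ib: "integrable lborel (%x. t^2 * (M * L * (indicator (cball 0 r) x * norm (G x))) + L * M * ((u (x + - y) - u x)^2 / 2 + t^2 * (norm (G x))^2 / 2))"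
     using iK L2_translation(1)[OF u, of "- y"] D(2)
     by (intro L1_add integrable_mult_right integrable_divide)
    have "(LINT x|lborel. \<bar>f (x - y) - f x\<bar> * \<bar>G x \<bullet> z\<bar>)
     <= (LINT x|lborel. t^2 * (M * L * (indicator (cball 0 r) x * norm (G x))) + L * M * ((u (x + - y) - u x)^2 / 2 + t^2 * (norm (G x))^2 / 2))"
    proof (rule LINT_mono[OF _ ib b])
     show "integrable lborel (%x. \<bar>f (x - y) - f x\<bar> * \<bar>G x \<bullet> z\<bar>)"
      by (rule L1_bound[OF ib])
       (auto intro!: AE_I2 order_trans[OF b] simp del: minus_add_distrib)
    qed
    also have "... = t^2 * (M * L * K) + L * M * ((LINT x|lborel. (u (x + - y) - u x)^2) / 2 + t^2 * DD / 2)"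
     unfolding K_def DD_def using iK L2_translation(1)[OF u, of "- y"] D(2)
     by (subst LINT_add) (auto simp: mult.assoc)
    also have "... <= t^2 * (M * L * K) + L * M * (t^2 * DD / 2 + t^2 * DD / 2)"
    proof -
     have "(LINT x|lborel. (u (x + - y) - u x)^2) <= (norm (- y))^2 * DD"
      unfolding DD_def by (rule L2_translation(2)[OF u])
     also have "... <= t^2 * DD"
      using ny power_mono[of "norm y" t 2] by (intro mult_right_mono) (auto simp: DD_def)
     finally have q: "(LINT x|lborel. (u (x + - y) - u x)^2) <= t^2 * DD" .
     show ?thesis
      by (intro add_left_mono mult_left_mono add_right_mono divide_right_mono q) (use L(1) M0 in auto)
    qed
    finally show "(LINT x|lborel. \<bar>f (x - s *\<^sub>R z) - f x\<bar> * \<bar>G x \<bullet> z\<bar>) <= t^2 * (M * L * K + M * L * DD)"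
     by (simp add: y_def algebra_simps)
   qed simp
   moreover have "(LINT x|lborel. f x * (G x \<bullet> z)) = t * J"
    by (simp add: J_def z_def mult_ac flip: integral_mult_right_zero)
   ultimately have "\<bar>A t + t * J\<bar> <= t^2 * (L * M * DD) + t^2 * (M * L * K + M * L * DD)"
    by (simp only: mult.commute[of "u _ - u _"])
   then show ?thesis by (simp add: C_def algebra_simps)
  qed
  have lim1: "(%n. \<integral>x. g (u x) * ((\<phi> x - \<phi> (x - (1 / real (Suc n)) *\<^sub>R e)) * real (Suc n)) \<partial>lborel)
    \<longlonglongrightarrow> (LINT x|lborel. g (u x) * partial_deriv k \<phi> x)"
  proof (rule integral_dominated_convergence)
   show "integrable lborel (%x. L * (indicator (cball 0 r) x * \<bar>g (u x)\<bar>))"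
    using lg integrable_abs[of lborel "%x. indicator (cball 0 r) x *\<^sub>R g (u x)"]
    by (simp add: locally_integrable_def set_integrable_def abs_mult)
   show "AE x in lborel. (%n. g (u x) * ((\<phi> x - \<phi> (x - (1 / real (Suc n)) *\<^sub>R e)) * real (Suc n))) \<longlonglongrightarrow> g (u x) * partial_deriv k \<phi> x"
    unfolding e_def by (intro AE_I2 tendsto_mult tendsto_const difference_quotient_tendsto[OF \<phi>])
   show "AE x in lborel. norm (g (u x) * ((\<phi> x - \<phi> (x - (1 / real (Suc n)) *\<^sub>R e)) * real (Suc n))) <= L * (indicator (cball 0 r) x * \<bar>g (u x)\<bar>)" for n
   proof (intro AE_I2)
    fix x
    have "\<bar>\<phi> x - \<phi> (x - (1 / real (Suc n)) *\<^sub>R e)\<bar> * real (Suc n) <= (L * norm ((1 / real (Suc n)) *\<^sub>R e) * indicator (cball 0 r) x) * real (Suc n)"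
     using L1[of "(1 / real (Suc n)) *\<^sub>R e" x] by (intro mult_right_mono) (auto simp: ne abs_minus_commute)
    also have "... = L * indicator (cball 0 r) x" by (simp add: ne)
    finally have "\<bar>g (u x)\<bar> * (\<bar>\<phi> x - \<phi> (x - (1 / real (Suc n)) *\<^sub>R e)\<bar> * real (Suc n)) <= \<bar>g (u x)\<bar> * (L * indicator (cball 0 r) x)"
     by (rule mult_left_mono) simp
    then show "norm (g (u x) * ((\<phi> x - \<phi> (x - (1 / real (Suc n)) *\<^sub>R e)) * real (Suc n))) <= L * (indicator (cball 0 r) x * \<bar>g (u x)\<bar>)"
     by (simp add: abs_mult mult_ac)
   qed
   have "partial_deriv k \<phi> \<in> borel_measurable borel" by (rule test_functionD(4)[OF test_function_partial[OF \<phi>]])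
   then show "(%x. g (u x) * partial_deriv k \<phi> x) \<in> borel_measurable lborel" by measurable
  qed measurable
  have lim2: "(%n. real (Suc n) * A (1 / real (Suc n))) \<longlonglongrightarrow> - J"
  proof (rule LIM_zero_cancel, rule Lim_null_comparison)
   show "\<forall>\<^sub>F n in sequentially. norm (real (Suc n) * A (1 / real (Suc n)) - - J) <= 1 / real (Suc n) * C"
   proof (intro always_eventually allI)
    fix n
    define t where "t = 1 / real (Suc n)"
    have t: "0 < t" "t <= 1" by (auto simp: t_def)
    have "\<bar>A t + t * J\<bar> / t <= t^2 * C / t" using main[OF t] t by (intro divide_right_mono) auto
    moreover have "(A t + t * J) / t = real (Suc n) * A t + J" using t by (simp add: t_def field_simps)
    moreover have "\<bar>A t + t * J\<bar> / t = \<bar>(A t + t * J) / t\<bar>" using t by simp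
    ultimately have "\<bar>real (Suc n) * A t + J\<bar> <= t * C" using t by (simp add: power2_eq_square)
    then show "norm (real (Suc n) * A (1 / real (Suc n)) - - J) <= 1 / real (Suc n) * C" by (simp add: t_def)
   qed
   show "(%n. 1 / real (Suc n) * C) \<longlonglongrightarrow> 0"
    using tendsto_mult_left_zero[OF LIMSEQ_Suc[OF lim_1_over_n]] .
  qed
  have "(LINT x|lborel. g (u x) * ((\<phi> x - \<phi> (x - (1 / real (Suc n)) *\<^sub>R e)) * real (Suc n))) = real (Suc n) * A (1 / real (Suc n))" for n
   unfolding A_def by (subst integral_mult_right_zero[symmetric]) (simp add: mult_ac)
  then have "(LINT x|lborel. g (u x) * partial_deriv k \<phi> x) = - J"
   using LIMSEQ_unique[OF lim1] lim2 by simp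
  then show "(LINT x|lborel. g (u x) * partial_deriv k \<phi> x) = - (LINT x|lborel. (g' (u x) *\<^sub>R G x) $ k * \<phi> x)"
   by (simp add: J_def f_def e_def inner_axis mult_ac)
 qed
 ultimately show ?thesis by (simp add: L2_gradient_def)
qed

section \<open>The Sobolev inequality\<close>

lemma pos_part_square_deriv:
 "((%s::real. (max 0 (s - c))^2) has_real_derivative 2 * max 0 (s - c)) (at s)"
proof -
 consider "s < c" | "s > c" | "s = c" by linarith
 then show ?thesis
 proof cases
  case 1
  have "((%s. 0) has_real_derivative 2 * max 0 (s - c)) (at s)" using 1 by simp
  then show ?thesis
   by (rule DERIV_cong_ev[THEN iffD1, OF refl _ refl, rotated])
    (use 1 in \<open>auto intro: eventually_mono[OF eventually_nhds_in_open[of "{..<c}" s]]\<close>)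
 next
  case 2
  have "((%s. (s - c)^2) has_real_derivative 2 * max 0 (s - c)) (at s)"
   using 2 by (auto intro!: derivative_eq_intros)
  then show ?thesis
   by (rule DERIV_cong_ev[THEN iffD1, OF refl _ refl, rotated])
    (use 2 in \<open>auto simp: max_def intro: eventually_mono[OF eventually_nhds_in_open[of "{c<..}" s]]\<close>)
 next
  case 3
  have "((%h. (max 0 h)^2 / h) \<longlongrightarrow> 0) (at (0::real))"
  proof (rule Lim_null_comparison)
   show "\<forall>\<^sub>F h in at (0::real). norm ((max 0 h)^2 / h) <= \<bar>h\<bar>"
    by (intro always_eventually) (auto simp: max_def power2_eq_square)
   show "((%h::real. \<bar>h\<bar>) \<longlongrightarrow> 0) (at 0)" by (intro tendsto_rabs_zero tendsto_ident_at)
  qed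
  then show ?thesis using 3 by (simp add: DERIV_def)
 qed
qed

text \<open>A \<open>C\<^sup>1\<^sup>,\<^sup>1\<close> truncation, vanishing on \<open>[-1, 1]\<close> and equal to \<open>1\<close> outside \<open>(-3, 3)\<close>; it stands in for the
 Lipschitz truncation, to which the chain rule above does not apply.\<close>

definition half_trunc :: "real => real"
 where "half_trunc s = ((max 0 (s - 1))^2 - 2 * (max 0 (s - 2))^2 + (max 0 (s - 3))^2) / 2"

definition tent :: "real => real"
 where "tent s = max 0 (s - 1) - 2 * max 0 (s - 2) + max 0 (s - 3)"

definition trunc :: "real => real"
 where "trunc s = half_trunc s + half_trunc (- s)"

definition trunc_deriv :: "real => real"
 where "trunc_deriv s = tent s - tent (- s)"

lemma half_trunc_deriv: "(half_trunc has_real_derivative tent s) (at s)"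
proof -
 have "(half_trunc has_real_derivative
   (2 * max 0 (s - 1) - 2 * (2 * max 0 (s - 2)) + 2 * max 0 (s - 3)) / 2) (at s)"
  unfolding half_trunc_def[abs_def]
  by (intro DERIV_cdivide DERIV_add DERIV_diff DERIV_cmult pos_part_square_deriv)
 moreover have "(2 * max 0 (s - 1) - 2 * (2 * max 0 (s - 2)) + 2 * max 0 (s - 3)) / 2 = tent s"
  by (simp add: tent_def field_simps)
 ultimately show ?thesis by simp
qed

lemma trunc_has_deriv: "(trunc has_real_derivative trunc_deriv s) (at s)"
 unfolding trunc_def[abs_def] trunc_deriv_def
 by (auto intro!: derivative_eq_intros half_trunc_deriv DERIV_chain2[OF half_trunc_deriv])

lemma tent_bounds: "0 <= tent s" "tent s <= 1" "s <= 1 ==> tent s = 0" "s >= 3 ==> tent s = 0"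
 by (auto simp: tent_def max_def)

lemma tent_Lipschitz: "\<bar>tent s - tent t\<bar> <= 4 * \<bar>s - t\<bar>"
proof -
 have "\<bar>max 0 (s - c) - max 0 (t - c)\<bar> <= \<bar>s - t\<bar>" for c :: real by (auto simp: max_def)
 note * = this[of 1] this[of 2] this[of 3]
 have "\<bar>(a1 - 2 * a2 + a3) - (b1 - 2 * b2 + b3)\<bar> <= 4 * d"
  if "\<bar>a1 - b1\<bar> <= d" "\<bar>a2 - b2\<bar> <= d" "\<bar>a3 - b3\<bar> <= d" for a1 a2 a3 b1 b2 b3 d :: real
  using that by linarith
 from this[OF *] show ?thesis unfolding tent_def .
qed

lemma half_trunc_small: "s <= 1 ==> half_trunc s = 0" and half_trunc_large: "s >= 3 ==> half_trunc s = 1"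
 by (auto simp: half_trunc_def max_def power2_eq_square algebra_simps)

lemma trunc_small: "\<bar>s\<bar> <= 1 ==> trunc s = 0" and trunc_large: "\<bar>s\<bar> >= 3 ==> trunc s = 1"
 using half_trunc_small[of s] half_trunc_small[of "- s"] half_trunc_large[of s] half_trunc_large[of "- s"]
 by (auto simp: trunc_def abs_if split: if_splits)

lemma trunc_deriv_bound: "\<bar>trunc_deriv s\<bar> <= (if 1 < \<bar>s\<bar> \<and> \<bar>s\<bar> < 3 then 1 else 0)"
proof (cases "1 < \<bar>s\<bar> \<and> \<bar>s\<bar> < 3")
 case True
 then show ?thesis using tent_bounds(1,2)[of s] tent_bounds(1,2)[of "- s"] unfolding trunc_deriv_def by simp
next
 case False
 then consider "\<bar>s\<bar> <= 1" | "s >= 3" | "s <= - 3" by linarith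
 then have "tent s = 0 \<and> tent (- s) = 0"
  by cases (use tent_bounds(3,4)[of s] tent_bounds(3,4)[of "- s"] in auto)
 then show ?thesis using False by (simp add: trunc_deriv_def)
qed

lemma trunc_deriv_Lipschitz: "\<bar>trunc_deriv s - trunc_deriv t\<bar> <= 8 * \<bar>s - t\<bar>"
proof -
 have "\<bar>tent (- s) - tent (- t)\<bar> <= 4 * \<bar>s - t\<bar>" using tent_Lipschitz[of "- s" "- t"] by (simp add: abs_minus_commute)
 then show ?thesis using tent_Lipschitz[of s t] unfolding trunc_deriv_def by linarith
qed

lemma L2_gradient_trunc:
 assumes u: "L2_gradient u G" and a: "a > 0"
 shows "L2_gradient (%x. a * trunc (u x / a)) (%x. trunc_deriv (u x / a) *\<^sub>R G x)"
proof (rule weak_gradient_chain[OF u, where g="%t. a * trunc (t / a)" and g'="%t. trunc_deriv (t / a)" and M="1 + 8 / a"])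
 show "((%t. a * trunc (t / a)) has_real_derivative trunc_deriv (t / a)) (at t)" for t
  using a by (auto intro!: derivative_eq_intros DERIV_chain2[OF trunc_has_deriv])
 show "\<bar>trunc_deriv (t / a)\<bar> <= 1 + 8 / a" for t
 proof -
  have "\<bar>trunc_deriv (t / a)\<bar> <= 1" using trunc_deriv_bound[of "t / a"] by (simp split: if_splits)
  also have "1 <= 1 + 8 / a" using a by simp
  finally show ?thesis .
 qed
 show "\<bar>trunc_deriv (s / a) - trunc_deriv (t / a)\<bar> <= (1 + 8 / a) * \<bar>s - t\<bar>" for s t
 proof -
  have "\<bar>trunc_deriv (s / a) - trunc_deriv (t / a)\<bar> <= 8 * \<bar>s / a - t / a\<bar>" by (rule trunc_deriv_Lipschitz)
  also have "... = (8 / a) * \<bar>s - t\<bar>" using a by (simp add: diff_divide_distrib[symmetric])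
  also have "... <= (1 + 8 / a) * \<bar>s - t\<bar>" by (intro mult_right_mono) auto
  finally show ?thesis .
 qed
qed

lemma ball_borel [measurable]: "ball a r \<in> sets borel"
 by simp

text \<open>Chebyshev's inequality. The first claim records finiteness separately, because
  \<open>measure\<close> returns 0 on sets of infinite measure.\<close>

lemma superlevel_measure:
 fixes u :: "real ^ 'n => real"
 assumes "integrable lborel (%x. (u x)^2)" and [measurable]: "u \<in> borel_measurable borel" and "a > 0"
 shows "emeasure lborel {x. \<bar>u x\<bar> > a} = ennreal (measure lborel {x. \<bar>u x\<bar> > a})"
  and "a^2 * measure lborel {x. \<bar>u x\<bar> > a} <= (LINT x|lborel. (u x)^2)"
proof -
 have "ennreal (a^2) * emeasure lborel {x. \<bar>u x\<bar> > a} = (\<integral>\<^sup>+x. ennreal (a^2) * indicator {x. \<bar>u x\<bar> > a} x \<partial>lborel)"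
  by (subst nn_integral_cmult_indicator) auto
 also have "... <= (\<integral>\<^sup>+x. ennreal ((u x)^2) \<partial>lborel)"
  using \<open>a > 0\<close> power_mono[of a "\<bar>u _\<bar>" 2]
  by (intro nn_integral_mono) (auto simp: indicator_def intro!: ennreal_leI)
 also have "... = ennreal (LINT x|lborel. (u x)^2)" by (rule nn_integral_eq_integral) (auto intro: assms)
 finally have *: "ennreal (a^2) * emeasure lborel {x. \<bar>u x\<bar> > a} <= ennreal (LINT x|lborel. (u x)^2)" .
 then have "ennreal (a^2) * emeasure lborel {x. \<bar>u x\<bar> > a} < \<infinity>"
  by (rule le_less_trans) simp
 then have "emeasure lborel {x. \<bar>u x\<bar> > a} < \<infinity>"
  using \<open>a > 0\<close> by (auto simp: ennreal_mult_less_top)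
 then show e: "emeasure lborel {x. \<bar>u x\<bar> > a} = ennreal (measure lborel {x. \<bar>u x\<bar> > a})"
  by (intro emeasure_eq_ennreal_measure) simp
 show "a^2 * measure lborel {x. \<bar>u x\<bar> > a} <= (LINT x|lborel. (u x)^2)"
  using * unfolding e by (simp add: ennreal_mult'[symmetric])
qed

text \<open>If the truncation at height \<open>a\<close> has plateau value \<open>a\<close> at \<open>x\<close>, then it vanishes on at least half of the ball
 around \<open>x\<close> whose volume is twice that of the superlevel set.\<close>

lemma superlevel_decay:
 fixes u :: "real ^ 'n => real"
 assumes u: "L2_gradient u G" and u2: "integrable lborel (%x. (u x)^2)" and a: "a > 0"
 defines "m \<equiv> measure lborel {x. \<bar>u x\<bar> > a}"
 defines "D \<equiv> \<integral>x. indicator {x. a < \<bar>u x\<bar> \<and> \<bar>u x\<bar> < 3 * a} x * (norm (G x))^2 \<partial>lborel"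
 shows "measure lborel {x. \<bar>u x\<bar> > 4 * a} <=
  2 * (2 / unit_ball_vol (real CARD('n))) powr (2 / real CARD('n)) * m powr (2 / real CARD('n)) * D / a^2"
proof (cases "m = 0")
 case True
 note [measurable] = L2_gradientD(4)[OF u]
 have "measure lborel {x. \<bar>u x\<bar> > 4 * a} <= m"
  unfolding m_def measure_def using a superlevel_measure(1)[OF u2 _ a]
  by (intro enn2real_mono emeasure_mono) auto
 then show ?thesis using True by (simp add: measure_le_0_iff)
next
 case False
 then have m: "m > 0" by (simp add: m_def zero_less_measure_iff)
 note [measurable] = L2_gradientD(4,5)[OF u]
 define N where "N = real CARD('n)"
 have N: "N > 0" by (simp add: N_def)
 define om where "om = unit_ball_vol N"
 have om: "om > 0" using N by (simp add: om_def)
 define t where "t = (2 * m / om) powr (1 / N)"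
 have t: "t > 0" using m om by (simp add: t_def)
 have tN: "om * t ^ CARD('n) = 2 * m"
  using om m N by (simp add: t_def powr_realpow[symmetric] powr_powr N_def)
 have ball: "emeasure lborel (ball (0::real^'n) t) = ennreal (2 * m)"
  using t emeasure_ball[of t "0::real^'n"] tN by (simp add: om_def N_def)
 define v where "v x = a * trunc (u x / a)" for x
 define H where "H x = trunc_deriv (u x / a) *\<^sub>R G x" for x
 have v: "L2_gradient v H" using L2_gradient_trunc[OF u a] by (simp add: v_def[abs_def] H_def[abs_def])
 note vD = L2_gradientD[OF v]
 note [measurable] = vD(4,5)
 define X where "X = {x. \<bar>u x\<bar> > 4 * a}"
 have [measurable]: "X \<in> sets borel" unfolding X_def by measurable
 have X: "emeasure lborel X = ennreal (measure lborel X)"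
  unfolding X_def using superlevel_measure(1)[OF u2, of "4 * a"] a by simp
 have HD: "(LINT x|lborel. (norm (H x))^2) <= D"
  unfolding D_def
 proof (rule LINT_mono[OF vD(2)])
  show "integrable lborel (%x. indicator {x. a < \<bar>u x\<bar> \<and> \<bar>u x\<bar> < 3 * a} x * (norm (G x))^2)"
   using integrable_mult_indicator[OF _ L2_gradientD(2)[OF u], of "{x. a < \<bar>u x\<bar> \<and> \<bar>u x\<bar> < 3 * a}"] by simp
  fix x
  have "\<bar>trunc_deriv (u x / a)\<bar> <= (if a < \<bar>u x\<bar> \<and> \<bar>u x\<bar> < 3 * a then 1 else 0)"
   using trunc_deriv_bound[of "u x / a"] a by (simp add: field_simps)
  then have "(trunc_deriv (u x / a))^2 <= indicator {x. a < \<bar>u x\<bar> \<and> \<bar>u x\<bar> < 3 * a} x"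
   by (auto simp: indicator_def abs_square_le_1 split: if_splits)
  then show "(norm (H x))^2 <= indicator {x. a < \<bar>u x\<bar> \<and> \<bar>u x\<bar> < 3 * a} x * (norm (G x))^2"
   by (simp add: H_def power_mult_distrib mult_right_mono)
 qed
 \<comment> \<open>The double integral is estimated in both orders: from above with \<open>x\<close>
   inside, by the translation estimate for the truncation \<open>v\<close>, and from below with
   \<open>z\<close> inside, at the points of \<open>X\<close>.\<close>
 let ?f = "%x z. ennreal ((v (x + z) - v x)^2) * indicator (ball 0 t) z"
 have up: "(\<integral>\<^sup>+z. (\<integral>\<^sup>+x. ?f x z \<partial>lborel) \<partial>lborel) <= ennreal (t^2 * D * (2 * m))"
 proof -
  have "(\<integral>\<^sup>+x. ?f x z \<partial>lborel) <= ennreal (t^2 * D) * indicator (ball 0 t) z" for z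
  proof (cases "z \<in> ball 0 t")
   case True
   have "(LINT x|lborel. (v (x + z) - v x)^2) <= (norm z)^2 * (LINT x|lborel. (norm (H x))^2)"
    by (rule L2_translation(2)[OF v])
   also have "... <= t^2 * D"
    using HD True by (intro mult_mono power_mono) auto
   finally have "ennreal (LINT x|lborel. (v (x + z) - v x)^2) <= ennreal (t^2 * D)"
    by (rule ennreal_leI)
   moreover have "(\<integral>\<^sup>+x. ennreal ((v (x + z) - v x)^2) \<partial>lborel) = ennreal (LINT x|lborel. (v (x + z) - v x)^2)"
    by (rule nn_integral_eq_integral[OF L2_translation(1)[OF v]]) simp
   ultimately show ?thesis using True by simp
  qed simp
  then have "(\<integral>\<^sup>+z. (\<integral>\<^sup>+x. ?f x z \<partial>lborel) \<partial>lborel) <= (\<integral>\<^sup>+z. ennreal (t^2 * D) * indicator (ball (0::real^'n) t) z \<partial>lborel)"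
   by (intro nn_integral_mono)
  also have "... = ennreal (t^2 * D * (2 * m))"
   using m by (subst nn_integral_cmult_indicator) (auto simp: ball ennreal_mult'')
  finally show ?thesis .
 qed
 have low: "ennreal (a^2 * m * measure lborel X) <= (\<integral>\<^sup>+x. (\<integral>\<^sup>+z. ?f x z \<partial>lborel) \<partial>lborel)"
 proof -
  have "ennreal (a^2 * m) <= (\<integral>\<^sup>+z. ?f x z \<partial>lborel)" if x: "x \<in> X" for x
  proof -
   define Y where "Y = {z. \<bar>u (x + z)\<bar> > a}"
   have [measurable]: "Y \<in> sets borel" unfolding Y_def by measurable
   have "emeasure lborel Y = (\<integral>\<^sup>+z. indicator Y z \<partial>lborel)" by simp
   also have "... = (\<integral>\<^sup>+z. indicator {x. \<bar>u x\<bar> > a} (z + x) \<partial>lborel)"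
    by (intro nn_integral_cong) (auto simp only: Y_def indicator_def add.commute mem_Collect_eq)
   also have "... = (\<integral>\<^sup>+z. indicator {x. \<bar>u x\<bar> > a} z \<partial>lborel)"
    by (rule nn_integral_shift) measurable
   also have "... = ennreal m" unfolding m_def using superlevel_measure(1)[OF u2 _ a] by simp
   finally have Y: "emeasure lborel Y = ennreal m" .
   have "ennreal (2 * m) <= emeasure lborel ((ball 0 t - Y) \<union> Y)"
    unfolding ball[symmetric] by (intro emeasure_mono) auto
   also have "... <= emeasure lborel (ball 0 t - Y) + ennreal m"
    unfolding Y[symmetric] by (intro emeasure_subadditive) auto
   finally have "ennreal m <= emeasure lborel (ball 0 t - Y)"
    using m by (cases "emeasure lborel (ball 0 t - Y)") (auto simp flip: ennreal_plus)
   then have "ennreal (a^2 * m) <= ennreal (a^2) * emeasure lborel (ball 0 t - Y)"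
    by (simp add: ennreal_mult' mult_left_mono)
   also have "... = (\<integral>\<^sup>+z. ennreal (a^2) * indicator (ball 0 t - Y) z \<partial>lborel)"
    by (subst nn_integral_cmult_indicator) auto
   also have "... <= (\<integral>\<^sup>+z. ?f x z \<partial>lborel)"
   proof (rule nn_integral_mono)
    fix z
    have "v x = a" using x a by (simp add: v_def X_def trunc_large field_simps)
    moreover have "v (x + z) = 0" if "z \<notin> Y"
     using that a by (simp add: v_def Y_def trunc_small field_simps)
    ultimately show "ennreal (a^2) * indicator (ball 0 t - Y) z <= ?f x z"
     by (auto simp: indicator_def)
   qed
   finally show ?thesis .
  qed
  then have "(\<integral>\<^sup>+x. ennreal (a^2 * m) * indicator X x \<partial>lborel) <= (\<integral>\<^sup>+x. (\<integral>\<^sup>+z. ?f x z \<partial>lborel) \<partial>lborel)"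
   by (intro nn_integral_mono) (auto simp: indicator_def)
  moreover have "(\<integral>\<^sup>+x. ennreal (a^2 * m) * indicator X x \<partial>lborel) = ennreal (a^2 * m * measure lborel X)"
   using m by (subst nn_integral_cmult_indicator) (auto simp: X ennreal_mult'')
  ultimately show ?thesis by simp
 qed
 have "(\<integral>\<^sup>+x. (\<integral>\<^sup>+z. ?f x z \<partial>lborel) \<partial>lborel) = (\<integral>\<^sup>+z. (\<integral>\<^sup>+x. ?f x z \<partial>lborel) \<partial>lborel)"
  by (rule lborel_pair.Fubini') measurable
 then have "ennreal (a^2 * m * measure lborel X) <= ennreal (t^2 * D * (2 * m))"
  using low up by simp
 moreover have D0: "D >= 0" unfolding D_def by simp
 ultimately have "a^2 * m * measure lborel X <= t^2 * D * (2 * m)"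
  using m by (subst (asm) ennreal_le_iff) auto
 then have "measure lborel X <= 2 * t^2 * D / a^2" using a m by (simp add: field_simps)
 also have "t^2 = (2 / om) powr (2 / N) * m powr (2 / N)"
  using m om N t by (simp add: t_def powr_realpow[symmetric] powr_powr powr_mult[symmetric])
 finally show ?thesis by (simp add: X_def om_def N_def mult_ac)
qed

text \<open>Absorption: if \<open>S\<close> exceeds \<open>2 * r\<close>, the sublinear term is at
  least half of \<open>S\<close>, and division by \<open>S powr \<theta>\<close> leaves a bound in
  terms of \<open>c\<close> alone.\<close>

lemma self_improving_bound:
 fixes S :: real
 assumes "S >= 0" "r >= 0" "c >= 0" "0 < \<theta>" "\<theta> < 1" "S <= r + c * S powr \<theta>"
 shows "S <= 2 * r + (2 * c) powr (1 / (1 - \<theta>))"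
proof (cases "S <= 2 * r")
 case False
 then have S: "S > 0" using assms by linarith
 have "S / 2 <= c * S powr \<theta>" using assms False by linarith
 then have "S / S powr \<theta> <= 2 * c" using S by (simp add: field_simps)
 then have "S powr (1 - \<theta>) <= 2 * c" using S by (simp add: powr_diff)
 then have "(S powr (1 - \<theta>)) powr (1 / (1 - \<theta>)) <= (2 * c) powr (1 / (1 - \<theta>))"
  using assms by (intro powr_mono2) auto
 then have "S <= (2 * c) powr (1 / (1 - \<theta>))" using S assms by (simp add: powr_powr)
 then show ?thesis using assms by simp
next
 case True
 then show ?thesis using powr_ge_zero[of "2 * c" "1 / (1 - \<theta>)"] by linarith
qed

text \<open>The ratio 3 between the ends of a layer is below 4, so two admissible exponents differ
  by at most 1.\<close>

lemma card_dyadic_overlap: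
 fixes A :: "int set" and t :: real
 assumes "finite A" "!!k. k \<in> A ==> 2 powr real_of_int k < t \<and> t < 3 * 2 powr real_of_int k"
 shows "card A <= 2"
proof (cases "A = {}")
 case False
 define k0 where "k0 = Min A"
 have "k \<in> {k0, k0 + 1}" if k: "k \<in> A" for k
 proof -
  have "k0 \<in> A" "k0 <= k" using False assms(1) k by (auto simp: k0_def)
  then have "2 powr real_of_int k < 3 * 2 powr real_of_int k0" using assms(2)[OF k] assms(2)[of k0] by linarith
  also have "... < 2 powr (real_of_int k0 + 2)" by (simp add: powr_add)
  finally have "real_of_int k < real_of_int k0 + 2" by simp
  then show ?thesis using \<open>k0 <= k\<close> by auto
 qed
 then have "A \<subseteq> {k0, k0 + 1}" by blast
 then have "card A <= card {k0, k0 + 1}" by (intro card_mono) auto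
 then show ?thesis by simp
qed simp

text \<open>Summation of the decay estimate over dyadic levels: with \<open>b k = 2\<^bsup>P k\<^esup> |{|u| > 2\<^bsup>k\<^esup>}|\<close> it reads
 \<open>b (k + 2) \<le> C b(k)\<^bsup>2/N\<^esup> D k\<close>, and the energies \<open>D k\<close> of the dyadic layers overlap at most twice.\<close>

theorem Sobolev_inequality:
 assumes N3: "CARD('n) >= 3"
 defines "N \<equiv> real CARD('n)"
 defines "P \<equiv> 2 * N / (N - 2)"
 obtains C where "C > 0" "!!(u :: real ^ 'n => real) G. L2_gradient u G ==> integrable lborel (%x. (u x)^2) ==>
  (\<integral>\<^sup>+x. ennreal (\<bar>u x\<bar> powr P) \<partial>lborel) <= ennreal (C * (LINT x|lborel. (norm (G x))^2) powr (N / (N - 2)))"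
proof -
 have N: "N >= 3" using N3 by (simp add: N_def)
 then have P2: "P > 2" by (simp add: P_def field_simps)
 \<comment> \<open>The identity that singles out the critical exponent: the powers of
   \<open>a k\<close> left over from the decay estimate combine with \<open>m k powr (2 / N)\<close>
   into exactly \<open>b k powr (2 / N)\<close>.\<close>
 have PN: "P - 2 = P * (2 / N)" using N by (simp add: P_def field_simps)
 define C0 where "C0 = 2 * (2 / unit_ball_vol N) powr (2 / N)"
 have "unit_ball_vol N > 0" using N by simp
 then have C0: "C0 > 0" by (simp add: C0_def)
 define C1 where "C1 = C0 * 4 powr P"
 have C1: "C1 > 0" using C0 by (simp add: C1_def)
 define C where "C = 2 powr P * (4 * C1) powr (N / (N - 2))"
 have "(\<integral>\<^sup>+x. ennreal (\<bar>u x\<bar> powr P) \<partial>lborel) <= ennreal (C * (LINT x|lborel. (norm (G x))^2) powr (N / (N - 2)))"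
  if u: "L2_gradient u G" and u2: "integrable lborel (%x. (u x)^2)" for u :: "real ^ 'n => real" and G
 proof -
  note [measurable] = L2_gradientD(4,5)[OF u]
  define a where "a k = 2 powr real_of_int k" for k :: int
  have a: "a k > 0" for k by (simp add: a_def)
  define m where "m k = measure lborel {x. \<bar>u x\<bar> > a k}" for k
  define D where "D k = (LINT x|lborel. indicator {x. a k < \<bar>u x\<bar> \<and> \<bar>u x\<bar> < 3 * a k} x * (norm (G x))^2)" for k
  define DD where "DD = (LINT x|lborel. (norm (G x))^2)"
  define U where "U = (LINT x|lborel. (u x)^2)"
  define b where "b k = a k powr P * m k" for k
  have b0: "b k >= 0" for k by (simp add: b_def m_def)
  have D0: "D k >= 0" for k unfolding D_def by simp
  have DD0: "DD >= 0" unfolding DD_def by simp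
  have bstep: "b (k + 2) <= C1 * b k powr (2 / N) * D k" for k
  proof -
   have a4: "a (k + 2) = 4 * a k" by (simp add: a_def powr_add)
   have "m (k + 2) <= C0 * m k powr (2 / N) * D k / (a k)^2"
    using superlevel_decay[OF u u2 a[of k]] unfolding m_def D_def C0_def N_def a4 .
   then have "b (k + 2) <= (4 * a k) powr P * (C0 * m k powr (2 / N) * D k / (a k)^2)"
    unfolding b_def a4 by (intro mult_left_mono) auto
   also have "(4 * a k) powr P = 4 powr P * (a k powr P)" using a[of k] by (simp add: powr_mult)
   also have "4 powr P * a k powr P * (C0 * m k powr (2 / N) * D k / (a k)^2)
     = C1 * (a k powr P / (a k)^2) * m k powr (2 / N) * D k" by (simp add: C1_def)
   also have "a k powr P / (a k)^2 = a k powr (P - 2)" using a[of k] by (simp add: powr_diff)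
   also have "... = (a k powr P) powr (2 / N)" unfolding PN by (simp add: powr_powr)
   finally show ?thesis by (simp add: b_def powr_mult m_def mult_ac)
  qed
  \<comment> \<open>A finite range of levels keeps the sum finite, which the absorption argument
    presupposes. The two lowest levels are not reached by the step from k to k + 2; they are
    collected in \<open>r K\<close>.\<close>
  define S where "S K = (\<Sum>k\<in>{- int K..int K}. b k)" for K
  define r where "r K = b (- int K) + b (- int K + 1)" for K
  have S0: "S K >= 0" for K unfolding S_def by (intro sum_nonneg b0)
  have bS: "b k <= S K" if "k \<in> {- int K..int K}" for k K
   unfolding S_def using that b0 by (intro member_le_sum) auto
  have sumD: "(\<Sum>k\<in>A. D k) <= 2 * DD" if A: "finite A" for A
  proof -
   have i: "integrable lborel (%x. indicator {x. a k < \<bar>u x\<bar> \<and> \<bar>u x\<bar> < 3 * a k} x * (norm (G x))^2)" for k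
    using integrable_mult_indicator[OF _ L2_gradientD(2)[OF u], of "{x. a k < \<bar>u x\<bar> \<and> \<bar>u x\<bar> < 3 * a k}"] by simp
   have "(\<Sum>k\<in>A. D k) = (LINT x|lborel. (\<Sum>k\<in>A. indicator {x. a k < \<bar>u x\<bar> \<and> \<bar>u x\<bar> < 3 * a k} x * (norm (G x))^2))"
    unfolding D_def by (rule LINT_sum[symmetric]) (rule i)
   also have "... <= (LINT x|lborel. 2 * (norm (G x))^2)"
   proof (rule LINT_mono)
    show "integrable lborel (%x. \<Sum>k\<in>A. indicator {x. a k < \<bar>u x\<bar> \<and> \<bar>u x\<bar> < 3 * a k} x * (norm (G x))^2)"
     by (intro L1_sum i)
    show "integrable lborel (%x. 2 * (norm (G x))^2)" using L2_gradientD(2)[OF u] by simp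
    fix x
    define B where "B = {k\<in>A. a k < \<bar>u x\<bar> \<and> \<bar>u x\<bar> < 3 * a k}"
    have "(\<Sum>k\<in>A. indicator {x. a k < \<bar>u x\<bar> \<and> \<bar>u x\<bar> < 3 * a k} x :: real) = (\<Sum>k\<in>B. 1)"
     by (rule sum.mono_neutral_cong_right) (use A in \<open>auto simp: B_def indicator_def\<close>)
    also have "... = real (card B)" by simp
    also have "card B <= 2"
     by (rule card_dyadic_overlap[of _ "\<bar>u x\<bar>"]) (use A in \<open>auto simp: B_def a_def\<close>)
    then have "real (card B) <= 2" by simp
    finally show "(\<Sum>k\<in>A. indicator {x. a k < \<bar>u x\<bar> \<and> \<bar>u x\<bar> < 3 * a k} x * (norm (G x))^2) <= 2 * (norm (G x))^2"
     by (simp add: sum_distrib_right[symmetric] mult_right_mono)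
   qed
   finally show ?thesis by (simp add: DD_def)
  qed
  have Srec: "S K <= r K + 2 * C1 * DD * S K powr (2 / N)" if K: "K >= 1" for K
  proof -
   have "S K = (\<Sum>k\<in>{- int K, - int K + 1} \<union> {- int K + 2..int K}. b k)"
    unfolding S_def using K by (intro sum.cong) auto
   also have "... = r K + (\<Sum>k\<in>{- int K + 2..int K}. b k)"
    by (subst sum.union_disjoint) (auto simp: r_def)
   also have "(\<Sum>k\<in>{- int K + 2..int K}. b k) = (\<Sum>k\<in>{- int K..int K - 2}. b (k + 2))"
    by (rule sum.reindex_bij_witness[where i="%k. k + 2" and j="%k. k - 2"]) auto
   also have "... <= (\<Sum>k\<in>{- int K..int K - 2}. C1 * S K powr (2 / N) * D k)"
   proof (rule sum_mono)
    fix k assume k: "k \<in> {- int K..int K - 2}"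
    have "b (k + 2) <= C1 * b k powr (2 / N) * D k" by (rule bstep)
    also have "... <= C1 * S K powr (2 / N) * D k"
     using bS[of k K] k b0 C1 N D0 by (intro mult_right_mono mult_left_mono powr_mono2) auto
    finally show "b (k + 2) <= C1 * S K powr (2 / N) * D k" .
   qed
   also have "... = C1 * S K powr (2 / N) * (\<Sum>k\<in>{- int K..int K - 2}. D k)"
    by (simp add: sum_distrib_left)
   also have "... <= C1 * S K powr (2 / N) * (2 * DD)"
    using C1 by (intro mult_left_mono sumD) auto
   finally show ?thesis by (simp add: mult_ac)
  qed
  define E where "E = (4 * C1 * DD) powr (N / (N - 2))"
  have SE: "S K <= 2 * r K + E" if "K >= 1" for K
  proof -
   have "S K <= 2 * r K + (2 * (2 * C1 * DD)) powr (1 / (1 - 2 / N))"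
    using N C1 DD0 by (intro self_improving_bound S0 Srec[OF that]) (auto simp: r_def b0)
   moreover have "1 / (1 - 2 / N) = N / (N - 2)" using N by (simp add: field_simps)
   ultimately show ?thesis by (simp add: E_def mult_ac)
  qed
  \<comment> \<open>Chebyshev's inequality in L^2 bounds \<open>b k\<close> by a multiple of 2^(k (P
    - 2)), which tends to 0 as k tends to minus infinity since P > 2.\<close>
  have rlim: "r \<longlonglongrightarrow> 0"
  proof (rule tendsto_sandwich[OF _ _ tendsto_const])
   have bU: "b k <= 2 powr (real_of_int k * (P - 2)) * U" for k
   proof -
    have "(a k)^2 * m k <= U" unfolding m_def U_def by (rule superlevel_measure(2)[OF u2 _ a]) simp
    then have "a k powr (P - 2) * ((a k)^2 * m k) <= a k powr (P - 2) * U" by (rule mult_left_mono) simp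
    moreover have "a k powr P = a k powr (P - 2) * (a k)^2" using a[of k] by (simp add: powr_diff)
    ultimately show ?thesis by (simp add: b_def a_def powr_powr mult.assoc)
   qed
   show "\<forall>\<^sub>F K in sequentially. r K <= 2 powr (- (P - 2) * real K) * U + 2 powr (- (P - 2) * real K + (P - 2)) * U"
    using bU[of "- int _"] bU[of "- int _ + 1"]
    by (intro always_eventually allI) (auto simp: r_def algebra_simps intro!: add_mono)
   have "(%K. (2 powr (- (P - 2))) ^ K) \<longlonglongrightarrow> 0"
   proof (rule LIMSEQ_realpow_zero)
    have "2 powr (- (P - 2)) < 2 powr 0" using P2 by (intro powr_less_mono) auto
    then show "2 powr (- (P - 2)) < 1" by simp
   qed simp
   then have lim: "(%K. 2 powr (- (P - 2) * real K)) \<longlonglongrightarrow> 0"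
    by (simp add: powr_powr powr_realpow[symmetric])
   from tendsto_add[OF tendsto_mult_left_zero[OF lim, of U] tendsto_mult_left_zero[OF lim, of "2 powr (P - 2) * U"]]
   show "(%K. 2 powr (- (P - 2) * real K) * U + 2 powr (- (P - 2) * real K + (P - 2)) * U) \<longlonglongrightarrow> 0"
    by (simp add: powr_add mult.assoc)
  qed (auto simp: r_def b0)
  define f where "f K x = ennreal (\<bar>u x\<bar> powr P) * indicator {x. 2 powr (- real K) < \<bar>u x\<bar> \<and> \<bar>u x\<bar> <= 2 powr (real K + 1)} x" for K x
  have [measurable]: "f K \<in> borel_measurable borel" for K unfolding f_def[abs_def] by measurable
  have fS: "(\<integral>\<^sup>+x. f K x \<partial>lborel) <= ennreal (2 powr P * S K)" for K
  proof -
   have "f K x <= (\<Sum>k\<in>{- int K..int K}. ennreal (2 powr P * a k powr P) * indicator {x. \<bar>u x\<bar> > a k} x)" for x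
   proof (cases "2 powr (- real K) < \<bar>u x\<bar> \<and> \<bar>u x\<bar> <= 2 powr (real K + 1)")
    case True
    then have u0: "\<bar>u x\<bar> > 0" using powr_gt_zero[of 2 "- real K"] by linarith
    \<comment> \<open>Ceiling minus 1 gives 2^k < |u x| <= 2^(k+1); the strict inequality sits on
      the lower side, as in the superlevel sets that define \<open>m k\<close>.\<close>
    define k where "k = \<lceil>log 2 \<bar>u x\<bar>\<rceil> - 1"
    have k1: "real_of_int k < log 2 \<bar>u x\<bar>" "log 2 \<bar>u x\<bar> <= real_of_int k + 1"
     unfolding k_def by linarith+
    have "- real K < log 2 \<bar>u x\<bar>" "log 2 \<bar>u x\<bar> <= real K + 1"
     using True u0 by (auto simp: less_log_iff log_le_iff)
    then have k: "k \<in> {- int K..int K}" unfolding k_def by (auto simp: ceiling_le_iff le_ceiling_iff; linarith)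
    have ak: "a k < \<bar>u x\<bar>" using k1 u0 by (simp add: a_def less_log_iff)
    have "\<bar>u x\<bar> <= 2 * a k" using k1 u0 by (simp add: a_def log_le_iff powr_add)
    then have "\<bar>u x\<bar> powr P <= (2 * a k) powr P" using P2 by (intro powr_mono2) auto
    also have "... = 2 powr P * a k powr P" using a[of k] by (simp add: powr_mult)
    finally have "f K x <= ennreal (2 powr P * a k powr P) * indicator {x. \<bar>u x\<bar> > a k} x"
     using True ak by (simp add: f_def ennreal_leI)
    also have "... <= (\<Sum>k\<in>{- int K..int K}. ennreal (2 powr P * a k powr P) * indicator {x. \<bar>u x\<bar> > a k} x)"
     using k by (intro member_le_sum) auto
    finally show ?thesis .
   qed (auto simp: f_def)
   then have "(\<integral>\<^sup>+x. f K x \<partial>lborel)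
     <= (\<integral>\<^sup>+x. (\<Sum>k\<in>{- int K..int K}. ennreal (2 powr P * a k powr P) * indicator {x. \<bar>u x\<bar> > a k} x) \<partial>lborel)"
    by (intro nn_integral_mono)
   also have "... = (\<Sum>k\<in>{- int K..int K}. ennreal (2 powr P * a k powr P) * emeasure lborel {x. \<bar>u x\<bar> > a k})"
    by (subst nn_integral_sum) (auto simp: nn_integral_cmult_indicator)
   also have "... = (\<Sum>k\<in>{- int K..int K}. ennreal (2 powr P * b k))"
    using superlevel_measure(1)[OF u2 _ a] by (simp add: b_def m_def ennreal_mult'[symmetric] mult.assoc)
   also have "... = ennreal (2 powr P * S K)"
    by (simp add: sum_ennreal b0 S_def sum_distrib_left)
   finally show ?thesis .
  qed
  have flim: "(%K. f K x) \<longlonglongrightarrow> ennreal (\<bar>u x\<bar> powr P)" for x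
  proof (cases "u x = 0")
   case False
   show ?thesis
   proof (rule tendsto_eventually, rule eventually_sequentiallyI)
    fix K assume K: "nat \<lceil>\<bar>log 2 \<bar>u x\<bar>\<bar>\<rceil> + 1 <= K"
    then have "- real K < log 2 \<bar>u x\<bar>" "log 2 \<bar>u x\<bar> <= real K + 1" by linarith+
    then show "f K x = ennreal (\<bar>u x\<bar> powr P)"
     using False by (simp add: f_def less_log_iff log_le_iff)
   qed
  qed (simp add: f_def)
  have "(\<integral>\<^sup>+x. ennreal (\<bar>u x\<bar> powr P) \<partial>lborel) = (\<integral>\<^sup>+x. liminf (%K. f K x) \<partial>lborel)"
   by (intro nn_integral_cong) (simp add: lim_imp_Liminf[OF _ flim])
  also have "... <= liminf (%K. \<integral>\<^sup>+x. f K x \<partial>lborel)"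
   by (rule nn_integral_liminf) simp
  also have "... <= liminf (%K. ennreal (2 powr P * (2 * r K + E)))"
  proof (rule Liminf_mono)
   show "\<forall>\<^sub>F K in sequentially. (\<integral>\<^sup>+x. f K x \<partial>lborel) <= ennreal (2 powr P * (2 * r K + E))"
    using eventually_ge_at_top[of 1]
    by eventually_elim (auto intro!: order_trans[OF fS] ennreal_leI mult_left_mono SE)
  qed
  also have "... = ennreal (2 powr P * (2 * 0 + E))"
   by (intro lim_imp_Liminf tendsto_ennrealI tendsto_intros rlim) simp
  also have "2 powr P * (2 * 0 + E) = C * DD powr (N / (N - 2))"
   using C1 DD0 by (simp add: E_def C_def powr_mult)
  finally show ?thesis by (simp add: DD_def)
 qed
 moreover have "C > 0" using C1 by (simp add: C_def)
 ultimately show ?thesis using that by blast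
qed

section \<open>Compactness in Lebesgue spaces\<close>

lemma tendsto_abs_powr_0: "r > 0 ==> ((%h::real. \<bar>h\<bar> powr r) \<longlongrightarrow> 0) (at 0)"
 using tendsto_powr'[of "%h::real. \<bar>h\<bar>" 0 "at 0" "%_. r" r] tendsto_rabs_zero[OF tendsto_ident_at, of UNIV]
 by (simp add: always_eventually)

lemma abs_powr_deriv:
 fixes r :: real
 assumes "r > 1"
 shows "((%t. \<bar>t\<bar> powr r) has_real_derivative r * (\<bar>t\<bar> powr (r - 1) * sgn t)) (at t)"
proof -
 consider "t > 0" | "t < 0" | "t = 0" by linarith
 then show ?thesis
 proof cases
  case 1
  have "((%t. t powr r) has_real_derivative r * (\<bar>t\<bar> powr (r - 1) * sgn t)) (at t)"
   using 1 by (auto intro!: derivative_eq_intros)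
  then show ?thesis
   by (rule DERIV_cong_ev[THEN iffD1, OF refl _ refl, rotated])
    (use 1 in \<open>auto intro: eventually_mono[OF eventually_nhds_in_open[of "{0<..}" t]]\<close>)
 next
  case 2
  have "((%t. (- t) powr r) has_real_derivative r * (\<bar>t\<bar> powr (r - 1) * sgn t)) (at t)"
   using 2 by (auto intro!: derivative_eq_intros)
  then show ?thesis
   by (rule DERIV_cong_ev[THEN iffD1, OF refl _ refl, rotated])
    (use 2 in \<open>auto intro: eventually_mono[OF eventually_nhds_in_open[of "{..<0}" t]]\<close>)
 next
  case 3
  have "((%h. \<bar>h\<bar> powr r / h) \<longlongrightarrow> 0) (at (0::real))"
  proof (rule Lim_null_comparison)
   have "norm (\<bar>h\<bar> powr r / h) <= \<bar>h\<bar> powr (r - 1)" for h :: real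
    by (cases "h = 0") (auto simp: powr_diff abs_mult)
   then show "\<forall>\<^sub>F h in at (0::real). norm (\<bar>h\<bar> powr r / h) <= \<bar>h\<bar> powr (r - 1)" by (rule always_eventually[OF allI])
   show "((%h::real. \<bar>h\<bar> powr (r - 1)) \<longlongrightarrow> 0) (at 0)" using assms by (intro tendsto_abs_powr_0) simp
  qed
  then show ?thesis using 3 assms by (simp add: DERIV_def)
 qed
qed

lemma signed_powr_deriv:
 fixes r :: real
 assumes "r > 1"
 shows "((%t. \<bar>t\<bar> powr r * sgn t) has_real_derivative r * \<bar>t\<bar> powr (r - 1)) (at t)"
proof -
 consider "t > 0" | "t < 0" | "t = 0" by linarith
 then show ?thesis
 proof cases
  case 1
  have "((%t. t powr r) has_real_derivative r * \<bar>t\<bar> powr (r - 1)) (at t)"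
   using 1 by (auto intro!: derivative_eq_intros)
  then show ?thesis
   by (rule DERIV_cong_ev[THEN iffD1, OF refl _ refl, rotated])
    (use 1 in \<open>auto intro: eventually_mono[OF eventually_nhds_in_open[of "{0<..}" t]]\<close>)
 next
  case 2
  have "((%t. - ((- t) powr r)) has_real_derivative r * \<bar>t\<bar> powr (r - 1)) (at t)"
   using 2 by (auto intro!: derivative_eq_intros)
  then show ?thesis
   by (rule DERIV_cong_ev[THEN iffD1, OF refl _ refl, rotated])
    (use 2 in \<open>auto intro: eventually_mono[OF eventually_nhds_in_open[of "{..<0}" t]]\<close>)
 next
  case 3
  have "((%h. \<bar>h\<bar> powr r * sgn h / h) \<longlongrightarrow> 0) (at (0::real))"
  proof (rule Lim_null_comparison)
   have "norm (\<bar>h\<bar> powr r * sgn h / h) <= \<bar>h\<bar> powr (r - 1)" for h :: real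
    by (cases "h = 0") (auto simp: powr_diff abs_mult)
   then show "\<forall>\<^sub>F h in at (0::real). norm (\<bar>h\<bar> powr r * sgn h / h) <= \<bar>h\<bar> powr (r - 1)" by (rule always_eventually[OF allI])
   show "((%h::real. \<bar>h\<bar> powr (r - 1)) \<longlongrightarrow> 0) (at 0)" using assms by (intro tendsto_abs_powr_0) simp
  qed
  then show ?thesis using 3 assms by (simp add: DERIV_def)
 qed
qed

lemma abs_segment_le:
 fixes a b t :: real
 assumes "t \<in> closed_segment a (a + b)"
 shows "\<bar>t\<bar> <= \<bar>a\<bar> + \<bar>b\<bar>" "\<bar>t - a\<bar> <= \<bar>b\<bar>"
proof -
 show "\<bar>t - a\<bar> <= \<bar>b\<bar>" using dist_in_closed_segment[OF assms] by (simp add: dist_real_def)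
 then show "\<bar>t\<bar> <= \<bar>a\<bar> + \<bar>b\<bar>" by linarith
qed

lemma powr_add_le:
 fixes x y r :: real
 assumes "x >= 0" "y >= 0" "r >= 0"
 shows "(x + y) powr r <= 2 powr r * (x powr r + y powr r)"
proof -
 have "(x + y) powr r <= (2 * max x y) powr r" using assms by (intro powr_mono2) auto
 also have "... = 2 powr r * max x y powr r" using assms by (simp add: powr_mult)
 also have "... <= 2 powr r * (x powr r + y powr r)" by (intro mult_left_mono) (auto simp: max_def)
 finally show ?thesis .
qed

lemma abs_powr_diff_le:
 fixes a b q :: real
 assumes "q > 1"
 shows "\<bar>\<bar>a + b\<bar> powr q - \<bar>a\<bar> powr q\<bar> <= q * 2 powr (q - 1) * (\<bar>a\<bar> powr (q - 1) * \<bar>b\<bar> + \<bar>b\<bar> powr q)"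
proof -
 have "\<bar>\<bar>a + b\<bar> powr q - \<bar>a\<bar> powr q\<bar> <= (q * (\<bar>a\<bar> + \<bar>b\<bar>) powr (q - 1)) * \<bar>(a + b) - a\<bar>"
 proof (rule field_differentiable_bound[of "closed_segment a (a + b)", simplified real_norm_def])
  show "((%t. \<bar>t\<bar> powr q) has_real_derivative q * (\<bar>t\<bar> powr (q - 1) * sgn t)) (at t within closed_segment a (a + b))" for t
   by (rule DERIV_subset[OF abs_powr_deriv[OF assms]]) simp
  fix t assume t: "t \<in> closed_segment a (a + b)"
  have "\<bar>t\<bar> powr (q - 1) * \<bar>sgn t\<bar> <= (\<bar>a\<bar> + \<bar>b\<bar>) powr (q - 1) * 1"
   using abs_segment_le(1)[OF t] assms by (intro mult_mono powr_mono2) (auto simp: sgn_if)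
  then show "\<bar>q * (\<bar>t\<bar> powr (q - 1) * sgn t)\<bar> <= q * (\<bar>a\<bar> + \<bar>b\<bar>) powr (q - 1)"
   using assms by (simp add: abs_mult)
 qed auto
 also have "... <= (q * (2 powr (q - 1) * (\<bar>a\<bar> powr (q - 1) + \<bar>b\<bar> powr (q - 1)))) * \<bar>b\<bar>"
  using assms by (simp add: mult_right_mono powr_add_le)
 also have "... = q * 2 powr (q - 1) * (\<bar>a\<bar> powr (q - 1) * \<bar>b\<bar> + \<bar>b\<bar> powr (q - 1) * \<bar>b\<bar>)"
  by (simp add: algebra_simps)
 also have "\<bar>b\<bar> powr (q - 1) * \<bar>b\<bar> = \<bar>b\<bar> powr q" by (cases "b = 0") (auto simp: powr_diff)
 finally show ?thesis .
qed

text \<open>Two applications of the mean value theorem: one to the derivative of the power, one to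
  the power minus its tangent. The factor (|a| + |b|)^(q-2) is finally split by
  \<open>powr_add_le\<close>, so that the remainder becomes a sum of two terms with separate
  homogeneity.\<close>

lemma abs_powr_taylor:
 fixes a b q :: real
 assumes "q > 2"
 shows "\<bar>\<bar>a + b\<bar> powr q - \<bar>a\<bar> powr q - q * (\<bar>a\<bar> powr (q - 1) * sgn a) * b\<bar>
  <= q * (q - 1) * 2 powr (q - 2) * (\<bar>a\<bar> powr (q - 2) * b^2 + \<bar>b\<bar> powr q)"
proof -
 define M where "M = (q - 1) * (\<bar>a\<bar> + \<bar>b\<bar>) powr (q - 2)"
 have M0: "M >= 0" using assms by (simp add: M_def)
 have inner: "\<bar>\<bar>t\<bar> powr (q - 1) * sgn t - \<bar>a\<bar> powr (q - 1) * sgn a\<bar> <= M * \<bar>b\<bar>"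
  if t: "t \<in> closed_segment a (a + b)" for t
 proof -
  have "\<bar>\<bar>t\<bar> powr (q - 1) * sgn t - \<bar>a\<bar> powr (q - 1) * sgn a\<bar> <= M * \<bar>t - a\<bar>"
  proof (rule field_differentiable_bound[of "closed_segment a (a + b)", simplified real_norm_def])
   show "((%t. \<bar>t\<bar> powr (q - 1) * sgn t) has_real_derivative (q - 1) * \<bar>s\<bar> powr (q - 1 - 1)) (at s within closed_segment a (a + b))" for s
    using assms by (intro DERIV_subset[OF signed_powr_deriv]) auto
   fix s assume s: "s \<in> closed_segment a (a + b)"
   have "\<bar>s\<bar> powr (q - 2) <= (\<bar>a\<bar> + \<bar>b\<bar>) powr (q - 2)"
    using abs_segment_le(1)[OF s] assms by (intro powr_mono2) auto
   then show "\<bar>(q - 1) * \<bar>s\<bar> powr (q - 1 - 1)\<bar> <= M"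
    using assms by (simp add: M_def abs_mult)
  qed (use t in auto)
  also have "... <= M * \<bar>b\<bar>" using abs_segment_le(2)[OF t] M0 by (intro mult_left_mono) auto
  finally show ?thesis .
 qed
 let ?g = "%t. \<bar>t\<bar> powr q - q * (\<bar>a\<bar> powr (q - 1) * sgn a) * t"
 have "\<bar>?g (a + b) - ?g a\<bar> <= (q * (M * \<bar>b\<bar>)) * \<bar>(a + b) - a\<bar>"
 proof (rule field_differentiable_bound[of "closed_segment a (a + b)", simplified real_norm_def])
  show "(?g has_real_derivative q * (\<bar>t\<bar> powr (q - 1) * sgn t) - q * (\<bar>a\<bar> powr (q - 1) * sgn a))
    (at t within closed_segment a (a + b))" for t
   using assms by (intro DERIV_diff DERIV_cmult_Id DERIV_subset[OF abs_powr_deriv]) auto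
  fix t assume "t \<in> closed_segment a (a + b)"
  from mult_left_mono[OF inner[OF this], of q] assms
  show "\<bar>q * (\<bar>t\<bar> powr (q - 1) * sgn t) - q * (\<bar>a\<bar> powr (q - 1) * sgn a)\<bar> <= q * (M * \<bar>b\<bar>)"
   by (simp add: right_diff_distrib[symmetric] abs_mult del: right_diff_distrib)
 qed auto
 then have 1: "\<bar>\<bar>a + b\<bar> powr q - \<bar>a\<bar> powr q - q * (\<bar>a\<bar> powr (q - 1) * sgn a) * b\<bar> <= (q * (M * \<bar>b\<bar>)) * \<bar>b\<bar>"
  by (simp add: algebra_simps)
 have 2: "(q * (M * \<bar>b\<bar>)) * \<bar>b\<bar> = q * (q - 1) * (\<bar>a\<bar> + \<bar>b\<bar>) powr (q - 2) * b^2"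
  by (simp add: M_def power2_eq_square mult_ac)
 have 3: "... <= q * (q - 1) * (2 powr (q - 2) * (\<bar>a\<bar> powr (q - 2) + \<bar>b\<bar> powr (q - 2))) * b^2"
  using assms by (intro mult_right_mono mult_left_mono powr_add_le) auto
 have 4: "\<bar>b\<bar> powr (q - 2) * b^2 = \<bar>b\<bar> powr q"
  by (cases "b = 0") (auto simp: powr_diff)
 have 5: "q * (q - 1) * (2 powr (q - 2) * (\<bar>a\<bar> powr (q - 2) + \<bar>b\<bar> powr (q - 2))) * b^2
   = q * (q - 1) * 2 powr (q - 2) * (\<bar>a\<bar> powr (q - 2) * b^2 + \<bar>b\<bar> powr q)"
  unfolding 4[symmetric] by (simp add: algebra_simps)
 show ?thesis using 1 3 unfolding 2 5 by (rule order_trans)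
qed

lemma powr_superadditive:
 fixes x y p :: real
 assumes "x >= 0" "y >= 0" "p >= 1"
 shows "x powr p + y powr p <= (x + y) powr p"
proof -
 have *: "z powr p <= z * (x + y) powr (p - 1)" if "0 <= z" "z <= x + y" for z
 proof (cases "z = 0")
  case False
  then have "z powr p = z * z powr (p - 1)" using that by (simp add: powr_diff)
  also have "... <= z * (x + y) powr (p - 1)" using that assms by (intro mult_left_mono powr_mono2) auto
  finally show ?thesis .
 qed simp
 have "x powr p + y powr p <= (x + y) * (x + y) powr (p - 1)"
  using *[of x] *[of y] assms by (simp add: distrib_right)
 also have "... = (x + y) powr p" by (cases "x + y = 0") (use assms in \<open>auto simp: powr_diff\<close>)
 finally show ?thesis .
qed

lemma powr_midpoint_le:
 fixes x y p :: real
 assumes "x >= 0" "y >= 0" "p >= 1"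
 shows "((x + y) / 2) powr p <= (x powr p + y powr p) / 2"
proof -
 have half: "(z / 2) powr p <= z powr p / 2" if "z >= 0" for z
 proof -
  have "2 powr 1 <= 2 powr p" using assms by (intro powr_mono) auto
  then have "z powr p / 2 powr p <= z powr p / 2" by (intro divide_left_mono) auto
  then show ?thesis using that by (simp add: powr_divide)
 qed
 consider "x = 0" | "y = 0" | "x > 0" "y > 0" using assms by linarith
 then show ?thesis
 proof cases
  case 3
  have "((1 - 1/2) *\<^sub>R x + (1/2) *\<^sub>R y) powr p <= (1 - 1/2) * x powr p + (1/2) * y powr p"
   using 3 by (intro convex_onD[OF powr_convex[OF assms(3)]]) auto
  moreover have "(1 - 1/2) *\<^sub>R x + (1/2) *\<^sub>R y = (x + y) / 2" by simp
  ultimately show ?thesis by (simp add: add_divide_distrib)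
 qed (use half[of x] half[of y] assms in auto)
qed

text \<open>Superadditivity of the p-th power bounds the left-hand side by a power of a sum of
  squares, the parallelogram law evaluates this sum, and convexity of the p-th power separates the
  two squares again.\<close>

lemma Clarkson_pointwise:
 fixes x y p :: real
 assumes "p >= 1"
 shows "\<bar>(x + y) / 2\<bar> powr (2 * p) + \<bar>(x - y) / 2\<bar> powr (2 * p) <= (\<bar>x\<bar> powr (2 * p) + \<bar>y\<bar> powr (2 * p)) / 2"
proof -
 have sq: "\<bar>t\<bar> powr (2 * p) = (t^2) powr p" for t :: real
  by (cases "t = 0") (auto simp: powr_powr[symmetric] powr_numeral)
 have "((x + y) / 2)\<^sup>2 powr p + ((x - y) / 2)\<^sup>2 powr p <= (((x + y) / 2)^2 + ((x - y) / 2)^2) powr p"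
  using assms by (intro powr_superadditive) auto
 also have "((x + y) / 2)^2 + ((x - y) / 2)^2 = (x^2 + y^2) / 2"
  by (simp add: power2_eq_square field_simps)
 also have "... powr p <= (x\<^sup>2 powr p + y\<^sup>2 powr p) / 2"
  using assms by (intro powr_midpoint_le) auto
 finally show ?thesis by (simp only: sq)
qed

text \<open>Riesz-Fischer: a sparse subsequence converges almost everywhere, and Fatou's lemma
  transfers the Cauchy bound to its limit. Values in a Banach space are allowed because the
  statement is applied to gradients as well as to functions.\<close>

lemma Lq_complete:
 fixes f :: "nat => 'a => 'b::{banach, second_countable_topology}"
 assumes [measurable]: "!!n. f n \<in> borel_measurable M" and q: "q > 0"
  and Cauchy: "!!e. e > 0 ==> \<exists>n0. \<forall>m\<ge>n0. \<forall>n\<ge>n0. (\<integral>\<^sup>+x. ennreal (norm (f m x - f n x) powr q) \<partial>M) <= ennreal e"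
 obtains g r where "strict_mono r" "g \<in> borel_measurable M" "AE x in M. (%k. f (r k) x) \<longlonglongrightarrow> g x"
  "!!e. e > 0 ==> \<exists>n0. \<forall>n\<ge>n0. (\<integral>\<^sup>+x. ennreal (norm (f n x - g x) powr q) \<partial>M) <= ennreal e"
proof -
 \<comment> \<open>After multiplication by 2^(q k) the increments have integrals at most 2^(-k).
   Finiteness of the resulting series at a point forces \<open>norm (d k x) <= (1/2) ^ k\<close>
   eventually, hence convergence there.\<close>
 define e where "e k = (1/2) ^ k * 2 powr (- q * real k)" for k :: nat
 have "\<exists>n0. \<forall>m\<ge>n0. \<forall>n\<ge>n0. (\<integral>\<^sup>+x. ennreal (norm (f m x - f n x) powr q) \<partial>M) <= ennreal (e k)" for k
  by (rule Cauchy) (simp add: e_def)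
 then obtain s where s: "!!k m n. m >= s k ==> n >= s k ==>
   (\<integral>\<^sup>+x. ennreal (norm (f m x - f n x) powr q) \<partial>M) <= ennreal (e k)" by metis
 define r where "r k = k + (\<Sum>i\<le>k. s i)" for k
 have r_mono: "strict_mono r" by (rule strict_monoI_Suc) (simp add: r_def)
 have rs: "r k >= s k" for k unfolding r_def using member_le_sum[of k "{..k}" s] by simp
 have rs2: "r (Suc k) >= s k" for k using rs[of k] strict_mono_less_eq[OF r_mono, of k "Suc k"] by simp
 define d where "d k x = f (r (Suc k)) x - f (r k) x" for k x
 have [measurable]: "d k \<in> borel_measurable M" for k unfolding d_def[abs_def] by measurable
 have "(\<integral>\<^sup>+x. (\<Sum>k. ennreal (2 powr (q * real k) * norm (d k x) powr q)) \<partial>M)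
   = (\<Sum>k. \<integral>\<^sup>+x. ennreal (2 powr (q * real k) * norm (d k x) powr q) \<partial>M)"
  by (rule nn_integral_suminf) simp
 also have "... <= (\<Sum>k. ennreal ((1/2) ^ k))"
 proof (rule suminf_le)
  fix k
  have "(\<integral>\<^sup>+x. ennreal (2 powr (q * real k) * norm (d k x) powr q) \<partial>M)
    = ennreal (2 powr (q * real k)) * (\<integral>\<^sup>+x. ennreal (norm (d k x) powr q) \<partial>M)"
   by (subst nn_integral_cmult[symmetric]) (auto simp: ennreal_mult')
  also have "... <= ennreal (2 powr (q * real k)) * ennreal (e k)"
   unfolding d_def by (intro mult_left_mono s rs rs2) simp
  also have "... = ennreal ((1/2) ^ k)" by (simp add: e_def ennreal_mult'[symmetric] powr_minus field_simps)
  finally show "(\<integral>\<^sup>+x. ennreal (2 powr (q * real k) * norm (d k x) powr q) \<partial>M) <= ennreal ((1/2) ^ k)" .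
 qed auto
 also have "(\<Sum>k. ennreal ((1/2) ^ k)) = ennreal (\<Sum>k. (1/2) ^ k)"
  by (rule suminf_ennreal2) (auto intro: summable_geometric)
 also have "... < \<infinity>" by simp
 finally have "(\<integral>\<^sup>+x. (\<Sum>k. ennreal (2 powr (q * real k) * norm (d k x) powr q)) \<partial>M) ~= \<infinity>" by simp
 then have AE_fin: "AE x in M. (\<Sum>k. ennreal (2 powr (q * real k) * norm (d k x) powr q)) ~= \<infinity>"
  by (intro nn_integral_PInf_AE) auto
 have conv: "convergent (%k. f (r k) x)" if fin: "(\<Sum>k. ennreal (2 powr (q * real k) * norm (d k x) powr q)) ~= \<infinity>" for x
 proof -
  have "summable (%k. 2 powr (q * real k) * norm (d k x) powr q)"
   using fin by (intro summable_suminf_not_top) auto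
  from summable_LIMSEQ_zero[OF this]
  have "\<forall>\<^sub>F k in sequentially. 2 powr (q * real k) * norm (d k x) powr q < 1"
   by (rule order_tendstoD) simp
  then have "\<forall>\<^sub>F k in sequentially. norm (d k x) <= (1/2) ^ k"
  proof eventually_elim
   case (elim k)
   have "(2 ^ k * norm (d k x)) powr q = 2 powr (q * real k) * norm (d k x) powr q"
    by (simp add: powr_mult powr_powr powr_realpow[symmetric] mult.commute)
   then have "(2 ^ k * norm (d k x)) powr q <= 1 powr q" using elim by simp
   then have "2 ^ k * norm (d k x) <= 1"
    using powr_less_mono2[OF q, of 1 "2 ^ k * norm (d k x)"] by linarith
   then show ?case by (simp add: field_simps power_divide)
  qed
  then have "summable (%k. d k x)"
   by (rule summable_comparison_test_ev) (simp add: summable_geometric)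
  then have "convergent (%n. \<Sum>k<n. d k x)" by (simp add: summable_iff_convergent)
  moreover have "(\<Sum>k<n. d k x) = f (r n) x - f (r 0) x" for n
   unfolding d_def by (rule sum_lessThan_telescope)
  ultimately have "convergent (%n. f (r n) x - f (r 0) x)" by simp
  from convergent_add[OF this convergent_const[of "f (r 0) x"]] show ?thesis by simp
 qed
 define g where "g x = lim (%k. f (r k) x)" for x
 have g_meas [measurable]: "g \<in> borel_measurable M" unfolding g_def[abs_def] by measurable
 have lim: "AE x in M. (%k. f (r k) x) \<longlonglongrightarrow> g x"
  using AE_fin
 proof eventually_elim
  case (elim x)
  then have "convergent (%k. f (r k) x)" by (rule conv)
  then show ?case by (simp add: g_def convergent_LIMSEQ_iff)
 qed
 have fin: "\<exists>n0. \<forall>n\<ge>n0. (\<integral>\<^sup>+x. ennreal (norm (f n x - g x) powr q) \<partial>M) <= ennreal e" if e: "e > 0" for e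
 proof -
  obtain n0 where n0: "!!m n. m >= n0 ==> n >= n0 ==> (\<integral>\<^sup>+x. ennreal (norm (f m x - f n x) powr q) \<partial>M) <= ennreal e"
   using Cauchy[OF e] by metis
  have "(\<integral>\<^sup>+x. ennreal (norm (f n x - g x) powr q) \<partial>M) <= ennreal e" if n: "n >= n0" for n
  proof -
   have "(\<integral>\<^sup>+x. ennreal (norm (f n x - g x) powr q) \<partial>M)
     = (\<integral>\<^sup>+x. liminf (%k. ennreal (norm (f n x - f (r k) x) powr q)) \<partial>M)"
   proof (rule nn_integral_cong_AE)
    show "AE x in M. ennreal (norm (f n x - g x) powr q) = liminf (%k. ennreal (norm (f n x - f (r k) x) powr q))"
     using lim
    proof eventually_elim
     case (elim x)
     have "(%k. norm (f n x - f (r k) x) powr q) \<longlonglongrightarrow> norm (f n x - g x) powr q"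
      using q by (intro tendsto_powr' tendsto_norm tendsto_diff tendsto_const elim) (auto simp: always_eventually)
     then have "(%k. ennreal (norm (f n x - f (r k) x) powr q)) \<longlonglongrightarrow> ennreal (norm (f n x - g x) powr q)"
      by (rule tendsto_ennrealI)
     from lim_imp_Liminf[OF _ this] show ?case by simp
    qed
   qed
   also have "... <= liminf (%k. \<integral>\<^sup>+x. ennreal (norm (f n x - f (r k) x) powr q) \<partial>M)"
    by (rule nn_integral_liminf) simp
   also have "... <= liminf (%k::nat. ennreal e)"
   proof (rule Liminf_mono)
    show "\<forall>\<^sub>F k in sequentially. (\<integral>\<^sup>+x. ennreal (norm (f n x - f (r k) x) powr q) \<partial>M) <= ennreal e"
     using eventually_ge_at_top[of n0]
     by eventually_elim (use n n0 seq_suble[OF r_mono] in \<open>meson order_trans\<close>)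
   qed
   finally show ?thesis by (simp add: Liminf_const)
  qed
  then show ?thesis by blast
 qed
 show ?thesis using that[OF r_mono g_meas lim fin] .
qed

section \<open>Local compactness by averaging over small cubes\<close>

definition cell :: "nat => ('n::finite => int) => (real ^ 'n) set"
 where "cell m j = {x. \<forall>i. \<lfloor>real m * x $ i\<rfloor> = j i}"

lemma cell_borel [measurable]:
 fixes j :: "'n::finite => int"
 shows "cell m j \<in> sets borel"
proof -
 have "(%x::real^'n. x $ i) \<in> borel_measurable borel" for i
  by (intro borel_measurable_continuous_onI continuous_intros)
 then have [measurable]: "(%x::real^'n. \<lfloor>real m * x $ i\<rfloor>) \<in> measurable borel (count_space UNIV)" for i
  by measurable
 have "cell m j = (\<Inter>i. {x. \<lfloor>real m * x $ i\<rfloor> = j i})" by (auto simp: cell_def)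
 moreover have "{x \<in> space borel. \<lfloor>real m * x $ i\<rfloor> = j i} \<in> sets borel" for i :: 'n by measurable
 ultimately show ?thesis by simp
qed

lemma cell_measure:
 fixes j :: "'n::finite => int"
 assumes "m > 0"
 shows "emeasure lborel (cell m j) = ennreal ((1 / real m) ^ CARD('n))"
proof -
 define a b :: "real ^ 'n" where "a = (\<chi> i. real_of_int (j i) / real m)" and "b = (\<chi> i. (real_of_int (j i) + 1) / real m)"
 have ne: "cbox a b ~= {}" using assms by (auto simp: interval_ne_empty_cart a_def b_def divide_right_mono)
 have le: "a \<bullet> k <= b \<bullet> k" if "k \<in> Basis" for k using ne that by (simp add: box_ne_empty)
 have cb: "measure lborel (cbox a b) = (1 / real m) ^ CARD('n)"
  using content_cbox_cart[OF ne] assms by (simp add: a_def b_def field_simps flip: diff_divide_distrib)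
 have e1: "emeasure lborel (cbox a b) = ennreal ((1 / real m) ^ CARD('n))"
  unfolding cb[symmetric] using emeasure_lborel_cbox_finite[of a b] by (intro emeasure_eq_ennreal_measure) simp
 have e2: "emeasure lborel (box a b) = emeasure lborel (cbox a b)"
  using le by (simp add: emeasure_lborel_box_eq emeasure_lborel_cbox_eq)
 have 1: "box a b \<subseteq> cell m j" and 2: "cell m j \<subseteq> cbox a b"
  using assms by (auto simp: cell_def mem_box_cart a_def b_def floor_eq_iff field_simps less_imp_le)
 have "emeasure lborel (box a b) <= emeasure lborel (cell m j)" using 1 by (intro emeasure_mono) auto
 moreover have "emeasure lborel (cell m j) <= emeasure lborel (cbox a b)" using 2 by (intro emeasure_mono) auto
 ultimately show ?thesis unfolding e2 e1 by (rule antisym[rotated])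
qed

lemma cell_diameter:
 fixes x y :: "real ^ 'n"
 assumes "m > 0" "x \<in> cell m j" "y \<in> cell m j"
 shows "norm (y - x) <= real CARD('n) / real m"
proof -
 have "\<bar>(y - x) $ i\<bar> <= 1 / real m" for i
 proof -
  have "\<lfloor>real m * x $ i\<rfloor> = \<lfloor>real m * y $ i\<rfloor>" using assms by (auto simp: cell_def)
  then have "\<bar>real m * y $ i - real m * x $ i\<bar> <= 1" by linarith
  then have "real m * \<bar>(y - x) $ i\<bar> <= 1" by (simp add: abs_mult flip: right_diff_distrib)
  then show ?thesis using assms(1) by (simp add: field_simps)
 qed
 then have "(\<Sum>i\<in>UNIV. \<bar>(y - x) $ i\<bar>) <= real CARD('n) * (1 / real m)" by (intro sum_bounded_above) auto
 then show ?thesis using norm_le_l1_cart[of "y - x"] by simp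
qed

lemma square_int_on_finite_measure:
 fixes f :: "'a => real"
 assumes [measurable]: "f \<in> borel_measurable M" "c \<in> sets M" and c: "emeasure M c < \<infinity>"
  and f2: "integrable M (%x. indicator c x * (f x)^2)"
 shows "integrable M (%x. indicator c x * f x)"
proof (rule L1_bound)
 have "integrable M (indicator c :: _ => real)" using c assms(2) by (rule integrable_real_indicator[rotated])
 then show "integrable M (%x. indicator c x + indicator c x * (f x)^2)" using f2 by (intro L1_add)
 have "\<bar>t\<bar> <= 1 + t^2" for t :: real
  using zero_le_power2[of "\<bar>t\<bar> - 1/2"] by (simp add: power2_diff power_divide)
 then show "AE x in M. norm (indicator c x * f x) <= norm (indicator c x + indicator c x * (f x)^2)"
  by (intro AE_I2) (auto simp: indicator_def)
qed measurable

text \<open>Expanding the square expresses the oscillation of \<open>f\<close> over \<open>c\<close>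
  through its second moment and its integral. This isolates the integral over the cell, the only
  quantity per cell whose convergence has to be arranged.\<close>

lemma variance_identity:
 fixes f :: "real ^ 'n => real"
 assumes [measurable]: "f \<in> borel_measurable borel" "c \<in> sets borel" and c: "emeasure lborel c = ennreal V" "V > 0"
  and f2: "integrable lborel (%x. indicator c x * (f x)^2)"
 shows "ennreal (2 * V * (LINT x|lborel. indicator c x * (f x)^2) - 2 * (LINT x|lborel. indicator c x * f x)^2)
  = (\<integral>\<^sup>+x. (\<integral>\<^sup>+y. ennreal ((f y - f x)^2) * indicator c y * indicator c x \<partial>lborel) \<partial>lborel)"
proof -
 have f1: "integrable lborel (%x. indicator c x * f x)"
  by (rule square_int_on_finite_measure[OF _ _ _ f2]) (auto simp: c)
 have ci: "integrable lborel (indicator c :: _ => real)" using c by (intro integrable_real_indicator) auto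
 have cV: "measure lborel c = V" using c by (simp add: measure_def)
 define I where "I = (LINT x|lborel. indicator c x * f x)"
 define I2 where "I2 = (LINT x|lborel. indicator c x * (f x)^2)"
 have exp: "indicator c y * (f y - t)^2 = indicator c y * (f y)^2 - (2 * t) * (indicator c y * f y) + t^2 * indicator c y" for y t
  by (simp add: power2_eq_square algebra_simps)
 have int: "integrable lborel (%y. indicator c y * (f y - t)^2)" for t
  unfolding exp using f1 f2 ci by (intro L1_add L1_diff integrable_mult_right)
 have val: "(LINT y|lborel. indicator c y * (f y - t)^2) = I2 - 2 * t * I + t^2 * V" for t
  unfolding exp using f1 f2 ci by (simp add: I_def I2_def cV)
 have "(\<integral>\<^sup>+y. ennreal ((f y - f x)^2) * indicator c y * indicator c x \<partial>lborel)
   = ennreal (indicator c x * (I2 - 2 * f x * I + (f x)^2 * V))" for x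
 proof -
  have "(\<integral>\<^sup>+y. ennreal ((f y - f x)^2) * indicator c y \<partial>lborel) = (\<integral>\<^sup>+y. ennreal (indicator c y * (f y - f x)^2) \<partial>lborel)"
   by (intro nn_integral_cong) (auto simp: indicator_def)
  also have "... = ennreal (I2 - 2 * f x * I + (f x)^2 * V)"
   using nn_integral_eq_integral[OF int] val by simp
  finally show ?thesis by (subst nn_integral_multc) (auto simp: indicator_def)
 qed
 then have "(\<integral>\<^sup>+x. (\<integral>\<^sup>+y. ennreal ((f y - f x)^2) * indicator c y * indicator c x \<partial>lborel) \<partial>lborel)
   = (\<integral>\<^sup>+x. ennreal (indicator c x * (I2 - 2 * f x * I + (f x)^2 * V)) \<partial>lborel)" by simp
 also have "... = ennreal (LINT x|lborel. indicator c x * (I2 - 2 * f x * I + (f x)^2 * V))"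
 proof (rule nn_integral_eq_integral)
  have "(%x. indicator c x * (I2 - 2 * f x * I + (f x)^2 * V))
    = (%x. I2 * indicator c x - (2 * I) * (indicator c x * f x) + V * (indicator c x * (f x)^2))"
   by (simp add: fun_eq_iff algebra_simps)
  then show "integrable lborel (%x. indicator c x * (I2 - 2 * f x * I + (f x)^2 * V))"
   using f1 f2 ci by simp
  have "0 <= I2 - 2 * f x * I + (f x)^2 * V" for x
   unfolding val[symmetric] by simp
  then show "AE x in lborel. 0 <= indicator c x * (I2 - 2 * f x * I + (f x)^2 * V)" by simp
 qed
 also have "(%x. indicator c x * (I2 - 2 * f x * I + (f x)^2 * V))
   = (%x. I2 * indicator c x - (2 * I) * (indicator c x * f x) + V * (indicator c x * (f x)^2))"
  by (simp add: fun_eq_iff algebra_simps)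
 also have "(LINT x|lborel. I2 * indicator c x - (2 * I) * (indicator c x * f x) + V * (indicator c x * (f x)^2))
   = I2 * V - 2 * I * I + V * I2"
  using f1 f2 ci cV by (simp add: I_def I2_def)
 finally show ?thesis by (simp add: I_def I2_def power2_eq_square algebra_simps)
qed

definition cell_index :: "nat => ('n::finite => int) set"
 where "cell_index m = PiE UNIV (%_. {- int m..int m})"

lemma finite_cell_index [simp]: "finite (cell_index m)"
 unfolding cell_index_def by (rule finite_PiE) auto

lemma cell_cover:
 assumes "norm x < 1"
 shows "\<exists>j\<in>cell_index m. x \<in> cell m j"
proof -
 have "\<bar>x $ i\<bar> < 1" for i using component_le_norm_cart[of x i] assms by linarith
 then have "\<bar>real m * x $ i\<bar> <= real m" for i using mult_left_mono[of "\<bar>x $ i\<bar>" 1 "real m"] by (simp add: abs_mult less_imp_le)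
 then have "- real m <= real m * x $ i \<and> real m * x $ i <= real m" for i by (simp add: abs_le_iff minus_le_iff)
 then have "- int m <= \<lfloor>real m * x $ i\<rfloor> \<and> \<lfloor>real m * x $ i\<rfloor> <= int m" for i
  by (metis floor_mono floor_of_nat le_floor_iff of_int_minus of_int_of_nat_eq)
 then have "(%i. \<lfloor>real m * x $ i\<rfloor>) \<in> cell_index m" by (auto simp: cell_index_def PiE_iff extensional_def)
 then show ?thesis by (auto simp: cell_def)
qed

lemma disjoint_cell_sum_le:
 fixes g :: "real ^ 'n => ennreal"
 assumes "finite J"
 shows "(\<Sum>j\<in>J. g x * indicator (cell m j) x) <= g x"
proof (cases "\<exists>j\<in>J. x \<in> cell m j")
 case True
 then obtain j where j: "j \<in> J" "x \<in> cell m j" by blast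
 have "x \<notin> cell m i" if "i ~= j" for i using j that by (auto simp: cell_def)
 then have "(\<Sum>j\<in>J. g x * indicator (cell m j) x) = (\<Sum>i\<in>J. if i = j then g x else 0)"
  using j by (intro sum.cong) auto
 then show ?thesis using j assms by simp
qed auto

text \<open>On each cell the second moment is an oscillation plus a squared mean. The oscillations
  of all cells together involve only translations no longer than the cell diameter, which the
  gradient controls with a gain of m^(-2). The constant \<open>K\<close> is the volume of the ball
  of admissible translations, in units of the cell volume, times the square of its radius, with the
  powers of m taken out.\<close>

lemma cell_Poincare:
 fixes f :: "real ^ 'n => real"
 assumes f: "L2_gradient f G" and m: "m > 0"
  and f2: "!!j. j \<in> cell_index m ==> integrable lborel (%x. indicator (cell m j) x * (f x)^2)"
 defines "K \<equiv> unit_ball_vol (real CARD('n)) * real CARD('n) ^ CARD('n) * (real CARD('n))^2"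
 shows "(\<integral>\<^sup>+x. ennreal ((f x)^2) * indicator (ball 0 1) x \<partial>lborel)
  <= ennreal (K / (real m)^2 * (LINT x|lborel. (norm (G x))^2)
    + (\<Sum>j\<in>cell_index m. real m ^ CARD('n) * (LINT x|lborel. indicator (cell m j) x * f x)^2))"
proof -
 note [measurable] = L2_gradientD(4,5)[OF f]
 define V where "V = (1 / real m) ^ CARD('n)"
 have V: "V > 0" using m by (simp add: V_def)
 have cV: "emeasure lborel (cell m j) = ennreal V" for j :: "'n => int"
  using cell_measure[OF m, of j] by (simp add: V_def)
 define \<rho> where "\<rho> = real CARD('n) / real m"
 have \<rho>: "\<rho> >= 0" by (simp add: \<rho>_def)
 define I2 where "I2 j = (LINT x|lborel. indicator (cell m j) x * (f x)^2)" for j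
 define I where "I j = (LINT x|lborel. indicator (cell m j) x * f x)" for j
 define W where "W j = 2 * V * I2 j - 2 * (I j)^2" for j
 define DD where "DD = (LINT x|lborel. (norm (G x))^2)"
 let ?h = "%x. \<integral>\<^sup>+z. ennreal ((f (x + z) - f x)^2) * indicator (cball 0 \<rho>) z \<partial>lborel"
 have Wle: "ennreal (W j) <= (\<integral>\<^sup>+x. ?h x * indicator (cell m j) x \<partial>lborel)" if j: "j \<in> cell_index m" for j
 proof -
  have "ennreal (W j) = (\<integral>\<^sup>+x. (\<integral>\<^sup>+y. ennreal ((f y - f x)^2) * indicator (cell m j) y * indicator (cell m j) x \<partial>lborel) \<partial>lborel)"
   unfolding W_def I2_def I_def by (rule variance_identity[OF _ _ cV V f2[OF j]]) auto
  also have "... <= (\<integral>\<^sup>+x. ?h x * indicator (cell m j) x \<partial>lborel)"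
  proof (rule nn_integral_mono)
   fix x :: "real ^ 'n"
   show "(\<integral>\<^sup>+y. ennreal ((f y - f x)^2) * indicator (cell m j) y * indicator (cell m j) x \<partial>lborel) <= ?h x * indicator (cell m j) x"
   proof (cases "x \<in> cell m j")
    case True
    have "(\<integral>\<^sup>+y. ennreal ((f y - f x)^2) * indicator (cell m j) y \<partial>lborel)
      = (\<integral>\<^sup>+z. ennreal ((f (z + x) - f x)^2) * indicator (cell m j) (z + x) \<partial>lborel)"
     by (rule nn_integral_shift[symmetric]) measurable
    also have "... <= ?h x"
    proof (rule nn_integral_mono)
     fix z
     have "indicator (cell m j) (z + x) <= (indicator (cball 0 \<rho>) z :: ennreal)"
      using cell_diameter[OF m True, of "z + x"] by (auto simp: indicator_def \<rho>_def)
     then show "ennreal ((f (z + x) - f x)^2) * indicator (cell m j) (z + x) <= ennreal ((f (x + z) - f x)^2) * indicator (cball 0 \<rho>) z"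
      by (simp add: add.commute mult_left_mono)
    qed
    finally show ?thesis using True by simp
   qed simp
  qed
  finally show ?thesis .
 qed
 have "(\<Sum>j\<in>cell_index m. ennreal (W j)) <= (\<Sum>j\<in>cell_index m. (\<integral>\<^sup>+x. ?h x * indicator (cell m j) x \<partial>lborel))"
  by (intro sum_mono Wle)
 also have "... = (\<integral>\<^sup>+x. (\<Sum>j\<in>cell_index m. ?h x * indicator (cell m j) x) \<partial>lborel)"
  by (rule nn_integral_sum[symmetric]) measurable
 also have "... <= (\<integral>\<^sup>+x. ?h x \<partial>lborel)"
  by (intro nn_integral_mono disjoint_cell_sum_le) simp
 also have "... = (\<integral>\<^sup>+z. (\<integral>\<^sup>+x. ennreal ((f (x + z) - f x)^2) * indicator (cball 0 \<rho>) z \<partial>lborel) \<partial>lborel)"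
  by (rule lborel_pair.Fubini') measurable
 also have "... <= (\<integral>\<^sup>+z. ennreal (\<rho>^2 * DD) * indicator (cball (0 :: real ^ 'n) \<rho>) z \<partial>lborel)"
 proof (rule nn_integral_mono)
  fix z :: "real ^ 'n"
  show "(\<integral>\<^sup>+x. ennreal ((f (x + z) - f x)^2) * indicator (cball 0 \<rho>) z \<partial>lborel) <= ennreal (\<rho>^2 * DD) * indicator (cball 0 \<rho>) z"
  proof (cases "z \<in> cball 0 \<rho>")
   case True
   have "(LINT x|lborel. (f (x + z) - f x)^2) <= (norm z)^2 * DD" unfolding DD_def by (rule L2_translation(2)[OF f])
   also have "... <= \<rho>^2 * DD" using True by (intro mult_right_mono power_mono) (auto simp: DD_def)
   finally have "ennreal (LINT x|lborel. (f (x + z) - f x)^2) <= ennreal (\<rho>^2 * DD)" by (rule ennreal_leI)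
   moreover have "(\<integral>\<^sup>+x. ennreal ((f (x + z) - f x)^2) \<partial>lborel) = ennreal (LINT x|lborel. (f (x + z) - f x)^2)"
    by (rule nn_integral_eq_integral[OF L2_translation(1)[OF f]]) simp
   ultimately show ?thesis using True by simp
  qed simp
 qed
 also have "... = ennreal (\<rho>^2 * DD) * emeasure lborel (cball (0 :: real ^ 'n) \<rho>)"
  by (rule nn_integral_cmult_indicator) simp
 also have "... = ennreal (\<rho>^2 * DD * (unit_ball_vol (real CARD('n)) * \<rho> ^ CARD('n)))"
  using emeasure_cball[OF \<rho>, of "0::real^'n"] \<rho> by (simp add: DD_def ennreal_mult')
 also have "\<rho>^2 * DD * (unit_ball_vol (real CARD('n)) * \<rho> ^ CARD('n)) = K / (real m)^2 * DD * V"
  by (simp add: \<rho>_def K_def V_def power_divide)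
 finally have "ennreal (\<Sum>j\<in>cell_index m. W j) <= ennreal (K / (real m)^2 * DD * V)"
 proof -
  \<comment> \<open>\<open>ennreal\<close> truncates negative numbers to 0, so the sum can be pulled
    inside only once every \<open>W j\<close> is nonnegative; this is the Cauchy-Schwarz inequality
    on the cell.\<close>
  have W0: "W j >= 0" if j: "j \<in> cell_index m" for j
  proof -
   have i1: "integrable lborel (%x. indicator (cell m j) x * f x)"
    by (rule square_int_on_finite_measure[OF _ _ _ f2[OF j]]) (auto simp: cV)
   have ci: "integrable lborel (indicator (cell m j) :: _ => real)" using cV by (intro integrable_real_indicator) auto
   have "0 <= (LINT x|lborel. (V * (indicator (cell m j) x * f x) - I j * indicator (cell m j) x)^2)" by simp
   also have "(%x. (V * (indicator (cell m j) x * f x) - I j * indicator (cell m j) x)^2)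
     = (%x. V^2 * (indicator (cell m j) x * (f x)^2) - (2 * V * I j) * (indicator (cell m j) x * f x) + (I j)^2 * indicator (cell m j) x)"
    by (auto simp: fun_eq_iff indicator_def power2_eq_square algebra_simps)
   also have "integral\<^sup>L lborel ... = V^2 * I2 j - (2 * V * I j) * I j + (I j)^2 * V"
    using i1 ci f2[OF j] cV V by (simp add: I_def I2_def measure_def)
   also have "... = V / 2 * W j" by (simp add: W_def power2_eq_square algebra_simps)
   finally show ?thesis using V by (simp add: zero_le_mult_iff)
  qed
  assume "(\<Sum>j\<in>cell_index m. ennreal (W j)) <= ennreal (K / (real m)^2 * DD * V)"
  then show ?thesis using W0 by (simp add: sum_ennreal)
 qed
 then have "(\<Sum>j\<in>cell_index m. W j) <= K / (real m)^2 * DD * V"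
  by (subst (asm) ennreal_le_iff) (auto simp: K_def DD_def V less_imp_le intro!: mult_nonneg_nonneg divide_nonneg_nonneg)
 moreover have "(\<Sum>j\<in>cell_index m. W j) = 2 * V * (\<Sum>j\<in>cell_index m. I2 j) - 2 * (\<Sum>j\<in>cell_index m. (I j)^2)"
  by (simp add: W_def sum_subtractf sum_distrib_left)
 ultimately have "V * (\<Sum>j\<in>cell_index m. I2 j) <= K / (real m)^2 * DD * V / 2 + (\<Sum>j\<in>cell_index m. (I j)^2)"
  by (simp add: field_simps)
 also have "... <= V * (K / (real m)^2 * DD + (\<Sum>j\<in>cell_index m. (I j)^2) / V)"
 proof -
  have "0 <= K / (real m)^2 * DD * V" using V by (simp add: K_def DD_def)
  then show ?thesis using V by (simp add: algebra_simps)
 qed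
 finally have S: "(\<Sum>j\<in>cell_index m. I2 j) <= K / (real m)^2 * DD + (\<Sum>j\<in>cell_index m. real m ^ CARD('n) * (I j)^2)"
  using V m by (simp add: V_def sum_divide_distrib power_one_over field_simps sum_distrib_left flip: sum_distrib_right)
 have "(\<integral>\<^sup>+x. ennreal ((f x)^2) * indicator (ball 0 1) x \<partial>lborel)
   <= (\<integral>\<^sup>+x. (\<Sum>j\<in>cell_index m. ennreal (indicator (cell m j) x * (f x)^2)) \<partial>lborel)"
 proof (rule nn_integral_mono)
  fix x :: "real ^ 'n"
  show "ennreal ((f x)^2) * indicator (ball 0 1) x <= (\<Sum>j\<in>cell_index m. ennreal (indicator (cell m j) x * (f x)^2))"
  proof (cases "norm x < 1")
   case True
   then obtain j where j: "j \<in> cell_index m" "x \<in> cell m j" using cell_cover by blast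
   then have "ennreal ((f x)^2) * indicator (ball 0 1) x = ennreal (indicator (cell m j) x * (f x)^2)" using True by simp
   also have "... <= (\<Sum>j\<in>cell_index m. ennreal (indicator (cell m j) x * (f x)^2))"
    using j by (intro member_le_sum) auto
   finally show ?thesis .
  qed simp
 qed
 also have "... = (\<Sum>j\<in>cell_index m. (\<integral>\<^sup>+x. ennreal (indicator (cell m j) x * (f x)^2) \<partial>lborel))"
  by (rule nn_integral_sum) measurable
 also have "... = (\<Sum>j\<in>cell_index m. ennreal (I2 j))"
  unfolding I2_def by (intro sum.cong refl nn_integral_eq_integral f2) auto
 also have "... = ennreal (\<Sum>j\<in>cell_index m. I2 j)" by (rule sum_ennreal) (simp add: I2_def)
 also have "... <= ennreal (K / (real m)^2 * DD + (\<Sum>j\<in>cell_index m. real m ^ CARD('n) * (I j)^2))"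
  by (rule ennreal_leI[OF S])
 finally show ?thesis by (simp add: DD_def I_def)
qed

text \<open>Diagonal argument: Bolzano-Weierstrass refines the subsequence for one index at a time,
  and convergence for that index survives all later refinements.\<close>

lemma bounded_family_convergent_subseq:
 fixes X :: "nat => 'i::countable => real"
 assumes "!!s. \<exists>B. \<forall>n. \<bar>X n s\<bar> <= B"
 obtains r where "strict_mono r" "!!s. convergent (%k. X (r k) s)"
proof -
 define P where "P n r = (\<forall>s. to_nat s = n --> convergent (%k. X (r k) s))" for n :: nat and r :: "nat => nat"
 interpret subseqs P
 proof
  fix n :: nat and s :: "nat => nat" assume "strict_mono s"
  show "\<exists>r'. strict_mono r' \<and> P n (s \<circ> r')"
  proof (cases "\<exists>i::'i. to_nat i = n")
   case True
   then obtain i :: 'i where i: "to_nat i = n" by blast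
   obtain B where B: "!!n. \<bar>X n i\<bar> <= B" using assms by blast
   have "bounded (range (%k. X (s k) i))"
    unfolding bounded_iff using B by (intro exI[of _ B]) auto
   from bounded_imp_convergent_subsequence[OF this]
   obtain l r where "strict_mono r" "((%k. X (s k) i) \<circ> r) \<longlonglongrightarrow> l" by blast
   then have "convergent (%k. X ((s \<circ> r) k) i)" by (auto simp: convergent_def o_def)
   then have "P n (s \<circ> r)" using i by (auto simp: P_def dest: injD[OF inj_to_nat])
   then show ?thesis using \<open>strict_mono r\<close> by blast
  next
   case False
   then show ?thesis by (intro exI[of _ id]) (auto simp: P_def strict_mono_id)
  qed
 qed
 have "convergent (%k. X (diagseq k) s)" for s
 proof -
  define n where "n = to_nat s"
  have "P n (diagseq \<circ> ((+) (Suc n)))"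
  proof (rule diagseq_holds)
   fix r t :: "nat => nat" and n assume "strict_mono r" "P n t"
   show "P n (t \<circ> r)"
    unfolding P_def
   proof (intro allI impI)
    fix s :: 'i assume "to_nat s = n"
    then have "convergent (%k. X (t k) s)" using \<open>P n t\<close> by (simp add: P_def)
    from convergent_subseq_convergent[OF this \<open>strict_mono r\<close>]
    show "convergent (%k. X ((t \<circ> r) k) s)" by (simp add: o_def)
   qed
  qed
  then have "convergent (%k. X (diagseq (k + Suc n)) s)"
   by (auto simp: P_def n_def add.commute)
  then show ?thesis
   using LIMSEQ_offset[of "%k. X (diagseq k) s" "Suc n"] by (auto simp: convergent_def)
 qed
 then show ?thesis using that subseq_diagseq by blast
qed

lemma cell_subset_cball:
 assumes "m > 0" "j \<in> cell_index m"
 shows "cell m j \<subseteq> cball (0 :: real ^ 'n) (2 * real CARD('n))"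
proof
 fix x :: "real ^ 'n" assume x: "x \<in> cell m j"
 have "\<bar>x $ i\<bar> <= 2" for i
 proof -
  have "- int m <= j i" "j i <= int m" using assms(2) by (auto simp: cell_index_def PiE_iff)
  moreover have "\<lfloor>real m * x $ i\<rfloor> = j i" using x by (auto simp: cell_def)
  ultimately have "- real m <= real m * x $ i" "real m * x $ i <= real m + 1" by linarith+
  moreover have "real m >= 1" using assms(1) by simp
  ultimately have "real m * x $ i <= real m * 2" "real m * (- 1) <= real m * x $ i" by linarith+
  then have "x $ i <= 2" "- 1 <= x $ i" using assms(1) by (simp_all only: mult_le_cancel_left_pos of_nat_0_less_iff)
  then show ?thesis by linarith
 qed
 then have "(\<Sum>i\<in>UNIV. \<bar>x $ i\<bar>) <= real CARD('n) * 2" by (intro sum_bounded_above) auto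
 then show "x \<in> cball 0 (2 * real CARD('n))" using norm_le_l1_cart[of x] by simp
qed

lemma integrable_square_local:
 fixes u :: "real ^ 'n => real"
 assumes [measurable]: "u \<in> borel_measurable borel" "S \<in> sets borel" and P: "P >= 2" and u: "integrable lborel (%x. \<bar>u x\<bar> powr P)"
  and S: "S \<subseteq> cball 0 R"
 shows "integrable lborel (%x. indicator S x * (u x)^2)"
proof (rule L1_bound)
 show "integrable lborel (%x. indicator (cball 0 R) x + \<bar>u x\<bar> powr P)"
  using u emeasure_lborel_cball_finite by (intro L1_add integrable_real_indicator) auto
 have "t^2 <= 1 + \<bar>t\<bar> powr P" for t :: real
 proof (cases "\<bar>t\<bar> <= 1")
  case True
  then have "t^2 <= 1" by (simp add: abs_square_le_1)
  then show ?thesis using powr_ge_zero[of "\<bar>t\<bar>" P] by linarith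
 next
  case False
  then have "\<bar>t\<bar> powr 2 <= \<bar>t\<bar> powr P" using P by (intro powr_mono) auto
  then show ?thesis using False by (simp add: powr_numeral)
 qed
 then show "AE x in lborel. norm (indicator S x * (u x)^2) <= norm (indicator (cball 0 R) x + \<bar>u x\<bar> powr P)"
  using S by (intro AE_I2) (auto simp: indicator_def)
qed measurable

text \<open>The mesh is fixed first, fine enough for the gradient term of
  \<open>cell_Poincare\<close> to be at most \<open>e / 2\<close>. For this mesh only finitely many
  cell integrals remain, and those are Cauchy.\<close>

lemma local_compactness_L2:
 fixes f :: "nat => real ^ 'n => real"
 assumes f: "!!n. L2_gradient (f n) (G n)" and A: "!!n. (LINT x|lborel. (norm (G n x))^2) <= A"
  and f2: "!!n. integrable lborel (%x. indicator (cball 0 (2 * real CARD('n))) x * (f n x)^2)"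
  and conv: "!!m j. m > 0 ==> j \<in> cell_index m ==> convergent (%n. \<integral>x. indicator (cell m j) x * f n x \<partial>lborel)"
  and e: "e > 0"
 shows "\<exists>n0. \<forall>k\<ge>n0. \<forall>n\<ge>n0. (\<integral>\<^sup>+x. ennreal ((f k x - f n x)^2) * indicator (ball 0 1) x \<partial>lborel) <= ennreal e"
proof -
 define K where "K = unit_ball_vol (real CARD('n)) * real CARD('n) ^ CARD('n) * (real CARD('n))^2"
 have K: "K >= 0" by (simp add: K_def)
 have A0: "A >= 0" using A[of 0] order_trans[OF _ A[of 0], of 0] by simp
 obtain m :: nat where m0: "K * (4 * A) * 2 / e < real m" using reals_Archimedean2 by blast
 define m' where "m' = Suc m"
 have m: "m' > 0" by (simp add: m'_def)
 have "K * (4 * A) * 2 / e <= (real m')^2"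
 proof -
  have "real m' <= (real m')^2" using m by (simp add: power2_eq_square)
  then show ?thesis using m0 by (simp add: m'_def)
 qed
 then have Km: "K / (real m')^2 * (4 * A) <= e / 2" using m e by (simp add: field_simps)
 define I where "I n j = (LINT x|lborel. indicator (cell m' j) x * f n x)" for n j
 define c where "c = real (card (cell_index m' :: ('n => int) set)) * real m' ^ CARD('n) + 1"
 have c: "c > 0" by (simp add: c_def add_nonneg_pos)
 define d where "d = sqrt (e / (2 * c))"
 have d: "d > 0" "d^2 = e / (2 * c)" using e c by (auto simp: d_def)
 have "\<exists>n0. \<forall>k\<ge>n0. \<forall>n\<ge>n0. \<bar>I k j - I n j\<bar> < d" if "j \<in> cell_index m'" for j
  using Cauchy_iff[THEN iffD1, OF convergent_Cauchy[OF conv[OF m that]]] d(1) by (simp add: I_def)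
 then obtain n0 where n0: "!!j k n. j \<in> cell_index m' ==> k >= n0 j ==> n >= n0 j ==> \<bar>I k j - I n j\<bar> < d" by metis
 define n1 where "n1 = Max (insert 0 (n0 ` cell_index m'))"
 have n1: "n0 j <= n1" if "j \<in> cell_index m'" for j unfolding n1_def using that by (intro Max_ge) auto
 have "(\<integral>\<^sup>+x. ennreal ((f k x - f n x)^2) * indicator (ball 0 1) x \<partial>lborel) <= ennreal e" if kn: "k >= n1" "n >= n1" for k n
 proof -
  have g: "L2_gradient (%x. f k x - f n x) (%x. G k x - G n x)"
   using L2_gradient_lincomb[OF f[of k] f[of n], of 1 "-1"] by simp
  note meas [measurable] = L2_gradientD(4)[OF f]
  have ff: "integrable lborel (%x. indicator (cell m' j) x * (f n x)^2)" if j: "j \<in> cell_index m'" for j n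
  proof (rule L1_bound[OF f2[of n]])
   show "AE x in lborel. norm (indicator (cell m' j) x * (f n x)^2) <= norm (indicator (cball 0 (2 * real CARD('n))) x * (f n x)^2)"
    using cell_subset_cball[OF m j] by (intro AE_I2) (auto split: split_indicator)
  qed measurable
  have f1: "integrable lborel (%x. indicator (cell m' j) x * f n x)" if j: "j \<in> cell_index m'" for j n
   by (rule square_int_on_finite_measure[OF _ _ _ ff[OF j]]) (auto simp: cell_measure[OF m])
  have g2: "integrable lborel (%x. indicator (cell m' j) x * (f k x - f n x)^2)" if j: "j \<in> cell_index m'" for j
  proof (rule L1_bound)
   show "integrable lborel (%x. 2 * (indicator (cell m' j) x * (f k x)^2) + 2 * (indicator (cell m' j) x * (f n x)^2))"
    using ff[OF j] by simp
   have "(s - t)^2 <= 2 * s^2 + 2 * t^2" for s t :: real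
    using zero_le_power2[of "s + t"] by (simp add: power2_diff power2_sum)
   then show "AE x in lborel. norm (indicator (cell m' j) x * (f k x - f n x)^2) <=
     norm (2 * (indicator (cell m' j) x * (f k x)^2) + 2 * (indicator (cell m' j) x * (f n x)^2))"
    by (intro AE_I2) (auto simp: indicator_def)
  qed measurable
  have "(\<integral>\<^sup>+x. ennreal ((f k x - f n x)^2) * indicator (ball 0 1) x \<partial>lborel)
   <= ennreal (K / (real m')^2 * (LINT x|lborel. (norm (G k x - G n x))^2)
    + (\<Sum>j\<in>cell_index m'. real m' ^ CARD('n) * (LINT x|lborel. indicator (cell m' j) x * (f k x - f n x))^2))"
   unfolding K_def by (rule cell_Poincare[OF g m g2])
  also have "... <= ennreal e"
  proof (rule ennreal_leI)
   have "(LINT x|lborel. (norm (G k x - G n x))^2) <= (LINT x|lborel. 2 * (norm (G k x))^2 + 2 * (norm (G n x))^2)"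
   proof (rule LINT_mono[OF L2_gradientD(2)[OF g]])
    show "integrable lborel (%x. 2 * (norm (G k x))^2 + 2 * (norm (G n x))^2)"
     using L2_gradientD(2)[OF f] by simp
    show "(norm (G k x - G n x))^2 <= 2 * (norm (G k x))^2 + 2 * (norm (G n x))^2" for x
     using norm_lincomb_sq[of 1 "G k x" "-1" "G n x"] norm_lincomb_sq[of 1 "G k x" "1" "G n x"]
      zero_le_power2[of "norm (1 *\<^sub>R G k x + 1 *\<^sub>R G n x)"] by simp
   qed
   also have "... <= 4 * A"
    using L2_gradientD(2)[OF f] A[of k] A[of n] by simp
   finally have "K / (real m')^2 * (LINT x|lborel. (norm (G k x - G n x))^2) <= K / (real m')^2 * (4 * A)"
    using K by (intro mult_left_mono) auto
   moreover have "(\<Sum>j\<in>cell_index m'. real m' ^ CARD('n) * (LINT x|lborel. indicator (cell m' j) x * (f k x - f n x))^2)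
     <= (\<Sum>j\<in>(cell_index m' :: ('n => int) set). real m' ^ CARD('n) * d^2)"
   proof (intro sum_mono mult_left_mono)
    fix j :: "'n => int" assume j: "j \<in> cell_index m'"
    have "(LINT x|lborel. indicator (cell m' j) x * (f k x - f n x)) = I k j - I n j"
     using f1[OF j] by (simp add: I_def right_diff_distrib)
    moreover have "\<bar>I k j - I n j\<bar> <= d" using n0[OF j, of k n] n1[OF j] kn by simp
    ultimately show "(LINT x|lborel. indicator (cell m' j) x * (f k x - f n x))^2 <= d^2"
     using power_mono[of "\<bar>I k j - I n j\<bar>" d 2] by simp
   qed simp
   moreover have "(\<Sum>j\<in>(cell_index m' :: ('n => int) set). real m' ^ CARD('n) * d^2) <= c * d^2"
    by (simp add: c_def distrib_right)
   moreover have "c * d^2 = e / 2" using c d by simp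
   ultimately show "K / (real m')^2 * (LINT x|lborel. (norm (G k x - G n x))^2)
    + (\<Sum>j\<in>cell_index m'. real m' ^ CARD('n) * (LINT x|lborel. indicator (cell m' j) x * (f k x - f n x))^2) <= e"
    using Km by linarith
  qed
  finally show ?thesis .
 qed
 then show ?thesis by blast
qed

text \<open>Split at the threshold \<open>K\<close>: below it the square is kept, above it the power
  is raised to \<open>P\<close>. A large \<open>K\<close> makes the coefficient of the critical
  power small, which is where subcriticality enters.\<close>

lemma powr_interpolation:
 fixes t K q P :: real
 assumes "K > 0" "2 < q" "q < P"
 shows "\<bar>t\<bar> powr q <= K powr (q - 2) * t^2 + K powr (q - P) * \<bar>t\<bar> powr P"
proof (cases "t = 0")
 case t: False
 show ?thesis
 proof (cases "\<bar>t\<bar> <= K")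
  case True
  have "\<bar>t\<bar> powr q = \<bar>t\<bar> powr (q - 2) * t^2" using t by (simp add: powr_diff)
  also have "... <= K powr (q - 2) * t^2" using True assms by (intro mult_right_mono powr_mono2) auto
  finally show ?thesis using powr_ge_zero[of K "q - P"] powr_ge_zero[of "\<bar>t\<bar>" P] mult_nonneg_nonneg by (smt (verit))
 next
  case False
  have "\<bar>t\<bar> powr q = \<bar>t\<bar> powr (q - P) * \<bar>t\<bar> powr P" using t by (simp add: powr_diff)
  also have "... <= K powr (q - P) * \<bar>t\<bar> powr P" using False assms by (intro mult_right_mono powr_mono2') auto
  finally show ?thesis using powr_ge_zero[of K "q - 2"] zero_le_power2[of t] mult_nonneg_nonneg by (smt (verit))
 qed
qed (use assms in auto)

theorem local_compactness:
 fixes f :: "nat => 'i::finite => real ^ 'n => real"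
 assumes f: "!!n i. L2_gradient (f n i) (G n i)" and A: "!!n i. (LINT x|lborel. (norm (G n i x))^2) <= A"
  and q: "2 < q" "q < P"
  and P: "!!n i. integrable lborel (%x. \<bar>f n i x\<bar> powr P)" and B: "!!n i. (LINT x|lborel. \<bar>f n i x\<bar> powr P) <= B"
 obtains r :: "nat => nat" where "strict_mono r" "!!i e. e > 0 ==> \<exists>n0. \<forall>k\<ge>n0. \<forall>n\<ge>n0.
  (\<integral>\<^sup>+x. ennreal (\<bar>f (r k) i x - f (r n) i x\<bar> powr q) * indicator (ball 0 1) x \<partial>lborel) <= ennreal e"
proof -
 note meas [measurable] = L2_gradientD(4)[OF f]
 \<comment> \<open>All components and all cells of all meshes form one countable index, so that a
   single diagonal subsequence serves every component and every mesh.\<close>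
 define X where "X n s = (case s of (i, m, j) => if m > 0 \<and> j \<in> cell_index m
  then (LINT x|lborel. indicator (cell m j) x * f n i x) else 0)" for n and s :: "'i \<times> nat \<times> ('n => int)"
 have f2: "integrable lborel (%x. indicator (cball 0 (2 * real CARD('n))) x * (f n i x)^2)" for n i
  by (rule integrable_square_local[OF meas _ _ P order_refl]) (use q in auto)
 have Xb: "\<exists>b. \<forall>n. \<bar>X n s\<bar> <= b" for s
 proof -
  obtain i m j where s: "s = (i, m, j)" by (cases s) auto
  have "\<bar>X n s\<bar> <= measure lborel (cell m j) + B" for n
  proof (cases "m > 0 \<and> j \<in> cell_index m")
   case True
   have fin: "emeasure lborel (cell m j) < \<infinity>" using True by (simp add: cell_measure)
   have bd: "integrable lborel (%x. indicator (cell m j) x + \<bar>f n i x\<bar> powr P)"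
    using fin P by (intro L1_add integrable_real_indicator) auto
   have pw: "\<bar>t\<bar> <= 1 + \<bar>t\<bar> powr P" for t :: real
   proof (cases "\<bar>t\<bar> <= 1")
    case True then show ?thesis using powr_ge_zero[of "\<bar>t\<bar>" P] by linarith
   next
    case False
    then have "\<bar>t\<bar> powr 1 <= \<bar>t\<bar> powr P" using q by (intro powr_mono) auto
    then show ?thesis using False by simp
   qed
   have le: "\<bar>indicator (cell m j) x * f n i x\<bar> <= indicator (cell m j) x + \<bar>f n i x\<bar> powr P" for x
    using pw[of "f n i x"] by (auto simp: indicator_def)
   have i1: "integrable lborel (%x. \<bar>indicator (cell m j) x * f n i x\<bar>)"
    by (rule L1_bound[OF bd]) (auto intro!: AE_I2 order_trans[OF le])
   have "\<bar>X n s\<bar> <= (LINT x|lborel. \<bar>indicator (cell m j) x * f n i x\<bar>)"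
    using True by (simp only: X_def s prod.case if_True simp_thms integral_abs_bound)
   also have "... <= (LINT x|lborel. indicator (cell m j) x + \<bar>f n i x\<bar> powr P)"
    by (rule LINT_mono[OF i1 bd le])
   also have "... = measure lborel (cell m j) + (LINT x|lborel. \<bar>f n i x\<bar> powr P)"
    using fin P by (subst LINT_add) (auto intro: integrable_real_indicator)
   finally show ?thesis using B[of n i] by linarith
  next
   case False
   have "0 <= (LINT x|lborel. \<bar>f n i x\<bar> powr P)" by simp
   then have "B >= 0" using B[of n i] by linarith
   then show ?thesis using False by (auto simp: X_def s)
  qed
  then show ?thesis by blast
 qed
 have "\<exists>r. strict_mono r \<and> (\<forall>s. convergent (%k. X (r k) s))"
  by (rule bounded_family_convergent_subseq[of X, OF Xb]) auto
 then obtain r where r: "strict_mono r" "!!s. convergent (%k. X (r k) s)" by blast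
 have "\<exists>n0. \<forall>k\<ge>n0. \<forall>n\<ge>n0.
  (\<integral>\<^sup>+x. ennreal (\<bar>f (r k) i x - f (r n) i x\<bar> powr q) * indicator (ball 0 1) x \<partial>lborel) <= ennreal e" if e: "e > 0" for i e
 proof -
  have B0: "B >= 0" using B[of 0 i] order_trans[OF _ B[of 0 i], of 0] by simp
  define C where "C = 2 powr P * (2 * B) + 1"
  have C: "C > 0" using B0 by (simp add: C_def add_nonneg_pos)
  \<comment> \<open>Chosen so that the contribution of the power \<open>P\<close>, bounded by
    \<open>C\<close>, is \<open>e / 2\<close>; the accuracy \<open>d\<close> demanded in L^2 then
    accounts for the other half.\<close>
  define K where "K = (e / (2 * C)) powr (1 / (q - P))"
  have K: "K > 0" using e C by (simp add: K_def)
  have KC: "K powr (q - P) * C = e / 2" using e C q by (simp add: K_def powr_powr)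
  define d where "d = e / (2 * K powr (q - 2))"
  have d: "d > 0" "K powr (q - 2) * d = e / 2" using e K by (auto simp: d_def)
  have conv: "convergent (%n. \<integral>x. indicator (cell m j) x * f (r n) i x \<partial>lborel)" if "m > 0" "j \<in> cell_index m" for m j
   using r(2)[of "(i, m, j)"] that by (simp add: X_def)
  have "\<exists>n0. \<forall>k\<ge>n0. \<forall>n\<ge>n0.
    (\<integral>\<^sup>+x. ennreal ((f (r k) i x - f (r n) i x)^2) * indicator (ball 0 1) x \<partial>lborel) <= ennreal d"
   by (rule local_compactness_L2[of "%n. f (r n) i" "%n. G (r n) i", OF f A f2 conv d(1)])
  then obtain n0 where n0: "!!k n. k >= n0 ==> n >= n0 ==>
    (\<integral>\<^sup>+x. ennreal ((f (r k) i x - f (r n) i x)^2) * indicator (ball 0 1) x \<partial>lborel) <= ennreal d"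
   by blast
  have "(\<integral>\<^sup>+x. ennreal (\<bar>f (r k) i x - f (r n) i x\<bar> powr q) * indicator (ball 0 1) x \<partial>lborel) <= ennreal e"
   if kn: "k >= n0" "n >= n0" for k n
  proof -
   define g where "g x = f (r k) i x - f (r n) i x" for x
   have [measurable]: "g \<in> borel_measurable borel" unfolding g_def[abs_def] by measurable
   have gP: "(\<integral>\<^sup>+x. ennreal (\<bar>g x\<bar> powr P) \<partial>lborel) <= ennreal C"
   proof -
    have "(\<integral>\<^sup>+x. ennreal (\<bar>g x\<bar> powr P) \<partial>lborel)
      <= (\<integral>\<^sup>+x. ennreal (2 powr P * (\<bar>f (r k) i x\<bar> powr P + \<bar>f (r n) i x\<bar> powr P)) \<partial>lborel)"
    proof (intro nn_integral_mono ennreal_leI)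
     fix x
     have "\<bar>g x\<bar> powr P <= (\<bar>f (r k) i x\<bar> + \<bar>f (r n) i x\<bar>) powr P"
      unfolding g_def using q by (intro powr_mono2) auto
     also have "... <= 2 powr P * (\<bar>f (r k) i x\<bar> powr P + \<bar>f (r n) i x\<bar> powr P)"
      using q by (intro powr_add_le) auto
     finally show "\<bar>g x\<bar> powr P <= 2 powr P * (\<bar>f (r k) i x\<bar> powr P + \<bar>f (r n) i x\<bar> powr P)" .
    qed
    also have "... = ennreal (LINT x|lborel. 2 powr P * (\<bar>f (r k) i x\<bar> powr P + \<bar>f (r n) i x\<bar> powr P))"
     using P by (intro nn_integral_eq_integral) auto
    also have "... <= ennreal C"
    proof (rule ennreal_leI)
     have "(LINT x|lborel. 2 powr P * (\<bar>f (r k) i x\<bar> powr P + \<bar>f (r n) i x\<bar> powr P))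
       = 2 powr P * ((LINT x|lborel. \<bar>f (r k) i x\<bar> powr P) + (LINT x|lborel. \<bar>f (r n) i x\<bar> powr P))"
      using P by simp
     also have "... <= 2 powr P * (2 * B)" using B[of "r k" i] B[of "r n" i] by (intro mult_left_mono) auto
     finally show "(LINT x|lborel. 2 powr P * (\<bar>f (r k) i x\<bar> powr P + \<bar>f (r n) i x\<bar> powr P)) <= C"
      unfolding C_def by linarith
    qed
    finally show ?thesis .
   qed
   have "(\<integral>\<^sup>+x. ennreal (\<bar>g x\<bar> powr q) * indicator (ball 0 1) x \<partial>lborel)
    <= (\<integral>\<^sup>+x. ennreal (K powr (q - 2)) * (ennreal ((g x)^2) * indicator (ball 0 1) x) + ennreal (K powr (q - P)) * ennreal (\<bar>g x\<bar> powr P) \<partial>lborel)"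
   proof (intro nn_integral_mono)
    fix x
    have "ennreal (\<bar>g x\<bar> powr q) <= ennreal (K powr (q - 2)) * ennreal ((g x)^2) + ennreal (K powr (q - P)) * ennreal (\<bar>g x\<bar> powr P)"
     using powr_interpolation[OF K q, of "g x"] by (simp add: ennreal_mult'[symmetric] ennreal_leI flip: ennreal_plus)
    then show "ennreal (\<bar>g x\<bar> powr q) * indicator (ball 0 1) x
     <= ennreal (K powr (q - 2)) * (ennreal ((g x)^2) * indicator (ball 0 1) x) + ennreal (K powr (q - P)) * ennreal (\<bar>g x\<bar> powr P)"
     by (cases "x \<in> ball 0 1") auto
   qed
   also have "... = ennreal (K powr (q - 2)) * (\<integral>\<^sup>+x. ennreal ((g x)^2) * indicator (ball 0 1) x \<partial>lborel)
     + ennreal (K powr (q - P)) * (\<integral>\<^sup>+x. ennreal (\<bar>g x\<bar> powr P) \<partial>lborel)"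
    by (subst nn_integral_add, measurable) (simp add: nn_integral_cmult)
   also have "... <= ennreal (K powr (q - 2)) * ennreal d + ennreal (K powr (q - P)) * ennreal C"
    using n0[OF kn] gP by (intro add_mono mult_left_mono) (auto simp: g_def)
   also have "... = ennreal e"
    using d e C KC by (simp add: ennreal_mult'[symmetric] flip: ennreal_plus)
   finally show ?thesis by (simp add: g_def)
  qed
  then show ?thesis by blast
 qed
 then show ?thesis using that[OF r(1)] by blast
qed

section \<open>The limit functional and its minimizers\<close>

definition dirichlet :: "(real ^ 'n => real) => real"
 where "dirichlet u = (LINT x|lborel. (norm (weak_grad u x))^2)"

definition dir_inner :: "(real ^ 'n => real) => (real ^ 'n => real) => real"
 where "dir_inner u h = (LINT x|lborel. weak_grad u x \<bullet> weak_grad h x)"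

lemma dirichlet_nonneg [simp]: "dirichlet u >= 0"
 by (simp add: dirichlet_def)

lemma D12_norm_sq_dirichlet: "(D12_norm u)^2 = dirichlet u"
 by (simp add: D12_norm_def dirichlet_def)

lemma dirichlet_eq: "L2_gradient u G ==> dirichlet u = (LINT x|lborel. (norm (G x))^2)"
 using D12_norm_sq D12_norm_sq_dirichlet by metis

lemma dir_inner_eq:
 assumes "has_L2_gradient u" "L2_gradient h H"
 shows "dir_inner u h = (LINT x|lborel. weak_grad u x \<bullet> H x)"
proof -
 note [measurable] = L2_gradientD(5)[OF L2_gradient_weak_grad[OF assms(1)]] L2_gradientD(5)[OF assms(2)]
  L2_gradientD(5)[OF L2_gradient_weak_grad[OF L2_gradient_imp[OF assms(2)]]]
 show ?thesis unfolding dir_inner_def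
  using weak_grad_AE[OF L2_gradientD(1)[OF assms(2)]]
  by (intro integral_cong_AE) auto
qed

lemma dirichlet_lincomb:
 assumes u: "has_L2_gradient u" and h: "has_L2_gradient h"
 shows "has_L2_gradient (%x. a * u x + b * h x)"
  and "dirichlet (%x. a * u x + b * h x) = a^2 * dirichlet u + 2 * a * b * dir_inner u h + b^2 * dirichlet h"
proof -
 note uG = L2_gradient_weak_grad[OF u] and hG = L2_gradient_weak_grad[OF h]
 note L = L2_gradient_lincomb[OF uG hG, of a b]
 show "has_L2_gradient (%x. a * u x + b * h x)" by (rule L2_gradient_imp[OF L])
 have i: "integrable lborel (%x. weak_grad u x \<bullet> weak_grad h x)"
  using L2_gradientD[OF uG] L2_gradientD[OF hG] by (intro integrable_square_inner) auto
 show "dirichlet (%x. a * u x + b * h x) = a^2 * dirichlet u + 2 * a * b * dir_inner u h + b^2 * dirichlet h"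
  unfolding dirichlet_eq[OF L] norm_lincomb_sq
  using i L2_gradientD(2)[OF uG] L2_gradientD(2)[OF hG]
  by (simp add: dirichlet_def dir_inner_def)
qed

lemma LqD:
 assumes "u \<in> Lq r"
 shows "u \<in> borel_measurable borel" "integrable lborel (%x. \<bar>u x\<bar> powr r)"
 using assms by (auto simp: Lq_def)

lemma Lq_lincomb:
 assumes u: "u \<in> Lq r" and h: "h \<in> Lq r" and r: "r >= 0"
 shows "(%x. a * u x + b * h x) \<in> Lq r"
proof -
 note [measurable] = LqD(1)[OF u] LqD(1)[OF h]
 have "integrable lborel (%x. \<bar>a * u x + b * h x\<bar> powr r)"
 proof (rule L1_bound)
  show "integrable lborel (%x. 2 powr r * (\<bar>a\<bar> powr r * \<bar>u x\<bar> powr r + \<bar>b\<bar> powr r * \<bar>h x\<bar> powr r))"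
   using LqD(2)[OF u] LqD(2)[OF h] by simp
  have "\<bar>a * u x + b * h x\<bar> powr r <= 2 powr r * (\<bar>a\<bar> powr r * \<bar>u x\<bar> powr r + \<bar>b\<bar> powr r * \<bar>h x\<bar> powr r)" for x
  proof -
   have "\<bar>a * u x + b * h x\<bar> powr r <= (\<bar>a * u x\<bar> + \<bar>b * h x\<bar>) powr r" using r by (intro powr_mono2) auto
   also have "... <= 2 powr r * (\<bar>a * u x\<bar> powr r + \<bar>b * h x\<bar> powr r)" using r by (intro powr_add_le) auto
   finally show ?thesis by (simp add: abs_mult powr_mult)
  qed
  then show "AE x in lborel. norm (\<bar>a * u x + b * h x\<bar> powr r)
    <= norm (2 powr r * (\<bar>a\<bar> powr r * \<bar>u x\<bar> powr r + \<bar>b\<bar> powr r * \<bar>h x\<bar> powr r))"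
   by (intro AE_I2) (simp add: order_trans[OF _ abs_ge_self])
 qed measurable
 then show ?thesis by (simp add: Lq_def)
qed

lemma E_spaceD:
 fixes u :: "real ^ 'n => real"
 assumes "u \<in> E_space p"
 shows "has_L2_gradient u" "u \<in> Lq (2 * p)" "u \<in> borel_measurable borel"
  "u \<in> Lq (2 * real CARD('n) / (real CARD('n) - 2))"
 using assms by (auto simp: E_space_def D12_def Lq_def)

lemma E_space_lincomb:
 fixes u h :: "real ^ 'n => real"
 assumes "u \<in> E_space p" "h \<in> E_space p" "p > 0" "CARD('n) >= 3"
 shows "(%x. a * u x + b * h x) \<in> E_space p"
 using assms by (auto simp: E_space_def D12_def intro!: Lq_lincomb dirichlet_lincomb)

lemma E_space_mult:
 fixes u :: "real ^ 'n => real"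
 assumes "u \<in> E_space p" "p > 0" "CARD('n) >= 3"
 shows "(%x. a * u x) \<in> E_space p"
 using E_space_lincomb[OF assms(1,1,2,3), of a 0] by simp

text \<open>The free weight lets one notion cover the full mass (weight 1), the mass in a region (an
  indicator) and the nonlinear term with \<open>Q\<close>.\<close>

definition wmass :: "(real ^ 'n => real) => real => (real ^ 'n => real) => real"
 where "wmass k q u = (LINT x|lborel. k x * \<bar>u x\<bar> powr q)"

lemma wmass_integrable:
 assumes [measurable]: "k \<in> borel_measurable borel" and k: "!!x. \<bar>k x\<bar> <= C" and u: "u \<in> Lq q"
 shows "integrable lborel (%x. k x * \<bar>u x\<bar> powr q)"
proof (rule L1_bound)
 note [measurable] = LqD(1)[OF u]
 show "integrable lborel (%x. C * \<bar>u x\<bar> powr q)" using LqD(2)[OF u] by simp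
 show "(%x. k x * \<bar>u x\<bar> powr q) \<in> borel_measurable lborel" by measurable
 show "AE x in lborel. norm (k x * \<bar>u x\<bar> powr q) <= norm (C * \<bar>u x\<bar> powr q)"
  using k by (intro AE_I2) (auto simp: abs_mult intro!: mult_right_mono order_trans[OF k abs_ge_self])
qed

lemma wmass_mult: "wmass k q (%x. t * u x) = \<bar>t\<bar> powr q * wmass k q u"
 unfolding wmass_def integral_mult_right_zero[symmetric]
 by (rule LINT_cong) (simp_all add: abs_mult powr_mult)

text \<open>Young's inequality with a parameter but without sharp constants: |b| is compared with t
  |a|, and one of the two terms dominates in each case.\<close>

lemma mixed_powr_le:
 fixes a b t q :: real
 assumes "q > 1" "t > 0"
 shows "\<bar>a\<bar> powr (q - 1) * \<bar>b\<bar> <= t * \<bar>a\<bar> powr q + t powr (1 - q) * \<bar>b\<bar> powr q"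
proof (cases "\<bar>b\<bar> <= t * \<bar>a\<bar>")
 case True
 have "\<bar>a\<bar> powr (q - 1) * \<bar>b\<bar> <= \<bar>a\<bar> powr (q - 1) * (t * \<bar>a\<bar>)" using True by (intro mult_left_mono) auto
 also have "... = t * \<bar>a\<bar> powr q" by (cases "a = 0") (auto simp: powr_diff)
 finally show ?thesis using mult_nonneg_nonneg[OF powr_ge_zero powr_ge_zero, of t "1 - q" "\<bar>b\<bar>" q] by linarith
next
 case False
 then have b: "\<bar>b\<bar> > 0" using assms by (smt (verit) mult_nonneg_nonneg)
 have "\<bar>a\<bar> <= \<bar>b\<bar> / t" using False assms by (simp add: field_simps)
 then have "\<bar>a\<bar> powr (q - 1) * \<bar>b\<bar> <= (\<bar>b\<bar> / t) powr (q - 1) * \<bar>b\<bar>" using assms by (intro mult_right_mono powr_mono2) auto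
 also have "... = t powr (1 - q) * \<bar>b\<bar> powr q"
  using b assms by (simp add: powr_divide powr_diff)
 finally show ?thesis using assms mult_nonneg_nonneg[OF less_imp_le[OF assms(2)] powr_ge_zero, of "\<bar>a\<bar>" q] by linarith
qed

text \<open>The parameter \<open>t\<close> balances the two masses: a small \<open>t\<close> makes
  the share of \<open>u\<close> small as long as its mass is bounded, and for this fixed
  \<open>t\<close> the rest is small with the mass of \<open>h\<close>.\<close>

lemma wmass_diff_le:
 assumes k_meas: "k \<in> borel_measurable borel" and k: "!!x. \<bar>k x\<bar> <= C" and u: "u \<in> Lq q" and h: "h \<in> Lq q"
  and q: "q > 1" and t: "t > 0"
 shows "\<bar>wmass k q (%x. u x + h x) - wmass k q u\<bar> <=
  C * (q * 2 powr (q - 1)) * (t * wmass (%_. 1) q u + (t powr (1 - q) + 1) * wmass (%_. 1) q h)"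
proof -
 have C: "C >= 0" using k[of undefined] by linarith
 have uh: "(%x. u x + h x) \<in> Lq q" using Lq_lincomb[OF u h, of 1 1] q by simp
 note i = wmass_integrable[OF k_meas k u] wmass_integrable[OF k_meas k uh]
 let ?b = "%x. C * (q * 2 powr (q - 1)) * (t * \<bar>u x\<bar> powr q + (t powr (1 - q) + 1) * \<bar>h x\<bar> powr q)"
 have ib: "integrable lborel ?b" using LqD(2)[OF u] LqD(2)[OF h] by simp
 have "\<bar>wmass k q (%x. u x + h x) - wmass k q u\<bar> = \<bar>\<integral>x. k x * \<bar>u x + h x\<bar> powr q - k x * \<bar>u x\<bar> powr q \<partial>lborel\<bar>"
  using i by (simp add: wmass_def)
 also have "... <= (LINT x|lborel. \<bar>k x * \<bar>u x + h x\<bar> powr q - k x * \<bar>u x\<bar> powr q\<bar>)" by (rule integral_abs_bound)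
 also have "... <= (LINT x|lborel. ?b x)"
 proof (rule LINT_mono[OF _ ib])
  show "integrable lborel (%x. \<bar>k x * \<bar>u x + h x\<bar> powr q - k x * \<bar>u x\<bar> powr q\<bar>)" using i by simp
  fix x
  have "\<bar>k x * \<bar>u x + h x\<bar> powr q - k x * \<bar>u x\<bar> powr q\<bar> = \<bar>k x\<bar> * \<bar>\<bar>u x + h x\<bar> powr q - \<bar>u x\<bar> powr q\<bar>"
   by (simp add: abs_mult flip: right_diff_distrib)
  also have "... <= C * (q * 2 powr (q - 1) * (\<bar>u x\<bar> powr (q - 1) * \<bar>h x\<bar> + \<bar>h x\<bar> powr q))"
   using C by (intro mult_mono k abs_powr_diff_le q) auto
  also have "... <= C * (q * 2 powr (q - 1) * (t * \<bar>u x\<bar> powr q + t powr (1 - q) * \<bar>h x\<bar> powr q + \<bar>h x\<bar> powr q))"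
   using C q by (intro mult_left_mono add_right_mono mixed_powr_le t) auto
  finally show "\<bar>k x * \<bar>u x + h x\<bar> powr q - k x * \<bar>u x\<bar> powr q\<bar> <= ?b x"
   by (simp add: algebra_simps)
 qed
 also have "... = C * (q * 2 powr (q - 1)) * (t * wmass (%_. 1) q u + (t powr (1 - q) + 1) * wmass (%_. 1) q h)"
  using LqD(2)[OF u] LqD(2)[OF h] by (simp add: wmass_def)
 finally show ?thesis .
qed

lemma wmass_nonneg: "(!!x. k x >= 0) ==> wmass k q u >= 0"
 by (simp add: wmass_def)

text \<open>Both the base functions and the filter are arbitrary, because the statement serves for
  perturbations of one fixed function along a sequence and for pairs of indices in a Cauchy
  argument.\<close>

lemma wmass_perturbation:
 assumes k_meas: "k \<in> borel_measurable borel" and k: "!!x. \<bar>k x\<bar> <= C"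
  and u: "!!n. u n \<in> Lq q" and h: "!!n. h n \<in> Lq q" and q: "q > 1"
  and B: "!!n. wmass (%_. 1) q (u n) <= B" and h0: "((%n. wmass (%_. 1) q (h n)) \<longlongrightarrow> 0) F"
 shows "((%n. wmass k q (%x. u n x + h n x) - wmass k q (u n)) \<longlongrightarrow> 0) F"
proof -
 have C: "C >= 0" using k[of undefined] by linarith
 define K where "K = C * (q * 2 powr (q - 1))"
 have K: "K >= 0" using C q by (simp add: K_def)
 have B0: "B >= 0" by (rule order_trans[OF wmass_nonneg B[of undefined]]) simp
 show ?thesis
 proof (rule tendstoI)
  fix e :: real assume e: "e > 0"
  define t where "t = e / (2 * (K * B + 1))"
  have KB: "K * B + 1 > 0" using K B0 by (simp add: add_nonneg_pos)
  have t: "t > 0" using e KB by (simp add: t_def)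
  have tB: "K * (t * B) < e / 2 + 0"
  proof -
   have "K * (t * B) = (e / 2) * (K * B / (K * B + 1))" by (simp add: t_def)
   also have "... < e / 2 * 1" using e KB by (intro mult_strict_left_mono) auto
   finally show ?thesis by simp
  qed
  have "((%n. K * ((t powr (1 - q) + 1) * wmass (%_. 1) q (h n))) \<longlongrightarrow> K * ((t powr (1 - q) + 1) * 0)) F"
   by (intro tendsto_mult tendsto_const h0)
  then have "\<forall>\<^sub>F n in F. K * ((t powr (1 - q) + 1) * wmass (%_. 1) q (h n)) < e / 2"
   using e by (intro order_tendstoD) auto
  then show "\<forall>\<^sub>F n in F. dist (wmass k q (%x. u n x + h n x) - wmass k q (u n)) 0 < e"
  proof eventually_elim
   case (elim n)
   have "\<bar>wmass k q (%x. u n x + h n x) - wmass k q (u n)\<bar> <=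
    K * (t * wmass (%_. 1) q (u n) + (t powr (1 - q) + 1) * wmass (%_. 1) q (h n))"
    unfolding K_def by (rule wmass_diff_le[OF k_meas k u h q t])
   also have "... = K * (t * wmass (%_. 1) q (u n)) + K * ((t powr (1 - q) + 1) * wmass (%_. 1) q (h n))"
    by (simp add: distrib_left)
   also have "K * (t * wmass (%_. 1) q (u n)) <= K * (t * B)"
    using K t B by (intro mult_left_mono) auto
   finally show ?case using elim tB by (simp add: dist_real_def)
  qed
 qed
qed

text \<open>The derivative of \<open>wmass k q\<close> at \<open>u\<close> in direction
  \<open>h\<close>, divided by \<open>q\<close>. The factor with \<open>sgn\<close> is |u|^(q-2) u
  with value 0 at zeros of \<open>u\<close>.\<close>

definition wderiv :: "(real ^ 'n => real) => real => (real ^ 'n => real) => (real ^ 'n => real) => real"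
 where "wderiv k q u h = (LINT x|lborel. k x * (\<bar>u x\<bar> powr (q - 1) * sgn (u x)) * h x)"

lemma wderiv_integrable:
 assumes k_meas: "k \<in> borel_measurable borel" and k: "!!x. \<bar>k x\<bar> <= C" and u: "u \<in> Lq q" and h: "h \<in> Lq q" and q: "q > 1"
 shows "integrable lborel (%x. k x * (\<bar>u x\<bar> powr (q - 1) * sgn (u x)) * h x)"
proof (rule L1_bound)
 have C: "C >= 0" using k[of undefined] by linarith
 note [measurable] = LqD(1)[OF u] LqD(1)[OF h] k_meas
 show "integrable lborel (%x. C * (\<bar>u x\<bar> powr q + \<bar>h x\<bar> powr q))" using LqD(2)[OF u] LqD(2)[OF h] by simp
 show "(%x. k x * (\<bar>u x\<bar> powr (q - 1) * sgn (u x)) * h x) \<in> borel_measurable lborel" by measurable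
 have "\<bar>k x * (\<bar>u x\<bar> powr (q - 1) * sgn (u x)) * h x\<bar> <= C * (\<bar>u x\<bar> powr q + \<bar>h x\<bar> powr q)" for x
 proof -
  have "\<bar>k x * (\<bar>u x\<bar> powr (q - 1) * sgn (u x)) * h x\<bar> = (\<bar>k x\<bar> * \<bar>sgn (u x)\<bar>) * (\<bar>u x\<bar> powr (q - 1) * \<bar>h x\<bar>)"
   by (simp add: abs_mult)
  also have "... <= (C * 1) * (1 * \<bar>u x\<bar> powr q + 1 powr (1 - q) * \<bar>h x\<bar> powr q)"
   using C by (intro mult_mono k mixed_powr_le q) (auto simp: sgn_if)
  finally show ?thesis by simp
 qed
 then show "AE x in lborel. norm (k x * (\<bar>u x\<bar> powr (q - 1) * sgn (u x)) * h x) <= norm (C * (\<bar>u x\<bar> powr q + \<bar>h x\<bar> powr q))"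
  by (intro AE_I2) (simp add: order_trans[OF _ abs_ge_self])
qed

lemma AE_zero_of_wmass_zero:
 assumes "h \<in> Lq q" "wmass (%_. 1) q h = 0"
 shows "AE x in lborel. h x = 0"
proof -
 have "AE x in lborel. \<bar>h x\<bar> powr q = 0"
  using integral_nonneg_eq_0_iff_AE[OF LqD(2)[OF assms(1)]] assms(2) by (simp add: wmass_def)
 then show ?thesis by eventually_elim simp
qed

text \<open>The mixed term |u|^(q-2) h^2 is handled pointwise after normalizing \<open>h\<close> by
  its norm \<open>\<tau>\<close>, in place of Hoelder's inequality. Vanishing norm is a separate
  case because \<open>\<tau>\<close> becomes a divisor.\<close>

lemma wmass_taylor:
 assumes k_meas: "k \<in> borel_measurable borel" and k: "!!x. \<bar>k x\<bar> <= C" and u: "u \<in> Lq q" and h: "h \<in> Lq q" and q: "q > 2"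
 defines "\<tau> \<equiv> Lq_norm q h"
 shows "\<bar>wmass k q (%x. u x + h x) - wmass k q u - q * wderiv k q u h\<bar>
  <= C * (q * (q - 1) * 2 powr (q - 2)) * (\<tau>^2 * (wmass (%_. 1) q u + 1) + \<tau> powr q)"
proof -
 have C: "C >= 0" using k[of undefined] by linarith
 note [measurable] = LqD(1)[OF u] LqD(1)[OF h] k_meas
 have uh: "(%x. u x + h x) \<in> Lq q" using Lq_lincomb[OF u h, of 1 1] q by simp
 define S where "S = wmass (%_. 1) q h"
 have S0: "S >= 0" by (simp add: S_def wmass_nonneg)
 have tau: "\<tau> = S powr (1 / q)" by (simp add: \<tau>_def S_def wmass_def Lq_norm_def)
 have tauq: "\<tau> powr q = S" using S0 q by (simp add: tau powr_powr)
 define K where "K = C * (q * (q - 1) * 2 powr (q - 2))"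
 have K: "K >= 0" using C q by (simp add: K_def)
 show ?thesis
 proof (cases "S = 0")
  case True
  have "AE x in lborel. h x = 0" by (rule AE_zero_of_wmass_zero[OF h]) (use True S_def in simp)
  then have "wmass k q (%x. u x + h x) = wmass k q u" "wderiv k q u h = 0"
   unfolding wmass_def wderiv_def by (auto intro!: integral_cong_AE integral_eq_zero_AE)
  then show ?thesis using True K by (simp add: tau K_def)
 next
  case False
  then have t: "\<tau> > 0" using S0 by (simp add: tau)
  note i = wmass_integrable[OF k_meas k u] wmass_integrable[OF k_meas k uh] wderiv_integrable[OF k_meas k u h]
  let ?r = "%x. k x * \<bar>u x + h x\<bar> powr q - k x * \<bar>u x\<bar> powr q - q * (k x * (\<bar>u x\<bar> powr (q - 1) * sgn (u x)) * h x)"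
  let ?b = "%x. K * (\<tau>^2 * (\<bar>u x\<bar> powr q + \<bar>h x\<bar> powr q / \<tau> powr q) + \<bar>h x\<bar> powr q)"
  have ib: "integrable lborel ?b" using LqD(2)[OF u] LqD(2)[OF h] by simp
  have ir: "integrable lborel ?r" using i q by (intro L1_diff integrable_mult_right) auto
  have "\<bar>wmass k q (%x. u x + h x) - wmass k q u - q * wderiv k q u h\<bar> = \<bar>\<integral>x. ?r x \<partial>lborel\<bar>"
   using i q by (simp add: wmass_def wderiv_def)
  also have "... <= (LINT x|lborel. \<bar>?r x\<bar>)" by (rule integral_abs_bound)
  also have "... <= (LINT x|lborel. ?b x)"
  proof (rule LINT_mono[OF integrable_abs[OF ir] ib])
   fix x
   have "\<bar>?r x\<bar> = \<bar>k x\<bar> * \<bar>\<bar>u x + h x\<bar> powr q - \<bar>u x\<bar> powr q - q * (\<bar>u x\<bar> powr (q - 1) * sgn (u x)) * h x\<bar>"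
    unfolding abs_mult[symmetric] by (simp add: algebra_simps)
   also have "... <= C * (q * (q - 1) * 2 powr (q - 2) * (\<bar>u x\<bar> powr (q - 2) * (h x)^2 + \<bar>h x\<bar> powr q))"
    using C by (intro mult_mono k abs_powr_taylor q) auto
   also have "... = K * (\<bar>u x\<bar> powr (q - 2) * (h x)^2 + \<bar>h x\<bar> powr q)" by (simp add: K_def)
   also have "... <= K * (\<tau>^2 * (\<bar>u x\<bar> powr q + \<bar>h x\<bar> powr q / \<tau> powr q) + \<bar>h x\<bar> powr q)"
   proof (intro mult_left_mono add_right_mono K)
    define y where "y = \<bar>h x\<bar> / \<tau>"
    have y: "y >= 0" using t by (simp add: y_def)
    define z where "z = max \<bar>u x\<bar> y"
    have "\<bar>u x\<bar> powr (q - 2) * y^2 <= z powr (q - 2) * z^2"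
     using y q by (intro mult_mono powr_mono2 power_mono) (auto simp: z_def)
    also have "... = z powr q" using y by (cases "z = 0") (auto simp: powr_diff z_def)
    also have "... <= \<bar>u x\<bar> powr q + y powr q" by (auto simp: z_def max_def)
    finally have "\<tau>^2 * (\<bar>u x\<bar> powr (q - 2) * y^2) <= \<tau>^2 * (\<bar>u x\<bar> powr q + y powr q)"
     by (rule mult_left_mono) simp
    moreover have "\<tau>^2 * (\<bar>u x\<bar> powr (q - 2) * y^2) = \<bar>u x\<bar> powr (q - 2) * (h x)^2"
     using t by (simp add: y_def power_divide)
    moreover have "y powr q = \<bar>h x\<bar> powr q / \<tau> powr q" using t by (simp add: y_def powr_divide)
    ultimately show "\<bar>u x\<bar> powr (q - 2) * (h x)^2 <= \<tau>^2 * (\<bar>u x\<bar> powr q + \<bar>h x\<bar> powr q / \<tau> powr q)" by simp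
   qed
   finally show "\<bar>?r x\<bar> <= ?b x" .
  qed
  also have "... = K * (\<tau>^2 * (wmass (%_. 1) q u + S / \<tau> powr q) + S)"
   using LqD(2)[OF u] LqD(2)[OF h] by (simp add: wmass_def S_def)
  finally show ?thesis using False by (simp add: tauq K_def)
 qed
qed

section \<open>The natural constraint, Euler-Lagrange equation and least energy solutions\<close>

definition qmass :: "real => real => (real ^ 'n => real) => real"
 where "qmass p m u = wmass (%x. m * Q 1 x) (2 * p) u"

text \<open>The condition J'(u)u = 0 with the derivative evaluated, so that membership can be
  checked without any statement about differentiability.\<close>

definition natural_constraint :: "real => real => (real ^ 'n => real) set"
 where "natural_constraint p m = {u \<in> E_space p. nontrivial u \<and> dirichlet u = qmass p m u}"

lemma Q_measurable [measurable]: "Q e \<in> borel_measurable borel"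
 unfolding Q_def[abs_def] by measurable

lemma Q_abs [simp]: "\<bar>Q e x\<bar> = 1"
 by (simp add: Q_def)

lemma weight_measurable: "(%x. m * Q 1 x) \<in> borel_measurable borel"
 by measurable

lemma weight_bound: "m > 0 ==> \<bar>m * Q 1 x\<bar> <= m"
 by (simp add: abs_mult)

lemma J_func_eq: "J_func p m u = 1 / 2 * dirichlet u - 1 / (2 * p) * qmass p m u"
 by (simp add: J_func_def D12_norm_sq_dirichlet qmass_def wmass_def)

lemma qmass_mult: "qmass p m (%x. t * u x) = \<bar>t\<bar> powr (2 * p) * qmass p m u"
 by (simp add: qmass_def wmass_mult)

lemma dirichlet_mult:
 assumes "has_L2_gradient u"
 shows "dirichlet (%x. t * u x) = t^2 * dirichlet u"
 using dirichlet_lincomb(2)[OF assms assms, of t 0] by simp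

lemma qmass_nonzero_imp_nontrivial:
 assumes "qmass p m u ~= 0"
 shows "nontrivial u"
 unfolding nontrivial_def
proof
 assume "AE x in lborel. u x = 0"
 then have "AE x in lborel. m * Q 1 x * \<bar>u x\<bar> powr (2 * p) = 0" by eventually_elim simp
 then have "qmass p m u = 0" unfolding qmass_def wmass_def by (rule integral_eq_zero_AE)
 then show False using assms by simp
qed

text \<open>Scaling \<open>u\<close> by the factor t with t^(2p-2) = \<open>dirichlet u\<close> /
  \<open>qmass p m u\<close> lands on the constraint; raising c <= t^2 \<open>dirichlet u\<close> to
  the power p - 1 eliminates t. For nonpositive \<open>qmass\<close> the inequality is a matter of
  signs.\<close>

lemma projection_bound:
 fixes u :: "real ^ 'n => real"
 assumes lb: "!!v :: real ^ 'n => real. v \<in> natural_constraint p m ==> c <= dirichlet v" and c: "c >= 0"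
  and p: "p > 1" and m: "m > 0" and N: "CARD('n) >= 3"
  and u: "u \<in> E_space p" and D: "dirichlet u > 0"
 shows "c powr (p - 1) * qmass p m u <= dirichlet u powr p"
proof (cases "qmass p m u <= 0")
 case True
 then have "c powr (p - 1) * qmass p m u <= 0" by (simp add: mult_nonneg_nonpos)
 also have "... <= dirichlet u powr p" by simp
 finally show ?thesis .
next
 case False
 define q where "q = qmass p m u"
 have q: "q > 0" using False by (simp add: q_def)
 define D' where "D' = dirichlet u"
 have D': "D' > 0" using D by (simp add: D'_def)
 define t where "t = (D' / q) powr (1 / (2 * p - 2))"
 have t: "t > 0" using q D' by (simp add: t_def)
 define v where "v x = t * u x" for x
 have vD: "dirichlet v = t^2 * D'"
  unfolding v_def[abs_def] D'_def by (rule dirichlet_mult[OF E_spaceD(1)[OF u]])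
 have vq: "qmass p m v = t powr (2 * p) * q"
  unfolding v_def[abs_def] q_def using t by (simp add: qmass_mult)
 have "t powr (2 * p) = t^2 * t powr (2 * p - 2)" using t by (simp add: powr_diff)
 also have "t powr (2 * p - 2) = D' / q" using p q D' by (simp add: t_def powr_powr)
 finally have "qmass p m v = dirichlet v" using q by (simp add: vD vq)
 moreover have "v \<in> E_space p" unfolding v_def[abs_def] using p N by (intro E_space_mult u) auto
 moreover have "nontrivial v" by (rule qmass_nonzero_imp_nontrivial[of p m]) (use vq q t in simp)
 ultimately have "v \<in> natural_constraint p m" by (simp add: natural_constraint_def)
 then have "c <= t^2 * D'" using lb[of v] vD by simp
 then have "c powr (p - 1) <= (t^2 * D') powr (p - 1)" using c p by (intro powr_mono2) auto
 also have "... = (t powr (2 * (p - 1))) * D' powr (p - 1)"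
  using t D' by (simp add: powr_mult powr_powr flip: powr_numeral)
 also have "t powr (2 * (p - 1)) = D' / q" using p q D' by (simp add: t_def powr_powr)
 also have "D' / q * D' powr (p - 1) = D' powr p / q" using D' by (simp add: powr_diff)
 finally show ?thesis using q by (simp add: field_simps q_def D'_def)
qed

lemma DERIV_quadratic:
 fixes g :: "real => real"
 assumes "!!s. \<bar>s\<bar> <= 1 ==> \<bar>g s - g 0 - s * d\<bar> <= K * s^2"
 shows "(g has_real_derivative d) (at 0)"
 unfolding DERIV_def
proof (rule LIM_zero_cancel, rule Lim_null_comparison)
 show "\<forall>\<^sub>F s in at 0. norm ((g (0 + s) - g 0) / s - d) <= K * \<bar>s\<bar>"
 proof -
  have "\<forall>\<^sub>F s::real in at 0. s \<in> {-1<..<1}" by (intro eventually_at_in_open') auto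
  moreover have "\<forall>\<^sub>F s::real in at 0. s ~= 0" by (simp add: eventually_at_filter)
  ultimately show ?thesis
  proof eventually_elim
   case (elim s)
   have "(g (0 + s) - g 0) / s - d = (g s - g 0 - s * d) / s" using elim by (simp add: field_simps)
   then have "\<bar>(g (0 + s) - g 0) / s - d\<bar> = \<bar>g s - g 0 - s * d\<bar> / \<bar>s\<bar>" by simp
   also have "... <= K * s^2 / \<bar>s\<bar>" using assms[of s] elim by (intro divide_right_mono) auto
   also have "... = K * \<bar>s\<bar>" using elim by (simp add: power2_eq_square abs_if)
   finally show ?case by simp
  qed
 qed
 show "((%s. K * \<bar>s\<bar>) \<longlongrightarrow> 0) (at 0)" by (intro tendsto_mult_right_zero tendsto_rabs_zero tendsto_ident_at)
qed

lemma Lq_norm_mult: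
 assumes "q > 0"
 shows "Lq_norm q (%x. t * u x) = \<bar>t\<bar> * Lq_norm q u"
proof -
 have "Lq_norm q (%x. t * u x) = wmass (%_. 1) q (%x. t * u x) powr (1 / q)"
  by (simp add: Lq_norm_def wmass_def)
 also have "... = (\<bar>t\<bar> powr q * wmass (%_. 1) q u) powr (1 / q)" by (simp only: wmass_mult)
 also have "... = \<bar>t\<bar> * Lq_norm q u"
  using assms by (simp add: powr_mult wmass_nonneg powr_powr) (simp add: Lq_norm_def wmass_def)
 finally show ?thesis .
qed

lemma E_norm_eq: "E_norm p u = sqrt (dirichlet u + (Lq_norm (2 * p) u)^2)"
 by (simp add: E_norm_def D12_norm_sq_dirichlet)

lemma E_norm_nonneg: "E_norm p u >= 0"
 by (simp add: E_norm_eq)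

lemma E_norm_bounds:
 "dirichlet u <= (E_norm p u)^2" "Lq_norm (2 * p) u <= E_norm p u"
 by (auto simp: E_norm_eq intro: real_le_rsqrt)

lemma E_norm_mult:
 assumes "u \<in> E_space p" "p > 0"
 shows "E_norm p (%x. t * u x) = \<bar>t\<bar> * E_norm p u"
 using assms E_spaceD(1)[OF assms(1)]
 by (simp add: E_norm_eq dirichlet_mult Lq_norm_mult power_mult_distrib real_sqrt_mult flip: distrib_left)

text \<open>Only the ray s -> (1 + s) u matters: along it \<open>J_func\<close> is an explicit
  function of s whose derivative at 0 is \<open>D - q\<close>, whereas \<open>L u = 0\<close> and
  the Frechet remainder make that derivative 0.\<close>

lemma Nehari_limit_subset:
 fixes u :: "real ^ 'n => real"
 assumes p: "p > 1" and N: "CARD('n) >= 3" and u: "u \<in> Nehari_limit p m"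
 shows "u \<in> natural_constraint p m"
proof -
 obtain L where uE: "u \<in> E_space p" and nt: "nontrivial u" and Lu: "L u = 0"
  and L: "has_Frechet_derivative (E_space p) (E_norm p) (J_func p m) u L"
  using u by (auto simp: Nehari_limit_def)
 define D where "D = dirichlet u"
 define q where "q = qmass p m u"
 define \<phi> where "\<phi> s = 1 / 2 * (1 + s)^2 * D - 1 / (2 * p) * (1 + s) powr (2 * p) * q" for s :: real
 have su: "u + s *\<^sub>R u = (%x. (1 + s) * u x)" for s
  by (simp add: fun_eq_iff scaleR_fun_def plus_fun_def algebra_simps)
 have J: "J_func p m (u + s *\<^sub>R u) = \<phi> s" if "\<bar>s\<bar> < 1" for s
  unfolding su J_func_eq \<phi>_def D_def q_def using that
  by (simp add: dirichlet_mult[OF E_spaceD(1)[OF uE]] qmass_mult)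
 have J0: "J_func p m u = \<phi> 0" by (simp add: J_func_eq \<phi>_def D_def q_def)
 have "(\<phi> has_real_derivative D - q) (at 0)"
 proof -
  have "((%s. 1 / 2 * (1 + s)^2 * D - 1 / (2 * p) * (1 + s) powr (2 * p) * q) has_real_derivative D - q) (at 0)"
   using p by (auto intro!: derivative_eq_intros)
  then show ?thesis by (simp add: \<phi>_def[abs_def])
 qed
 moreover have "(\<phi> has_real_derivative 0) (at 0)"
  unfolding DERIV_def LIM_eq
 proof (intro allI impI)
  fix r :: real assume r: "r > 0"
  define M where "M = E_norm p u + 1"
  have M: "M > 0" "E_norm p u < M" using E_norm_nonneg[of p u] by (auto simp: M_def)
  have "r / M > 0" using r M by simp
  then obtain d where d: "d > 0" "!!h. h \<in> E_space p ==> E_norm p h < d ==>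
    \<bar>J_func p m (u + h) - J_func p m u - L h\<bar> <= r / M * E_norm p h"
   using L unfolding has_Frechet_derivative_def by metis
  show "\<exists>s>0. \<forall>x. x ~= 0 \<and> norm (x - 0) < s --> norm ((\<phi> (0 + x) - \<phi> 0) / x - 0) < r"
  proof (intro exI[of _ "min 1 (d / M)"] conjI allI impI)
   show "0 < min 1 (d / M)" using d M by simp
   fix s :: real assume s: "s ~= 0 \<and> norm (s - 0) < min 1 (d / M)"
   then have s1: "\<bar>s\<bar> < 1" "\<bar>s\<bar> * M < d" "s ~= 0" using M by (auto simp: field_simps)
   have sR: "s *\<^sub>R u = (%x. s * u x)" by (simp add: scaleR_fun_def)
   have sE: "s *\<^sub>R u \<in> E_space p" unfolding sR using p N by (intro E_space_mult uE) auto
   have sn: "E_norm p (s *\<^sub>R u) = \<bar>s\<bar> * E_norm p u" unfolding sR using p by (intro E_norm_mult uE) auto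
   have "L (s *\<^sub>R u) = s * L u" using L uE by (simp add: has_Frechet_derivative_def)
   then have "L (s *\<^sub>R u) = 0" using Lu by simp
   moreover have "E_norm p (s *\<^sub>R u) < d"
    using s1 M mult_left_mono[of "E_norm p u" M "\<bar>s\<bar>"] unfolding sn by linarith
   ultimately have "\<bar>\<phi> s - \<phi> 0\<bar> <= r / M * (\<bar>s\<bar> * E_norm p u)"
    using d(2)[OF sE] J[OF s1(1)] J0 sn by simp
   also have "... < r / M * (\<bar>s\<bar> * M)"
    using r M s1 by (intro mult_strict_left_mono) auto
   also have "... = r * \<bar>s\<bar>" using M by simp
   finally have "\<bar>\<phi> s - \<phi> 0\<bar> / \<bar>s\<bar> < r" using s1 by (simp add: field_simps)
   then show "norm ((\<phi> (0 + s) - \<phi> 0) / s - 0) < r" by simp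
  qed
 qed
 ultimately have "D - q = 0" by (rule DERIV_unique)
 then show ?thesis using uE nt by (simp add: natural_constraint_def D_def q_def)
qed

text \<open>The functional \<open>u \<mapsto> \<parallel>u\<parallel>\<^sup>2\<^sup>p - c\<^sup>p\<^sup>-\<^sup>1 \<integral>\<mu> Q |u|\<^sup>2\<^sup>p\<close> is nonnegative near a minimizer \<open>w\<close> and vanishes at \<open>w\<close>,
 so its derivative there is zero.\<close>

lemma minimizer_Euler_Lagrange:
 fixes w h :: "real ^ 'n => real"
 assumes lb: "!!v :: real ^ 'n => real. v \<in> natural_constraint p m ==> c <= dirichlet v" and c: "c > 0"
  and p: "p > 1" and m: "m > 0" and N: "CARD('n) >= 3"
  and w: "w \<in> natural_constraint p m" "dirichlet w = c" and h: "h \<in> E_space p"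
 shows "dir_inner w h = wderiv (%x. m * Q 1 x) (2 * p) w h"
proof -
 have wE: "w \<in> E_space p" and wq: "qmass p m w = c" using w by (auto simp: natural_constraint_def)
 note wL = E_spaceD(1)[OF wE] and hL = E_spaceD(1)[OF h]
 define a where "a = dir_inner w h"
 define b where "b = wderiv (%x. m * Q 1 x) (2 * p) w h"
 define D where "D s = c + 2 * s * a + s^2 * dirichlet h" for s :: real
 define g where "g s = qmass p m (%x. w x + s * h x)" for s
 have D_eq: "dirichlet (%x. w x + s * h x) = D s" for s
  using dirichlet_lincomb(2)[OF wL hL, of 1 s] w by (simp add: D_def a_def)
 have g0: "g 0 = c" using wq by (simp add: g_def)
 define T where "T = Lq_norm (2 * p) h"
 have T0: "T >= 0" by (simp add: T_def Lq_norm_def)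
 define K where "K = m * (2 * p * (2 * p - 1) * 2 powr (2 * p - 2))"
 have K0: "K >= 0" using m p by (simp add: K_def)
 have "(g has_real_derivative 2 * p * b) (at 0)"
 proof (rule DERIV_quadratic)
  fix s :: real assume s: "\<bar>s\<bar> <= 1"
  have sh: "(%x. s * h x) \<in> Lq (2 * p)" using E_spaceD(2)[OF E_space_mult[OF h _ N]] p by simp
  have sT: "Lq_norm (2 * p) (%x. s * h x) = \<bar>s\<bar> * T" unfolding T_def by (rule Lq_norm_mult) (use p in simp)
  have sb: "wderiv (%x. m * Q 1 x) (2 * p) w (%x. s * h x) = s * b"
   unfolding wderiv_def b_def integral_mult_right_zero[symmetric] by (simp add: mult_ac)
  have e: "s * (2 * p * b) = 2 * p * (s * b)" by simp
  have "\<bar>g s - g 0 - s * (2 * p * b)\<bar> <= K * ((\<bar>s\<bar> * T)^2 * (wmass (%_. 1) (2 * p) w + 1) + (\<bar>s\<bar> * T) powr (2 * p))"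
   using wmass_taylor[OF weight_measurable weight_bound[OF m] E_spaceD(2)[OF wE] sh] p
   unfolding e g_def qmass_def by (simp add: sT sb K_def)
  also have "(\<bar>s\<bar> * T) powr (2 * p) = \<bar>s\<bar> powr (2 * p) * T powr (2 * p)" using T0 by (simp add: powr_mult)
  also have "\<bar>s\<bar> powr (2 * p) <= \<bar>s\<bar> powr 2" using s p by (intro powr_mono') auto
  also have "\<bar>s\<bar> powr 2 = s^2" by (cases "s = 0") (auto simp: powr_numeral)
  finally have "\<bar>g s - g 0 - s * (2 * p * b)\<bar> <= K * ((\<bar>s\<bar> * T)^2 * (wmass (%_. 1) (2 * p) w + 1) + s^2 * T powr (2 * p))"
   using K0 by (simp add: mult_left_mono mult_right_mono)
  then show "\<bar>g s - g 0 - s * (2 * p * b)\<bar> <= (K * (T^2 * (wmass (%_. 1) (2 * p) w + 1) + T powr (2 * p))) * s^2"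
   by (simp add: power_mult_distrib algebra_simps)
 qed
 moreover have "(D has_real_derivative 2 * a) (at 0)"
  unfolding D_def[abs_def] by (auto intro!: derivative_eq_intros)
 moreover have D0: "D 0 = c" by (simp add: D_def)
 ultimately have der: "((%s. D s powr p - c powr (p - 1) * g s) has_real_derivative
   p * c powr (p - 1) * (2 * a) - c powr (p - 1) * (2 * p * b)) (at 0)"
  using c by (auto intro!: derivative_eq_intros simp: powr_diff field_simps)
 have "p * c powr (p - 1) * (2 * a) - c powr (p - 1) * (2 * p * b) = 0"
 proof -
  have "isCont D 0" using \<open>(D has_real_derivative 2 * a) (at 0)\<close> by (rule DERIV_isCont)
  then have "D \<midarrow>0\<rightarrow> c" unfolding isCont_def D0 .
  then have "\<forall>\<^sub>F s in at 0. D s > 0" using c by (rule order_tendstoD)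
  then obtain d where d: "d > 0" "!!s. s ~= 0 ==> \<bar>s\<bar> < d ==> D s > 0"
   by (auto simp: eventually_at dist_real_def)
  have "D 0 powr p - c powr (p - 1) * g 0 <= D s powr p - c powr (p - 1) * g s" if s: "\<bar>0 - s\<bar> < d" for s
  proof -
   have "D s > 0" using d(2)[of s] s D0 c by (cases "s = 0") auto
   moreover have "(%x. w x + s * h x) \<in> E_space p" using E_space_lincomb[OF wE h _ N, of 1 s] p by simp
   ultimately have "c powr (p - 1) * g s <= D s powr p"
    using projection_bound[OF lb less_imp_le[OF c] p m N, of "%x. w x + s * h x"] by (simp add: D_eq g_def)
   moreover have "D 0 powr p - c powr (p - 1) * g 0 = 0" using c by (simp add: D0 g0 powr_diff)
   ultimately show ?thesis by simp
  qed
  then show ?thesis by (intro DERIV_local_min[OF der d(1)]) auto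
 qed
 then have "p * c powr (p - 1) * (2 * a) = p * c powr (p - 1) * (2 * b)" by (simp add: algebra_simps)
 then show ?thesis using p c by (simp add: a_def b_def)
qed

text \<open>By the Euler-Lagrange identity the linear terms of \<open>J_func\<close> at
  \<open>w\<close> cancel, and what remains is quadratic in the norm of the increment. On the
  constraint \<open>J_func\<close> is a fixed positive multiple of \<open>dirichlet\<close>, so
  minimal Dirichlet energy is minimal energy.\<close>

theorem minimizer_least_energy:
 fixes w :: "real ^ 'n => real"
 assumes lb: "!!v :: real ^ 'n => real. v \<in> natural_constraint p m ==> c <= dirichlet v" and c: "c > 0"
  and p: "p > 1" and m: "m > 0" and N: "CARD('n) >= 3"
  and w: "w \<in> natural_constraint p m" "dirichlet w = c"
 shows "least_energy_limit p m w"
proof -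
 have wE: "w \<in> E_space p" and wq: "qmass p m w = c" and nt: "nontrivial w"
  using w by (auto simp: natural_constraint_def)
 define W where "W = wmass (%_. 1) (2 * p) w"
 have W0: "W >= 0" by (simp add: W_def wmass_nonneg)
 define K where "K = m * (2 * p * (2 * p - 1) * 2 powr (2 * p - 2))"
 have K0: "K >= 0" using m p by (simp add: K_def)
 define C where "C = 1 + K * (W + 2)"
 have C: "C > 0" using K0 W0 by (simp add: C_def add_pos_nonneg)
 have crit: "has_Frechet_derivative (E_space p) (E_norm p) (J_func p m) w (%h. 0)"
  unfolding has_Frechet_derivative_def
 proof (intro conjI wE ballI allI impI)
  show "\<exists>C. \<forall>h\<in>E_space p. \<bar>0\<bar> <= C * E_norm p h" by (intro exI[of _ 0]) simp
  fix \<eta> :: real assume \<eta>: "\<eta> > 0"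
  show "\<exists>\<delta>>0. \<forall>h\<in>E_space p. E_norm p h < \<delta> --> \<bar>J_func p m (w + h) - J_func p m w - 0\<bar> <= \<eta> * E_norm p h"
  proof (intro exI[of _ "min 1 (\<eta> / C)"] conjI ballI impI)
   show "0 < min 1 (\<eta> / C)" using \<eta> C by simp
   fix h :: "real ^ 'n => real" assume h: "h \<in> E_space p" and hn: "E_norm p h < min 1 (\<eta> / C)"
   define e where "e = E_norm p h"
   have e: "0 <= e" "e < 1" "e * C < \<eta>" using hn C E_norm_nonneg[of p h] by (auto simp: e_def field_simps)
   define \<tau> where "\<tau> = Lq_norm (2 * p) h"
   have tau: "0 <= \<tau>" "\<tau> <= e" using E_norm_bounds(2)[where p=p and u=h] by (auto simp: \<tau>_def e_def Lq_norm_def)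
   have sum: "w + h = (%x. 1 * w x + 1 * h x)" by (simp add: plus_fun_def)
   have D: "dirichlet (w + h) = dirichlet w + 2 * dir_inner w h + dirichlet h"
    unfolding sum using dirichlet_lincomb(2)[OF E_spaceD(1)[OF wE] E_spaceD(1)[OF h], of 1 1] by simp
   define R where "R = qmass p m (w + h) - qmass p m w - 2 * p * dir_inner w h"
   have EL: "dir_inner w h = wderiv (%x. m * Q 1 x) (2 * p) w h"
    by (rule minimizer_Euler_Lagrange[OF lb c p m N w h])
   have "\<bar>R\<bar> <= K * (\<tau>^2 * (W + 1) + \<tau> powr (2 * p))"
    using wmass_taylor[OF weight_measurable weight_bound[OF m] E_spaceD(2)[OF wE] E_spaceD(2)[OF h]] p
    by (simp add: K_def \<tau>_def W_def qmass_def sum R_def EL)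
   also have "... <= K * (e^2 * (W + 1) + e^2)"
   proof (intro mult_left_mono add_mono mult_right_mono K0)
    show "\<tau>^2 <= e^2" using tau by (intro power_mono) auto
    have "\<tau> powr (2 * p) <= \<tau> powr 2" using tau e p by (intro powr_mono') auto
    also have "... <= e powr 2" using tau by (intro powr_mono2) auto
    also have "... = e^2" using e by (cases "e = 0") (auto simp: powr_numeral)
    finally show "\<tau> powr (2 * p) <= e^2" .
   qed (use W0 in auto)
   finally have R: "\<bar>R\<bar> <= (K * (W + 2)) * e^2" by (simp add: algebra_simps)
   have "J_func p m (w + h) - J_func p m w
     = 1 / 2 * (dirichlet (w + h) - dirichlet w) - 1 / (2 * p) * (qmass p m (w + h) - qmass p m w)"
    by (simp add: J_func_eq right_diff_distrib diff_divide_distrib)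
   also have "dirichlet (w + h) - dirichlet w = 2 * dir_inner w h + dirichlet h" using D by simp
   also have "qmass p m (w + h) - qmass p m w = R + 2 * p * dir_inner w h" by (simp add: R_def)
   also have "1 / 2 * (2 * dir_inner w h + dirichlet h) - 1 / (2 * p) * (R + 2 * p * dir_inner w h)
     = 1 / 2 * dirichlet h - 1 / (2 * p) * R" using p by (simp add: field_simps)
   finally have "J_func p m (w + h) - J_func p m w = 1 / 2 * dirichlet h - 1 / (2 * p) * R" .
   then have "\<bar>J_func p m (w + h) - J_func p m w\<bar> <= 1 / 2 * dirichlet h + 1 / (2 * p) * \<bar>R\<bar>"
    using p abs_triangle_ineq4[of "1 / 2 * dirichlet h" "1 / (2 * p) * R"] by (simp add: abs_mult)
   also have "... <= 1 * e^2 + 1 * ((K * (W + 2)) * e^2)"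
    using E_norm_bounds(1)[of h p] p R
    by (intro add_mono mult_mono) (auto simp: e_def)
   also have "... = (e * C) * e" by (simp add: C_def power2_eq_square algebra_simps)
   also have "... <= \<eta> * e" using e by (intro mult_right_mono) auto
   finally show "\<bar>J_func p m (w + h) - J_func p m w - 0\<bar> <= \<eta> * E_norm p h" by (simp add: e_def)
  qed
 qed auto
 have "attains_inf_on (J_func p m) (Nehari_limit p m) w"
  unfolding attains_inf_on_def
 proof (intro conjI ballI)
  show "w \<in> Nehari_limit p m" using wE nt crit by (auto simp: Nehari_limit_def)
  fix v :: "real ^ 'n => real" assume "v \<in> Nehari_limit p m"
  then have v: "v \<in> natural_constraint p m" by (rule Nehari_limit_subset[OF p N])
  then have "J_func p m v = (1 / 2 - 1 / (2 * p)) * dirichlet v"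
   by (simp add: J_func_eq natural_constraint_def algebra_simps)
  moreover have "J_func p m w = (1 / 2 - 1 / (2 * p)) * dirichlet w"
   using w by (simp add: J_func_eq wq algebra_simps)
  moreover have "(1 / 2 - 1 / (2 * p)) * dirichlet w <= (1 / 2 - 1 / (2 * p)) * dirichlet v"
   using lb[OF v] w p by (intro mult_left_mono) (auto simp: field_simps)
  ultimately show "J_func p m w <= J_func p m v" by simp
 qed
 then show ?thesis using crit nt by (simp add: least_energy_limit_def solves_limit_def critical_point_def)
qed

section \<open>Perturbation of energies and completeness of E\<close>

lemma dir_inner_le:
 assumes u: "has_L2_gradient u" and h: "has_L2_gradient h"
 shows "\<bar>dir_inner u h\<bar> <= sqrt (dirichlet h) * (dirichlet u + 1) / 2"
proof -
 \<comment> \<open>Nonnegativity of the Dirichlet form at t u + h and t u - h. The choice t =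
   \<open>sqrt (dirichlet h)\<close> gives the claim; if \<open>dirichlet h\<close> is 0, small t
   forces the inner product to vanish.\<close>
 have main: "\<bar>dir_inner u h\<bar> <= (t * dirichlet u + dirichlet h / t) / 2" if t: "t > 0" for t
 proof -
  have "0 <= t^2 * dirichlet u + 2 * t * dir_inner u h + dirichlet h"
   using dirichlet_lincomb(2)[OF u h, of t 1] dirichlet_nonneg[of "%x. t * u x + 1 * h x"] by simp
  moreover have "0 <= t^2 * dirichlet u - 2 * t * dir_inner u h + dirichlet h"
   using dirichlet_lincomb(2)[OF u h, of t "-1"] dirichlet_nonneg[of "%x. t * u x + - 1 * h x"] by simp
  ultimately have "t * (2 * \<bar>dir_inner u h\<bar>) <= t * (t * dirichlet u + dirichlet h / t)"
   using t by (simp add: power2_eq_square algebra_simps abs_if)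
  then show ?thesis using t by (simp add: mult_le_cancel_left_pos)
 qed
 show ?thesis
 proof (cases "dirichlet h = 0")
  case False
  then have "dirichlet h > 0" using dirichlet_nonneg[of h] by linarith
  then show ?thesis using main[of "sqrt (dirichlet h)"] by (simp add: real_div_sqrt algebra_simps)
 next
  case True
  have "\<bar>dir_inner u h\<bar> <= 0"
  proof (rule field_le_epsilon)
   fix e :: real assume e: "e > 0"
   define t where "t = 2 * e / (dirichlet u + 1)"
   have D: "dirichlet u + 1 > 0" using dirichlet_nonneg[of u] by linarith
   have "\<bar>dir_inner u h\<bar> <= t * dirichlet u / 2" using main[of t] True e D by (simp add: t_def)
   also have "... <= e" using e D by (simp add: t_def field_simps)
   finally show "\<bar>dir_inner u h\<bar> <= 0 + e" by simp
  qed
  then show ?thesis using True by simp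
 qed
qed

lemma dirichlet_perturbation:
 assumes u: "has_L2_gradient u" and h: "!!n. has_L2_gradient (h n)" and h0: "((%n. dirichlet (h n)) \<longlongrightarrow> 0) F"
 shows "((%n. dirichlet (%x. u x + h n x)) \<longlongrightarrow> dirichlet u) F"
proof -
 have "((%n. dir_inner u (h n)) \<longlongrightarrow> 0) F"
 proof (rule Lim_null_comparison)
  show "\<forall>\<^sub>F n in F. norm (dir_inner u (h n)) <= sqrt (dirichlet (h n)) * (dirichlet u + 1) / 2"
   using dir_inner_le[OF u h] by simp
  have "((%n. sqrt (dirichlet (h n)) * (dirichlet u + 1) / 2) \<longlongrightarrow> sqrt 0 * (dirichlet u + 1) / 2) F"
   by (intro tendsto_intros h0) auto
  then show "((%n. sqrt (dirichlet (h n)) * (dirichlet u + 1) / 2) \<longlongrightarrow> 0) F" by simp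
 qed
 then have "((%n. dirichlet u + 2 * dir_inner u (h n) + dirichlet (h n)) \<longlongrightarrow> dirichlet u + 2 * 0 + 0) F"
  by (intro tendsto_intros h0)
 then show ?thesis using dirichlet_lincomb(2)[OF u h, of 1 1] by simp
qed

text \<open>The pointwise bound s <= t + t^(1-q) s^q replaces Hoelder's inequality: \<open>t\<close>
  is fixed first against the volume of the support, and the power term is then small by
  convergence.\<close>

lemma test_pairing_tendsto:
 fixes f :: "nat => real ^ 'n => real"
 assumes f: "!!n. locally_integrable (f n)" and g: "locally_integrable g" and q: "q > 1"
  and lim: "!!e. e > 0 ==> \<exists>n0. \<forall>n\<ge>n0. (\<integral>\<^sup>+x. ennreal (\<bar>f n x - g x\<bar> powr q) \<partial>lborel) <= ennreal e"
  and \<psi>: "\<psi> \<in> test_functions"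
 shows "(%n. \<integral>x. f n x * \<psi> x \<partial>lborel) \<longlonglongrightarrow> (LINT x|lborel. g x * \<psi> x)"
proof (rule LIMSEQ_I)
 fix e :: real assume e: "e > 0"
 note [measurable] = locally_integrable_measurable[OF f] locally_integrable_measurable[OF g] test_functionD(4)[OF \<psi>]
 obtain r where r: "!!x. norm x > r ==> \<psi> x = 0" using test_function_support[OF \<psi>] by metis
 obtain B where B: "B > 0" "!!x. \<bar>\<psi> x\<bar> <= B" using test_function_bounded[OF \<psi>] by metis
 define V where "V = measure lborel (cball (0 :: real ^ 'n) r)"
 have V0: "V >= 0" by (simp add: V_def)
 have V: "emeasure lborel (cball (0 :: real ^ 'n) r) = ennreal V"
  unfolding V_def using emeasure_lborel_cball_finite[of "0 :: real ^ 'n" r] by (intro emeasure_eq_ennreal_measure) simp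
 define t where "t = e / (4 * B * (V + 1))"
 have t: "t > 0" using e B V0 by (simp add: t_def)
 define d where "d = e / (4 * B * t powr (1 - q))"
 have d: "d > 0" using e B t by (simp add: d_def)
 obtain n0 where n0: "!!n. n >= n0 ==> (\<integral>\<^sup>+x. ennreal (\<bar>f n x - g x\<bar> powr q) \<partial>lborel) <= ennreal d"
  using lim[OF d] by metis
 show "\<exists>n0. \<forall>n\<ge>n0. norm ((LINT x|lborel. f n x * \<psi> x) - (LINT x|lborel. g x * \<psi> x)) < e"
 proof (intro exI allI impI)
  fix n assume n: "n >= n0"
  have i: "integrable lborel (%x. f n x * \<psi> x)" "integrable lborel (%x. g x * \<psi> x)"
   by (rule integrable_mult_test[OF f \<psi>], rule integrable_mult_test[OF g \<psi>])
  have eq: "(LINT x|lborel. f n x * \<psi> x) - (LINT x|lborel. g x * \<psi> x) = (LINT x|lborel. (f n x - g x) * \<psi> x)"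
   using i by (simp add: left_diff_distrib)
  have "ennreal (norm (LINT x|lborel. (f n x - g x) * \<psi> x)) <= (\<integral>\<^sup>+x. ennreal (norm ((f n x - g x) * \<psi> x)) \<partial>lborel)"
   using i by (intro integral_norm_bound_ennreal) (simp add: left_diff_distrib)
  also have "... <= (\<integral>\<^sup>+x. ennreal (B * t) * indicator (cball 0 r) x + ennreal (B * t powr (1 - q)) * ennreal (\<bar>f n x - g x\<bar> powr q) \<partial>lborel)"
  proof (rule nn_integral_mono)
   fix x
   show "ennreal (norm ((f n x - g x) * \<psi> x)) <= ennreal (B * t) * indicator (cball 0 r) x + ennreal (B * t powr (1 - q)) * ennreal (\<bar>f n x - g x\<bar> powr q)"
   proof (cases "norm x > r")
    case False
    have "\<bar>f n x - g x\<bar> * \<bar>\<psi> x\<bar> <= (t + t powr (1 - q) * \<bar>f n x - g x\<bar> powr q) * B"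
     using mixed_powr_le[OF q t, of 1 "f n x - g x"] B by (intro mult_mono) auto
    then have "norm ((f n x - g x) * \<psi> x) <= B * t + B * t powr (1 - q) * \<bar>f n x - g x\<bar> powr q"
     unfolding real_norm_def abs_mult by (simp add: distrib_left mult_ac)
    then have "ennreal (norm ((f n x - g x) * \<psi> x)) <= ennreal (B * t + B * t powr (1 - q) * \<bar>f n x - g x\<bar> powr q)"
     by (rule ennreal_leI)
    then show ?thesis using False B t by (simp add: ennreal_mult')
   qed (simp add: r)
  qed
  also have "... = ennreal (B * t) * ennreal V + ennreal (B * t powr (1 - q)) * (\<integral>\<^sup>+x. ennreal (\<bar>f n x - g x\<bar> powr q) \<partial>lborel)"
   by (subst nn_integral_add, measurable) (simp add: nn_integral_cmult nn_integral_cmult_indicator V)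
  also have "... <= ennreal (B * t) * ennreal V + ennreal (B * t powr (1 - q)) * ennreal d"
   by (intro add_left_mono mult_left_mono n0 n) simp
  also have "... = ennreal (B * t * V + B * t powr (1 - q) * d)"
   using B t V0 d by (simp add: ennreal_mult'[symmetric] flip: ennreal_plus)
  finally have "norm (LINT x|lborel. (f n x - g x) * \<psi> x) <= B * t * V + B * t powr (1 - q) * d"
   using B t V0 d by (subst (asm) ennreal_le_iff) auto
  also have "B * t powr (1 - q) * d = e / 4" using B t by (simp add: d_def)
  also have "B * t = e / 4 / (V + 1)" using B by (simp add: t_def)
  also have "e / 4 / (V + 1) * V = e / 4 * (V / (V + 1))" by simp
  also have "... <= e / 4 * 1" using e V0 by (intro mult_left_mono) auto
  finally show "norm ((LINT x|lborel. f n x * \<psi> x) - (LINT x|lborel. g x * \<psi> x)) < e"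
   using e unfolding eq by simp
 qed
qed

lemma locally_integrable_of_powr:
 fixes g :: "real ^ 'n => 'b::{banach, second_countable_topology}"
 assumes [measurable]: "g \<in> borel_measurable borel" and q: "q > 1"
  and fin: "(\<integral>\<^sup>+x. ennreal (norm (g x) powr q) \<partial>lborel) < \<infinity>"
 shows "locally_integrable g"
proof (rule locally_integrableI)
 fix r
 have "(\<integral>\<^sup>+x. ennreal (norm (g x)) * indicator (cball 0 r) x \<partial>lborel)
   <= (\<integral>\<^sup>+x. indicator (cball 0 r) x + ennreal (norm (g x) powr q) \<partial>lborel)"
 proof (rule nn_integral_mono)
  fix x
  have "norm (g x) <= 1 + norm (g x) powr q" using mixed_powr_le[OF q, of 1 1 "norm (g x)"] by simp
  then have "ennreal (norm (g x)) <= 1 + ennreal (norm (g x) powr q)"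
   by (metis ennreal_1 ennreal_leI ennreal_plus powr_ge_zero zero_le_one)
  then show "ennreal (norm (g x)) * indicator (cball 0 r) x <= indicator (cball 0 r) x + ennreal (norm (g x) powr q)"
   by (auto simp: indicator_def)
 qed
 also have "... = emeasure lborel (cball (0 :: real ^ 'n) r) + (\<integral>\<^sup>+x. ennreal (norm (g x) powr q) \<partial>lborel)"
  by (subst nn_integral_add) auto
 also have "... < \<infinity>" using fin emeasure_lborel_cball_finite by auto
 finally show "(\<integral>\<^sup>+x. ennreal (norm (g x)) * indicator (cball 0 r) x \<partial>lborel) < \<infinity>" .
qed simp

lemma Lq_locally_integrable: "u \<in> Lq q ==> q > 1 ==> locally_integrable u"
 by (rule locally_integrable_of_powr[where q=q]) (auto simp: Lq_def integrable_iff_bounded)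

text \<open>The functions and their gradients converge separately in their Lebesgue spaces; pairing
  with test functions identifies the second limit as the weak gradient of the first. Membership in
  the critical Lebesgue space, part of \<open>E_space\<close>, comes from the bound \<open>B\<close>
  and Fatou's lemma along an almost everywhere convergent subsequence, which also preserves
  signs.\<close>

lemma E_complete:
 fixes f :: "nat => real ^ 'n => real"
 assumes N: "CARD('n) >= 3" and p: "p > 1" and f: "!!n. f n \<in> E_space p"
  and B: "!!n. (LINT x|lborel. \<bar>f n x\<bar> powr (2 * real CARD('n) / (real CARD('n) - 2))) <= B"
  and CD: "!!e. e > 0 ==> \<exists>n0. \<forall>k\<ge>n0. \<forall>n\<ge>n0. dirichlet (%x. f k x - f n x) <= e"
  and Cq: "!!e. e > 0 ==> \<exists>n0. \<forall>k\<ge>n0. \<forall>n\<ge>n0. wmass (%_. 1) (2 * p) (%x. f k x - f n x) <= e"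
 obtains w where "w \<in> E_space p" "(%n. dirichlet (%x. f n x - w x)) \<longlonglongrightarrow> 0"
  "(%n. wmass (%_. 1) (2 * p) (%x. f n x - w x)) \<longlonglongrightarrow> 0"
  "(\<forall>n. AE x in lborel. 0 <= f n x) --> (AE x in lborel. 0 <= w x)"
proof -
 define P where "P = 2 * real CARD('n) / (real CARD('n) - 2)"
 have P: "P > 0" using N by (simp add: P_def)
 define G where "G n = weak_grad (f n)" for n
 have fG: "L2_gradient (f n) (G n)" for n unfolding G_def by (rule L2_gradient_weak_grad[OF E_spaceD(1)[OF f]])
 note fm [measurable] = L2_gradientD(4)[OF fG]
 note Gm [measurable] = L2_gradientD(5)[OF fG]
 have diff: "L2_gradient (%x. f k x - f n x) (%x. G k x - G n x)" for k n
  using L2_gradient_lincomb[OF fG[of k] fG[of n], of 1 "-1"] by simp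
 have "\<exists>n0. \<forall>k\<ge>n0. \<forall>n\<ge>n0. (\<integral>\<^sup>+x. ennreal (norm (f k x - f n x) powr (2 * p)) \<partial>lborel) <= ennreal e" if e: "e > 0" for e
 proof -
  have "(\<integral>\<^sup>+x. ennreal (norm (f k x - f n x) powr (2 * p)) \<partial>lborel) = ennreal (wmass (%_. 1) (2 * p) (%x. f k x - f n x))" for k n
   using LqD(2)[OF Lq_lincomb[OF E_spaceD(2)[OF f[of k]] E_spaceD(2)[OF f[of n]], of 1 "-1"]] p
   unfolding wmass_def by (subst nn_integral_eq_integral) auto
  then show ?thesis using Cq[OF e] by (metis ennreal_leI)
 qed
 then obtain w r where r: "strict_mono (r :: nat => nat)" and wm [measurable]: "w \<in> borel_measurable lborel"
  and AEw: "AE x in lborel. (%k. f (r k) x) \<longlonglongrightarrow> w x"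
  and limw: "!!e. e > 0 ==> \<exists>n0. \<forall>n\<ge>n0. (\<integral>\<^sup>+x. ennreal (norm (f n x - w x) powr (2 * p)) \<partial>lborel) <= ennreal e"
  by (rule Lq_complete[of f lborel "2 * p", rotated 2]) (use p in auto)
 have sq: "norm (z :: real ^ 'n) powr 2 = (norm z)^2" for z by (cases "z = 0") (auto simp: powr_numeral)
 have "\<exists>n0. \<forall>k\<ge>n0. \<forall>n\<ge>n0. (\<integral>\<^sup>+x. ennreal (norm (G k x - G n x) powr 2) \<partial>lborel) <= ennreal e" if e: "e > 0" for e
 proof -
  have "(\<integral>\<^sup>+x. ennreal (norm (G k x - G n x) powr 2) \<partial>lborel) = ennreal (dirichlet (%x. f k x - f n x))" for k n
   unfolding sq dirichlet_eq[OF diff] by (rule nn_integral_eq_integral[OF L2_gradientD(2)[OF diff]]) simp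
  then show ?thesis using CD[OF e] by (metis ennreal_leI)
 qed
 then obtain H r' where Hm [measurable]: "H \<in> borel_measurable lborel"
  and limH: "!!e. e > 0 ==> \<exists>n0. \<forall>n\<ge>n0. (\<integral>\<^sup>+x. ennreal (norm (G n x - H x) powr 2) \<partial>lborel) <= ennreal e"
  by (rule Lq_complete[of G lborel 2, rotated 2]) auto
 obtain n1 where n1: "(\<integral>\<^sup>+x. ennreal (norm (f n1 x - w x) powr (2 * p)) \<partial>lborel) <= ennreal 1"
  using limw[of 1] by auto
 have "(%x. f n1 x - w x) \<in> Lq (2 * p)"
  unfolding Lq_def integrable_iff_bounded using n1 by (auto intro: le_less_trans)
 from Lq_lincomb[OF E_spaceD(2)[OF f[of n1]] this, of 1 "-1"] have wq: "w \<in> Lq (2 * p)" using p by simp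
 obtain n2 where n2: "(\<integral>\<^sup>+x. ennreal (norm (G n2 x - H x) powr 2) \<partial>lborel) <= ennreal 1"
  using limH[of 1] by auto
 have H2: "integrable lborel (%x. (norm (H x))^2)"
 proof (rule L1_bound)
  have "integrable lborel (%x. (norm (G n2 x - H x))^2)"
   unfolding integrable_iff_bounded using n2 by (auto simp: sq intro: le_less_trans)
  then show "integrable lborel (%x. 2 * (norm (G n2 x))^2 + 2 * (norm (G n2 x - H x))^2)"
   using L2_gradientD(2)[OF fG[of n2]] by simp
  have "(norm (H x))^2 <= 2 * (norm (G n2 x))^2 + 2 * (norm (G n2 x - H x))^2" for x
  proof -
   have "norm (H x) <= norm (G n2 x) + norm (G n2 x - H x)"
    using norm_triangle_ineq4[of "G n2 x" "G n2 x - H x"] by simp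
   then have "(norm (H x))^2 <= (norm (G n2 x) + norm (G n2 x - H x))^2" by (intro power_mono) auto
   then show ?thesis using sum_squares_bound[of "norm (G n2 x)" "norm (G n2 x - H x)"] by (simp add: power2_sum)
  qed
  then show "AE x in lborel. norm ((norm (H x))^2) <= norm (2 * (norm (G n2 x))^2 + 2 * (norm (G n2 x - H x))^2)"
   by (intro AE_I2) (simp add: order_trans[OF _ abs_ge_self])
 qed measurable
 have liw: "locally_integrable w" by (rule Lq_locally_integrable[OF wq]) (use p in simp)
 have liH: "locally_integrable H"
  by (rule locally_integrable_of_powr[where q=2]) (use H2 in \<open>auto simp: integrable_iff_bounded sq\<close>)
 have "has_weak_gradient w H"
  unfolding has_weak_gradient_def
 proof (intro conjI liw liH ballI allI)
  fix \<phi> :: "real ^ 'n => real" and k :: 'n assume \<phi>: "\<phi> \<in> test_functions"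
  have 1: "(%n. \<integral>x. f n x * partial_deriv k \<phi> x \<partial>lborel) \<longlonglongrightarrow> (LINT x|lborel. w x * partial_deriv k \<phi> x)"
   by (rule test_pairing_tendsto[OF L2_gradientD(3)[OF fG] liw _ _ test_function_partial[OF \<phi>], where q="2 * p"])
    (use limw p in auto)
  have "(%n. \<integral>x. G n x $ k * \<phi> x \<partial>lborel) \<longlonglongrightarrow> (LINT x|lborel. H x $ k * \<phi> x)"
  proof (rule test_pairing_tendsto[OF locally_integrable_nth[OF weak_gradientD(2)[OF L2_gradientD(1)[OF fG]]]
     locally_integrable_nth[OF liH] _ _ \<phi>, where q=2])
   fix e :: real assume "e > 0"
   then obtain n0 where n0: "\<forall>n\<ge>n0. (\<integral>\<^sup>+x. ennreal (norm (G n x - H x) powr 2) \<partial>lborel) <= ennreal e" using limH by blast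
   have "(\<integral>\<^sup>+x. ennreal (\<bar>G n x $ k - H x $ k\<bar> powr 2) \<partial>lborel) <= (\<integral>\<^sup>+x. ennreal (norm (G n x - H x) powr 2) \<partial>lborel)" for n
    using component_le_norm_cart[of "G n _ - H _" k]
    by (intro nn_integral_mono ennreal_leI powr_mono2) auto
   then show "\<exists>n0. \<forall>n\<ge>n0. (\<integral>\<^sup>+x. ennreal (\<bar>G n x $ k - H x $ k\<bar> powr 2) \<partial>lborel) <= ennreal e"
    using n0 by (meson order_trans)
  qed simp
  from tendsto_minus[OF this]
  have 2: "(%n. \<integral>x. f n x * partial_deriv k \<phi> x \<partial>lborel) \<longlonglongrightarrow> - (LINT x|lborel. H x $ k * \<phi> x)"
   using L2_gradientD(1)[OF fG] \<phi> by (simp add: has_weak_gradient_def)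
  show "(LINT x|lborel. w x * partial_deriv k \<phi> x) = - (LINT x|lborel. H x $ k * \<phi> x)"
   by (rule LIMSEQ_unique[OF 1 2])
 qed
 then have wH: "L2_gradient w H" using H2 by (simp add: L2_gradient_def)
 have "integrable lborel (%x. \<bar>w x\<bar> powr P)"
  unfolding integrable_iff_bounded
 proof
  have "(\<integral>\<^sup>+x. ennreal (norm (\<bar>w x\<bar> powr P)) \<partial>lborel) = (\<integral>\<^sup>+x. liminf (%k. ennreal (\<bar>f (r k) x\<bar> powr P)) \<partial>lborel)"
  proof (rule nn_integral_cong_AE)
   show "AE x in lborel. ennreal (norm (\<bar>w x\<bar> powr P)) = liminf (%k. ennreal (\<bar>f (r k) x\<bar> powr P))"
    using AEw
   proof eventually_elim
    case (elim x)
    have "(%k. \<bar>f (r k) x\<bar> powr P) \<longlonglongrightarrow> \<bar>w x\<bar> powr P"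
     using P by (intro tendsto_powr' tendsto_rabs tendsto_const elim) (auto simp: always_eventually)
    from lim_imp_Liminf[OF _ tendsto_ennrealI[OF this]] show ?case by simp
   qed
  qed
  also have "... <= liminf (%k. \<integral>\<^sup>+x. ennreal (\<bar>f (r k) x\<bar> powr P) \<partial>lborel)"
   by (rule nn_integral_liminf) simp
  also have "... <= liminf (%k::nat. ennreal B)"
  proof (rule Liminf_mono, rule always_eventually, rule allI)
   fix k
   have "(\<integral>\<^sup>+x. ennreal (\<bar>f (r k) x\<bar> powr P) \<partial>lborel) = ennreal (LINT x|lborel. \<bar>f (r k) x\<bar> powr P)"
    by (rule nn_integral_eq_integral) (use LqD(2)[OF E_spaceD(4)[OF f[of "r k"]]] in \<open>auto simp: P_def\<close>)
   then show "(\<integral>\<^sup>+x. ennreal (\<bar>f (r k) x\<bar> powr P) \<partial>lborel) <= ennreal B"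
    using B[of "r k"] by (simp add: P_def ennreal_leI)
  qed
  also have "... < \<infinity>" by (simp add: Liminf_const)
  finally show "(\<integral>\<^sup>+x. ennreal (norm (\<bar>w x\<bar> powr P)) \<partial>lborel) < \<infinity>" .
 qed measurable
 then have wE: "w \<in> E_space p"
  using wq L2_gradient_imp[OF wH] by (auto simp: E_space_def D12_def Lq_def P_def)
 have wf: "L2_gradient (%x. f n x - w x) (%x. G n x - H x)" for n
  using L2_gradient_lincomb[OF fG[of n] wH, of 1 "-1"] by simp
 have lim1: "(%n. dirichlet (%x. f n x - w x)) \<longlonglongrightarrow> 0"
 proof (rule LIMSEQ_I)
  fix e :: real assume e: "e > 0"
  obtain n0 where n0: "!!n. n >= n0 ==> (\<integral>\<^sup>+x. ennreal (norm (G n x - H x) powr 2) \<partial>lborel) <= ennreal (e / 2)"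
   using limH[of "e / 2"] e by auto
  have "norm (dirichlet (%x. f n x - w x) - 0) < e" if n: "n >= n0" for n
  proof -
   have "ennreal (dirichlet (%x. f n x - w x)) = (\<integral>\<^sup>+x. ennreal (norm (G n x - H x) powr 2) \<partial>lborel)"
    unfolding sq dirichlet_eq[OF wf] by (rule nn_integral_eq_integral[OF L2_gradientD(2)[OF wf], symmetric]) simp
   then have "ennreal (dirichlet (%x. f n x - w x)) <= ennreal (e / 2)" using n0[OF n] by simp
   then have "dirichlet (%x. f n x - w x) <= e / 2" using e by (subst (asm) ennreal_le_iff) auto
   then show ?thesis using e by simp
  qed
  then show "\<exists>n0. \<forall>n\<ge>n0. norm (dirichlet (%x. f n x - w x) - 0) < e" by blast
 qed
 have lim2: "(%n. wmass (%_. 1) (2 * p) (%x. f n x - w x)) \<longlonglongrightarrow> 0"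
 proof (rule LIMSEQ_I)
  fix e :: real assume e: "e > 0"
  obtain n0 where n0: "!!n. n >= n0 ==> (\<integral>\<^sup>+x. ennreal (norm (f n x - w x) powr (2 * p)) \<partial>lborel) <= ennreal (e / 2)"
   using limw[of "e / 2"] e by auto
  have "norm (wmass (%_. 1) (2 * p) (%x. f n x - w x) - 0) < e" if n: "n >= n0" for n
  proof -
   have "(\<integral>\<^sup>+x. ennreal (norm (f n x - w x) powr (2 * p)) \<partial>lborel) = ennreal (wmass (%_. 1) (2 * p) (%x. f n x - w x))"
    using LqD(2)[OF Lq_lincomb[OF E_spaceD(2)[OF f[of n]] wq, of 1 "-1"]] p
    unfolding wmass_def by (subst nn_integral_eq_integral) auto
   then have "wmass (%_. 1) (2 * p) (%x. f n x - w x) <= e / 2" using n0[OF n] e by simp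
   then show ?thesis using e wmass_nonneg[of "%_. 1" "2 * p" "%x. f n x - w x"] by simp
  qed
  then show "\<exists>n0. \<forall>n\<ge>n0. norm (wmass (%_. 1) (2 * p) (%x. f n x - w x) - 0) < e" by blast
 qed
 have lim3: "AE x in lborel. 0 <= w x" if "\<forall>n. AE x in lborel. 0 <= f n x"
 proof -
  have "AE x in lborel. \<forall>n. 0 <= f n x" using that by (simp add: AE_all_countable)
  then show ?thesis using AEw
  proof eventually_elim
   case (elim x)
   show ?case by (rule LIMSEQ_le_const[OF elim(2)]) (use elim(1) in auto)
  qed
 qed
 show ?thesis using that[OF wE lim1 lim2] lim3 by blast
qed

lemma qmass_split:
 assumes u: "u \<in> Lq (2 * p)"
 shows "qmass p m u = m * (wmass (indicator (ball 0 1)) (2 * p) u - wmass (indicator (- ball 0 1)) (2 * p) u)"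
  and "wmass (%_. 1) (2 * p) u = wmass (indicator (ball 0 1)) (2 * p) u + wmass (indicator (- ball 0 1)) (2 * p) u"
proof -
 have i: "integrable lborel (%x. indicator (ball 0 1) x * \<bar>u x\<bar> powr (2 * p))"
  "integrable lborel (%x. indicator (- ball 0 1) x * \<bar>u x\<bar> powr (2 * p))"
  by (rule wmass_integrable[where C=1, OF _ _ u]; force simp: indicator_def)+
 have "m * Q 1 x * \<bar>u x\<bar> powr (2 * p) =
   m * (indicator (ball 0 1) x * \<bar>u x\<bar> powr (2 * p) - indicator (- ball 0 1) x * \<bar>u x\<bar> powr (2 * p))" for x
  by (simp add: Q_def indicator_def)
 then have "qmass p m u = (LINT x|lborel. m * (indicator (ball 0 1) x * \<bar>u x\<bar> powr (2 * p)
   - indicator (- ball 0 1) x * \<bar>u x\<bar> powr (2 * p)))"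
  by (simp only: qmass_def wmass_def)
 then show "qmass p m u = m * (wmass (indicator (ball 0 1)) (2 * p) u - wmass (indicator (- ball 0 1)) (2 * p) u)"
  using i by (simp add: wmass_def)
 have "1 * \<bar>u x\<bar> powr (2 * p) = indicator (ball 0 1) x * \<bar>u x\<bar> powr (2 * p) + indicator (- ball 0 1) x * \<bar>u x\<bar> powr (2 * p)" for x
  by (simp add: indicator_def)
 then show "wmass (%_. 1) (2 * p) u = wmass (indicator (ball 0 1)) (2 * p) u + wmass (indicator (- ball 0 1)) (2 * p) u"
  unfolding wmass_def using i by (simp only: LINT_add)
qed

lemma indicator_weight:
 "S \<in> sets borel ==> (indicator S :: real ^ 'n => real) \<in> borel_measurable borel" "\<bar>indicator S x :: real\<bar> <= 1"
 by (auto simp: indicator_def)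

lemma wmass_Clarkson:
 assumes u: "u \<in> Lq (2 * p)" and v: "v \<in> Lq (2 * p)" and p: "p >= 1" and [measurable]: "S \<in> sets borel"
 shows "wmass (indicator S) (2 * p) (%x. (u x + v x) / 2) + wmass (indicator S) (2 * p) (%x. (u x - v x) / 2)
  <= (wmass (indicator S) (2 * p) u + wmass (indicator S) (2 * p) v) / 2"
proof -
 have 1: "(%x. (u x + v x) / 2) \<in> Lq (2 * p)" "(%x. (u x - v x) / 2) \<in> Lq (2 * p)"
  using Lq_lincomb[OF u v, of "1/2" "1/2"] Lq_lincomb[OF u v, of "1/2" "- 1/2"] p
  by (simp_all add: add_divide_distrib diff_divide_distrib)
 note i = wmass_integrable[OF indicator_weight(1)[OF assms(4)] indicator_weight(2)]
 have "wmass (indicator S) (2 * p) (%x. (u x + v x) / 2) + wmass (indicator S) (2 * p) (%x. (u x - v x) / 2)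
   = (LINT x|lborel. indicator S x * \<bar>(u x + v x) / 2\<bar> powr (2 * p) + indicator S x * \<bar>(u x - v x) / 2\<bar> powr (2 * p))"
  unfolding wmass_def using i[OF 1(1)] i[OF 1(2)] by simp
 also have "... <= (LINT x|lborel. (indicator S x * \<bar>u x\<bar> powr (2 * p) + indicator S x * \<bar>v x\<bar> powr (2 * p)) / 2)"
 proof (rule LINT_mono)
  fix x
  show "indicator S x * \<bar>(u x + v x) / 2\<bar> powr (2 * p) + indicator S x * \<bar>(u x - v x) / 2\<bar> powr (2 * p)
    <= (indicator S x * \<bar>u x\<bar> powr (2 * p) + indicator S x * \<bar>v x\<bar> powr (2 * p)) / 2"
   using mult_left_mono[OF Clarkson_pointwise[OF p, of "u x" "v x"], of "indicator S x"]
   by (simp only: distrib_left times_divide_eq_right indicator_pos_le)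
 qed (use i[OF 1(1)] i[OF 1(2)] i[OF u] i[OF v] in simp_all)
 also have "... = (wmass (indicator S) (2 * p) u + wmass (indicator S) (2 * p) v) / 2"
  unfolding wmass_def using i[OF u] i[OF v] by simp
 finally show ?thesis .
qed

text \<open>Here the perturbation is small on \<open>S\<close> only. Multiplying all functions by
  the indicator of \<open>S\<close> reduces this to the global statement.\<close>

lemma wmass_local_perturbation:
 fixes u h :: "'a => real ^ 'n => real"
 assumes [measurable]: "S \<in> sets borel" and u: "!!n. u n \<in> Lq q" and h: "!!n. h n \<in> Lq q" and q: "q > 1"
  and B: "!!n. wmass (%_. 1) q (u n) <= B" and h0: "((%n. wmass (indicator S) q (h n)) \<longlongrightarrow> 0) F"
 shows "((%n. wmass (indicator S) q (%x. u n x + h n x) - wmass (indicator S) q (u n)) \<longlongrightarrow> 0) F"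
proof -
 have restr: "(%x. indicator S x * f x) \<in> Lq q" if f: "f \<in> Lq q" for f :: "real ^ 'n => real"
 proof -
  note [measurable] = LqD(1)[OF f]
  have "\<bar>indicator S x * f x\<bar> powr q = indicator S x * \<bar>f x\<bar> powr q" for x
   by (simp add: indicator_def)
  then show ?thesis using wmass_integrable[OF indicator_weight(1)[OF assms(1)] indicator_weight(2) f]
   by (simp add: Lq_def)
 qed
 have eq: "wmass (indicator S) q (%x. indicator S x * f x) = wmass (indicator S) q f"
  and eq1: "wmass (%_. 1) q (%x. indicator S x * f x) = wmass (indicator S) q f" for f :: "real ^ 'n => real"
  unfolding wmass_def by (intro LINT_cong refl; simp add: indicator_def)+
 have le: "wmass (%_. 1) q (%x. indicator S x * u n x) <= B" for n
 proof -
  have "wmass (indicator S) q (u n) <= wmass (%_. 1) q (u n)"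
   unfolding wmass_def using LqD(2)[OF u[of n]] wmass_integrable[OF indicator_weight(1)[OF assms(1)] indicator_weight(2) u[of n]]
   by (intro LINT_mono) (auto simp: indicator_def)
  then show ?thesis unfolding eq1 using B[of n] by linarith
 qed
 have "((%n. wmass (indicator S) q (%x. indicator S x * u n x + indicator S x * h n x)
   - wmass (indicator S) q (%x. indicator S x * u n x)) \<longlongrightarrow> 0) F"
  by (rule wmass_perturbation[where B=B and C=1, OF indicator_weight(1)[OF assms(1)] indicator_weight(2) restr[OF u] restr[OF h] q le])
   (use h0 eq1 in simp)
 then show ?thesis by (simp only: distrib_left[symmetric] eq)
qed

text \<open>Midpoints of a minimizing sequence: the projection bound, the parallelogram identity for the gradient and
 Clarkson's inequality outside the unit ball leave no room for oscillation once there is compactness inside the ball.\<close>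

theorem minimizing_sequence_converges:
 fixes f :: "nat => real ^ 'n => real"
 assumes N: "CARD('n) >= 3" and p: "p > 1" and m: "m > 0"
  and lb: "!!v :: real ^ 'n => real. v \<in> natural_constraint p m ==> c <= dirichlet v" and c: "c > 0"
  and f: "!!n. f n \<in> E_space p"
  and pos: "!!k n. qmass p m (%x. (f k x + f n x) / 2) > 0 ==> dirichlet (%x. (f k x + f n x) / 2) > 0"
  and dl: "(%n. dirichlet (f n)) \<longlonglongrightarrow> c" and dq: "!!n. dirichlet (f n) <= qmass p m (f n)"
  and loc: "!!e. e > 0 ==> \<exists>n0. \<forall>k\<ge>n0. \<forall>n\<ge>n0. wmass (indicator (ball 0 1)) (2 * p) (%x. f k x - f n x) <= e"
  and B: "!!n. (LINT x|lborel. \<bar>f n x\<bar> powr (2 * real CARD('n) / (real CARD('n) - 2))) <= B"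
 obtains w where "w \<in> natural_constraint p m" "dirichlet w = c"
  "(%n. dirichlet (%x. f n x - w x)) \<longlonglongrightarrow> 0"
  "(%n. wmass (%_. 1) (2 * p) (%x. f n x - w x)) \<longlonglongrightarrow> 0"
  "(\<forall>n. AE x in lborel. 0 <= f n x) --> (AE x in lborel. 0 <= w x)"
proof -
 define q where "q = 2 * p"
 have q: "q > 2" using p by (simp add: q_def)
 define D where "D n = dirichlet (f n)" for n
 define S where "S = ball (0 :: real ^ 'n) 1"
 have SB [measurable]: "S \<in> sets borel" "- S \<in> sets borel" by (auto simp: S_def)
 define Pm where "Pm u = wmass (indicator S) q u" for u :: "real ^ 'n => real"
 define Rm where "Rm u = wmass (indicator (- S)) q u" for u :: "real ^ 'n => real"
 have Pm0: "Pm u >= 0" and Rm0: "Rm u >= 0" for u by (auto simp: Pm_def Rm_def intro!: wmass_nonneg)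
 have fq: "f n \<in> Lq q" for n using E_spaceD(2)[OF f] by (simp add: q_def)
 have fL: "has_L2_gradient (f n)" for n by (rule E_spaceD(1)[OF f])
 have split: "qmass p m u = m * (Pm u - Rm u)" "wmass (%_. 1) q u = Pm u + Rm u" if "u \<in> Lq q" for u
  using qmass_split(1)[of u p m] qmass_split(2)[of u p] that by (simp_all add: Pm_def Rm_def S_def q_def)
 have dif: "(%x. f k x - f n x) \<in> Lq q" and half: "(%x. (f k x + f n x) / 2) \<in> Lq q"
  and hdif: "(%x. (f k x - f n x) / 2) \<in> Lq q" for k n
  using Lq_lincomb[OF fq[of k] fq[of n], of 1 "-1"] Lq_lincomb[OF fq[of k] fq[of n], of "1/2" "1/2"]
   Lq_lincomb[OF fq[of k] fq[of n], of "1/2" "-1/2"] q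
  by (simp_all add: add_divide_distrib diff_divide_distrib)
 have halfE: "(%x. (f k x + f n x) / 2) \<in> E_space p" for k n
  using E_space_lincomb[OF f[of k] f[of n] _ N, of "1/2" "1/2"] p by (simp add: add_divide_distrib)
 have hm: "wmass k q (%x. (u x) / 2) = wmass k q u / 2 powr q" for k and u :: "real ^ 'n => real"
  using wmass_mult[of k q "1/2" u] by (simp add: powr_divide)
 \<comment> \<open>Two indices tending to infinity independently: limits along this product filter
   express the Cauchy property.\<close>
 let ?F = "sequentially \<times>\<^sub>F sequentially"
 have evF: "\<forall>\<^sub>F z in ?F. case z of (k, n) => A k n" if "\<exists>n0. \<forall>k\<ge>n0. \<forall>n\<ge>n0. A k n" for A :: "nat => nat => bool"
  using that unfolding eventually_prod_sequentially by auto
 have lim_fst: "((%z. g (fst z)) \<longlongrightarrow> l) ?F" and lim_snd: "((%z. g (snd z)) \<longlongrightarrow> l) ?F" if "g \<longlonglongrightarrow> l" for g :: "nat => real" and l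
  using filterlim_compose[OF that filterlim_fst] filterlim_compose[OF that filterlim_snd] by auto
 have bound: "c powr (p - 1) * qmass p m u <= dirichlet u powr p"
  if "u \<in> E_space p" "qmass p m u > 0 ==> dirichlet u > 0" for u :: "real ^ 'n => real"
 proof (cases "qmass p m u > 0")
  case True
  then show ?thesis using projection_bound[OF lb less_imp_le[OF c] p m N] that by blast
 next
  case False
  then have "c powr (p - 1) * qmass p m u <= 0" by (simp add: mult_nonneg_nonpos)
  also have "... <= dirichlet u powr p" by simp
  finally show ?thesis .
 qed
 \<comment> \<open>The projection inequality bounds \<open>qmass\<close> from above by an expression
   with the same limit as \<open>dirichlet\<close>. The hypothesis \<open>pos\<close> at equal
   indices covers \<open>f n\<close>, which is its own midpoint.\<close>
 have ql: "(%n. qmass p m (f n)) \<longlonglongrightarrow> c"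
 proof (rule tendsto_sandwich[OF _ _ dl])
  show "\<forall>\<^sub>F n in sequentially. dirichlet (f n) <= qmass p m (f n)" using dq by simp
  show "\<forall>\<^sub>F n in sequentially. qmass p m (f n) <= dirichlet (f n) powr p / c powr (p - 1)"
   using bound[OF f] pos[of n n for n] c by (intro always_eventually allI) (simp add: field_simps)
  have "(%n. dirichlet (f n) powr p / c powr (p - 1)) \<longlonglongrightarrow> c powr p / c powr (p - 1)"
   using c by (intro tendsto_intros dl) auto
  then show "(%n. dirichlet (f n) powr p / c powr (p - 1)) \<longlonglongrightarrow> c" using c by (simp add: powr_diff)
 qed
 have Ploc: "((%z. Pm (%x. f (fst z) x - f (snd z) x)) \<longlongrightarrow> 0) ?F"
 proof (rule tendstoI)
  fix e :: real assume e: "e > 0"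
  have "\<exists>n0. \<forall>k\<ge>n0. \<forall>n\<ge>n0. Pm (%x. f k x - f n x) <= e / 2"
   using loc[of "e / 2"] e by (simp add: Pm_def S_def q_def)
  from evF[OF this] show "\<forall>\<^sub>F z in ?F. dist (Pm (%x. f (fst z) x - f (snd z) x)) 0 < e"
   by eventually_elim (use e Pm0 in \<open>auto simp: dist_real_def\<close>)
 qed
 \<comment> \<open>Nonnegative \<open>qmass\<close> forces the exterior mass below the interior
   mass, and the interior mass is bounded because the sequence is Cauchy in the ball.\<close>
 obtain K where K: "!!n. wmass (%_. 1) q (f n) <= K"
 proof -
  obtain n0 where n0: "!!k n. k >= n0 ==> n >= n0 ==> Pm (%x. f k x - f n x) <= 1"
   using loc[of 1] by (auto simp: Pm_def S_def q_def)
  have b1: "wmass (%_. 1) q (f n) <= 2 * Pm (f n)" for n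
  proof -
   have "0 <= m * (Pm (f n) - Rm (f n))" using dq[of n] dirichlet_nonneg[of "f n"] split(1)[OF fq[of n]] by linarith
   then have "Rm (f n) <= Pm (f n)" using m by (simp add: zero_le_mult_iff)
   then show ?thesis using split(2)[OF fq[of n]] by simp
  qed
  have b2: "Pm (f n) <= 2 powr q * (1 + Pm (f n0))" if n: "n >= n0" for n
  proof -
   have i: "integrable lborel (%x. indicator S x * \<bar>u x\<bar> powr q)" if "u \<in> Lq q" for u
    by (rule wmass_integrable[OF indicator_weight(1)[OF SB(1)] indicator_weight(2) that])
   have "Pm (f n) <= (LINT x|lborel. 2 powr q * (indicator S x * \<bar>f n x - f n0 x\<bar> powr q + indicator S x * \<bar>f n0 x\<bar> powr q))"
    unfolding Pm_def wmass_def
   proof (rule LINT_mono[OF i[OF fq]])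
    show "integrable lborel (%x. 2 powr q * (indicator S x * \<bar>f n x - f n0 x\<bar> powr q + indicator S x * \<bar>f n0 x\<bar> powr q))"
     using i[OF dif] i[OF fq] by simp
    fix x
    have "\<bar>f n x\<bar> powr q <= (\<bar>f n x - f n0 x\<bar> + \<bar>f n0 x\<bar>) powr q" using q by (intro powr_mono2) auto
    also have "... <= 2 powr q * (\<bar>f n x - f n0 x\<bar> powr q + \<bar>f n0 x\<bar> powr q)" using q by (intro powr_add_le) auto
    finally show "indicator S x * \<bar>f n x\<bar> powr q <= 2 powr q * (indicator S x * \<bar>f n x - f n0 x\<bar> powr q + indicator S x * \<bar>f n0 x\<bar> powr q)"
     by (simp add: indicator_def)
   qed
   also have "... = 2 powr q * (Pm (%x. f n x - f n0 x) + Pm (f n0))"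
    using i[OF dif] i[OF fq] by (simp add: Pm_def wmass_def)
   also have "... <= 2 powr q * (1 + Pm (f n0))" using n0[OF n order_refl] by (intro mult_left_mono) auto
   finally show ?thesis .
  qed
  have "wmass (%_. 1) q (f n) <= 2 * (2 powr q * (1 + Pm (f n0))) + (\<Sum>k<n0. wmass (%_. 1) q (f k))" for n
  proof (cases "n >= n0")
   case True
   have "0 <= (\<Sum>k<n0. wmass (%_. 1) q (f k))" by (intro sum_nonneg wmass_nonneg) simp
   then show ?thesis using b1[of n] b2[OF True] by linarith
  next
   case False
   have "wmass (%_. 1) q (f n) <= (\<Sum>k<n0. wmass (%_. 1) q (f k))"
    using False by (intro member_le_sum) (auto intro: wmass_nonneg)
   moreover have "0 <= 2 * (2 powr q * (1 + Pm (f n0)))" using Pm0[of "f n0"] by simp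
   ultimately show ?thesis by linarith
  qed
  then show ?thesis using that by blast
 qed
 have P1: "((%z. Pm (f (fst z)) - Pm (f (snd z))) \<longlongrightarrow> 0) ?F"
  using wmass_local_perturbation[where u="%z. f (snd z)" and h="%z x. f (fst z) x - f (snd z) x" and F="?F", OF SB(1) fq dif _ K] q Ploc
  by (simp add: Pm_def)
 have P2: "((%z. Pm (%x. (f (fst z) x + f (snd z) x) / 2) - Pm (f (snd z))) \<longlongrightarrow> 0) ?F"
 proof -
  have "((%z. Pm (%x. (f (fst z) x - f (snd z) x) / 2)) \<longlongrightarrow> 0) ?F"
   using tendsto_divide_zero[OF Ploc, of "2 powr q"] by (simp add: Pm_def hm)
  then have "((%z. Pm (%x. f (snd z) x + (f (fst z) x - f (snd z) x) / 2) - Pm (f (snd z))) \<longlongrightarrow> 0) ?F"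
   unfolding Pm_def using q by (intro wmass_local_perturbation[OF SB(1) fq hdif _ K]) auto
  moreover have "f (snd z) x + (f (fst z) x - f (snd z) x) / 2 = (f (fst z) x + f (snd z) x) / 2" for z x
   by (simp add: field_simps)
  ultimately show ?thesis by (simp only:)
 qed
 define d where "d z = (D (fst z) + D (snd z)) / 2" for z :: "nat \<times> nat"
 \<comment> \<open>The slack in the projection inequality at the midpoint, with the Dirichlet energy
   and the exterior mass of the midpoint replaced by the averages of the two endpoints. It tends to
   0, since all averaged quantities have the limits of a minimizing sequence.\<close>
 define T where "T z = d z powr p - c powr (p - 1) * (m * (Pm (%x. (f (fst z) x + f (snd z) x) / 2)
   - (Rm (f (fst z)) + Rm (f (snd z))) / 2))" for z
 have dlim: "(d \<longlongrightarrow> c) ?F"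
  using tendsto_divide[OF tendsto_add[OF lim_fst[OF dl] lim_snd[OF dl]] tendsto_const[of 2]]
  by (simp add: d_def[abs_def] D_def)
 have Tlim: "(T \<longlongrightarrow> 0) ?F"
 proof -
  have e: "m * (Pm (%x. (f (fst z) x + f (snd z) x) / 2) - (Rm (f (fst z)) + Rm (f (snd z))) / 2)
   = m * (Pm (%x. (f (fst z) x + f (snd z) x) / 2) - Pm (f (snd z)))
    - m * (Pm (f (fst z)) - Pm (f (snd z))) / 2 + (qmass p m (f (fst z)) + qmass p m (f (snd z))) / 2" for z
   unfolding split(1)[OF fq] by (simp add: field_simps)
  have "((%z. d z powr p - c powr (p - 1) * (m * (Pm (%x. (f (fst z) x + f (snd z) x) / 2) - Pm (f (snd z)))
    - m * (Pm (f (fst z)) - Pm (f (snd z))) / 2 + (qmass p m (f (fst z)) + qmass p m (f (snd z))) / 2))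
   \<longlongrightarrow> c powr p - c powr (p - 1) * (m * 0 - m * 0 / 2 + (c + c) / 2)) ?F"
   using c by (intro tendsto_intros dlim P1 P2 lim_fst[OF ql] lim_snd[OF ql]) auto
  moreover have "c powr p - c powr (p - 1) * (m * 0 - m * 0 / 2 + (c + c) / 2) = 0" using c by (simp add: powr_diff)
  ultimately show ?thesis unfolding T_def e by simp
 qed
 \<comment> \<open>By the parallelogram identity the midpoint has energy \<open>d (k, n)\<close>
   minus a quarter of the energy of the difference; by Clarkson its exterior mass falls short of the
   average by at least the exterior mass of the half difference. Both gains must fit into the slack
   \<open>T\<close>.\<close>
 have key: "c powr (p - 1) * m * Rm (%x. (f k x - f n x) / 2) + d (k, n) powr (p - 1) * dirichlet (%x. f k x - f n x) / 4 <= T (k, n)" for k n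
 proof -
  define u where "u x = (f k x + f n x) / 2" for x
  have uE: "u \<in> E_space p" and uq: "u \<in> Lq q" using halfE half by (auto simp: u_def[abs_def])
  have Du: "dirichlet u = d (k, n) - dirichlet (%x. f k x - f n x) / 4"
  proof -
   have "dirichlet u = D k / 4 + dir_inner (f k) (f n) / 2 + D n / 4"
    using dirichlet_lincomb(2)[OF fL[of k] fL[of n], of "1/2" "1/2"]
    by (simp add: u_def[abs_def] add_divide_distrib D_def power2_eq_square)
   moreover have "dirichlet (%x. f k x - f n x) = D k - 2 * dir_inner (f k) (f n) + D n"
    using dirichlet_lincomb(2)[OF fL[of k] fL[of n], of "1" "-1"] by (simp add: D_def)
   ultimately show ?thesis by (simp add: d_def field_simps)
  qed
  have "c powr (p - 1) * (m * (Pm u - Rm u)) <= dirichlet u powr p"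
   using bound[OF uE] pos[of k n] split(1)[OF uq] by (simp add: u_def[abs_def])
  also have "... = dirichlet u powr (p - 1) * dirichlet u"
   using dirichlet_nonneg[of u] by (cases "dirichlet u = 0") (auto simp: powr_diff)
  also have "... <= d (k, n) powr (p - 1) * dirichlet u"
  proof -
   have "dirichlet u <= d (k, n)" using Du dirichlet_nonneg[of "%x. f k x - f n x"] by linarith
   then show ?thesis using p by (intro mult_right_mono powr_mono2) auto
  qed
  also have "... = d (k, n) powr (p - 1) * d (k, n) - d (k, n) powr (p - 1) * dirichlet (%x. f k x - f n x) / 4"
   by (simp add: Du right_diff_distrib)
  also have "d (k, n) powr (p - 1) * d (k, n) = d (k, n) powr p"
   by (cases "d (k, n) = 0") (auto simp: powr_diff d_def D_def)
  finally have 1: "c powr (p - 1) * (m * (Pm u - Rm u)) + d (k, n) powr (p - 1) * dirichlet (%x. f k x - f n x) / 4 <= d (k, n) powr p"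
   by simp
  have "Rm u + Rm (%x. (f k x - f n x) / 2) <= (Rm (f k) + Rm (f n)) / 2"
   unfolding Rm_def u_def q_def using p fq by (intro wmass_Clarkson) (auto simp: q_def SB)
  then have "Pm u - (Rm (f k) + Rm (f n)) / 2 + Rm (%x. (f k x - f n x) / 2) <= Pm u - Rm u" by linarith
  then have "c powr (p - 1) * (m * (Pm u - (Rm (f k) + Rm (f n)) / 2 + Rm (%x. (f k x - f n x) / 2))) <= c powr (p - 1) * (m * (Pm u - Rm u))"
   using m by (intro mult_left_mono) auto
  moreover have "c powr (p - 1) * (m * (Pm u - (Rm (f k) + Rm (f n)) / 2 + Rm (%x. (f k x - f n x) / 2)))
    = c powr (p - 1) * (m * (Pm u - (Rm (f k) + Rm (f n)) / 2)) + c powr (p - 1) * m * Rm (%x. (f k x - f n x) / 2)"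
   by (simp only: distrib_left mult.assoc)
  moreover have "T (k, n) = d (k, n) powr p - c powr (p - 1) * (m * (Pm u - (Rm (f k) + Rm (f n)) / 2))"
   by (simp add: T_def u_def[abs_def])
  ultimately show ?thesis using 1 by linarith
 qed
 have Rlim: "((%z. Rm (%x. f (fst z) x - f (snd z) x)) \<longlongrightarrow> 0) ?F"
 proof (rule tendsto_sandwich[OF _ _ tendsto_const])
  show "\<forall>\<^sub>F z in ?F. 0 <= Rm (%x. f (fst z) x - f (snd z) x)" by (simp add: Rm0)
  show "\<forall>\<^sub>F z in ?F. Rm (%x. f (fst z) x - f (snd z) x) <= 2 powr q * T z / (c powr (p - 1) * m)"
  proof (intro always_eventually allI)
   fix z :: "nat \<times> nat"
   have "c powr (p - 1) * m * (Rm (%x. f (fst z) x - f (snd z) x) / 2 powr q) <= T z"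
   proof -
    have "0 <= d z powr (p - 1) * dirichlet (%x. f (fst z) x - f (snd z) x)" by simp
    then show ?thesis using key[of "fst z" "snd z"] unfolding Rm_def hm prod.collapse by linarith
   qed
   then show "Rm (%x. f (fst z) x - f (snd z) x) <= 2 powr q * T z / (c powr (p - 1) * m)"
    using c m by (simp add: field_simps)
  qed
  have "((%z. 2 powr q * T z / (c powr (p - 1) * m)) \<longlongrightarrow> 2 powr q * 0 / (c powr (p - 1) * m)) ?F"
   using c m by (intro tendsto_intros Tlim) auto
  then show "((%z. 2 powr q * T z / (c powr (p - 1) * m)) \<longlongrightarrow> 0) ?F" by simp
 qed
 have Dlim: "((%z. dirichlet (%x. f (fst z) x - f (snd z) x)) \<longlongrightarrow> 0) ?F"
 proof (rule tendsto_sandwich[OF _ _ tendsto_const])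
  show "\<forall>\<^sub>F z in ?F. 0 <= dirichlet (%x. f (fst z) x - f (snd z) x)" by simp
  have "\<forall>\<^sub>F z in ?F. d z > 0" using dlim c by (rule order_tendstoD)
  then show "\<forall>\<^sub>F z in ?F. dirichlet (%x. f (fst z) x - f (snd z) x) <= 4 * T z / d z powr (p - 1)"
  proof eventually_elim
   case (elim z)
   have "d z powr (p - 1) * dirichlet (%x. f (fst z) x - f (snd z) x) / 4 <= T z"
   proof -
    have "0 <= c powr (p - 1) * m * Rm (%x. (f (fst z) x - f (snd z) x) / 2)"
     using m Rm0 by (intro mult_nonneg_nonneg) auto
    then show ?thesis using key[of "fst z" "snd z"] unfolding prod.collapse by linarith
   qed
   then show ?case using elim by (simp add: field_simps)
  qed
  have "((%z. 4 * T z / d z powr (p - 1)) \<longlongrightarrow> 4 * 0 / c powr (p - 1)) ?F"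
   using c by (intro tendsto_intros Tlim dlim) auto
  then show "((%z. 4 * T z / d z powr (p - 1)) \<longlongrightarrow> 0) ?F" by simp
 qed
 have ev_le: "\<exists>n0. \<forall>k\<ge>n0. \<forall>n\<ge>n0. g (k, n) <= e" if "(g \<longlongrightarrow> 0) ?F" "e > 0" for g :: "nat \<times> nat => real" and e
 proof -
  have "\<forall>\<^sub>F z in ?F. g z < e" using that by (rule order_tendstoD)
  then show ?thesis unfolding eventually_prod_sequentially by (meson less_imp_le)
 qed
 have CD: "\<exists>n0. \<forall>k\<ge>n0. \<forall>n\<ge>n0. dirichlet (%x. f k x - f n x) <= e" if "e > 0" for e
  using ev_le[OF Dlim that] by simp
 have "((%z. wmass (%_. 1) q (%x. f (fst z) x - f (snd z) x)) \<longlongrightarrow> 0) ?F"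
  using tendsto_add[OF Ploc Rlim] split(2)[OF dif] by simp
 from ev_le[OF this] have Cq: "\<exists>n0. \<forall>k\<ge>n0. \<forall>n\<ge>n0. wmass (%_. 1) (2 * p) (%x. f k x - f n x) <= e" if "e > 0" for e
  using that by (simp add: q_def)
 obtain w where wE: "w \<in> E_space p" and w1: "(%n. dirichlet (%x. f n x - w x)) \<longlonglongrightarrow> 0"
  and w2: "(%n. wmass (%_. 1) (2 * p) (%x. f n x - w x)) \<longlonglongrightarrow> 0"
  and w3: "(\<forall>n. AE x in lborel. 0 <= f n x) --> (AE x in lborel. 0 <= w x)"
  by (rule E_complete[OF N p f B CD Cq]) blast
 have "(%n. dirichlet (%x. w x + (f n x - w x))) \<longlonglongrightarrow> dirichlet w"
 proof (rule dirichlet_perturbation[OF E_spaceD(1)[OF wE] _ w1])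
  show "has_L2_gradient (%x. f n x - w x)" for n
   using dirichlet_lincomb(1)[OF fL[of n] E_spaceD(1)[OF wE], of 1 "-1"] by simp
 qed
 then have "(%n. dirichlet (f n)) \<longlonglongrightarrow> dirichlet w" by simp
 then have wc: "dirichlet w = c" using dl by (rule LIMSEQ_unique)
 have "(%n. wmass (%x. m * Q 1 x) (2 * p) (%x. w x + (f n x - w x)) - wmass (%x. m * Q 1 x) (2 * p) w) \<longlonglongrightarrow> 0"
 proof (rule wmass_perturbation[OF weight_measurable weight_bound[OF m] E_spaceD(2)[OF wE] _ _ order_refl w2])
  show "(%x. f n x - w x) \<in> Lq (2 * p)" for n
   using Lq_lincomb[OF E_spaceD(2)[OF f[of n]] E_spaceD(2)[OF wE], of 1 "-1"] p by simp
 qed (use p in simp)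
 then have "(%n. qmass p m (f n) - qmass p m w) \<longlonglongrightarrow> 0" by (simp add: qmass_def)
 then have "(%n. qmass p m (f n)) \<longlonglongrightarrow> qmass p m w" by (rule LIM_zero_cancel)
 then have wq: "qmass p m w = c" using ql by (rule LIMSEQ_unique)
 have "nontrivial w" by (rule qmass_nonzero_imp_nontrivial[of p m]) (use wq c in simp)
 then have "w \<in> natural_constraint p m" using wE wc wq by (simp add: natural_constraint_def)
 then show ?thesis using that wc w1 w2 w3 by blast
qed

section \<open>Positivity of minimizers\<close>

lemma DERIV_glue:
 fixes f g :: "real => real"
 assumes f: "(f has_real_derivative D) (at 0)" and g: "(g has_real_derivative D) (at 0)" and 0: "f 0 = g 0"
 shows "((%s. if s >= 0 then f s else g s) has_real_derivative D) (at 0)"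
 unfolding DERIV_def
proof (rule filterlim_split_at)
 have "((%h. (g h - g 0) / h) \<longlongrightarrow> D) (at_left 0)"
  using g by (auto simp: DERIV_def filterlim_at_split)
 then show "((%h. ((if 0 <= 0 + h then f (0 + h) else g (0 + h)) - (if 0 <= (0::real) then f 0 else g 0)) / h) \<longlongrightarrow> D) (at_left 0)"
  by (rule tendsto_cong[THEN iffD1, rotated]) (auto simp: 0 eventually_at_left_field intro!: exI[of _ "-1"])
 have "((%h. (f h - f 0) / h) \<longlongrightarrow> D) (at_right 0)"
  using f by (auto simp: DERIV_def filterlim_at_split)
 then show "((%h. ((if 0 <= 0 + h then f (0 + h) else g (0 + h)) - (if 0 <= (0::real) then f 0 else g 0)) / h) \<longlongrightarrow> D) (at_right 0)"
  by (rule tendsto_cong[THEN iffD1, rotated]) (auto simp: eventually_at_right_field intro!: exI[of _ 1])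
qed

text \<open>\<open>ext_inverse d\<close> and \<open>ext_log d\<close> extend \<open>1 / (s + d)\<close> and \<open>log (1 + s / d)\<close> to functions with Lipschitz derivative on the
 whole line, as required by the chain rule; the limit \<open>w\<close> is nonnegative only almost everywhere.\<close>

definition pole_weight :: "real => real => real"
 where "pole_weight d s = 1 / (max 0 s + d)"

definition ext_inverse :: "real => real => real"
 where "ext_inverse d s = (if s >= 0 then 1 / (s + d) else (d - s) / d^2)"

definition ext_log :: "real => real => real"
 where "ext_log d s = (if s >= 0 then ln (1 + s / d) else s / d)"

lemma pole_weight_bounds:
 assumes "d > 0"
 shows "0 < pole_weight d s" "pole_weight d s <= 1 / d"
 using assms by (auto simp: pole_weight_def intro!: divide_left_mono mult_pos_pos add_nonneg_pos)

lemma pole_weight_Lipschitz: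
 assumes d: "d > 0"
 shows "\<bar>pole_weight d a - pole_weight d b\<bar> <= (1 / d^2) * \<bar>a - b\<bar>"
proof -
 have pos: "max 0 a + d > 0" "max 0 b + d > 0" using d by (auto intro: add_nonneg_pos)
 have "pole_weight d a - pole_weight d b = (max 0 b - max 0 a) * (pole_weight d a * pole_weight d b)"
  using pos by (simp add: pole_weight_def field_simps)
 then have "\<bar>pole_weight d a - pole_weight d b\<bar> = \<bar>max 0 b - max 0 a\<bar> * (pole_weight d a * pole_weight d b)"
  by (simp add: abs_mult abs_of_pos[OF pole_weight_bounds(1)[OF d]])
 also have "... <= \<bar>a - b\<bar> * (1 / d * (1 / d))"
  using pole_weight_bounds[OF d] d by (intro mult_mono) (auto simp: max_def intro: less_imp_le mult_nonneg_nonneg)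
 finally show ?thesis by (simp add: power2_eq_square mult.commute)
qed

lemma ext_inverse_deriv:
 assumes d: "d > 0"
 shows "(ext_inverse d has_real_derivative - (pole_weight d s)\<^sup>2) (at s)"
proof -
 have A: "((%s. 1 / (s + d)) has_real_derivative - (1 / (s + d))\<^sup>2) (at s)" if "s >= 0" for s
  using that d by (auto intro!: derivative_eq_intros simp: power2_eq_square)
 have B: "((%s. (d - s) / d^2) has_real_derivative - (1 / d)\<^sup>2) (at s)" for s
 proof -
  have "((%s. (d - s) / d^2) has_real_derivative (0 - 1) / d^2) (at s)"
   by (intro DERIV_cdivide DERIV_diff DERIV_const DERIV_ident)
  then show ?thesis by (simp add: power_divide)
 qed
 consider "s > 0" | "s < 0" | "s = 0" by linarith
 then show ?thesis
 proof cases
  case 1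
  have "((%s. 1 / (s + d)) has_real_derivative - (pole_weight d s)\<^sup>2) (at s)"
   using A[of s] 1 by (simp add: pole_weight_def)
  then show ?thesis
   by (rule DERIV_cong_ev[THEN iffD1, OF refl _ refl, rotated])
    (use 1 in \<open>auto simp: ext_inverse_def intro: eventually_mono[OF eventually_nhds_in_open[of "{0<..}" s]]\<close>)
 next
  case 2
  have "((%s. (d - s) / d^2) has_real_derivative - (pole_weight d s)\<^sup>2) (at s)"
   using B[of s] 2 by (simp add: pole_weight_def)
  then show ?thesis
   by (rule DERIV_cong_ev[THEN iffD1, OF refl _ refl, rotated])
    (use 2 in \<open>auto simp: ext_inverse_def intro: eventually_mono[OF eventually_nhds_in_open[of "{..<0}" s]]\<close>)
 next
  case 3
  have "((%s. if s >= 0 then 1 / (s + d) else (d - s) / d^2) has_real_derivative - (1 / d)\<^sup>2) (at 0)"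
   using A[of 0] B[of 0] d by (intro DERIV_glue) (auto simp: power2_eq_square)
  then show ?thesis using 3 by (simp add: ext_inverse_def[abs_def] pole_weight_def)
 qed
qed

lemma ext_log_deriv:
 assumes d: "d > 0"
 shows "(ext_log d has_real_derivative pole_weight d s) (at s)"
proof -
 have A: "((%s. ln (1 + s / d)) has_real_derivative 1 / (s + d)) (at s)" if "s >= 0" for s
  using that d by (auto intro!: derivative_eq_intros simp: field_simps add_pos_nonneg)
 have B: "((%s. s / d) has_real_derivative 1 / d) (at s)" for s
  using d by (auto intro!: derivative_eq_intros)
 consider "s > 0" | "s < 0" | "s = 0" by linarith
 then show ?thesis
 proof cases
  case 1
  have "((%s. ln (1 + s / d)) has_real_derivative pole_weight d s) (at s)"
   using A[of s] 1 by (simp add: pole_weight_def)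
  then show ?thesis
   by (rule DERIV_cong_ev[THEN iffD1, OF refl _ refl, rotated])
    (use 1 in \<open>auto simp: ext_log_def intro: eventually_mono[OF eventually_nhds_in_open[of "{0<..}" s]]\<close>)
 next
  case 2
  have "((%s. s / d) has_real_derivative pole_weight d s) (at s)"
   using B[of s] 2 by (simp add: pole_weight_def)
  then show ?thesis
   by (rule DERIV_cong_ev[THEN iffD1, OF refl _ refl, rotated])
    (use 2 in \<open>auto simp: ext_log_def intro: eventually_mono[OF eventually_nhds_in_open[of "{..<0}" s]]\<close>)
 next
  case 3
  have "((%s. if s >= 0 then ln (1 + s / d) else s / d) has_real_derivative 1 / d) (at 0)"
   using A[of 0] B[of 0] by (intro DERIV_glue) auto
  then show ?thesis using 3 by (simp add: ext_log_def[abs_def] pole_weight_def)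
 qed
qed

lemma L2_gradient_ext_log:
 assumes u: "L2_gradient u G" and d: "d > 0"
 shows "L2_gradient (%x. ext_log d (u x)) (%x. pole_weight d (u x) *\<^sub>R G x)"
proof (rule weak_gradient_chain[OF u ext_log_deriv[OF d], where M="1 / d + 1 / d^2"])
 show "\<bar>pole_weight d t\<bar> <= 1 / d + 1 / d^2" for t
  using pole_weight_bounds[OF d, of t] d by (simp add: add_increasing2)
 show "\<bar>pole_weight d a - pole_weight d b\<bar> <= (1 / d + 1 / d^2) * \<bar>a - b\<bar>" for a b
  by (rule order_trans[OF pole_weight_Lipschitz[OF d]]) (use d in \<open>intro mult_right_mono; simp\<close>)
qed

lemma L2_gradient_ext_inverse:
 assumes u: "L2_gradient u G" and d: "d > 0"
 shows "L2_gradient (%x. ext_inverse d (u x)) (%x. - (pole_weight d (u x))\<^sup>2 *\<^sub>R G x)"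
proof (rule weak_gradient_chain[OF u ext_inverse_deriv[OF d], where M="1 / d^2 + 2 / d ^ 3"])
 note pb = pole_weight_bounds[OF d]
 show "\<bar>- (pole_weight d t)\<^sup>2\<bar> <= 1 / d^2 + 2 / d ^ 3" for t
 proof -
  have "(pole_weight d t)^2 <= (1 / d)^2" using pb[of t] by (intro power_mono) auto
  also have "... <= 1 / d^2 + 2 / d ^ 3" using d by (simp add: power_divide)
  finally show ?thesis by simp
 qed
 show "\<bar>- (pole_weight d a)\<^sup>2 - - (pole_weight d b)\<^sup>2\<bar> <= (1 / d^2 + 2 / d ^ 3) * \<bar>a - b\<bar>" for a b
 proof -
  have "- (pole_weight d a)\<^sup>2 - - (pole_weight d b)\<^sup>2 = - ((pole_weight d a - pole_weight d b) * (pole_weight d a + pole_weight d b))"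
   by (simp add: power2_eq_square algebra_simps)
  then have "\<bar>- (pole_weight d a)\<^sup>2 - - (pole_weight d b)\<^sup>2\<bar> = \<bar>pole_weight d a - pole_weight d b\<bar> * (pole_weight d a + pole_weight d b)"
   using pb(1)[of a] pb(1)[of b] by (simp only: abs_mult abs_minus_cancel)
  also have "... <= ((1 / d^2) * \<bar>a - b\<bar>) * (1 / d + 1 / d)"
   using pb[of a] pb[of b] by (intro mult_mono pole_weight_Lipschitz[OF d] add_mono) (auto intro: less_imp_le add_nonneg_nonneg)
  also have "... = (2 / d ^ 3) * \<bar>a - b\<bar>" by (simp add: power2_eq_square power3_eq_cube)
  also have "... <= (1 / d^2 + 2 / d ^ 3) * \<bar>a - b\<bar>" by (intro mult_right_mono) auto
  finally show ?thesis .
 qed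
qed

lemma test_function_integrable:
 assumes \<phi>: "\<phi> \<in> test_functions"
 shows "integrable lborel \<phi>"
proof -
 have "locally_integrable (%_ :: real ^ 'a. 1 :: real)"
  using emeasure_lborel_cball_finite by (intro locally_integrableI) auto
 from integrable_mult_test[OF this \<phi>] show ?thesis by simp
qed

lemma grad_square_integrable:
 assumes \<phi>: "\<phi> \<in> test_functions"
 shows "integrable lborel (%x. (norm (grad \<phi> x))^2)"
proof -
 have "(%x. partial_deriv k \<phi> x * partial_deriv k \<phi> x) \<in> test_functions" for k
  by (intro test_function_mult test_functionD(1) test_function_partial \<phi>)
 then have "integrable lborel (%x. \<Sum>k\<in>UNIV. partial_deriv k \<phi> x * partial_deriv k \<phi> x)"
  by (intro L1_sum test_function_integrable)
 moreover have "(norm (grad \<phi> x))^2 = (\<Sum>k\<in>UNIV. partial_deriv k \<phi> x * partial_deriv k \<phi> x)" for x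
  by (simp add: power2_norm_eq_inner inner_vec_def grad_def)
 ultimately show ?thesis by simp
qed

lemma bounded_compact_support_Lq:
 fixes h :: "real ^ 'n => real"
 assumes [measurable]: "h \<in> borel_measurable borel" and h: "AE x in lborel. \<bar>h x\<bar> <= B * indicator (cball 0 r) x" and q: "q > 0"
 shows "h \<in> Lq q"
 unfolding Lq_def
proof (intro CollectI conjI)
 show "integrable lborel (%x. \<bar>h x\<bar> powr q)"
 proof (rule L1_bound)
  show "integrable lborel (%x. \<bar>B\<bar> powr q * indicator (cball (0 :: real ^ 'n) r) x)"
   using emeasure_lborel_cball_finite by (intro integrable_mult_right integrable_real_indicator) auto
  show "AE x in lborel. norm (\<bar>h x\<bar> powr q) <= norm (\<bar>B\<bar> powr q * indicator (cball 0 r) x)"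
   using h
  proof eventually_elim
   case (elim x)
   show ?case
   proof (cases "x \<in> cball 0 r")
    case True
    then have "\<bar>h x\<bar> <= \<bar>B\<bar>" using elim by simp
    then show ?thesis using True q by (simp add: powr_mono2)
   qed (use elim in simp)
  qed
 qed measurable
qed simp

text \<open>Testing the equation with \<open>\<phi>\<^sup>2 / (w + d)\<close> bounds the gradient of \<open>log (1 + w / d)\<close> independently of \<open>d\<close>.\<close>

lemma log_gradient_bound:
 fixes w :: "real ^ 'n => real"
 assumes N: "CARD('n) >= 3" and p: "p > 1" and m: "m > 0" and wE: "w \<in> E_space p"
  and w0: "AE x in lborel. 0 <= w x"
  and EL: "!!h. h \<in> E_space p ==> dir_inner w h = wderiv (%x. m * Q 1 x) (2 * p) w h"
  and \<phi>: "\<phi> \<in> test_functions"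
 obtains C where "!!d. d > 0 ==> (LINT x|lborel. (\<phi> x)^2 * (norm (pole_weight d (w x) *\<^sub>R weak_grad w x))^2) <= C"
proof -
 define q where "q = 2 * p"
 have q: "q > 2" using p by (simp add: q_def)
 define P where "P = 2 * real CARD('n) / (real CARD('n) - 2)"
 have P: "P > 0" using N by (simp add: P_def)
 define G where "G = weak_grad w"
 have wG: "L2_gradient w G" unfolding G_def by (rule L2_gradient_weak_grad[OF E_spaceD(1)[OF wE]])
 note [measurable] = L2_gradientD(4,5)[OF wG] test_functionD(4)[OF \<phi>] grad_measurable[OF \<phi>]
 have wq: "w \<in> Lq q" using E_spaceD(2)[OF wE] by (simp add: q_def)
 obtain B where B: "B > 0" "!!x. \<bar>\<phi> x\<bar> <= B" using test_function_bounded[OF \<phi>] by metis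
 obtain r where r: "!!x. norm x > r ==> \<phi> x = 0" using test_function_support[OF \<phi>] by metis
 define \<Phi> where "\<Phi> x = \<phi> x * \<phi> x" for x
 have \<Phi>: "\<Phi> \<in> test_functions" unfolding \<Phi>_def[abs_def] by (intro test_function_mult \<phi> test_functionD(1)[OF \<phi>])
 have grad\<Phi>: "grad \<Phi> x = (2 * \<phi> x) *\<^sub>R grad \<phi> x" for x
 proof -
  have "partial_deriv k \<Phi> x = 2 * \<phi> x * partial_deriv k \<phi> x" for k
   unfolding \<Phi>_def[abs_def] using partial_deriv_mult[OF test_functionD(2)[OF \<phi>] test_functionD(2)[OF \<phi>]] by simp
  then show ?thesis by (simp add: grad_def vec_eq_iff)
 qed
 have \<Phi>B: "\<bar>\<Phi> x\<bar> <= B * B" for x unfolding \<Phi>_def abs_mult using B(1) by (intro mult_mono B(2)) auto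
 \<comment> \<open>Bounds the nonlinear side uniformly in \<open>d\<close>: since w / (w + d) <= 1,
   the integrand is at most m B^2 w^(q-2) on the support of \<open>\<phi>\<close>, and w^(q-2) <= 1
   + w^q.\<close>
 define C1 where "C1 = m * (B * B) * ((LINT x|lborel. \<bar>w x\<bar> powr q) + measure lborel (cball (0 :: real ^ 'n) r))"
 define C where "C = 4 * (LINT x|lborel. (norm (grad \<phi> x))^2) + 2 * C1"
 have main: "(LINT x|lborel. (\<phi> x)^2 * (norm (pole_weight d (w x) *\<^sub>R G x))^2) <= C" if d: "d > 0" for d
 proof -
  define \<rho> where "\<rho> x = pole_weight d (w x)" for x
  have \<rho>: "0 < \<rho> x" "\<rho> x <= 1 / d" for x using pole_weight_bounds[OF d] by (auto simp: \<rho>_def)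
  have [measurable]: "\<rho> \<in> borel_measurable borel" unfolding \<rho>_def[abs_def] pole_weight_def by measurable
  define g where "g x = ext_inverse d (w x)" for x
  have gG: "L2_gradient g (%x. - (\<rho> x)\<^sup>2 *\<^sub>R G x)"
   using L2_gradient_ext_inverse[OF wG d] by (simp add: g_def[abs_def] \<rho>_def)
  note [measurable] = L2_gradientD(4)[OF gG]
  \<comment> \<open>The two functions differ where \<open>w\<close> is negative, a null set:
    \<open>g\<close> has the weak gradient, while \<open>\<rho>\<close> carries the bounds.\<close>
  have g\<rho>: "AE x in lborel. g x = \<rho> x"
   using w0 by eventually_elim (simp add: g_def \<rho>_def ext_inverse_def pole_weight_def)
  define h where "h x = \<Phi> x * g x" for x
  define H where "H x = \<Phi> x *\<^sub>R (- (\<rho> x)\<^sup>2 *\<^sub>R G x) + g x *\<^sub>R grad \<Phi> x" for x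
  have hH: "has_weak_gradient h H"
   unfolding h_def[abs_def] H_def[abs_def] by (rule weak_gradient_mult_test[OF L2_gradientD(1)[OF gG] \<Phi>])
  note [measurable] = weak_gradientD(3,4)[OF hH]
  have Hnorm: "AE x in lborel. (norm (H x))^2 <= 2 * (B * B / d^2)^2 * (norm (G x))^2 + 2 * (2 * B / d)^2 * (norm (grad \<phi> x))^2"
   using g\<rho>
  proof eventually_elim
   case (elim x)
   have r2: "(\<rho> x)^2 <= 1 / d^2" using power_mono[OF \<rho>(2)[of x], of 2] \<rho>(1)[of x] by (simp add: power_divide)
   have 1: "norm (\<Phi> x *\<^sub>R (- (\<rho> x)\<^sup>2 *\<^sub>R G x)) <= B * B / d^2 * norm (G x)"
   proof -
    have "norm (\<Phi> x *\<^sub>R (- (\<rho> x)\<^sup>2 *\<^sub>R G x)) = (\<bar>\<Phi> x\<bar> * (\<rho> x)^2) * norm (G x)" by (simp add: abs_mult)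
    also have "... <= (B * B * (1 / d^2)) * norm (G x)"
     using B(1) by (intro mult_right_mono mult_mono \<Phi>B r2) auto
    finally show ?thesis by simp
   qed
   have 2: "norm (g x *\<^sub>R grad \<Phi> x) <= 2 * B / d * norm (grad \<phi> x)"
   proof -
    have "norm (g x *\<^sub>R grad \<Phi> x) = (\<rho> x * (2 * \<bar>\<phi> x\<bar>)) * norm (grad \<phi> x)"
     using \<rho>(1)[of x] by (simp add: elim grad\<Phi> abs_mult)
    also have "... <= (1 / d * (2 * B)) * norm (grad \<phi> x)"
     using B d \<rho>(1)[of x] by (intro mult_right_mono mult_mono \<rho>(2)) auto
    finally show ?thesis by simp
   qed
   have "norm (H x) <= B * B / d^2 * norm (G x) + 2 * B / d * norm (grad \<phi> x)"
    unfolding H_def by (rule order_trans[OF norm_triangle_ineq add_mono[OF 1 2]])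
   then have "(norm (H x))^2 <= (B * B / d^2 * norm (G x) + 2 * B / d * norm (grad \<phi> x))^2" by (intro power_mono) auto
   also have "... <= 2 * (B * B / d^2 * norm (G x))^2 + 2 * (2 * B / d * norm (grad \<phi> x))^2"
    using sum_squares_bound[of "B * B / d^2 * norm (G x)" "2 * B / d * norm (grad \<phi> x)"] by (simp add: power2_sum)
   finally show ?case by (simp only: power_mult_distrib mult.assoc)
  qed
  have H2: "integrable lborel (%x. (norm (H x))^2)"
  proof (rule L1_bound)
   show "integrable lborel (%x. 2 * (B * B / d^2)^2 * (norm (G x))^2 + 2 * (2 * B / d)^2 * (norm (grad \<phi> x))^2)"
    using L2_gradientD(2)[OF wG] grad_square_integrable[OF \<phi>]
    by (intro L1_add integrable_mult_right)
   show "AE x in lborel. norm ((norm (H x))^2) <= norm (2 * (B * B / d^2)^2 * (norm (G x))^2 + 2 * (2 * B / d)^2 * (norm (grad \<phi> x))^2)"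
    using Hnorm by eventually_elim (simp add: order_trans[OF _ abs_ge_self])
  qed measurable
  have hL: "L2_gradient h H" using hH H2 by (simp add: L2_gradient_def)
  have hb: "AE x in lborel. \<bar>h x\<bar> <= (B * B / d) * indicator (cball 0 r) x"
   using g\<rho>
  proof eventually_elim
   case (elim x)
   show ?case
   proof (cases "norm x > r")
    case True
    then show ?thesis using r[of x] B d by (simp add: h_def \<Phi>_def)
   next
    case False
    have "\<bar>\<Phi> x\<bar> * \<rho> x <= (B * B) * (1 / d)" using B d \<rho>[of x] by (intro mult_mono \<Phi>B) (auto intro: less_imp_le)
    then show ?thesis using False \<rho>(1)[of x] by (simp add: h_def elim abs_mult)
   qed
  qed
  have hE: "h \<in> E_space p"
   using bounded_compact_support_Lq[OF _ hb, of P] bounded_compact_support_Lq[OF _ hb, of q] P q L2_gradient_imp[OF hL]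
   by (simp add: E_space_def D12_def P_def q_def)
  define X where "X = (LINT x|lborel. (\<phi> x)^2 * (norm (\<rho> x *\<^sub>R G x))^2)"
  define Y where "Y = (LINT x|lborel. (2 * \<phi> x * \<rho> x) * (G x \<bullet> grad \<phi> x))"
  have iX: "integrable lborel (%x. (\<phi> x)^2 * (norm (\<rho> x *\<^sub>R G x))^2)"
  proof (rule L1_bound)
   show "integrable lborel (%x. (B * B / d^2) * (norm (G x))^2)" using L2_gradientD(2)[OF wG] by simp
   have "(\<phi> x)^2 * (norm (\<rho> x *\<^sub>R G x))^2 <= (B * B / d^2) * (norm (G x))^2" for x
   proof -
    have r2: "(\<rho> x)^2 <= 1 / d^2" using power_mono[OF \<rho>(2)[of x], of 2] \<rho>(1)[of x] by (simp add: power_divide)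
    have "(\<phi> x)^2 <= B * B" using power_mono[OF B(2)[of x], of 2] by (simp add: power2_eq_square)
    then have "((\<phi> x)^2 * (\<rho> x)^2) * (norm (G x))^2 <= (B * B * (1 / d^2)) * (norm (G x))^2"
     using B(1) r2 by (intro mult_right_mono mult_mono) auto
    then show ?thesis by (simp add: power_mult_distrib mult.assoc)
   qed
   then show "AE x in lborel. norm ((\<phi> x)^2 * (norm (\<rho> x *\<^sub>R G x))^2) <= norm ((B * B / d^2) * (norm (G x))^2)"
    by (intro AE_I2) (simp add: order_trans[OF _ abs_ge_self])
  qed measurable
  have young: "\<bar>(2 * \<phi> x * \<rho> x) * (G x \<bullet> grad \<phi> x)\<bar> <= 1/2 * ((\<phi> x)^2 * (norm (\<rho> x *\<^sub>R G x))^2) + 2 * (norm (grad \<phi> x))^2" for x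
  proof -
   have "\<bar>(2 * \<phi> x * \<rho> x) * (G x \<bullet> grad \<phi> x)\<bar> <= \<bar>2 * \<phi> x * \<rho> x\<bar> * (norm (G x) * norm (grad \<phi> x))"
    unfolding abs_mult by (intro mult_left_mono Cauchy_Schwarz_ineq2) auto
   also have "... = 2 * (\<bar>\<phi> x * \<rho> x\<bar> * norm (G x)) * norm (grad \<phi> x)" by (simp add: abs_mult)
   also have "... <= 1/2 * (\<bar>\<phi> x * \<rho> x\<bar> * norm (G x))^2 + 2 * (norm (grad \<phi> x))^2"
    using zero_le_power2[of "\<bar>\<phi> x * \<rho> x\<bar> * norm (G x) - 2 * norm (grad \<phi> x)"] by (simp add: power2_diff power_mult_distrib)
   also have "(\<bar>\<phi> x * \<rho> x\<bar> * norm (G x))^2 = (\<phi> x)^2 * (norm (\<rho> x *\<^sub>R G x))^2" by (simp add: power_mult_distrib)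
   finally show ?thesis .
  qed
  have iyb: "integrable lborel (%x. 1/2 * ((\<phi> x)^2 * (norm (\<rho> x *\<^sub>R G x))^2) + 2 * (norm (grad \<phi> x))^2)"
   using iX grad_square_integrable[OF \<phi>] by (intro L1_add integrable_mult_right)
  have iY: "integrable lborel (%x. (2 * \<phi> x * \<rho> x) * (G x \<bullet> grad \<phi> x))"
  proof (rule L1_bound[OF iyb])
   show "AE x in lborel. norm ((2 * \<phi> x * \<rho> x) * (G x \<bullet> grad \<phi> x)) <= norm (1/2 * ((\<phi> x)^2 * (norm (\<rho> x *\<^sub>R G x))^2) + 2 * (norm (grad \<phi> x))^2)"
    unfolding real_norm_def by (intro AE_I2 order_trans[OF young abs_ge_self])
  qed measurable
  have "dir_inner w h = (LINT x|lborel. G x \<bullet> H x)"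
   unfolding G_def by (rule dir_inner_eq[OF E_spaceD(1)[OF wE] hL])
  also have "... = (LINT x|lborel. (2 * \<phi> x * \<rho> x) * (G x \<bullet> grad \<phi> x) - (\<phi> x)^2 * (norm (\<rho> x *\<^sub>R G x))^2)"
  proof (rule integral_cong_AE)
   show "AE x in lborel. G x \<bullet> H x = (2 * \<phi> x * \<rho> x) * (G x \<bullet> grad \<phi> x) - (\<phi> x)^2 * (norm (\<rho> x *\<^sub>R G x))^2"
    using g\<rho>
    by eventually_elim (simp add: H_def grad\<Phi> \<Phi>_def inner_simps power_mult_distrib power2_eq_square flip: power2_norm_eq_inner)
  qed measurable
  also have "... = Y - X" using iX iY by (simp add: X_def Y_def)
  finally have 1: "dir_inner w h = Y - X" .
  have 2: "- C1 <= wderiv (%x. m * Q 1 x) (2 * p) w h"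
  proof -
   have ic: "integrable lborel (indicator (cball (0 :: real ^ 'n) r) :: _ => real)"
    using emeasure_lborel_cball_finite by (intro integrable_real_indicator) auto
   have ib: "integrable lborel (%x. m * (B * B) * (\<bar>w x\<bar> powr q + indicator (cball 0 r) x))"
    using LqD(2)[OF wq] ic by (intro integrable_mult_right L1_add)
   have iw: "integrable lborel (%x. m * Q 1 x * (\<bar>w x\<bar> powr (q - 1) * sgn (w x)) * h x)"
    using wderiv_integrable[OF weight_measurable weight_bound[OF m] E_spaceD(2)[OF wE] E_spaceD(2)[OF hE]] p by (simp add: q_def)
   have "- (LINT x|lborel. m * Q 1 x * (\<bar>w x\<bar> powr (q - 1) * sgn (w x)) * h x)
     = (LINT x|lborel. - (m * Q 1 x * (\<bar>w x\<bar> powr (q - 1) * sgn (w x)) * h x))" by simp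
   also have "... <= (LINT x|lborel. m * (B * B) * (\<bar>w x\<bar> powr q + indicator (cball 0 r) x))"
   proof (rule integral_mono_AE[OF _ ib])
    show "AE x in lborel. - (m * Q 1 x * (\<bar>w x\<bar> powr (q - 1) * sgn (w x)) * h x) <= m * (B * B) * (\<bar>w x\<bar> powr q + indicator (cball 0 r) x)"
     using g\<rho> w0
    proof eventually_elim
     case (elim x)
     show ?case
     proof (cases "norm x > r \<or> w x = 0")
      case True
      have "0 <= m * (B * B) * (\<bar>w x\<bar> powr q + indicator (cball 0 r) x)" using m B by simp
      moreover have "- (m * Q 1 x * (\<bar>w x\<bar> powr (q - 1) * sgn (w x)) * h x) = 0"
       using True r[of x] by (auto simp: h_def \<Phi>_def)
      ultimately show ?thesis by linarith
     next
      case False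
      then have wp: "w x > 0" using elim by simp
      have wr: "w x * \<rho> x <= 1" using wp d by (simp add: \<rho>_def pole_weight_def)
      have "- (m * Q 1 x * (\<bar>w x\<bar> powr (q - 1) * sgn (w x)) * h x) <= \<bar>m * Q 1 x * (\<bar>w x\<bar> powr (q - 1) * sgn (w x)) * h x\<bar>"
       by linarith
      also have "... = m * (w x powr (q - 1) * (\<bar>\<Phi> x\<bar> * \<rho> x))"
       using wp m \<rho>(1)[of x] by (simp add: abs_mult h_def elim)
      also have "... = m * (\<bar>\<Phi> x\<bar> * (w x powr (q - 2) * (w x * \<rho> x)))"
       using wp by (simp add: powr_diff power2_eq_square powr_numeral field_simps)
      also have "... <= m * ((B * B) * (w x powr (q - 2) * 1))"
       using m B \<rho>(1)[of x] wp by (intro mult_left_mono mult_mono \<Phi>B wr) auto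
      also have "w x powr (q - 2) <= 1 + w x powr q"
      proof (cases "w x <= 1")
       case True
       then have "w x powr (q - 2) <= 1 powr (q - 2)" using wp q by (intro powr_mono2) auto
       then show ?thesis using powr_ge_zero[of "w x" q] by (simp only: powr_one_eq_one)
      next
       case False
       then have "w x powr (q - 2) <= w x powr q" by (intro powr_mono) auto
       then show ?thesis by simp
      qed
      finally show ?thesis using False wp m B by (simp add: mult.assoc add.commute)
     qed
    qed
   qed (use iw in simp)
   also have "... = C1" using LqD(2)[OF wq] ic by (simp add: C1_def)
   finally show ?thesis by (simp add: wderiv_def q_def)
  qed
  \<comment> \<open>The coefficient 1/2 in \<open>young\<close> allows half of \<open>X\<close> to
    be absorbed on the left; doubling what remains produces the constants 4 and 2 in
    \<open>C\<close>.\<close>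
  have "X <= Y + C1" using EL[OF hE] 1 2 by linarith
  moreover have "Y <= 1/2 * X + 2 * (LINT x|lborel. (norm (grad \<phi> x))^2)"
  proof -
   have "Y <= (LINT x|lborel. 1/2 * ((\<phi> x)^2 * (norm (\<rho> x *\<^sub>R G x))^2) + 2 * (norm (grad \<phi> x))^2)"
    unfolding Y_def by (rule LINT_mono[OF iY iyb order_trans[OF abs_ge_self young]])
   also have "... = 1/2 * X + 2 * (LINT x|lborel. (norm (grad \<phi> x))^2)"
    using iX grad_square_integrable[OF \<phi>] by (simp add: X_def)
   finally show ?thesis .
  qed
  ultimately have "X <= C" unfolding C_def by linarith
  then show ?thesis by (simp add: X_def \<rho>_def)
 qed
 then show ?thesis using that unfolding G_def by blast
qed

lemma ext_log_gap:
 assumes d: "d > 0" and K: "K > 0" and s: "s <= 0" and t: "t > 1 / K"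
 shows "ln (1 + 1 / (K * d)) <= ext_log d t - ext_log d s"
proof -
 have "0 < t" using K t by (meson divide_pos_pos less_trans zero_less_one)
 moreover have "ext_log d s <= 0" using s d by (auto simp: ext_log_def divide_nonpos_pos)
 moreover have "ln (1 + 1 / (K * d)) <= ln (1 + t / d)"
 proof -
  have "1 / K / d <= t / d" using t d by (intro divide_right_mono) auto
  moreover have "1 + 1 / (K * d) > 0" using K d by (simp add: add_pos_pos)
  ultimately show ?thesis by simp
 qed
 ultimately show ?thesis by (simp add: ext_log_def)
qed

text \<open>Both the zero set and the positivity set are countable unions of bounded pieces, so some
  piece of each has positive measure; enlarging the index makes one \<open>n\<close> work as radius
  for both and as threshold for the second.\<close>

lemma positive_superlevel_sets:
 fixes w :: "real ^ 'n => real"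
 assumes [measurable]: "w \<in> borel_measurable borel" and w0: "AE x in lborel. 0 <= w x"
  and nt: "nontrivial w" and np: "\<not> (AE x in lborel. 0 < w x)"
 obtains n :: nat where "n > 0" "emeasure lborel ({x. w x <= 0} \<inter> cball 0 (real n)) > 0"
  "emeasure lborel ({x. w x > 1 / real n} \<inter> cball 0 (real n)) > 0"
proof -
 define A where "A n = {x. w x <= 0} \<inter> cball 0 (real n)" for n
 define B where "B n = {x. w x > 1 / real (Suc n)} \<inter> cball 0 (real (Suc n))" for n
 have [measurable]: "A n \<in> sets lborel" "B n \<in> sets lborel" for n unfolding A_def B_def by measurable
 have rng: "range A \<subseteq> sets lborel" "range B \<subseteq> sets lborel" by (intro image_subsetI, measurable)+
 have ex: "\<exists>n. norm x <= real n" for x :: "real ^ 'n" by (rule real_arch_simple)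
 have UA: "(\<Union>n. A n) = {x. \<not> 0 < w x}" using ex by (auto simp: A_def not_less)
 have UB: "(\<Union>n. B n) = {x. 0 < w x}"
 proof (intro equalityI subsetI)
  fix x assume "x \<in> {x. 0 < w x}"
  then obtain n where n: "1 / real (Suc n) < w x" using nat_approx_posE by (metis mem_Collect_eq)
  obtain k where k: "norm x <= real k" using ex by blast
  have "1 / real (Suc (max n k)) <= 1 / real (Suc n)" by (intro divide_left_mono) auto
  then have "x \<in> B (max n k)" using n k by (auto simp: B_def)
  then show "x \<in> (\<Union>n. B n)" by blast
 next
  fix x assume "x \<in> (\<Union>n. B n)"
  then obtain n where "1 / real (Suc n) < w x" by (auto simp: B_def)
  then show "x \<in> {x. 0 < w x}" using less_trans[of 0 "1 / real (Suc n)" "w x"] by simp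
 qed
 have "emeasure lborel (\<Union>n. A n) ~= 0"
  using np AE_iff_measurable[of "{x. \<not> 0 < w x}" lborel "%x. 0 < w x"] by (auto simp: UA)
 then obtain n1 where n1: "emeasure lborel (A n1) ~= 0" using emeasure_UN_eq_0[OF _ rng(1)] by metis
 have "emeasure lborel (\<Union>n. B n) ~= 0"
 proof
  assume "emeasure lborel (\<Union>n. B n) = 0"
  then have "AE x in lborel. \<not> 0 < w x"
   using AE_iff_measurable[of "{x. 0 < w x}" lborel "%x. \<not> 0 < w x"] by (auto simp: UB)
  then have "AE x in lborel. w x = 0" using w0 by eventually_elim simp
  then show False using nt by (simp add: nontrivial_def)
 qed
 then obtain n2 where n2: "emeasure lborel (B n2) ~= 0" using emeasure_UN_eq_0[OF _ rng(2)] by metis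
 define n where "n = Suc (max n1 n2)"
 show ?thesis
 proof (rule that)
  show "n > 0" by (simp add: n_def)
  have "A n1 \<subseteq> {x. w x <= 0} \<inter> cball 0 (real n)" by (auto simp: A_def n_def)
  from emeasure_mono[OF this, of lborel] n1 show "emeasure lborel ({x. w x <= 0} \<inter> cball 0 (real n)) > 0"
   by (auto simp: zero_less_iff_neq_zero)
  have "1 / real n <= 1 / real (Suc n2)" by (intro divide_left_mono) (auto simp: n_def)
  then have "B n2 \<subseteq> {x. w x > 1 / real n} \<inter> cball 0 (real n)" by (auto simp: B_def n_def)
  from emeasure_mono[OF this, of lborel] n2 show "emeasure lborel ({x. w x > 1 / real n} \<inter> cball 0 (real n)) > 0"
   by (auto simp: zero_less_iff_neq_zero)
 qed
qed

lemma test_function_positive_on_cball: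
 obtains \<phi> :: "real ^ 'n => real" and c where "\<phi> \<in> test_functions" "c > 0"
  "!!x. x \<in> cball 0 R ==> c <= \<phi> x" "!!x. 0 <= \<phi> x" "!!x. \<phi> x <= 1"
proof -
 define T where "T = \<bar>R\<bar> + 1"
 define \<phi> :: "real ^ 'n => real" where "\<phi> = box_bump 1 (\<chi> i. - T) (\<chi> i. T)"
 have \<phi>: "\<phi> \<in> test_functions" by (simp add: \<phi>_def)
 have pos: "0 < \<phi> x" if "x \<in> cball 0 \<bar>R\<bar>" for x
 proof -
  have "\<bar>x $ i\<bar> < T" for i using component_le_norm_cart[of x i] that by (simp add: T_def)
  then have "x \<in> box (\<chi> i. - T) (\<chi> i. T)" by (auto simp: mem_box_cart abs_less_iff minus_less_iff)
  then show ?thesis by (simp add: \<phi>_def box_bump_pos)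
 qed
 obtain x0 where x0: "x0 \<in> cball (0 :: real ^ 'n) \<bar>R\<bar>" "!!x. x \<in> cball 0 \<bar>R\<bar> ==> \<phi> x0 <= \<phi> x"
  using continuous_attains_inf[OF compact_cball _ continuous_on_subset[OF test_functionD(3)[OF \<phi>] subset_UNIV], of 0 "\<bar>R\<bar>"] by auto
 show ?thesis
  by (rule that[of \<phi> "\<phi> x0"]) (use \<phi> pos[OF x0(1)] x0(2) in \<open>auto simp: \<phi>_def box_bump_bounds\<close>)
qed

text \<open>A Poincare inequality between two sets: every pair of points of \<open>A\<close> and
  \<open>B\<close> is joined by a segment. The difference of two points of the ball of radius r has
  length at most 2r, and the translated segments stay in the ball of radius 3r, whence the
  radii.\<close>

lemma difference_integral_bound:
 fixes u :: "real ^ 'n => real"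
 assumes uG: "has_weak_gradient u G" and r: "r >= 0" and [measurable]: "A \<in> sets borel" "B \<in> sets borel"
  and AB: "A \<subseteq> cball 0 r" "B \<subseteq> cball 0 r"
  and gap: "!!x z. x \<in> A ==> z \<in> B ==> a <= u z - u x" and a: "a >= 0"
 shows "ennreal (a^2) * emeasure lborel A * emeasure lborel B
  <= ennreal ((2 * r)^2) * sq_int (cball 0 (3 * r)) G * emeasure lborel (cball (0 :: real ^ 'n) (2 * r))"
proof -
 note [measurable] = weak_gradientD(3,4)[OF uG]
 have "ennreal (a^2) * emeasure lborel A * emeasure lborel B
   = (\<integral>\<^sup>+x. ennreal (a^2) * indicator A x * (\<integral>\<^sup>+z. indicator B z \<partial>lborel) \<partial>lborel)"
  by (simp add: nn_integral_multc nn_integral_cmult)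
 also have "... = (\<integral>\<^sup>+x. (\<integral>\<^sup>+z. ennreal (a^2) * indicator A x * indicator B (z + x) \<partial>lborel) \<partial>lborel)"
  by (subst nn_integral_cmult, measurable) (simp add: nn_integral_shift)
 also have "... <= (\<integral>\<^sup>+x. (\<integral>\<^sup>+z. ennreal ((norm (u (x + z) - u x))^2) * indicator (cball 0 r) x * indicator (cball 0 (2 * r)) z \<partial>lborel) \<partial>lborel)"
 proof (intro nn_integral_mono)
  fix x z :: "real ^ 'n"
  show "ennreal (a^2) * indicator A x * indicator B (z + x)
    <= ennreal ((norm (u (x + z) - u x))^2) * indicator (cball 0 r) x * indicator (cball 0 (2 * r)) z"
  proof (cases "x \<in> A \<and> x + z \<in> B")
   case True
   then have "norm x <= r" "norm (x + z) <= r" using AB by auto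
   then have "norm z <= 2 * r" using norm_triangle_ineq4[of "x + z" x] by simp
   moreover have "a^2 <= (norm (u (x + z) - u x))^2" using gap[of x "x + z"] True a by (intro power_mono) auto
   ultimately show ?thesis using True \<open>norm x <= r\<close> by (simp add: add.commute ennreal_leI)
  qed (auto simp: add.commute)
 qed
 also have "... = (\<integral>\<^sup>+z. (\<integral>\<^sup>+x. ennreal ((norm (u (x + z) - u x))^2) * indicator (cball 0 r) x * indicator (cball 0 (2 * r)) z \<partial>lborel) \<partial>lborel)"
  by (rule lborel_pair.Fubini') measurable
 also have "... = (\<integral>\<^sup>+z. sq_int (cball 0 r) (%x. u (x + z) - u x) * indicator (cball 0 (2 * r)) z \<partial>lborel)"
  unfolding sq_int_def by (intro nn_integral_cong nn_integral_multc) measurable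
 also have "... <= (\<integral>\<^sup>+z. (ennreal ((2 * r)^2) * sq_int (cball 0 (3 * r)) G) * indicator (cball (0 :: real ^ 'n) (2 * r)) z \<partial>lborel)"
 proof (intro nn_integral_mono)
  fix z :: "real ^ 'n"
  show "sq_int (cball 0 r) (%x. u (x + z) - u x) * indicator (cball 0 (2 * r)) z
    <= (ennreal ((2 * r)^2) * sq_int (cball 0 (3 * r)) G) * indicator (cball 0 (2 * r)) z"
  proof (cases "z \<in> cball 0 (2 * r)")
   case True
   have "sq_int (cball 0 r) (%x. u (x + z) - u x) <= ennreal ((norm z)^2) * sq_int (cball 0 (3 * r)) G"
   proof (rule translation_estimate[OF uG])
    show "x + s *\<^sub>R z \<in> cball 0 (3 * r)" if "x \<in> cball 0 r" "0 <= s" "s <= 1" for x s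
    proof -
     have "s * norm z <= 1 * (2 * r)" using True that by (intro mult_mono) auto
     then show ?thesis using that norm_triangle_ineq[of x "s *\<^sub>R z"] by simp
    qed
   qed auto
   also have "... <= ennreal ((2 * r)^2) * sq_int (cball 0 (3 * r)) G"
    using True by (intro mult_right_mono ennreal_leI power_mono) auto
   finally show ?thesis using True by simp
  qed simp
 qed
 also have "... = ennreal ((2 * r)^2) * sq_int (cball 0 (3 * r)) G * emeasure lborel (cball (0 :: real ^ 'n) (2 * r))"
  by (subst nn_integral_cmult_indicator) auto
 finally show ?thesis .
qed

text \<open>Between \<open>{w \<le> 0}\<close> and \<open>{w > 1 / r}\<close> the function \<open>log (1 + w / d)\<close> jumps by at least \<open>log (1 + 1 / (r d))\<close>, which is
 unbounded as \<open>d \<rightarrow> 0\<close>, whereas its gradient stays bounded in \<open>L\<^sup>2\<close>.\<close>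

theorem strong_maximum_principle:
 fixes w :: "real ^ 'n => real"
 assumes N: "CARD('n) >= 3" and p: "p > 1" and m: "m > 0" and wE: "w \<in> E_space p"
  and w0: "AE x in lborel. 0 <= w x" and nt: "nontrivial w"
  and EL: "!!h. h \<in> E_space p ==> dir_inner w h = wderiv (%x. m * Q 1 x) (2 * p) w h"
 shows "AE x in lborel. 0 < w x"
proof (rule ccontr)
 assume np: "\<not> (AE x in lborel. 0 < w x)"
 define G where "G = weak_grad w"
 have wG: "L2_gradient w G" unfolding G_def by (rule L2_gradient_weak_grad[OF E_spaceD(1)[OF wE]])
 note [measurable] = L2_gradientD(4,5)[OF wG]
 obtain n :: nat where n: "n > 0" and A0: "emeasure lborel ({x. w x <= 0} \<inter> cball 0 (real n)) > 0"
  and B0: "emeasure lborel ({x. w x > 1 / real n} \<inter> cball 0 (real n)) > 0"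
  using positive_superlevel_sets[OF L2_gradientD(4)[OF wG] w0 nt np] by metis
 define r where "r = real n"
 define A where "A = {x. w x <= 0} \<inter> cball 0 r"
 define B where "B = {x. w x > 1 / r} \<inter> cball 0 r"
 have [measurable]: "A \<in> sets borel" "B \<in> sets borel" unfolding A_def B_def by measurable
 have r: "r > 0" using n by (simp add: r_def)
 have fin: "emeasure lborel S = ennreal (measure lborel S)" if "S \<subseteq> cball 0 t" for S :: "(real ^ 'n) set" and t
  using order.strict_trans1[OF emeasure_mono[OF that, of lborel] emeasure_lborel_cball_finite[of 0 t]]
  by (intro emeasure_eq_ennreal_measure) auto
 have EA: "emeasure lborel A = ennreal (measure lborel A)" and EB: "emeasure lborel B = ennreal (measure lborel B)"
  by (rule fin[of _ r], simp add: A_def B_def)+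
 have A: "measure lborel A > 0" using A0 EA by (simp add: A_def r_def)
 have B: "measure lborel B > 0" using B0 EB by (simp add: B_def r_def)
 define V where "V = measure lborel (cball (0 :: real ^ 'n) (2 * r))"
 have EV: "emeasure lborel (cball (0 :: real ^ 'n) (2 * r)) = ennreal V" unfolding V_def by (rule fin) auto
 obtain \<phi> :: "real ^ 'n => real" and c where \<phi>: "\<phi> \<in> test_functions" and c: "c > 0"
  and \<phi>c: "!!x. x \<in> cball 0 (3 * r) ==> c <= \<phi> x" and \<phi>01: "!!x. 0 <= \<phi> x" "!!x. \<phi> x <= 1"
  by (rule test_function_positive_on_cball[of "3 * r"]) (rule that)
 note [measurable] = test_functionD(4)[OF \<phi>]
 obtain C where C: "!!d. d > 0 ==> (LINT x|lborel. (\<phi> x)^2 * (norm (pole_weight d (w x) *\<^sub>R G x))^2) <= C"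
  by (rule log_gradient_bound[OF N p m wE w0 EL \<phi>]) (assumption, rule that, simp add: G_def)
 define D where "D = (2 * r)^2 * (\<bar>C\<bar> / c^2) * V"
 \<comment> \<open>Large enough that L |A| |B| exceeds the uniform bound \<open>D\<close>; the
   summand 1 also gives L <= L^2. The parameter \<open>d\<close> below solves ln (1 + 1 / (r d)) =
   L, so the logarithmic gap is exactly \<open>L\<close>.\<close>
 define L where "L = 1 + D / (measure lborel A * measure lborel B)"
 have V: "V >= 0" by (simp add: V_def)
 have D: "D >= 0" using V by (simp add: D_def)
 have L: "L >= 1" using D A B by (simp add: L_def)
 define d where "d = 1 / (r * (exp L - 1))"
 have eL: "exp L - 1 > 0" using L by simp
 have d: "d > 0" unfolding d_def using r eL by (intro divide_pos_pos mult_pos_pos) auto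
 have dL: "ln (1 + 1 / (r * d)) = L"
 proof -
  have "1 / (r * d) = exp L - 1" using r eL by (simp add: d_def)
  then show ?thesis by simp
 qed
 define u where "u x = ext_log d (w x)" for x
 define H where "H x = pole_weight d (w x) *\<^sub>R G x" for x
 have uH: "L2_gradient u H" unfolding u_def[abs_def] H_def[abs_def] by (rule L2_gradient_ext_log[OF wG d])
 note [measurable] = L2_gradientD(4,5)[OF uH]
 have "sq_int (cball 0 (3 * r)) H <= (\<integral>\<^sup>+x. ennreal (1 / c^2 * ((\<phi> x)^2 * (norm (H x))^2)) \<partial>lborel)"
  unfolding sq_int_def
 proof (intro nn_integral_mono)
  fix x
  show "ennreal ((norm (H x))^2) * indicator (cball 0 (3 * r)) x <= ennreal (1 / c^2 * ((\<phi> x)^2 * (norm (H x))^2))"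
  proof (cases "x \<in> cball 0 (3 * r)")
   case True
   have "1 <= 1 / c^2 * (\<phi> x)^2" using power_mono[OF \<phi>c[OF True], of 2] c by simp
   from mult_right_mono[OF this, of "(norm (H x))^2"] show ?thesis using True by (simp add: ennreal_leI)
  qed simp
 qed
 also have "... = ennreal (LINT x|lborel. 1 / c^2 * ((\<phi> x)^2 * (norm (H x))^2))"
 proof (rule nn_integral_eq_integral)
  have "integrable lborel (%x. (\<phi> x)^2 * (norm (H x))^2)"
  proof (rule L1_bound[OF L2_gradientD(2)[OF uH]])
   show "AE x in lborel. norm ((\<phi> x)^2 * (norm (H x))^2) <= norm ((norm (H x))^2)"
    using \<phi>01 by (intro AE_I2) (simp add: mult_left_le_one_le power_le_one)
  qed measurable
  then show "integrable lborel (%x. 1 / c^2 * ((\<phi> x)^2 * (norm (H x))^2))" by simp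
 qed simp
 also have "... <= ennreal (\<bar>C\<bar> / c^2)"
 proof (rule ennreal_leI)
  have "(LINT x|lborel. (\<phi> x)^2 * (norm (H x))^2) <= \<bar>C\<bar>" unfolding H_def using C[OF d] by linarith
  then show "(LINT x|lborel. 1 / c^2 * ((\<phi> x)^2 * (norm (H x))^2)) <= \<bar>C\<bar> / c^2" by (simp add: divide_right_mono)
 qed
 finally have sq: "sq_int (cball 0 (3 * r)) H <= ennreal (\<bar>C\<bar> / c^2)" .
 have "ennreal (L^2) * emeasure lborel A * emeasure lborel B
   <= ennreal ((2 * r)^2) * sq_int (cball 0 (3 * r)) H * emeasure lborel (cball (0 :: real ^ 'n) (2 * r))"
 proof (rule difference_integral_bound[OF L2_gradientD(1)[OF uH]])
  show "L <= u z - u x" if "x \<in> A" "z \<in> B" for x z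
   using ext_log_gap[OF d r, of "w x" "w z"] that by (simp add: A_def B_def u_def dL)
 qed (use r L in \<open>auto simp: A_def B_def\<close>)
 also have "... <= ennreal ((2 * r)^2) * ennreal (\<bar>C\<bar> / c^2) * ennreal V"
  unfolding EV by (intro mult_mono order_refl sq) auto
 also have "... = ennreal D" unfolding D_def
  by (simp only: ennreal_mult[OF _ V] ennreal_mult[of "(2 * r)^2" "\<bar>C\<bar> / c^2"] zero_le_power2 divide_nonneg_nonneg abs_ge_zero mult_nonneg_nonneg)
 finally have "L^2 * (measure lborel A * measure lborel B) <= D"
  unfolding EA EB using D by (simp add: mult.assoc flip: ennreal_mult)
 moreover have "D < L * (measure lborel A * measure lborel B)"
  using A B by (simp add: L_def distrib_right)
 moreover have "L * (measure lborel A * measure lborel B) <= L^2 * (measure lborel A * measure lborel B)"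
  using A B L by (intro mult_right_mono) (auto simp: power2_eq_square)
 ultimately show False by linarith
qed

section \<open>Compactly supported competitors\<close>

text \<open>Young's inequality with the conjugate exponents N/2 and N/(N-2), its second term capped
  by the left-hand side. The cap is what makes that term tend to 0 pointwise as \<open>g\<close>
  does, while it stays dominated by a fixed power of |a|.\<close>

lemma critical_Young:
 fixes a g l N :: real
 assumes g: "g >= 0" and l: "l > 0" and N: "N > 2"
 shows "a^2 * g^2 <= l * g powr N + min (a^2 * g^2) (l powr (- 2 / (N - 2)) * \<bar>a\<bar> powr (2 * N / (N - 2)))"
proof (cases "a = 0 \<or> g = 0")
 case False
 then have a: "\<bar>a\<bar> > 0" and g: "g > 0" using g by auto
 have lg: "l * g powr N >= 0" using l by simp
 show ?thesis
 proof (cases "a^2 <= l * g powr (N - 2)")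
  case True
  have "a^2 * g^2 <= (l * g powr (N - 2)) * g^2" using True by (intro mult_right_mono) auto
  also have "... = l * g powr N" using g by (simp add: powr_diff)
  moreover have "0 <= min (a^2 * g^2) (l powr (- 2 / (N - 2)) * \<bar>a\<bar> powr (2 * N / (N - 2)))" by simp
  ultimately show ?thesis by linarith
 next
  case False
  have "g^2 = (g powr (N - 2)) powr (2 / (N - 2))"
  proof -
   have "(N - 2) * (2 / (N - 2)) = 2" using N nonzero_mult_div_cancel_left[of "N - 2" 2] by (simp only: times_divide_eq_right)
   then show ?thesis using g by (simp only: powr_powr) simp
  qed
  also have "... <= (a^2 / l) powr (2 / (N - 2))"
   using False l N by (intro powr_mono2) (auto simp: field_simps)
  also have "... = l powr (- 2 / (N - 2)) * \<bar>a\<bar> powr (2 * (2 / (N - 2)))"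
  proof -
   have "(a^2 / l) powr s = l powr (- s) * \<bar>a\<bar> powr (2 * s)" for s
   proof -
    have "a^2 / l = \<bar>a\<bar> powr 2 * inverse l" using a by (simp add: divide_inverse)
    then show ?thesis using l by (simp only: powr_mult powr_powr) (simp add: powr_minus inverse_powr)
   qed
   from this[of "2 / (N - 2)"] show ?thesis by simp
  qed
  finally have "a^2 * g^2 <= \<bar>a\<bar> powr 2 * (l powr (- 2 / (N - 2)) * \<bar>a\<bar> powr (2 * (2 / (N - 2))))"
   using a by (simp add: mult_left_mono)
  also have "... = l powr (- 2 / (N - 2)) * \<bar>a\<bar> powr (2 + 2 * (2 / (N - 2)))" by (simp only: powr_add mult.left_commute)
  also have "2 + 2 * (2 / (N - 2)) = 2 * N / (N - 2)" using N by (simp add: field_simps)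
  finally show ?thesis using lg by simp
 qed
qed (use l in auto)

lemma normalized_test_function:
 obtains \<theta> :: "real ^ 'n => real" where "\<theta> \<in> test_functions" "\<theta> 0 = 1"
proof -
 obtain \<phi> :: "real ^ 'n => real" and c where \<phi>: "\<phi> \<in> test_functions" "c > 0" "!!x. x \<in> cball 0 1 ==> c <= \<phi> x"
  by (rule test_function_positive_on_cball[of 1]) (rule that)
 have "\<phi> 0 > 0" using \<phi>(2) \<phi>(3)[of 0] by simp
 moreover have "(%x. 1 / \<phi> 0 * \<phi> x) \<in> test_functions" by (intro test_function_mult \<phi>(1) C_k_const)
 ultimately show ?thesis using that[of "%x. 1 / \<phi> 0 * \<phi> x"] by simp
qed

lemma grad_scaled:
 assumes \<theta>: "\<theta> \<in> test_functions"
 shows "grad (%x. \<theta> (a *\<^sub>R x)) x = a *\<^sub>R grad \<theta> (a *\<^sub>R x)"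
proof -
 have "partial_deriv k (%x. \<theta> (a *\<^sub>R x)) x = a * partial_deriv k \<theta> (a *\<^sub>R x)" for k
 proof -
  let ?D = "frechet_derivative \<theta> (at (a *\<^sub>R x))"
  have D: "(\<theta> has_derivative ?D) (at (a *\<^sub>R x))"
   using test_functionD(2)[OF \<theta>] by (simp add: frechet_derivative_works)
  have "((%x. \<theta> (a *\<^sub>R x)) has_derivative (%h. ?D (a *\<^sub>R h))) (at x)"
   by (rule has_derivative_compose[where f="%x. a *\<^sub>R x" and g=\<theta>, OF _ D]) (auto intro!: derivative_eq_intros)
  from fun_cong[OF frechet_derivative_at[OF this], of "axis k 1"] show ?thesis
   using linear_cmul[OF has_derivative_linear[OF D]] by (simp add: partial_deriv_def)
 qed
 then show ?thesis by (simp add: grad_def vec_eq_iff)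
qed

text \<open>The delicate term is \<open>u\<close> times the gradient of the cutoff: that gradient is
  uniformly small, but \<open>u\<close> need not be square integrable. \<open>critical_Young\<close>
  splits off an L^N norm of the cutoff gradient with an arbitrarily small coefficient; the rest
  vanishes by dominated convergence, as \<open>u\<close> lies in the critical Lebesgue
  space.\<close>

lemma cutoff_approximation:
 fixes u :: "real ^ 'n => real"
 assumes N: "CARD('n) >= 3" and p: "p > 1" and u: "u \<in> E_space p"
 obtains U :: "nat => real ^ 'n => real" where "!!n. U n \<in> E_space p" "!!n. integrable lborel (%x. (U n x)^2)"
  "!!n. \<exists>R. \<forall>x. norm x > R --> U n x = 0"
  "(%n. dirichlet (%x. U n x - u x)) \<longlonglongrightarrow> 0" "(%n. wmass (%_. 1) (2 * p) (%x. U n x - u x)) \<longlonglongrightarrow> 0"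
proof -
 define NN where "NN = real CARD('n)"
 have NN: "NN > 2" using N by (simp add: NN_def)
 define P where "P = 2 * NN / (NN - 2)"
 have P: "P > 2" using NN by (simp add: P_def field_simps)
 define G where "G = weak_grad u"
 have uG: "L2_gradient u G" unfolding G_def by (rule L2_gradient_weak_grad[OF E_spaceD(1)[OF u]])
 have uP: "u \<in> Lq P" using E_spaceD(4)[OF u] by (simp add: P_def NN_def)
 have uq: "u \<in> Lq (2 * p)" by (rule E_spaceD(2)[OF u])
 note [measurable] = L2_gradientD(4,5)[OF uG]
 obtain \<theta> :: "real ^ 'n => real" where \<theta>: "\<theta> \<in> test_functions" "\<theta> 0 = 1" by (rule normalized_test_function)
 obtain B where B: "B > 0" "!!x. \<bar>\<theta> x\<bar> <= B" using test_function_bounded[OF \<theta>(1)] by metis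
 obtain K where K: "K > 0" "!!x. norm (grad \<theta> x) <= K" using grad_bounded[OF \<theta>(1)] by metis
 note [measurable] = grad_measurable[OF \<theta>(1)] test_functionD(4)[OF \<theta>(1)]
 define a where "a n = 1 / real (Suc n)" for n
 have a: "a n > 0" for n by (simp add: a_def)
 have a0: "a \<longlonglongrightarrow> 0" unfolding a_def[abs_def] by (rule LIMSEQ_inverse_real_of_nat[unfolded inverse_eq_divide])
 define \<Phi> where "\<Phi> n x = \<theta> (a n *\<^sub>R x)" for n x
 have \<Phi>: "\<Phi> n \<in> test_functions" for n
  using test_function_affine[OF \<theta>(1), of "a n" 0] a[of n] by (simp add: \<Phi>_def[abs_def])
 note [measurable] = grad_measurable[OF \<Phi>] test_functionD(4)[OF \<Phi>]
 have \<Phi>B: "\<bar>\<Phi> n x\<bar> <= B" for n x unfolding \<Phi>_def by (rule B(2))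
 have \<Phi>1: "(%n. \<Phi> n x) \<longlonglongrightarrow> 1" for x
 proof -
  have "(%n. \<theta> (a n *\<^sub>R x)) \<longlonglongrightarrow> \<theta> (0 *\<^sub>R x)"
   using test_functionD(3)[OF \<theta>(1)]
   by (intro isCont_tendsto_compose[of _ \<theta>] tendsto_intros a0) (simp add: continuous_on_eq_continuous_at)
  then show ?thesis by (simp add: \<Phi>_def \<theta>(2))
 qed
 define g where "g n x = norm (grad (\<Phi> n) x)" for n x
 have g_eq: "g n x = a n * norm (grad \<theta> (a n *\<^sub>R x))" for n x
  using a[of n] by (simp add: g_def \<Phi>_def[abs_def] grad_scaled[OF \<theta>(1)])
 have g0: "g n x >= 0" for n x by (simp add: g_def)
 have [measurable]: "g n \<in> borel_measurable borel" for n unfolding g_def[abs_def] by measurable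
 define M where "M = (LINT x|lborel. norm (grad \<theta> x) powr NN)"
 have ig\<theta>: "integrable lborel (%x. norm (grad \<theta> x) powr NN)"
 proof (rule L1_bound)
  show "integrable lborel (%x. K powr (NN - 2) * (norm (grad \<theta> x))^2)"
   by (intro integrable_mult_right grad_square_integrable[OF \<theta>(1)])
  have "norm (grad \<theta> x) powr NN <= K powr (NN - 2) * (norm (grad \<theta> x))^2" for x
  proof (cases "grad \<theta> x = 0")
   case False
   then have "norm (grad \<theta> x) powr NN = norm (grad \<theta> x) powr (NN - 2) * (norm (grad \<theta> x))^2"
    by (simp add: powr_diff)
   also have "... <= K powr (NN - 2) * (norm (grad \<theta> x))^2"
    using K NN by (intro mult_right_mono powr_mono2) auto
   finally show ?thesis .
  qed simp
  then show "AE x in lborel. norm (norm (grad \<theta> x) powr NN) <= norm (K powr (NN - 2) * (norm (grad \<theta> x))^2)"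
   by (intro AE_I2) (simp add: order_trans[OF _ abs_ge_self])
 qed measurable
 have gN_eq: "g n x powr NN = a n ^ CARD('n) * (norm (grad \<theta> (a n *\<^sub>R x)) powr NN)" for n x
  using a[of n] by (simp add: g_eq powr_mult NN_def powr_realpow)
 have gN: "integrable lborel (%x. g n x powr NN)" for n
  using integrable_affine[OF ig\<theta> a[of n], of 0] by (simp add: gN_eq)
 \<comment> \<open>The L^N norm of a gradient is invariant under dilation: the factor
   \<open>a n\<close> from the chain rule, raised to the dimension, cancels the Jacobian.\<close>
 have gM: "(LINT x|lborel. g n x powr NN) = M" for n
 proof -
  have "M = a n ^ CARD('n) * (LINT x|lborel. norm (grad \<theta> (a n *\<^sub>R x)) powr NN)"
   unfolding M_def by (subst integral_affine[OF _ a[of n], of _ 0]) simp_all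
  then show ?thesis by (simp add: gN_eq)
 qed
 define Cl where "Cl l = l powr (- 2 / (NN - 2))" for l :: real
 define h where "h l n x = min ((u x)^2 * (g n x)^2) (Cl l * \<bar>u x\<bar> powr P)" for l n x
 have Cl0: "Cl l >= 0" for l by (simp add: Cl_def)
 have h0: "0 <= h l n x" "h l n x <= Cl l * \<bar>u x\<bar> powr P" for l n x
  using Cl0[of l] by (auto simp: h_def)
 have Young: "(u x)^2 * (g n x)^2 <= l * g n x powr NN + h l n x" if "l > 0" for l n x
  using critical_Young[OF g0 that NN, of "u x" n x] by (simp add: h_def Cl_def P_def)
 have [measurable]: "h l n \<in> borel_measurable borel" for l n unfolding h_def[abs_def] by measurable
 have iP: "integrable lborel (%x. Cl l * \<bar>u x\<bar> powr P)" for l using LqD(2)[OF uP] by simp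
 have ih: "integrable lborel (h l n)" for l n
  by (rule L1_bound[OF iP[of l]]) (use h0 Cl0 in \<open>auto simp: abs_of_nonneg\<close>)
 have h_lim: "(%n. \<integral>x. h l n x \<partial>lborel) \<longlonglongrightarrow> 0" for l
 proof -
  have "(%n. \<integral>x. h l n x \<partial>lborel) \<longlonglongrightarrow> (\<integral>x. (0 :: real) \<partial>(lborel :: (real ^ 'n) measure))"
  proof (rule integral_dominated_convergence[where w="%x. Cl l * \<bar>u x\<bar> powr P"])
   show "AE x in lborel. (%n. h l n x) \<longlonglongrightarrow> 0"
   proof (intro AE_I2)
    fix x
    have "(%n. (u x)^2 * (a n * K)^2) \<longlonglongrightarrow> (u x)\<^sup>2 * (0 * K)^2" by (intro tendsto_intros a0)
    then have lim: "(%n. (u x)^2 * (a n * K)^2) \<longlonglongrightarrow> 0" by simp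
    have "h l n x <= (u x)^2 * (a n * K)^2" for n
    proof -
     have "g n x <= a n * K" unfolding g_eq using K(2) a[of n] by (intro mult_left_mono) auto
     then have "(u x)^2 * (g n x)^2 <= (u x)^2 * (a n * K)^2" using g0 by (intro mult_left_mono power_mono) auto
     then show ?thesis unfolding h_def by linarith
    qed
    then show "(%n. h l n x) \<longlonglongrightarrow> 0"
     by (intro Lim_null_comparison[OF _ lim]) (simp add: abs_of_nonneg[OF h0(1)])
   qed
  qed (use iP h0 in \<open>auto simp: abs_of_nonneg\<close>)
  then show ?thesis by simp
 qed
 have ug: "integrable lborel (%x. (u x)^2 * (g n x)^2)" for n
 proof (rule L1_bound)
  show "integrable lborel (%x. 1 * g n x powr NN + h 1 n x)"
   using gN ih by (intro L1_add integrable_mult_right)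
  show "AE x in lborel. norm ((u x)^2 * (g n x)^2) <= norm (1 * g n x powr NN + h 1 n x)"
   using Young[of 1] by (intro AE_I2) (simp add: order_trans[OF _ abs_ge_self])
 qed measurable
 have M0: "M >= 0" by (simp add: M_def)
 have ug_lim: "(%n. \<integral>x. (u x)^2 * (g n x)^2 \<partial>lborel) \<longlonglongrightarrow> 0"
 proof (rule LIMSEQ_I)
  fix e :: real assume e: "e > 0"
  define l where "l = e / (2 * (M + 1))"
  have l: "l > 0" using e M0 by (simp add: l_def)
  have lM: "l * M < e / 2" using e M0 by (simp add: l_def field_simps)
  obtain n0 where n0: "!!n. n >= n0 ==> norm ((LINT x|lborel. h l n x) - 0) < e / 2"
   using LIMSEQ_D[OF h_lim[of l], of "e / 2"] e by auto
  have le: "(LINT x|lborel. (u x)^2 * (g n x)^2) <= l * M + (LINT x|lborel. h l n x)" for n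
  proof -
   have "(LINT x|lborel. (u x)^2 * (g n x)^2) <= (LINT x|lborel. l * g n x powr NN + h l n x)"
    using gN ih Young[OF l] by (intro LINT_mono ug) auto
   also have "... = l * M + (LINT x|lborel. h l n x)" using gN ih by (simp add: gM)
   finally show ?thesis .
  qed
  moreover have "0 <= (LINT x|lborel. (u x)^2 * (g n x)^2)" for n by simp
  have "norm ((LINT x|lborel. (u x)^2 * (g n x)^2) - 0) < e" if "n >= n0" for n
  proof -
   have "0 <= (LINT x|lborel. (u x)^2 * (g n x)^2)" by simp
   moreover have "(LINT x|lborel. h l n x) < e / 2" using n0[OF that] by simp
   ultimately show ?thesis using le[of n] lM by simp
  qed
  then show "\<exists>n0. \<forall>n\<ge>n0. norm ((LINT x|lborel. (u x)^2 * (g n x)^2) - 0) < e" by blast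
 qed
 define U where "U n x = \<Phi> n x * u x" for n x
 define D where "D n x = (\<Phi> n x - 1) *\<^sub>R G x + u x *\<^sub>R grad (\<Phi> n) x" for n x
 have [measurable]: "D n \<in> borel_measurable borel" for n unfolding D_def[abs_def] by measurable
 have D2: "(norm (D n x))^2 <= 2 * ((\<Phi> n x - 1)^2 * (norm (G x))^2) + 2 * ((u x)^2 * (g n x)^2)" for n x
 proof -
  have "norm (D n x) <= \<bar>\<Phi> n x - 1\<bar> * norm (G x) + \<bar>u x\<bar> * g n x"
   unfolding D_def g_def using norm_triangle_ineq[of "(\<Phi> n x - 1) *\<^sub>R G x" "u x *\<^sub>R grad (\<Phi> n) x"] by simp
  then have "(norm (D n x))^2 <= (\<bar>\<Phi> n x - 1\<bar> * norm (G x) + \<bar>u x\<bar> * g n x)^2" by (intro power_mono) auto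
  also have "... <= 2 * (\<bar>\<Phi> n x - 1\<bar> * norm (G x))^2 + 2 * (\<bar>u x\<bar> * g n x)^2"
   using sum_squares_bound[of "\<bar>\<Phi> n x - 1\<bar> * norm (G x)" "\<bar>u x\<bar> * g n x"] by (simp add: power2_sum)
  finally show ?thesis by (simp add: power_mult_distrib)
 qed
 have \<Phi>G: "(\<Phi> n x - 1)^2 * t <= (B + 1)^2 * t" if "t >= 0" for n x t
 proof -
  have "(\<Phi> n x - 1)^2 <= (B + 1)^2" using \<Phi>B[of n x] B(1) by (intro power2_le_iff_abs_le[THEN iffD2]) auto
  then show ?thesis using that by (rule mult_right_mono)
 qed
 have iG: "integrable lborel (%x. (\<Phi> n x - 1)^2 * (norm (G x))^2)" for n
  by (rule L1_bound[OF integrable_mult_right[OF L2_gradientD(2)[OF uG], of "(B + 1)^2"]])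
   (auto intro!: AE_I2 \<Phi>G)
 have iD: "integrable lborel (%x. (norm (D n x))^2)" for n
 proof (rule L1_bound)
  show "integrable lborel (%x. 2 * ((\<Phi> n x - 1)^2 * (norm (G x))^2) + 2 * ((u x)^2 * (g n x)^2))"
   using iG ug by (intro L1_add integrable_mult_right)
  show "AE x in lborel. norm ((norm (D n x))^2) <= norm (2 * ((\<Phi> n x - 1)^2 * (norm (G x))^2) + 2 * ((u x)^2 * (g n x)^2))"
   using D2[of n] by (intro AE_I2) (simp add: order_trans[OF _ abs_ge_self])
 qed measurable
 have wU: "has_weak_gradient (U n) (%x. \<Phi> n x *\<^sub>R G x + u x *\<^sub>R grad (\<Phi> n) x)" for n
  unfolding U_def[abs_def] by (rule weak_gradient_mult_test[OF L2_gradientD(1)[OF uG] \<Phi>])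
 have GD: "\<Phi> n x *\<^sub>R G x + u x *\<^sub>R grad (\<Phi> n) x = D n x + G x" for n x by (simp add: D_def algebra_simps)
 have UL: "L2_gradient (U n) (%x. D n x + G x)" for n
  unfolding L2_gradient_def
 proof (intro conjI)
  show "has_weak_gradient (U n) (%x. D n x + G x)" using wU[of n] by (simp add: GD)
  have "(norm (D n x + G x))^2 <= 2 * (norm (D n x))^2 + 2 * (norm (G x))^2" for x
  proof -
   have "(norm (D n x + G x))^2 <= (norm (D n x) + norm (G x))^2" by (intro power_mono norm_triangle_ineq) auto
   also have "... <= 2 * (norm (D n x))^2 + 2 * (norm (G x))^2"
    using sum_squares_bound[of "norm (D n x)" "norm (G x)"] by (simp add: power2_sum)
   finally show ?thesis .
  qed
  then show "integrable lborel (%x. (norm (D n x + G x))^2)"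
   by (intro L1_bound[OF L1_add[OF
     integrable_mult_right[OF iD[of n], of 2] integrable_mult_right[OF L2_gradientD(2)[OF uG], of 2]]])
    (auto intro!: AE_I2 intro: order_trans[OF _ abs_ge_self])
 qed
 have UuD: "L2_gradient (%x. U n x - u x) (D n)" for n
  using L2_gradient_lincomb[OF UL[of n] uG, of 1 "-1"] by simp
 have dom: "\<bar>U n x\<bar> powr q <= B powr q * \<bar>u x\<bar> powr q" if "q > 0" for n x q
 proof -
  have "\<bar>U n x\<bar> powr q = \<bar>\<Phi> n x\<bar> powr q * \<bar>u x\<bar> powr q" by (simp add: U_def abs_mult powr_mult)
  also have "... <= B powr q * \<bar>u x\<bar> powr q" using that \<Phi>B by (intro mult_right_mono powr_mono2) auto
  finally show ?thesis .
 qed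
 note [measurable] = L2_gradientD(4)[OF UL]
 have ULq: "U n \<in> Lq q" if "q > 0" "u \<in> Lq q" for n q
  unfolding Lq_def
 proof (intro CollectI conjI)
  show "integrable lborel (%x. \<bar>U n x\<bar> powr q)"
   by (rule L1_bound[OF integrable_mult_right[OF LqD(2)[OF that(2)], of "B powr q"]])
    (use dom[OF that(1)] in auto)
 qed measurable
 have UE: "U n \<in> E_space p" for n
  using ULq[OF _ uP, of n] ULq[OF _ uq, of n] L2_gradient_imp[OF UL[of n]] P p
  by (simp add: E_space_def D12_def P_def NN_def)
 have supp: "\<exists>R. \<forall>x. norm x > R --> U n x = 0" for n
  using test_function_support[OF \<Phi>[of n]] unfolding U_def by (metis mult_zero_left)
 show ?thesis
 proof (rule that[OF UE _ supp])
  fix n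
  obtain R where R: "\<forall>x. norm x > R --> U n x = 0" using supp by blast
  have "integrable lborel (%x. indicator (cball 0 R) x * (U n x)^2)"
   by (rule integrable_square_local[OF _ _ _ LqD(2)[OF ULq[OF _ uP]] order_refl]) (use P in auto)
  moreover have "indicator (cball 0 R) x * (U n x)^2 = (U n x)^2" for x using R by (auto simp: indicator_def)
  ultimately show "integrable lborel (%x. (U n x)^2)" by simp
 next
  have "(%n. \<integral>x. (\<Phi> n x - 1)^2 * (norm (G x))^2 \<partial>lborel) \<longlonglongrightarrow> (\<integral>x. 0 \<partial>(lborel :: (real ^ 'n) measure))"
  proof (rule integral_dominated_convergence[where w="%x. (B + 1)^2 * (norm (G x))^2"])
   show "AE x in lborel. (%n. (\<Phi> n x - 1)^2 * (norm (G x))^2) \<longlonglongrightarrow> 0"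
    by (intro AE_I2) (auto intro!: tendsto_eq_intros \<Phi>1)
  qed (use L2_gradientD(2)[OF uG] \<Phi>G in auto)
  then have lim: "(%n. 2 * (LINT x|lborel. (\<Phi> n x - 1)^2 * (norm (G x))^2) + 2 * (LINT x|lborel. (u x)^2 * (g n x)^2)) \<longlonglongrightarrow> 0"
   using ug_lim by (auto intro!: tendsto_eq_intros)
  show "(%n. dirichlet (%x. U n x - u x)) \<longlonglongrightarrow> 0"
  proof (rule Lim_null_comparison[OF _ lim], intro always_eventually allI)
   fix n
   have "dirichlet (%x. U n x - u x) <= (LINT x|lborel. 2 * ((\<Phi> n x - 1)^2 * (norm (G x))^2) + 2 * ((u x)^2 * (g n x)^2))"
    unfolding dirichlet_eq[OF UuD] using iD iG ug D2 by (intro LINT_mono) auto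
   then show "norm (dirichlet (%x. U n x - u x))
     <= 2 * (LINT x|lborel. (\<Phi> n x - 1)^2 * (norm (G x))^2) + 2 * (LINT x|lborel. (u x)^2 * (g n x)^2)"
    using iG ug by simp
  qed
 next
  have "(%n. \<integral>x. \<bar>U n x - u x\<bar> powr (2 * p) \<partial>lborel) \<longlonglongrightarrow> (\<integral>x. 0 \<partial>(lborel :: (real ^ 'n) measure))"
  proof (rule integral_dominated_convergence[where w="%x. (B + 1) powr (2 * p) * \<bar>u x\<bar> powr (2 * p)"])
   have eq: "\<bar>U n x - u x\<bar> powr (2 * p) = \<bar>\<Phi> n x - 1\<bar> powr (2 * p) * \<bar>u x\<bar> powr (2 * p)" for n x
   proof -
    have "U n x - u x = (\<Phi> n x - 1) * u x" by (simp add: U_def left_diff_distrib)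
    then show ?thesis by (simp only: abs_mult powr_mult abs_ge_zero)
   qed
   show "AE x in lborel. (%n. \<bar>U n x - u x\<bar> powr (2 * p)) \<longlonglongrightarrow> 0"
   proof (intro AE_I2)
    fix x
    have "(%n. \<bar>\<Phi> n x - 1\<bar> powr (2 * p)) \<longlonglongrightarrow> 0"
     using p by (intro tendsto_zero_powrI[where b="2 * p"]) (auto intro!: tendsto_eq_intros tendsto_rabs_zero \<Phi>1)
    then show "(%n. \<bar>U n x - u x\<bar> powr (2 * p)) \<longlonglongrightarrow> 0" unfolding eq by (rule tendsto_mult_left_zero)
   qed
   show "AE x in lborel. norm (\<bar>U n x - u x\<bar> powr (2 * p)) <= (B + 1) powr (2 * p) * \<bar>u x\<bar> powr (2 * p)" for n
   proof (intro AE_I2)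
    fix x
    have "\<bar>\<Phi> n x - 1\<bar> powr (2 * p) <= (B + 1) powr (2 * p)" using \<Phi>B[of n x] p by (intro powr_mono2) auto
    then show "norm (\<bar>U n x - u x\<bar> powr (2 * p)) <= (B + 1) powr (2 * p) * \<bar>u x\<bar> powr (2 * p)"
     by (simp add: eq mult_right_mono)
   qed
  qed (use LqD(2)[OF uq] in auto)
  then show "(%n. wmass (%_. 1) (2 * p) (%x. U n x - u x)) \<longlonglongrightarrow> 0" by (simp add: wmass_def)
 qed
qed

section \<open>Sobolev embedding and lower bounds for the Dirichlet energy\<close>

lemma H1_iff: "u \<in> H1 \<longleftrightarrow> has_L2_gradient u \<and> integrable lborel (%x. (u x)^2)"
proof -
 have "\<bar>u x\<bar> powr 2 = (u x)^2" for x by (cases "u x = 0") auto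
 then show ?thesis using L2_gradientD(4)[OF L2_gradient_weak_grad[of u]] by (auto simp: H1_def Lq_def)
qed

lemma Sobolev_H1:
 assumes N: "CARD('n) >= 3"
 defines "P \<equiv> 2 * real CARD('n) / (real CARD('n) - 2)"
 obtains C where "C > 0" "!!u :: real ^ 'n => real. u \<in> H1 ==> u \<in> Lq P \<and> (LINT x|lborel. \<bar>u x\<bar> powr P) <= C * dirichlet u powr (P / 2)"
proof -
 obtain C where C: "C > 0" "!!(u :: real ^ 'n => real) G. L2_gradient u G ==> integrable lborel (%x. (u x)^2) ==>
  (\<integral>\<^sup>+x. ennreal (\<bar>u x\<bar> powr P) \<partial>lborel) <= ennreal (C * (LINT x|lborel. (norm (G x))^2) powr (real CARD('n) / (real CARD('n) - 2)))"
  by (rule Sobolev_inequality[OF N]) (rule that, assumption, unfold P_def)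
 have P2: "real CARD('n) / (real CARD('n) - 2) = P / 2"
 proof -
  have "2 * a / b / 2 = a / b" for a b :: real by simp
  then show ?thesis unfolding P_def by (simp only:)
 qed
 show ?thesis
 proof (rule that[OF C(1)])
  fix u :: "real ^ 'n => real" assume "u \<in> H1"
  then have uG: "L2_gradient u (weak_grad u)" and u2: "integrable lborel (%x. (u x)^2)"
   using L2_gradient_weak_grad by (auto simp: H1_iff)
  note [measurable] = L2_gradientD(4)[OF uG]
  have le: "(\<integral>\<^sup>+x. ennreal (\<bar>u x\<bar> powr P) \<partial>lborel) <= ennreal (C * dirichlet u powr (P / 2))"
   using C(2)[OF uG u2] by (simp add: dirichlet_def P2)
  have i: "integrable lborel (%x. \<bar>u x\<bar> powr P)"
   using le by (intro integrableI_nonneg) (auto simp: less_top[symmetric] top_unique intro: le_less_trans)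
  have "ennreal (LINT x|lborel. \<bar>u x\<bar> powr P) <= ennreal (C * dirichlet u powr (P / 2))"
   using le nn_integral_eq_integral[OF i] by simp
  then have "(LINT x|lborel. \<bar>u x\<bar> powr P) <= C * dirichlet u powr (P / 2)"
   using C(1) by (subst (asm) ennreal_le_iff) auto
  with i show "u \<in> Lq P \<and> (LINT x|lborel. \<bar>u x\<bar> powr P) <= C * dirichlet u powr (P / 2)" by (simp add: Lq_def)
 qed
qed

lemma subcritical_exponent:
 fixes N p :: real
 assumes "N >= 3" "p < N / (N - 2)"
 shows "2 * p < 2 * N / (N - 2)"
 using assms by (simp add: field_simps)

lemma H1_subset_E_space:
 fixes u :: "real ^ 'n => real"
 assumes N: "CARD('n) >= 3" and p: "1 < p" "p < real CARD('n) / (real CARD('n) - 2)" and u: "u \<in> H1"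
 shows "u \<in> E_space p"
proof -
 define P where "P = 2 * real CARD('n) / (real CARD('n) - 2)"
 have pP: "2 * p < P" unfolding P_def by (rule subcritical_exponent) (use N p in auto)
 have uP: "u \<in> Lq P" using Sobolev_H1[OF N] u unfolding P_def by metis
 have u2: "integrable lborel (%x. (u x)^2)" and uL: "has_L2_gradient u" using u by (auto simp: H1_iff)
 note [measurable] = LqD(1)[OF uP]
 have "integrable lborel (%x. \<bar>u x\<bar> powr (2 * p))"
 proof (rule L1_bound[OF L1_add[OF u2 LqD(2)[OF uP]]])
  have "\<bar>u x\<bar> powr (2 * p) <= (u x)^2 + \<bar>u x\<bar> powr P" for x
   using powr_interpolation[of 1 "2 * p" P "u x"] p pP by simp
  then show "AE x in lborel. norm (\<bar>u x\<bar> powr (2 * p)) <= norm ((u x)^2 + \<bar>u x\<bar> powr P)" by simp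
 qed measurable
 then show ?thesis using uL uP by (simp add: E_space_def D12_def P_def Lq_def)
qed

text \<open>Proved first in \<open>H1\<close>, where the global Sobolev inequality applies, by
  interpolating between the finite volume of the ball and the critical power; cutoffs then extend it
  to \<open>E_space\<close>.\<close>

lemma local_Sobolev:
 assumes N: "CARD('n) >= 3" and p: "1 < p" "p < real CARD('n) / (real CARD('n) - 2)"
 obtains C where "C > 0" "!!u :: real ^ 'n => real. u \<in> E_space p ==> wmass (indicator (ball 0 1)) (2 * p) u <= C * dirichlet u powr p"
proof -
 define P where "P = 2 * real CARD('n) / (real CARD('n) - 2)"
 have pP: "2 * p < P" unfolding P_def by (rule subcritical_exponent) (use N p in auto)
 obtain C where C: "C > 0" "!!u :: real ^ 'n => real. u \<in> H1 ==> u \<in> Lq P \<and> (LINT x|lborel. \<bar>u x\<bar> powr P) <= C * dirichlet u powr (P / 2)"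
  by (rule Sobolev_H1[OF N]) (rule that, assumption, unfold P_def)
 define V where "V = measure lborel (ball (0 :: real ^ 'n) 1)"
 have iV: "integrable lborel (indicator (ball (0 :: real ^ 'n) 1) :: _ => real)"
  using emeasure_lborel_ball_finite by (intro integrable_real_indicator) auto
 have H: "wmass (indicator (ball 0 1)) (2 * p) u <= (V + C) * dirichlet u powr p" if u: "u \<in> H1" for u :: "real ^ 'n => real"
 proof (cases "dirichlet u = 0")
  case True
  then have "wmass (%_. 1) P u = 0" using C(2)[OF u] by (intro antisym wmass_nonneg) (auto simp: wmass_def)
  then have z: "AE x in lborel. u x = 0" using AE_zero_of_wmass_zero C(2)[OF u] by blast
  have "wmass (indicator (ball 0 1)) (2 * p) u = 0"
   unfolding wmass_def by (rule integral_eq_zero_AE) (use z in eventually_elim, simp)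
  then show ?thesis using True by simp
 next
  case False
  define d where "d = dirichlet u"
  \<comment> \<open>With the square root of the Dirichlet energy as threshold, both terms of the
    splitting become multiples of \<open>d powr p\<close>.\<close>
  define K where "K = d powr (1 / 2)"
  have d: "d > 0" using False dirichlet_nonneg[of u] by (simp add: d_def less_le)
  then have K: "K > 0" by (simp add: K_def)
  have i: "integrable lborel (%x. K powr (2 * p) * indicator (ball 0 1) x + K powr (2 * p - P) * \<bar>u x\<bar> powr P)"
   using iV LqD(2) C(2)[OF u] by (intro L1_add integrable_mult_right) auto
  have "wmass (indicator (ball 0 1)) (2 * p) u
    <= (LINT x|lborel. K powr (2 * p) * indicator (ball 0 1) x + K powr (2 * p - P) * \<bar>u x\<bar> powr P)"
   unfolding wmass_def
  proof (rule LINT_mono[OF wmass_integrable[where C=1, OF _ _ E_spaceD(2)[OF H1_subset_E_space[OF N p u]]] i])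
   fix x
   show "indicator (ball 0 1) x * \<bar>u x\<bar> powr (2 * p) <= K powr (2 * p) * indicator (ball 0 1) x + K powr (2 * p - P) * \<bar>u x\<bar> powr P"
   proof (cases "\<bar>u x\<bar> <= K")
    case True
    then have "\<bar>u x\<bar> powr (2 * p) <= K powr (2 * p)" using p by (intro powr_mono2) auto
    then show ?thesis by (auto simp: indicator_def intro: add_increasing2)
   next
    case False
    then have "\<bar>u x\<bar> powr (2 * p) = \<bar>u x\<bar> powr (2 * p - P) * \<bar>u x\<bar> powr P" using K by (simp flip: powr_add)
    also have "... <= K powr (2 * p - P) * \<bar>u x\<bar> powr P"
     using False K pP by (intro mult_right_mono powr_mono2') auto
    finally show ?thesis by (auto simp: indicator_def intro: add_increasing)
   qed
  qed (auto simp: indicator_def)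
  also have "... = K powr (2 * p) * V + K powr (2 * p - P) * (LINT x|lborel. \<bar>u x\<bar> powr P)"
   using iV LqD(2) C(2)[OF u] by (subst LINT_add) (auto simp: V_def)
  also have "... <= K powr (2 * p) * V + K powr (2 * p - P) * (C * d powr (P / 2))"
   unfolding d_def using C(2)[OF u] by (intro add_left_mono mult_left_mono) auto
  also have "... = (V + C) * d powr p"
  proof -
   have "K powr (2 * p - P) * d powr (P / 2) = d powr p"
    unfolding K_def powr_powr powr_add[symmetric] by (simp add: field_simps)
   moreover have "K powr (2 * p) = d powr p" unfolding K_def powr_powr by simp
   ultimately show ?thesis by (simp add: distrib_right mult.left_commute)
  qed
  finally show ?thesis by (simp add: d_def)
 qed
 show ?thesis
 proof (rule that)
  show "V + C > 0" using C(1) by (simp add: V_def add_nonneg_pos)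
  fix u :: "real ^ 'n => real" assume u: "u \<in> E_space p"
  obtain U :: "nat => real ^ 'n => real" where U: "!!n. U n \<in> E_space p" "!!n. integrable lborel (%x. (U n x)^2)"
   "(%n. dirichlet (%x. U n x - u x)) \<longlonglongrightarrow> 0" "(%n. wmass (%_. 1) (2 * p) (%x. U n x - u x)) \<longlonglongrightarrow> 0"
   by (rule cutoff_approximation[OF N p(1) u]) (rule that)
  have hE: "(%x. U n x - u x) \<in> E_space p" for n
   using E_space_lincomb[OF U(1)[of n] u _ N, of 1 "-1"] p by simp
  have "(%n. dirichlet (%x. u x + (U n x - u x))) \<longlonglongrightarrow> dirichlet u"
   by (intro dirichlet_perturbation E_spaceD(1)[OF u] E_spaceD(1)[OF hE] U(3))
  then have 1: "(%n. (V + C) * dirichlet (U n) powr p) \<longlonglongrightarrow> (V + C) * dirichlet u powr p"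
   using p by (intro tendsto_intros) (auto intro: tendsto_powr' )
  have "(%n. wmass (indicator (ball 0 1)) (2 * p) (%x. u x + (U n x - u x)) - wmass (indicator (ball 0 1)) (2 * p) u) \<longlonglongrightarrow> 0"
   by (rule wmass_perturbation[where C=1 and B="wmass (%_. 1) (2 * p) u", OF _ _ E_spaceD(2)[OF u] E_spaceD(2)[OF hE] _ _ U(4)])
    (use p in \<open>auto simp: indicator_def\<close>)
  then have 2: "(%n. wmass (indicator (ball 0 1)) (2 * p) (U n)) \<longlonglongrightarrow> wmass (indicator (ball 0 1)) (2 * p) u"
   by (simp add: LIM_zero_iff)
  show "wmass (indicator (ball 0 1)) (2 * p) u <= (V + C) * dirichlet u powr p"
  proof (rule LIMSEQ_le[OF 2 1])
   have "U n \<in> H1" for n using U(2) E_spaceD(1)[OF U(1)] by (simp add: H1_iff)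
   then show "\<exists>n0. \<forall>n\<ge>n0. wmass (indicator (ball 0 1)) (2 * p) (U n) <= (V + C) * dirichlet (U n) powr p" using H by blast
  qed
 qed
qed

text \<open>Only the unit ball contributes positively to \<open>qmass\<close>, so the local Sobolev
  inequality gives D <= m C D^p, and division by D yields \<open>k\<close>. For D = 0 the interior
  mass vanishes, then the exterior mass as well, contradicting nontriviality.\<close>

lemma dirichlet_lower_bound:
 assumes N: "CARD('n) >= 3" and p: "1 < p" "p < real CARD('n) / (real CARD('n) - 2)" and m: "m > 0"
 obtains k where "k > 0" "!!u :: real ^ 'n => real. u \<in> E_space p ==> nontrivial u ==> dirichlet u <= qmass p m u ==> k <= dirichlet u"
  "!!u :: real ^ 'n => real. u \<in> E_space p ==> qmass p m u > 0 ==> dirichlet u > 0"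
proof -
 obtain C where C: "C > 0" "!!u :: real ^ 'n => real. u \<in> E_space p ==> wmass (indicator (ball 0 1)) (2 * p) u <= C * dirichlet u powr p"
  by (rule local_Sobolev[OF N p]) (rule that)
 define k where "k = (1 / (m * C)) powr (1 / (p - 1))"
 have q: "qmass p m u <= m * C * dirichlet u powr p \<and>
   qmass p m u = m * (wmass (indicator (ball 0 1)) (2 * p) u - wmass (indicator (- ball 0 1)) (2 * p) u) \<and>
   wmass (%_. 1) (2 * p) u = wmass (indicator (ball 0 1)) (2 * p) u + wmass (indicator (- ball 0 1)) (2 * p) u \<and>
   0 <= wmass (indicator (ball 0 1)) (2 * p) u \<and> 0 <= wmass (indicator (- ball 0 1)) (2 * p) u"
  if u: "u \<in> E_space p" for u :: "real ^ 'n => real"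
 proof -
  note s = qmass_split[OF E_spaceD(2)[OF u]]
  have nn: "0 <= wmass (indicator (ball 0 1)) (2 * p) u" "0 <= wmass (indicator (- ball 0 1)) (2 * p) u"
   by (auto intro!: wmass_nonneg)
  have "m * (wmass (indicator (ball 0 1)) (2 * p) u - wmass (indicator (- ball 0 1)) (2 * p) u) <= m * (C * dirichlet u powr p)"
   using C(2)[OF u] nn m by (intro mult_left_mono) auto
  then show ?thesis using s nn by (simp add: mult.assoc)
 qed
 show ?thesis
 proof (rule that)
  show "k > 0" using m C(1) by (simp add: k_def)
  fix u :: "real ^ 'n => real" assume u: "u \<in> E_space p"
  show "dirichlet u > 0" if "qmass p m u > 0"
  proof (rule ccontr)
   assume "\<not> dirichlet u > 0"
   then have "dirichlet u = 0" using dirichlet_nonneg[of u] by linarith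
   then show False using q[OF u] that by simp
  qed
  assume nt: "nontrivial u" and le: "dirichlet u <= qmass p m u"
  have "dirichlet u ~= 0"
  proof
   assume 0: "dirichlet u = 0"
   then have "wmass (indicator (ball 0 1)) (2 * p) u = 0"
    using C(2)[OF u] q[OF u] by auto
   moreover have "qmass p m u = 0" using q[OF u] le 0 by auto
   ultimately have "wmass (%_. 1) (2 * p) u = 0" using q[OF u] m by auto
   then show False using AE_zero_of_wmass_zero[OF E_spaceD(2)[OF u]] nt by (simp add: nontrivial_def)
  qed
  then have d: "dirichlet u > 0" using dirichlet_nonneg[of u] by linarith
  have "dirichlet u * 1 <= m * C * (dirichlet u powr (p - 1) * dirichlet u)"
   using q[OF u] le d by (simp add: powr_diff)
  then have "1 / (m * C) <= dirichlet u powr (p - 1)" using d m C(1) by (simp add: field_simps)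
  then have "k <= (dirichlet u powr (p - 1)) powr (1 / (p - 1))"
   unfolding k_def using p m C(1) by (intro powr_mono2) auto
  also have "... = dirichlet u" using d p by (simp add: powr_powr)
  finally show "k <= dirichlet u" .
 qed
qed

section \<open>Rescaling and energy comparison\<close>

text \<open>Energy density with mass coefficient e^2, weighted by \<open>k\<close>: e = 1 belongs to
  the original variables, e = \<open>eps n\<close> to the rescaled ones, and an indicator as weight
  gives the energy in a ball.\<close>

definition wenergy :: "real => (real ^ 'n => real) => (real ^ 'n => real) => real"
 where "wenergy e k u = (LINT x|lborel. k x * ((norm (weak_grad u x))^2 + e^2 * (u x)^2))"

lemma wenergy_eq:
 assumes uG: "L2_gradient u G" and [measurable]: "k \<in> borel_measurable borel"
 shows "wenergy e k u = (LINT x|lborel. k x * ((norm (G x))^2 + e^2 * (u x)^2))"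
 unfolding wenergy_def
proof (rule integral_cong_AE)
 note [measurable] = L2_gradientD(4,5)[OF uG] L2_gradientD(5)[OF L2_gradient_weak_grad[OF L2_gradient_imp[OF uG]]]
 show "(%x. k x * ((norm (weak_grad u x))^2 + e^2 * (u x)^2)) \<in> borel_measurable lborel"
  "(%x. k x * ((norm (G x))^2 + e^2 * (u x)^2)) \<in> borel_measurable lborel" by measurable
 show "AE x in lborel. k x * ((norm (weak_grad u x))^2 + e^2 * (u x)^2) = k x * ((norm (G x))^2 + e^2 * (u x)^2)"
  using weak_grad_AE[OF L2_gradientD(1)[OF uG]] by eventually_elim simp
qed

lemma H1_D:
 assumes "u \<in> H1"
 shows "L2_gradient u (weak_grad u)" "has_L2_gradient u" "integrable lborel (%x. (u x)^2)"
  "integrable lborel (%x. (norm (weak_grad u x))^2)" "u \<in> borel_measurable borel" "weak_grad u \<in> borel_measurable borel"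
 using assms L2_gradient_weak_grad[of u] L2_gradientD[of u "weak_grad u"] by (auto simp: H1_iff)

lemma wenergy_H1:
 assumes "u \<in> H1"
 shows "wenergy e (%_. 1) u = dirichlet u + e^2 * (LINT x|lborel. (u x)^2)"
 using H1_D(3,4)[OF assms] by (simp add: wenergy_def dirichlet_def)

lemma wenergy_mult:
 assumes u: "u \<in> H1"
 shows "(%x. t * u x) \<in> H1" "k \<in> borel_measurable borel ==> wenergy e k (%x. t * u x) = t^2 * wenergy e k u"
proof -
 have L: "L2_gradient (%x. t * u x) (%x. t *\<^sub>R weak_grad u x)"
  using L2_gradient_lincomb[OF H1_D(1)[OF u] H1_D(1)[OF u], of t 0] by simp
 show "(%x. t * u x) \<in> H1" using L2_gradient_imp[OF L] H1_D(3)[OF u] by (simp add: H1_iff power_mult_distrib)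
 assume k: "k \<in> borel_measurable borel"
 show "wenergy e k (%x. t * u x) = t^2 * wenergy e k u"
  unfolding wenergy_eq[OF L k] unfolding wenergy_def integral_mult_right_zero[symmetric]
  by (intro LINT_cong) (simp_all add: power_mult_distrib algebra_simps)
qed

definition resc :: "real => real => real ^ 'n => (real ^ 'n => real) => real ^ 'n => real"
 where "resc p e b v x = e powr (1 / (p - 1)) * v (e *\<^sub>R x + b)"

text \<open>The common factor by which rescaling multiplies the quadratic energy and the mass with
  exponent 2p, for \<open>n\<close> the dimension. Its existence fixes the exponent in
  \<open>resc\<close>: for s = e^(1/(p-1)) the numbers s^2 e^2 and s^(2p) coincide.\<close>

definition resc_factor :: "real => real => nat => real"
 where "resc_factor p e n = e powr (2 * p / (p - 1)) / e ^ n"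

lemma resc_factor_pos: "e > 0 ==> resc_factor p e n > 0"
 by (simp add: resc_factor_def)

lemma resc_exponents:
 fixes e p :: real
 assumes "e > 0" "p > 1"
 shows "(e powr (1 / (p - 1)))^2 * e^2 = e powr (2 * p / (p - 1))" "(e powr (1 / (p - 1))) powr (2 * p) = e powr (2 * p / (p - 1))"
proof -
 have "2 * (1 / (p - 1)) + 2 = 2 * p / (p - 1)" using assms by (simp add: field_simps)
 moreover have "(e powr (1 / (p - 1)))^2 * e^2 = e powr (2 * (1 / (p - 1)) + 2)"
  unfolding mult_2 powr_add using assms by (simp add: power2_eq_square)
 ultimately show "(e powr (1 / (p - 1)))^2 * e^2 = e powr (2 * p / (p - 1))" by simp
 show "(e powr (1 / (p - 1))) powr (2 * p) = e powr (2 * p / (p - 1))" by (simp add: powr_powr)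
qed

lemma resc_gradient:
 assumes "L2_gradient v G" "e > 0"
 shows "L2_gradient (resc p e b v) (%x. (e powr (1 / (p - 1)) * e) *\<^sub>R G (e *\<^sub>R x + b))"
 using L2_gradient_lincomb[OF L2_gradient_affine[OF assms, of b] L2_gradient_affine[OF assms, of b], of "e powr (1 / (p - 1))" 0]
 by (simp add: resc_def[abs_def])

lemma resc_H1:
 assumes v: "v \<in> H1" and e: "e > 0"
 shows "resc p e b v \<in> H1"
proof -
 have "integrable lborel (%x. (v (e *\<^sub>R x + b))^2)" by (rule integrable_affine[OF H1_D(3)[OF v] e])
 then show ?thesis
  using L2_gradient_imp[OF resc_gradient[OF H1_D(1)[OF v] e, of p b]] by (simp add: H1_iff resc_def power_mult_distrib)
qed

lemma wenergy_resc:
 fixes v :: "real ^ 'n => real"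
 assumes v: "v \<in> H1" and e: "e > 0" and p: "p > 1" and k [measurable]: "k \<in> borel_measurable borel"
 shows "resc_factor p e CARD('n) * wenergy 1 k v = wenergy e (%x. k (e *\<^sub>R x + b)) (resc p e b v)"
proof -
 note [measurable] = H1_D(5,6)[OF v]
 define s where "s = e powr (1 / (p - 1))"
 have "wenergy e (%x. k (e *\<^sub>R x + b)) (resc p e b v) = (LINT x|lborel. k (e *\<^sub>R x + b)
   * ((norm ((s * e) *\<^sub>R weak_grad v (e *\<^sub>R x + b)))^2 + e^2 * (resc p e b v x)^2))"
  unfolding s_def by (rule wenergy_eq[OF resc_gradient[OF H1_D(1)[OF v] e]]) measurable
 also have "... = (LINT x|lborel. (s^2 * e^2) * (k (e *\<^sub>R x + b) * ((norm (weak_grad v (e *\<^sub>R x + b)))^2 + 1^2 * (v (e *\<^sub>R x + b))^2)))"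
  by (intro LINT_cong) (simp_all add: resc_def s_def power_mult_distrib algebra_simps)
 also have "... = (s^2 * e^2) * (LINT x|lborel. k (e *\<^sub>R x + b) * ((norm (weak_grad v (e *\<^sub>R x + b)))^2 + 1^2 * (v (e *\<^sub>R x + b))^2))"
  by simp
 also have "s^2 * e^2 = resc_factor p e CARD('n) * e ^ CARD('n)"
  using e resc_exponents(1)[OF e p] by (simp add: s_def resc_factor_def)
 also have "wenergy 1 k v = e ^ CARD('n) * (LINT x|lborel. k (e *\<^sub>R x + b) * ((norm (weak_grad v (e *\<^sub>R x + b)))^2 + 1^2 * (v (e *\<^sub>R x + b))^2))"
  unfolding wenergy_def by (subst integral_affine[OF _ e, of _ b]) simp_all
 ultimately show ?thesis by simp
qed

lemma wmass_resc:
 fixes v :: "real ^ 'n => real"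
 assumes [measurable]: "v \<in> borel_measurable borel" "k \<in> borel_measurable borel" and e: "e > 0" and p: "p > 1"
 shows "resc_factor p e CARD('n) * wmass k (2 * p) v = wmass (%x. k (e *\<^sub>R x + b)) (2 * p) (resc p e b v)"
proof -
 have "wmass (%x. k (e *\<^sub>R x + b)) (2 * p) (resc p e b v)
   = e powr (2 * p / (p - 1)) * wmass (%x. k (e *\<^sub>R x + b)) (2 * p) (%x. v (e *\<^sub>R x + b))"
  unfolding resc_def[abs_def] wmass_mult using resc_exponents(2)[OF e p] by simp
 also have "wmass k (2 * p) v = e ^ CARD('n) * wmass (%x. k (e *\<^sub>R x + b)) (2 * p) (%x. v (e *\<^sub>R x + b))"
  unfolding wmass_def by (subst integral_affine[OF _ e, of _ b]) simp_all
 ultimately show ?thesis using e by (simp add: resc_factor_def)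
qed

lemma qmass_resc:
 fixes v :: "real ^ 'n => real"
 assumes v: "v \<in> borel_measurable borel" and e: "e > 0" and p: "p > 1"
 shows "resc_factor p e CARD('n) * (LINT x|lborel. m * Q e (x - b) * \<bar>v x\<bar> powr (2 * p)) = qmass p m (resc p e b v)"
proof -
 have "(%x. m * Q e (x - b)) \<in> borel_measurable borel" by measurable
 from wmass_resc[OF v this e p, of b] show ?thesis
  using e by (simp add: wmass_def qmass_def Q_def abs_of_pos)
qed

section \<open>The system: Nehari identities, competitors and limits of the energies\<close>

definition cross_term :: "real => ('l::finite => 'l => real) => ('l => real ^ 'n => real) => 'l => real"
 where "cross_term p lam v i = (\<Sum>j\<in>UNIV - {i}. \<integral>x. lam i j * \<bar>v j x\<bar> powr p * \<bar>v i x\<bar> powr p \<partial>lborel)"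

lemma Nehari_systemD:
 assumes "v \<in> Nehari_system p \<mu> lam y e"
 shows "v i \<in> H1" "nontrivial (v i)"
  "wenergy 1 (%_. 1) (v i) = (LINT x|lborel. \<mu> i * Q e (x - y i) * \<bar>v i x\<bar> powr (2 * p)) + cross_term p lam v i"
 using assms by (auto simp: Nehari_system_def H1_prod_def wenergy_def cross_term_def)

lemma Nehari_energy:
 assumes v: "v \<in> Nehari_system p \<mu> lam y e"
 shows "I_func p \<mu> lam y e v = (1 / 2 - 1 / (2 * p)) * (\<Sum>i\<in>UNIV. wenergy 1 (%_. 1) (v i))"
proof -
 have "(\<Sum>i\<in>UNIV. \<integral>x. \<mu> i * Q e (x - y i) * \<bar>v i x\<bar> powr (2 * p) \<partial>lborel) + (\<Sum>i\<in>UNIV. cross_term p lam v i)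
   = (\<Sum>i\<in>UNIV. wenergy 1 (%_. 1) (v i))"
  by (simp only: Nehari_systemD(3)[OF v] sum.distrib)
 moreover have "I_func p \<mu> lam y e v = 1 / 2 * (\<Sum>i\<in>UNIV. wenergy 1 (%_. 1) (v i))
   - 1 / (2 * p) * ((\<Sum>i\<in>UNIV. \<integral>x. \<mu> i * Q e (x - y i) * \<bar>v i x\<bar> powr (2 * p) \<partial>lborel) + (\<Sum>i\<in>UNIV. cross_term p lam v i))"
  unfolding I_func_def wenergy_def cross_term_def by (simp add: distrib_left)
 ultimately show ?thesis by (simp add: left_diff_distrib)
qed

lemma Nehari_resc:
 fixes v :: "'l::finite => real ^ 'n => real"
 assumes v: "v \<in> Nehari_system p \<mu> lam y e" and lam: "!!i j. i ~= j ==> lam i j < 0" and e: "e > 0" and p: "p > 1"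
 shows "wenergy e (%_. 1) (resc p e (y i) (v i)) <= qmass p (\<mu> i) (resc p e (y i) (v i))"
proof -
 note D = Nehari_systemD[OF v, of i]
 have "cross_term p lam v i <= 0"
  unfolding cross_term_def mult.assoc integral_mult_right_zero using lam
  by (intro sum_nonpos mult_nonpos_nonneg) (auto intro: less_imp_le)
 then have "resc_factor p e CARD('n) * wenergy 1 (%_. 1) (v i)
   <= resc_factor p e CARD('n) * (LINT x|lborel. \<mu> i * Q e (x - y i) * \<bar>v i x\<bar> powr (2 * p))"
  using D(3) resc_factor_pos[OF e] by (intro mult_left_mono) (auto intro: less_imp_le)
 then show ?thesis using wenergy_resc[OF D(1) e p, of "%_. 1"] qmass_resc[OF H1_D(5)[OF D(1)] e p] by simp
qed

text \<open>Competitors with disjoint supports do not see the interaction terms.\<close>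

lemma Nehari_comparison:
 fixes v U :: "'l::finite => real ^ 'n => real"
 assumes min: "attains_inf_on (I_func p \<mu> lam y e) (Nehari_system p \<mu> lam y e) v" and e: "e > 0" and p: "p > 1"
  and U: "!!i. U i \<in> H1" and supp: "!!i x. norm x > R ==> U i x = 0"
  and sep: "!!i j. i ~= j ==> 2 * e * R < dist (y i) (y j)"
  and B: "!!i. qmass p (\<mu> i) (U i) > 0" and E: "!!i. wenergy e (%_. 1) (U i) > 0"
 shows "(\<Sum>i\<in>UNIV. wenergy e (%_. 1) (resc p e (y i) (v i)))
  <= (\<Sum>i\<in>UNIV. wenergy e (%_. 1) (U i) powr (p / (p - 1)) * qmass p (\<mu> i) (U i) powr (- 1 / (p - 1)))"
proof -
 define Ei where "Ei i = wenergy e (%_. 1) (U i)" for i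
 define Bi where "Bi i = qmass p (\<mu> i) (U i)" for i
 have EB: "Ei i > 0" "Bi i > 0" for i using E B by (auto simp: Ei_def Bi_def)
 \<comment> \<open>The positive solution of t^(2p) B = t^2 E, which places each scaled competitor on
   its own Nehari constraint when there is no interaction.\<close>
 define t where "t i = (Ei i / Bi i) powr (1 / (2 * p - 2))" for i
 have t: "t i > 0" for i using EB[of i] by (simp add: t_def)
 have t2: "(t i)^2 = (Ei i / Bi i) powr (1 / (p - 1))" for i
 proof -
  have "(t i)^2 = (Ei i / Bi i) powr (1 / (2 * p - 2) + 1 / (2 * p - 2))"
   unfolding powr_add t_def power2_eq_square ..
  also have "1 / (2 * p - 2) + 1 / (2 * p - 2) = 1 / (p - 1)" using p by (simp add: field_simps)
  finally show ?thesis .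
 qed
 have t2p: "t i powr (2 * p) * Bi i = (t i)^2 * Ei i" for i
 proof -
  have "t i powr (2 * p - 2) = Ei i / Bi i" unfolding t_def powr_powr using p EB[of i] by simp
  then show ?thesis using t[of i] EB[of i] by (simp add: powr_diff field_simps)
 qed
 define s where "s = e powr (1 / (p - 1))"
 have s: "s > 0" using e by (simp add: s_def)
 \<comment> \<open>The inverse of the rescaling around \<open>y i\<close>, applied to
   \<open>t i\<close> times \<open>U i\<close>; the prefactor 1 / s undoes the amplitude.\<close>
 define v' where "v' i x = (t i / s) * U i ((1 / e) *\<^sub>R x + (- (1 / e)) *\<^sub>R y i)" for i x
 have resc: "resc p e (y i) (v' i) = (%x. t i * U i x)" for i
 proof
  fix x
  have "(1 / e) *\<^sub>R (e *\<^sub>R x + y i) + (- (1 / e)) *\<^sub>R y i = x" using e by (simp add: scaleR_add_right)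
  then show "resc p e (y i) (v' i) x = t i * U i x" unfolding resc_def v'_def using s by (simp add: s_def)
 qed
 have v'H: "v' i \<in> H1" for i
 proof -
  have e': "1 / e > 0" using e by simp
  have "integrable lborel (%x. (U i ((1 / e) *\<^sub>R x + (- (1 / e)) *\<^sub>R y i))^2)"
   by (rule integrable_affine[OF H1_D(3)[OF U] e'])
  then have "(%x. U i ((1 / e) *\<^sub>R x + (- (1 / e)) *\<^sub>R y i)) \<in> H1"
   using L2_gradient_imp[OF L2_gradient_affine[OF H1_D(1)[OF U] e', of i "(- (1 / e)) *\<^sub>R y i"]] by (simp add: H1_iff)
  then show ?thesis unfolding v'_def[abs_def] by (rule wenergy_mult(1))
 qed
 let ?k = "resc_factor p e CARD('n)"
 have k: "?k > 0" by (rule resc_factor_pos[OF e])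
 have en: "?k * wenergy 1 (%_. 1) (v' i) = (t i)^2 * Ei i" for i
  using wenergy_resc[OF v'H[of i] e p, of "%_. 1" "y i"] wenergy_mult(2)[OF U[of i], where k="%_. 1" and e=e and t="t i"]
  by (simp add: resc Ei_def)
 have ma: "?k * (LINT x|lborel. \<mu> i * Q e (x - y i) * \<bar>v' i x\<bar> powr (2 * p)) = (t i)^2 * Ei i" for i
  using qmass_resc[OF H1_D(5)[OF v'H[of i]] e p, of "\<mu> i" "y i"] t[of i] t2p[of i]
  by (simp add: resc qmass_mult Bi_def)
 have zero: "v' j x = 0 \<or> v' i x = 0" if "i ~= j" for i j x
 proof (rule ccontr)
  have *: "norm (x - y i) <= e * R" if "v' i x ~= 0" for i
  proof -
   have "norm ((1 / e) *\<^sub>R x + (- (1 / e)) *\<^sub>R y i) <= R" using that supp[of _ i] by (force simp: v'_def not_le[symmetric])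
   moreover have "(1 / e) *\<^sub>R x + (- (1 / e)) *\<^sub>R y i = (1 / e) *\<^sub>R (x - y i)" by (simp add: scaleR_diff_right)
   ultimately have "norm ((1 / e) *\<^sub>R (x - y i)) <= R" by (simp only:)
   then have "norm (x - y i) / e <= R" using e by simp
   then show ?thesis using e by (simp add: field_simps)
  qed
  assume nz: "\<not> (v' j x = 0 \<or> v' i x = 0)"
  have "norm (y i - y j) <= norm (x - y j) + norm (x - y i)"
   using norm_triangle_ineq4[of "x - y j" "x - y i"] by simp
  also have "... <= e * R + e * R" using nz by (intro add_mono *) auto
  finally show False using sep[OF that] unfolding dist_norm by linarith
 qed
 have cross: "cross_term p lam v' i = 0" for i
  unfolding cross_term_def
 proof (intro sum.neutral ballI)
  fix j assume "j \<in> UNIV - {i}"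
  then have "(%x. lam i j * \<bar>v' j x\<bar> powr p * \<bar>v' i x\<bar> powr p) = (%_. 0)" using zero[of i j] by fastforce
  then show "(LINT x|lborel. lam i j * \<bar>v' j x\<bar> powr p * \<bar>v' i x\<bar> powr p) = 0" by simp
 qed
 have nt: "nontrivial (v' i)" for i
  unfolding nontrivial_def
 proof
  assume z: "AE x in lborel. v' i x = 0"
  have "(LINT x|lborel. \<mu> i * Q e (x - y i) * \<bar>v' i x\<bar> powr (2 * p)) = 0"
   by (rule integral_eq_zero_AE) (use z in eventually_elim, simp)
  then show False using ma[of i] t[of i] EB[of i] by simp
 qed
 have v'N: "v' \<in> Nehari_system p \<mu> lam y e"
  unfolding Nehari_system_def
 proof (intro CollectI conjI allI nt)
  show "v' \<in> H1_prod" using v'H by (simp add: H1_prod_def)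
  fix i
  have "wenergy 1 (%_. 1) (v' i) = (LINT x|lborel. \<mu> i * Q e (x - y i) * \<bar>v' i x\<bar> powr (2 * p))"
   by (rule mult_left_cancel[THEN iffD1, OF _ trans[OF en ma[symmetric]]]) (use k in simp)
  then show "(LINT x|lborel. ((norm (weak_grad (v' i) x))^2 + (v' i x)^2)) =
   (LINT x|lborel. \<mu> i * Q e (x - y i) * \<bar>v' i x\<bar> powr (2 * p))
   + (\<Sum>j\<in>UNIV - {i}. \<integral>x. lam i j * \<bar>v' j x\<bar> powr p * \<bar>v' i x\<bar> powr p \<partial>lborel)"
   using cross[of i] by (simp add: wenergy_def cross_term_def)
 qed
 have vN: "v \<in> Nehari_system p \<mu> lam y e" using min by (simp add: attains_inf_on_def)
 have "I_func p \<mu> lam y e v <= I_func p \<mu> lam y e v'" using min v'N by (simp add: attains_inf_on_def)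
 then have "(1 / 2 - 1 / (2 * p)) * (\<Sum>i\<in>UNIV. wenergy 1 (%_. 1) (v i)) <= (1 / 2 - 1 / (2 * p)) * (\<Sum>i\<in>UNIV. wenergy 1 (%_. 1) (v' i))"
  by (simp only: Nehari_energy[OF vN] Nehari_energy[OF v'N])
 moreover have "1 / 2 - 1 / (2 * p) > 0" using p by (simp add: field_simps)
 ultimately have "(\<Sum>i\<in>UNIV. wenergy 1 (%_. 1) (v i)) <= (\<Sum>i\<in>UNIV. wenergy 1 (%_. 1) (v' i))"
  by (simp only: mult_le_cancel_left_pos)
 then have "?k * (\<Sum>i\<in>UNIV. wenergy 1 (%_. 1) (v i)) <= ?k * (\<Sum>i\<in>UNIV. wenergy 1 (%_. 1) (v' i))"
  using k by (intro mult_left_mono) auto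
 then have "(\<Sum>i\<in>UNIV. ?k * wenergy 1 (%_. 1) (v i)) <= (\<Sum>i\<in>UNIV. (t i)^2 * Ei i)"
  by (simp only: sum_distrib_left en)
 moreover have "?k * wenergy 1 (%_. 1) (v i) = wenergy e (%_. 1) (resc p e (y i) (v i))" for i
  using wenergy_resc[OF Nehari_systemD(1)[OF vN] e p, of "%_. 1"] by simp
 moreover have "(t i)^2 * Ei i = Ei i powr (p / (p - 1)) * Bi i powr (- 1 / (p - 1))" for i
 proof -
  have "p / (p - 1) = 1 / (p - 1) + 1" using p by (simp add: field_simps)
  then show ?thesis using EB[of i] by (simp add: t2 powr_mult inverse_powr powr_add powr_minus divide_inverse)
 qed
 ultimately show ?thesis by (simp add: Ei_def Bi_def)
qed

text \<open>The \<open>itself\<close> argument fixes the dimension, which the numerical arguments do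
  not determine. As \<open>Inf\<close> of an empty set carries no information, nonemptiness of the
  constraint accompanies the statements that need a genuine infimum.\<close>

definition limit_level :: "real => real => 'n::finite itself => real"
 where "limit_level p m _ = Inf (dirichlet ` (natural_constraint p m :: (real ^ 'n => real) set))"

lemma limit_level_le:
 fixes u :: "real ^ 'n => real"
 shows "u \<in> natural_constraint p m ==> limit_level p m TYPE('n) <= dirichlet u"
 unfolding limit_level_def by (intro cINF_lower bdd_belowI[where m=0]) auto

text \<open>On an empty constraint every \<open>c\<close> would be a lower bound, and
  \<open>projection_bound\<close> would hold for all \<open>c\<close>; a sufficiently large
  \<open>c\<close> contradicts it.\<close>

lemma natural_constraint_nonempty:
 fixes u :: "real ^ 'n => real"
 assumes N: "CARD('n) >= 3" and p: "p > 1" and m: "m > 0" and u: "u \<in> E_space p" and D: "dirichlet u > 0" and q: "qmass p m u > 0"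
 shows "(natural_constraint p m :: (real ^ 'n => real) set) ~= {}"
proof
 assume "(natural_constraint p m :: (real ^ 'n => real) set) = {}"
 then have "c powr (p - 1) * qmass p m u <= dirichlet u powr p" if "c >= 0" for c
  using projection_bound[OF _ that p m N u D] by blast
 from this[of "((dirichlet u powr p + 1) / qmass p m u) powr (1 / (p - 1))"] p q show False
  by (simp add: powr_powr add_pos_nonneg add_nonneg_pos)
qed

lemma limit_level_pos:
 assumes N: "CARD('n) >= 3" and p: "1 < p" "p < real CARD('n) / (real CARD('n) - 2)" and m: "m > 0"
  and ne: "(natural_constraint p m :: (real ^ 'n => real) set) ~= {}"
 shows "limit_level p m TYPE('n) > 0"
proof -
 obtain k where k: "k > 0" "!!u :: real ^ 'n => real. u \<in> E_space p ==> nontrivial u ==> dirichlet u <= qmass p m u ==> k <= dirichlet u"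
  by (rule dirichlet_lower_bound[OF N p m]) (rule that)
 have "k <= limit_level p m TYPE('n)"
  unfolding limit_level_def by (rule cINF_greatest[OF ne]) (metis (mono_tags, lifting) k(2) mem_Collect_eq natural_constraint_def order_refl)
 then show ?thesis using k(1) by linarith
qed

text \<open>The quotient in the conclusion is invariant under multiplication by constants and agrees
  with the Dirichlet energy on the constraint. Cutoffs of a near-minimizer may therefore leave the
  constraint; continuity of both integrals suffices.\<close>

lemma near_optimal_compact_support:
 assumes N: "CARD('n) >= 3" and p: "1 < p" "p < real CARD('n) / (real CARD('n) - 2)" and m: "m > 0"
  and ne: "(natural_constraint p m :: (real ^ 'n => real) set) ~= {}" and \<eta>: "\<eta> > 0"
 shows "\<exists>(U :: real ^ 'n => real) R. U \<in> H1 \<and> (\<forall>x. norm x > R --> U x = 0) \<and> qmass p m U > 0 \<and> dirichlet U > 0 \<and>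
  dirichlet U powr (p / (p - 1)) * qmass p m U powr (- 1 / (p - 1)) < limit_level p m TYPE('n) + \<eta>"
proof -
 have "limit_level p m TYPE('n) < limit_level p m TYPE('n) + \<eta>" using \<eta> by simp
 then obtain u :: "real ^ 'n => real" where u: "u \<in> natural_constraint p m" "dirichlet u < limit_level p m TYPE('n) + \<eta>"
  unfolding limit_level_def using ne by (subst (asm) cINF_less_iff) (auto intro: bdd_belowI[where m=0])
 define d where "d = dirichlet u"
 have uE: "u \<in> E_space p" and q: "qmass p m u = d" using u(1) by (auto simp: natural_constraint_def d_def)
 have d: "d > 0" using limit_level_pos[OF N p m ne] limit_level_le[OF u(1)] by (simp add: d_def)
 obtain U :: "nat => real ^ 'n => real" where U: "!!n. U n \<in> E_space p" "!!n. integrable lborel (%x. (U n x)^2)"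
  "!!n. \<exists>R. \<forall>x. norm x > R --> U n x = 0"
  "(%n. dirichlet (%x. U n x - u x)) \<longlonglongrightarrow> 0" "(%n. wmass (%_. 1) (2 * p) (%x. U n x - u x)) \<longlonglongrightarrow> 0"
  by (rule cutoff_approximation[OF N p(1) uE]) (rule that)
 have hE: "(%x. U n x - u x) \<in> E_space p" for n
  using E_space_lincomb[OF U(1)[of n] uE _ N, of 1 "-1"] p by simp
 have "(%n. dirichlet (%x. u x + (U n x - u x))) \<longlonglongrightarrow> dirichlet u"
  by (intro dirichlet_perturbation E_spaceD(1)[OF uE] E_spaceD(1)[OF hE] U(4))
 then have 1: "(%n. dirichlet (U n)) \<longlonglongrightarrow> d" by (simp add: d_def)
 have "(%n. qmass p m (%x. u x + (U n x - u x)) - qmass p m u) \<longlonglongrightarrow> 0"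
  unfolding qmass_def
  by (rule wmass_perturbation[where C=m and B="wmass (%_. 1) (2 * p) u", OF weight_measurable weight_bound[OF m] E_spaceD(2)[OF uE] E_spaceD(2)[OF hE] _ _ U(5)])
   (use p in auto)
 then have 2: "(%n. qmass p m (U n)) \<longlonglongrightarrow> d" by (simp add: LIM_zero_iff q)
 have "(%n. dirichlet (U n) powr (p / (p - 1)) * qmass p m (U n) powr (- 1 / (p - 1))) \<longlonglongrightarrow> d powr (p / (p - 1)) * d powr (- 1 / (p - 1))"
  using d by (intro tendsto_intros 1 2) auto
 also have "d powr (p / (p - 1)) * d powr (- 1 / (p - 1)) = d"
 proof -
  have "p / (p - 1) + - 1 / (p - 1) = 1" unfolding add_divide_distrib[symmetric] using p by simp
  then show ?thesis using d by (simp flip: powr_add)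
 qed
 finally have 3: "(%n. dirichlet (U n) powr (p / (p - 1)) * qmass p m (U n) powr (- 1 / (p - 1))) \<longlonglongrightarrow> d" .
 have "\<forall>\<^sub>F n in sequentially. dirichlet (U n) powr (p / (p - 1)) * qmass p m (U n) powr (- 1 / (p - 1)) < limit_level p m TYPE('n) + \<eta>
   \<and> dirichlet (U n) > 0 \<and> qmass p m (U n) > 0"
  using order_tendstoD(2)[OF 3, of "limit_level p m TYPE('n) + \<eta>"] order_tendstoD(1)[OF 1 d] order_tendstoD(1)[OF 2 d] u(2)
  by (auto simp: d_def eventually_conj_iff)
 then obtain n where "dirichlet (U n) powr (p / (p - 1)) * qmass p m (U n) powr (- 1 / (p - 1)) < limit_level p m TYPE('n) + \<eta>"
   "dirichlet (U n) > 0" "qmass p m (U n) > 0"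
  by (auto simp: eventually_sequentially)
 moreover have "U n \<in> H1" using U(2) E_spaceD(1)[OF U(1)] by (simp add: H1_iff)
 ultimately show ?thesis using U(3)[of n] by blast
qed

text \<open>As \<open>qmass\<close> dominates \<open>dirichlet\<close>, the projection inequality
  reduces to c^(p-1) <= \<open>dirichlet u\<close>^(p-1). The function \<open>u\<close> itself shows
  that the constraint is nonempty, so that the level is positive.\<close>

lemma Nehari_nonempty_energy:
 fixes u :: "real ^ 'n => real"
 assumes N: "CARD('n) >= 3" and p: "1 < p" "p < real CARD('n) / (real CARD('n) - 2)" and m: "m > 0"
  and u: "u \<in> H1" and nt: "nontrivial u" and le: "wenergy e (%_. 1) u <= qmass p m u"
 shows "dirichlet u > 0" "dirichlet u <= wenergy e (%_. 1) u" "(natural_constraint p m :: (real ^ 'n => real) set) ~= {}"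
  "limit_level p m TYPE('n) <= dirichlet u"
proof -
 have uE: "u \<in> E_space p" by (rule H1_subset_E_space[OF N p u])
 show de: "dirichlet u <= wenergy e (%_. 1) u" by (simp add: wenergy_H1[OF u])
 then have dq: "dirichlet u <= qmass p m u" using le by linarith
 obtain k where k: "k > 0" "!!u :: real ^ 'n => real. u \<in> E_space p ==> nontrivial u ==> dirichlet u <= qmass p m u ==> k <= dirichlet u"
  by (rule dirichlet_lower_bound[OF N p m]) (rule that)
 show d: "dirichlet u > 0" using k(1) k(2)[OF uE nt dq] by linarith
 show ne: "(natural_constraint p m :: (real ^ 'n => real) set) ~= {}"
  by (rule natural_constraint_nonempty[OF N p(1) m uE d]) (use d dq in linarith)
 define c where "c = limit_level p m TYPE('n)"
 have c: "c > 0" unfolding c_def by (rule limit_level_pos[OF N p m ne])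
 have "c powr (p - 1) * qmass p m u <= dirichlet u powr p"
  by (rule projection_bound[OF _ _ p(1) m N uE d]) (use c limit_level_le in \<open>auto simp: c_def\<close>)
 moreover have "c powr (p - 1) * dirichlet u <= c powr (p - 1) * qmass p m u" using dq by (intro mult_left_mono) auto
 ultimately have "c powr (p - 1) * dirichlet u <= dirichlet u powr (p - 1) * dirichlet u" using d by (simp add: powr_diff)
 then have "c powr (p - 1) <= dirichlet u powr (p - 1)" using d by simp
 then have "(c powr (p - 1)) powr (1 / (p - 1)) <= (dirichlet u powr (p - 1)) powr (1 / (p - 1))"
  using p by (intro powr_mono2[OF _ powr_ge_zero]) auto
 then show "limit_level p m TYPE('n) <= dirichlet u" using c d p by (simp add: powr_powr c_def)
qed

lemma nontrivial_resc:
 fixes v :: "real ^ 'n => real"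
 assumes v: "v \<in> H1" and nt: "nontrivial v" and e: "e > 0" and p: "p > 1" and E: "v \<in> Lq (2 * p)"
 shows "nontrivial (resc p e b v)"
 unfolding nontrivial_def
proof
 assume z: "AE x in lborel. resc p e b v x = 0"
 have "wmass (%x. 1) (2 * p) (resc p e b v) = 0"
  unfolding wmass_def by (rule integral_eq_zero_AE) (use z in eventually_elim, simp)
 then have "wmass (%_. 1) (2 * p) v = 0"
  using wmass_resc[OF H1_D(5)[OF v], of "%_. 1" e p b] e p resc_factor_pos[OF e, of p "CARD('n)"] by simp
 then show False using AE_zero_of_wmass_zero[OF E] nt by (simp add: nontrivial_def)
qed

text \<open>Lower bounds hold for each component, upper bounds only for the sum; finitely many terms
  make the sum enough. The Dirichlet part of each component is squeezed between its level and its
  full energy, which forces the mass term to 0.\<close>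

lemma rescaled_energy_limits:
 fixes v :: "nat => 'l::finite => real ^ 'n => real"
 assumes N: "CARD('n) >= 3" and p: "1 < p" "p < real CARD('n) / (real CARD('n) - 2)" and m: "!!i. \<mu> i > 0"
  and lam: "!!i j. i ~= j ==> lam i j < 0" and y: "!!i j. i ~= j ==> y i ~= y j"
  and e: "!!n. e n > 0" and e0: "e \<longlonglongrightarrow> 0"
  and min: "!!n. attains_inf_on (I_func p \<mu> lam y (e n)) (Nehari_system p \<mu> lam y (e n)) (v n)"
 defines "w \<equiv> %n i. resc p (e n) (y i) (v n i)" and "c \<equiv> %i. limit_level p (\<mu> i) TYPE('n)"
 shows "w n i \<in> H1" "dirichlet (w n i) <= qmass p (\<mu> i) (w n i)" "c i > 0"
  "(%n. dirichlet (w n i)) \<longlonglongrightarrow> c i" "(%n. (e n)^2 * (LINT x|lborel. (w n i x)^2)) \<longlonglongrightarrow> 0"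
proof -
 have vN: "v n \<in> Nehari_system p \<mu> lam y (e n)" for n using min[of n] by (simp add: attains_inf_on_def)
 note D = Nehari_systemD[OF vN]
 show wH: "w n i \<in> H1" for n i unfolding w_def by (rule resc_H1[OF D(1) e])
 define b where "b n i = wenergy (e n) (%_. 1) (w n i)" for n i
 have bq: "b n i <= qmass p (\<mu> i) (w n i)" for n i
  unfolding b_def w_def by (rule Nehari_resc[OF vN lam e p(1)])
 have nt: "nontrivial (w n i)" for n i
  unfolding w_def by (rule nontrivial_resc[OF D(1) D(2) e p(1) E_spaceD(2)[OF H1_subset_E_space[OF N p D(1)]]])
 note NE = Nehari_nonempty_energy[OF N p m wH nt bq[unfolded b_def]]
 have ab: "dirichlet (w n i) <= b n i" for n i unfolding b_def by (rule NE(2))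
 show "dirichlet (w n i) <= qmass p (\<mu> i) (w n i)" for n i using ab[of n i] bq[of n i] by linarith
 have ne: "(natural_constraint p (\<mu> i) :: (real ^ 'n => real) set) ~= {}" for i by (rule NE(3))
 show c: "c i > 0" for i unfolding c_def by (rule limit_level_pos[OF N p m ne])
 have ca: "c i <= dirichlet (w n i)" for n i unfolding c_def by (rule NE(4))
 have up: "\<forall>\<^sub>F n in sequentially. (\<Sum>i\<in>UNIV. b n i) < (\<Sum>i\<in>UNIV. c i) + \<eta>" if \<eta>: "\<eta> > 0" for \<eta>
 proof -
  define \<eta>' where "\<eta>' = \<eta> / real CARD('l)"
  have \<eta>': "\<eta>' > 0" using \<eta> by (simp add: \<eta>'_def)
  obtain U :: "'l => real ^ 'n => real" and R' where U: "!!i. U i \<in> H1" "!!i x. norm x > R' i ==> U i x = 0"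
   "!!i. qmass p (\<mu> i) (U i) > 0" "!!i. dirichlet (U i) > 0"
   "!!i. dirichlet (U i) powr (p / (p - 1)) * qmass p (\<mu> i) (U i) powr (- 1 / (p - 1)) < c i + \<eta>'"
   using near_optimal_compact_support[OF N p m ne \<eta>'] unfolding c_def by metis
  define R where "R = Max (range R')"
  have R: "R' i <= R" for i unfolding R_def by (intro Max_ge) auto
  have supp: "U i x = 0" if "norm x > R" for i x using U(2)[of i x] R[of i] that by linarith
  define F where "F n i = wenergy (e n) (%_. 1) (U i) powr (p / (p - 1)) * qmass p (\<mu> i) (U i) powr (- 1 / (p - 1))" for n i
  have "(%n. wenergy (e n) (%_. 1) (U i)) \<longlonglongrightarrow> dirichlet (U i) + 0^2 * (LINT x|lborel. (U i x)^2)" for i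
   unfolding wenergy_H1[OF U(1)] by (intro tendsto_intros e0)
  then have "(%n. F n i) \<longlonglongrightarrow> (dirichlet (U i) + 0^2 * (LINT x|lborel. (U i x)^2)) powr (p / (p - 1)) * qmass p (\<mu> i) (U i) powr (- 1 / (p - 1))" for i
   unfolding F_def by (rule tendsto_mult[OF tendsto_powr tendsto_const]) (use U(4)[of i] in auto)
  then have "(%n. F n i) \<longlonglongrightarrow> dirichlet (U i) powr (p / (p - 1)) * qmass p (\<mu> i) (U i) powr (- 1 / (p - 1))" for i by simp
  from order_tendstoD(2)[OF this U(5)] have "\<forall>\<^sub>F n in sequentially. F n i < c i + \<eta>'" for i .
  then have F: "\<forall>\<^sub>F n in sequentially. \<forall>i. F n i < c i + \<eta>'" by (rule eventually_all_finite)
  have "(%n. 2 * e n * R) \<longlonglongrightarrow> 2 * 0 * R" by (intro tendsto_intros e0)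
  then have "\<forall>\<^sub>F n in sequentially. 2 * e n * R < dist (y i) (y j)" if "i ~= j" for i j
   using y[OF that] by (intro order_tendstoD(2)) auto
  then have "\<forall>\<^sub>F n in sequentially. i ~= j --> 2 * e n * R < dist (y i) (y j)" for i j
   by (cases "i = j") auto
  then have S: "\<forall>\<^sub>F n in sequentially. \<forall>i j. i ~= j --> 2 * e n * R < dist (y i) (y j)"
   by (intro eventually_all_finite)
  from F S show ?thesis
  proof eventually_elim
   case (elim n)
   have E: "wenergy (e n) (%_. 1) (U i) > 0" for i
    unfolding wenergy_H1[OF U(1)] using U(4)[of i] by (simp add: add_pos_nonneg)
   have "(\<Sum>i\<in>UNIV. b n i) <= (\<Sum>i\<in>UNIV. F n i)"
    unfolding b_def w_def F_def
    by (rule Nehari_comparison[OF min e p(1) U(1) supp _ U(3) E]) (use elim(2) in auto)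
   also have "... < (\<Sum>i\<in>UNIV. c i + \<eta>')" using elim(1) by (intro sum_strict_mono) auto
   also have "... = (\<Sum>i\<in>UNIV. c i) + \<eta>" by (simp add: sum.distrib \<eta>'_def)
   finally show ?case .
  qed
 qed
 have b_lim: "(%n. b n i) \<longlonglongrightarrow> c i" for i
 proof (rule LIMSEQ_I)
  fix \<eta> :: real assume "\<eta> > 0"
  from up[OF this] obtain n0 where n0: "!!n. n >= n0 ==> (\<Sum>i\<in>UNIV. b n i) < (\<Sum>i\<in>UNIV. c i) + \<eta>"
   by (auto simp: eventually_sequentially)
  have cb: "c i <= b n i" for n i using ca[of i n] ab[of n i] by linarith
  have "norm (b n i - c i) < \<eta>" if "n >= n0" for n
  proof -
   \<comment> \<open>Every component has nonnegative excess over its own level, so one excess is at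
     most the total excess.\<close>
   have "b n i - c i <= (\<Sum>i\<in>UNIV. b n i - c i)" using cb by (intro member_le_sum) auto
   also have "... < \<eta>" using n0[OF that] by (simp add: sum_subtractf)
   finally show ?thesis using cb[of i n] by simp
  qed
  then show "\<exists>n0. \<forall>n\<ge>n0. norm (b n i - c i) < \<eta>" by blast
 qed
 show a_lim: "(%n. dirichlet (w n i)) \<longlonglongrightarrow> c i" for i
  by (rule tendsto_sandwich[OF _ _ tendsto_const b_lim]) (use ca ab in auto)
 have "(%n. b n i - dirichlet (w n i)) \<longlonglongrightarrow> c i - c i" for i by (intro tendsto_diff b_lim a_lim)
 then show "(%n. (e n)^2 * (LINT x|lborel. (w n i x)^2)) \<longlonglongrightarrow> 0" for i by (simp add: b_def wenergy_H1[OF wH])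
qed

section \<open>Concentration and the conclusion\<close>

lemma tail_integral_tendsto_0:
 fixes h :: "real ^ 'n => real"
 assumes h: "integrable lborel h" and e: "!!n. e n > 0" and e0: "e \<longlonglongrightarrow> 0" and d: "d > 0"
 shows "(%n. \<integral>x. indicator (- cball 0 (d / e n)) x * h x \<partial>lborel) \<longlonglongrightarrow> 0"
proof -
 have [measurable]: "h \<in> borel_measurable borel" using h by auto
 have "(%n. \<integral>x. indicator (- cball 0 (d / e n)) x * h x \<partial>lborel) \<longlonglongrightarrow> (\<integral>x. 0 \<partial>(lborel :: (real ^ 'n) measure))"
 proof (rule integral_dominated_convergence[where w="%x. \<bar>h x\<bar>"])
  show "AE x in lborel. (%n. indicator (- cball 0 (d / e n)) x * h x) \<longlonglongrightarrow> 0"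
  proof (intro AE_I2)
   fix x :: "real ^ 'n"
   have "(%n. e n * norm x) \<longlonglongrightarrow> 0 * norm x" by (intro tendsto_intros e0)
   then have "\<forall>\<^sub>F n in sequentially. e n * norm x < d" using d by (intro order_tendstoD(2)) auto
   then have "\<forall>\<^sub>F n in sequentially. indicator (- cball 0 (d / e n)) x * h x = 0"
   proof eventually_elim
    case (elim n)
    then have "norm x <= d / e n" using e[of n] by (simp add: field_simps)
    then show ?case by simp
   qed
   then show "(%n. indicator (- cball 0 (d / e n)) x * h x) \<longlonglongrightarrow> 0" by (rule tendsto_eventually)
  qed
  show "integrable lborel (%x. \<bar>h x\<bar>)" using h by simp
 qed (auto simp: indicator_def)
 then show ?thesis by simp
qed

lemma ratio_tendsto_1:
 fixes S T R :: "nat => real"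
 assumes T: "T \<longlonglongrightarrow> c" and c: "c > 0" and S: "!!n. T n = S n + R n" and R0: "!!n. 0 <= R n" and RB: "!!n. R n <= B n" and B: "B \<longlonglongrightarrow> 0"
 shows "(%n. S n / T n) \<longlonglongrightarrow> 1"
proof -
 have "R \<longlonglongrightarrow> 0" by (rule tendsto_sandwich[OF _ _ tendsto_const B]) (use R0 RB in auto)
 then have "(%n. (T n - R n) / T n) \<longlonglongrightarrow> (c - 0) / c" using c by (intro tendsto_intros T) auto
 then show ?thesis using c by (simp add: S)
qed

text \<open>In rescaled variables the ball has radius \<open>d / e n\<close>, which grows without
  bound. Outside it the energy is at most twice the energy of the difference to \<open>w\<close>,
  twice the tail of \<open>w\<close>, and the whole mass term; all three vanish in the
  limit.\<close>

lemma energy_concentration: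
 fixes f :: "nat => real ^ 'n => real"
 assumes f: "!!n. f n \<in> H1" and w: "has_L2_gradient w" and conv: "(%n. dirichlet (%x. f n x - w x)) \<longlonglongrightarrow> 0"
  and e: "!!n. e n > 0" and e0: "e \<longlonglongrightarrow> 0" and d: "d > 0"
  and z: "(%n. (e n)^2 * (LINT x|lborel. (f n x)^2)) \<longlonglongrightarrow> 0" and w0: "dirichlet w > 0"
 shows "(%n. wenergy (e n) (indicator (cball 0 (d / e n))) (f n) / wenergy (e n) (%_. 1) (f n)) \<longlonglongrightarrow> 1"
proof -
 define G where "G = weak_grad w"
 have wG: "L2_gradient w G" unfolding G_def by (rule L2_gradient_weak_grad[OF w])
 have hL: "has_L2_gradient (%x. f n x - w x)" for n using dirichlet_lincomb(1)[OF H1_D(2)[OF f[of n]] w, of 1 "-1"] by simp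
 define D where "D n = weak_grad (%x. f n x - w x)" for n
 have hD: "L2_gradient (%x. f n x - w x) (D n)" for n unfolding D_def by (rule L2_gradient_weak_grad[OF hL])
 have fG: "L2_gradient (f n) (%x. D n x + G x)" for n using L2_gradient_lincomb[OF hD[of n] wG, of 1 1] by simp
 note [measurable] = L2_gradientD(4,5)[OF wG] L2_gradientD(5)[OF hD] H1_D(5)[OF f]
 define C where "C n = cball (0 :: real ^ 'n) (d / e n)" for n
 have [measurable]: "C n \<in> sets borel" for n by (simp add: C_def)
 define g where "g n x = (norm (D n x + G x))^2 + (e n)^2 * (f n x)^2" for n x
 have ig: "integrable lborel (g n)" for n
  unfolding g_def using L2_gradientD(2)[OF fG] H1_D(3)[OF f] by simp
 have k: "wenergy (e n) k (f n) = (LINT x|lborel. k x * g n x)" if "k \<in> borel_measurable borel" for k n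
  unfolding g_def by (rule wenergy_eq[OF fG that])
 have iS: "integrable lborel (%x. indicator S x * g n x)" if "S \<in> sets borel" for S n
  using integrable_mult_indicator[of S lborel "g n"] ig that by simp
 show ?thesis
 proof (rule ratio_tendsto_1[where R="%n. \<integral>x. indicator (- C n) x * g n x \<partial>lborel"
    and B="%n. 2 * dirichlet (%x. f n x - w x) + 2 * (LINT x|lborel. indicator (- cball 0 (d / e n)) x * (norm (G x))^2)
     + (e n)^2 * (LINT x|lborel. (f n x)^2)"])
  have "(%n. dirichlet (%x. w x + (f n x - w x))) \<longlonglongrightarrow> dirichlet w" by (rule dirichlet_perturbation[OF w hL conv])
  from tendsto_add[OF this z] show "(%n. wenergy (e n) (%_. 1) (f n)) \<longlonglongrightarrow> dirichlet w"
   by (simp add: wenergy_H1[OF f])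
  show "wenergy (e n) (%_. 1) (f n) = wenergy (e n) (indicator (cball 0 (d / e n))) (f n) + (LINT x|lborel. indicator (- C n) x * g n x)" for n
  proof -
   have "1 * g n x = indicator (C n) x * g n x + indicator (- C n) x * g n x" for x by (simp add: indicator_def)
   then have "(LINT x|lborel. 1 * g n x) = (LINT x|lborel. indicator (C n) x * g n x + indicator (- C n) x * g n x)" by (simp only:)
   also have "... = (LINT x|lborel. indicator (C n) x * g n x) + (LINT x|lborel. indicator (- C n) x * g n x)"
    by (intro LINT_add iS) auto
   finally show ?thesis by (simp add: k C_def)
  qed
  show "0 <= (LINT x|lborel. indicator (- C n) x * g n x)" for n by (simp add: g_def)
  have iG: "integrable lborel (%x. indicator (- C n) x * (norm (G x))^2)" for n
   using integrable_mult_indicator[of "- C n" lborel "%x. (norm (G x))^2"] L2_gradientD(2)[OF wG] by simp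
  show "(LINT x|lborel. indicator (- C n) x * g n x) <= 2 * dirichlet (%x. f n x - w x)
    + 2 * (LINT x|lborel. indicator (- cball 0 (d / e n)) x * (norm (G x))^2) + (e n)^2 * (LINT x|lborel. (f n x)^2)" for n
  proof -
   note i = L2_gradientD(2)[OF hD[of n]] H1_D(3)[OF f[of n]] iG[of n]
   have "(LINT x|lborel. indicator (- C n) x * g n x)
     <= (LINT x|lborel. 2 * (norm (D n x))^2 + 2 * (indicator (- C n) x * (norm (G x))^2) + (e n)^2 * (f n x)^2)"
   proof (rule LINT_mono[OF iS])
    fix x
    have "(norm (D n x + G x))^2 <= (norm (D n x) + norm (G x))^2" by (intro power_mono norm_triangle_ineq) auto
    also have "... <= 2 * (norm (D n x))^2 + 2 * (norm (G x))^2"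
     using sum_squares_bound[of "norm (D n x)" "norm (G x)"] by (simp add: power2_sum)
    finally show "indicator (- C n) x * g n x <= 2 * (norm (D n x))^2 + 2 * (indicator (- C n) x * (norm (G x))^2) + (e n)^2 * (f n x)^2"
     by (simp add: g_def indicator_def)
   qed (use i in auto)
   also have "... = 2 * dirichlet (%x. f n x - w x) + 2 * (LINT x|lborel. indicator (- C n) x * (norm (G x))^2) + (e n)^2 * (LINT x|lborel. (f n x)^2)"
    unfolding dirichlet_eq[OF hD] using i by simp
   finally show ?thesis by (simp add: C_def)
  qed
  show "(%n. 2 * dirichlet (%x. f n x - w x) + 2 * (LINT x|lborel. indicator (- cball 0 (d / e n)) x * (norm (G x))^2)
     + (e n)^2 * (LINT x|lborel. (f n x)^2)) \<longlonglongrightarrow> 0"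
   using tendsto_add[OF tendsto_add[OF tendsto_mult_left[OF conv, of 2]
    tendsto_mult_left[OF tail_integral_tendsto_0[OF L2_gradientD(2)[OF wG] e e0 d], of 2]] z] by simp
 qed (rule w0)
qed

lemma mass_concentration:
 fixes f :: "nat => real ^ 'n => real"
 assumes f: "!!n. f n \<in> Lq q" and w: "w \<in> Lq q" and q: "q > 1" and conv: "(%n. wmass (%_. 1) q (%x. f n x - w x)) \<longlonglongrightarrow> 0"
  and e: "!!n. e n > 0" and e0: "e \<longlonglongrightarrow> 0" and d: "d > 0" and nt: "nontrivial w"
 shows "(%n. wmass (indicator (cball 0 (d / e n))) q (f n) / wmass (%_. 1) q (f n)) \<longlonglongrightarrow> 1"
proof -
 have h: "(%x. f n x - w x) \<in> Lq q" for n using Lq_lincomb[OF f[of n] w, of 1 "-1"] q by simp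
 define C where "C n = cball (0 :: real ^ 'n) (d / e n)" for n
 have CB: "C n \<in> sets borel" "- C n \<in> sets borel" for n by (auto simp: C_def)
 have i: "integrable lborel (%x. indicator S x * \<bar>u x\<bar> powr q)" if "u \<in> Lq q" "S \<in> sets borel" for u and S :: "(real ^ 'n) set"
  by (rule wmass_integrable[OF indicator_weight that(1)]) (rule that(2))
 show ?thesis
 proof (rule ratio_tendsto_1[where R="%n. wmass (indicator (- C n)) q (f n)"
    and B="%n. 2 powr q * ((LINT x|lborel. indicator (- cball 0 (d / e n)) x * \<bar>w x\<bar> powr q) + wmass (%_. 1) q (%x. f n x - w x))"])
  have "(%n. wmass (%_. 1) q (%x. w x + (f n x - w x)) - wmass (%_. 1) q w) \<longlonglongrightarrow> 0"
   by (rule wmass_perturbation[where C=1 and B="wmass (%_. 1) q w", OF _ _ w h q _ conv]) auto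
  then show "(%n. wmass (%_. 1) q (f n)) \<longlonglongrightarrow> wmass (%_. 1) q w" by (simp add: LIM_zero_iff)
  have "wmass (%_. 1) q w ~= 0" using AE_zero_of_wmass_zero[OF w] nt by (auto simp: nontrivial_def)
  then show "wmass (%_. 1) q w > 0" using wmass_nonneg[of "%_. 1" q w] by simp
  show "wmass (%_. 1) q (f n) = wmass (indicator (cball 0 (d / e n))) q (f n) + wmass (indicator (- C n)) q (f n)" for n
  proof -
   have "1 * \<bar>f n x\<bar> powr q = indicator (C n) x * \<bar>f n x\<bar> powr q + indicator (- C n) x * \<bar>f n x\<bar> powr q" for x by (simp add: indicator_def)
   then show ?thesis
    unfolding wmass_def C_def[symmetric] using LINT_add[OF i[OF f CB(1)] i[OF f CB(2)]] by (simp only:)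
  qed
  show "0 <= wmass (indicator (- C n)) q (f n)" for n by (rule wmass_nonneg) simp
  show "wmass (indicator (- C n)) q (f n) <= 2 powr q * ((LINT x|lborel. indicator (- cball 0 (d / e n)) x * \<bar>w x\<bar> powr q) + wmass (%_. 1) q (%x. f n x - w x))" for n
  proof -
   note ii = i[OF w CB(2), of n] LqD(2)[OF h[of n]]
   have "wmass (indicator (- C n)) q (f n) <= (LINT x|lborel. 2 powr q * (indicator (- C n) x * \<bar>w x\<bar> powr q + \<bar>f n x - w x\<bar> powr q))"
    unfolding wmass_def
   proof (rule LINT_mono[OF i[OF f CB(2)]])
    fix x
    have "\<bar>f n x\<bar> powr q <= (\<bar>w x\<bar> + \<bar>f n x - w x\<bar>) powr q" using q by (intro powr_mono2) auto
    also have "... <= 2 powr q * (\<bar>w x\<bar> powr q + \<bar>f n x - w x\<bar> powr q)" using q by (intro powr_add_le) auto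
    finally show "indicator (- C n) x * \<bar>f n x\<bar> powr q <= 2 powr q * (indicator (- C n) x * \<bar>w x\<bar> powr q + \<bar>f n x - w x\<bar> powr q)"
     by (simp add: indicator_def)
   qed (use ii in auto)
   then show ?thesis using ii by (simp add: wmass_def C_def)
  qed
  show "(%n. 2 powr q * ((LINT x|lborel. indicator (- cball 0 (d / e n)) x * \<bar>w x\<bar> powr q) + wmass (%_. 1) q (%x. f n x - w x))) \<longlonglongrightarrow> 0"
   using tail_integral_tendsto_0[OF LqD(2)[OF w] e e0 d] conv by (auto intro!: tendsto_eq_intros)
 qed
qed

lemma tendsto_in_E_I:
 assumes "!!n. f n \<in> E_space p" "w \<in> E_space p" and p: "p > 1"
  and "(%n. dirichlet (%x. f n x - w x)) \<longlonglongrightarrow> 0" "(%n. wmass (%_. 1) (2 * p) (%x. f n x - w x)) \<longlonglongrightarrow> 0"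
 shows "tendsto_in_E p f w"
proof -
 have "(%n. Lq_norm (2 * p) (%x. f n x - w x)) \<longlonglongrightarrow> 0"
  using tendsto_zero_powrI[OF assms(5) tendsto_const[of "1 / (2 * p)"]] p by (simp add: Lq_norm_def wmass_def)
 then have "(%n. sqrt (dirichlet (%x. f n x - w x) + (Lq_norm (2 * p) (%x. f n x - w x))^2)) \<longlonglongrightarrow> sqrt (0 + 0^2)"
  by (intro tendsto_intros assms(4))
 then show ?thesis using assms(1,2) by (simp add: tendsto_in_E_def E_norm_eq fun_diff_def)
qed

lemma cball_resc:
 fixes b :: "real ^ 'n"
 assumes "e > 0"
 shows "(indicator (cball 0 (d / e)) :: real ^ 'n => real) = (%x. indicator (cball b d) (e *\<^sub>R x + b))"
 using assms by (auto simp: indicator_def dist_norm field_simps)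

text \<open>Affine changes of variables preserve null sets, here seen by transforming the integral
  of the indicator of the set where \<open>v\<close> is negative.\<close>

lemma AE_nonneg_resc:
 fixes v :: "real ^ 'n => real"
 assumes [measurable]: "v \<in> borel_measurable borel" and v: "AE x in lborel. 0 <= v x" and e: "e > 0"
 shows "AE x in lborel. 0 <= resc p e b v x"
proof -
 have "(\<integral>\<^sup>+x. indicator {x. v x < 0} x \<partial>lborel) = 0"
  by (rule nn_integral_0_iff_AE[THEN iffD2]) (use v in \<open>auto simp: indicator_def not_less\<close>)
 then have "(\<integral>\<^sup>+x. indicator {x. v x < 0} (e *\<^sub>R x + b) \<partial>lborel) = 0"
  using nn_integral_affine[of "indicator {x. v x < 0}" e b] e by simp
 then have "AE x in lborel. indicator {x. v x < 0} (e *\<^sub>R x + b) = (0 :: ennreal)"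
  by (subst (asm) nn_integral_0_iff_AE) auto
 then show ?thesis by eventually_elim (auto simp: resc_def indicator_def not_less split: if_splits)
qed

lemma ratio_scale: "k * a = A ==> k * b = B ==> k > 0 ==> a / b = A / B" for k :: real
 by auto

theorem theorem1p2:
  fixes p :: real
    and y :: "'l::finite \<Rightarrow> real ^ 'n"
    and \<mu> :: "'l \<Rightarrow> real"
    and lam :: "'l \<Rightarrow> 'l \<Rightarrow> real"
    and eps :: "nat \<Rightarrow> real"
    and v :: "nat \<Rightarrow> 'l \<Rightarrow> real ^ 'n \<Rightarrow> real"
    and w_resc :: "nat \<Rightarrow> 'l \<Rightarrow> real ^ 'n \<Rightarrow> real"
  assumes "CARD('n) \<ge> 3"
    and "1 < p" and "p < real CARD('n) / (real CARD('n) - 2)"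
    and "\<And>i. \<mu> i > 0"
    and "\<And>i j. i \<noteq> j \<Longrightarrow> lam i j = lam j i"
    and "\<And>i j. i \<noteq> j \<Longrightarrow> lam i j < 0"
    and "\<And>i j. i \<noteq> j \<Longrightarrow> y i \<noteq> y j"
    and "\<And>n. eps n > 0" and "eps \<longlonglongrightarrow> 0"
    and "\<And>n. least_energy_system p \<mu> lam y (eps n) (v n)"
    and "\<And>n i. AE x in lborel. 0 \<le> v n i x"
    and "\<And>n i x. w_resc n i x = eps n powr (1 / (p - 1)) * v n i (eps n *\<^sub>R x + y i)"
  shows "\<exists>r w. strict_mono (r :: nat \<Rightarrow> nat) \<and>
    (\<forall>i. tendsto_in_E p (\<lambda>n. w_resc (r n) i) (w i) \<and>
      least_energy_limit p (\<mu> i) (w i) \<and> (AE x in lborel. 0 < w i x)) \<and>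
    (\<forall>\<delta>>0. \<forall>i.
      (\<lambda>n. (LINT x:cball (y i) \<delta>|lborel. ((norm (weak_grad (v (r n) i) x))\<^sup>2 + (v (r n) i x)\<^sup>2))
           / (LINT x|lborel. ((norm (weak_grad (v (r n) i) x))\<^sup>2 + (v (r n) i x)\<^sup>2)))
        \<longlonglongrightarrow> 1 \<and>
      (\<lambda>n. (LINT x:cball (y i) \<delta>|lborel. \<bar>v (r n) i x\<bar> powr (2 * p))
           / (LINT x|lborel. \<bar>v (r n) i x\<bar> powr (2 * p))) \<longlonglongrightarrow> 1)"
proof -
 note N = assms(1) and p = assms(2,3) and m = assms(4) and lam = assms(6) and y = assms(7) and e = assms(8) and e0 = assms(9)
 define w where "w n i = resc p (eps n) (y i) (v n i)" for n i
 have w_eq: "w_resc n i = w n i" for n i by (rule ext) (simp add: w_def resc_def assms(12))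
 define c where "c i = limit_level p (\<mu> i) TYPE('n)" for i
 have min: "attains_inf_on (I_func p \<mu> lam y (eps n)) (Nehari_system p \<mu> lam y (eps n)) (v n)" for n
  using assms(10)[of n] by (simp add: least_energy_system_def)
 have vH: "v n i \<in> H1" for n i using min[of n] by (auto simp: attains_inf_on_def intro: Nehari_systemD(1))
 note L = rescaled_energy_limits[OF N p m lam y e e0 min, folded w_def, folded c_def]
 have wE: "w n i \<in> E_space p" for n i by (rule H1_subset_E_space[OF N p L(1)])
 define P where "P = 2 * real CARD('n) / (real CARD('n) - 2)"
 have P: "2 * p < P" unfolding P_def by (rule subcritical_exponent) (use N p in auto)
 obtain C where C: "C > 0" "!!u :: real ^ 'n => real. u \<in> H1 ==> u \<in> Lq P \<and> (LINT x|lborel. \<bar>u x\<bar> powr P) <= C * dirichlet u powr (P / 2)"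
  by (rule Sobolev_H1[OF N]) (rule that, assumption, unfold P_def)
 have "\<exists>A. \<forall>n. dirichlet (w n i) <= A" for i
  using Bseq_conv_Bfun convergent_imp_Bseq[OF convergentI[OF L(4)[of i]]] by (auto simp: Bseq_def)
 then obtain A' where A': "!!i n. dirichlet (w n i) <= A' i" by metis
 define A where "A = Max (range A')"
 have A: "dirichlet (w n i) <= A" for n i
  unfolding A_def by (rule order_trans[OF A' Max_ge]) auto
 define B where "B = C * A powr (P / 2)"
 have B: "(LINT x|lborel. \<bar>w n i x\<bar> powr P) <= B" for n i
 proof -
  have "dirichlet (w n i) powr (P / 2) <= A powr (P / 2)" using A P p by (intro powr_mono2) auto
  then show ?thesis unfolding B_def using C(2)[OF L(1)[of n i]] C(1) by (meson mult_left_mono less_imp_le order_trans)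
 qed
 \<comment> \<open>The bounds \<open>A\<close> and \<open>B\<close> are uniform over the finitely
   many components, so compactness is applied to the whole family and yields one subsequence for all
   of them.\<close>
 obtain r :: "nat => nat" where r: "strict_mono r" and loc: "!!i e. e > 0 ==> \<exists>n0. \<forall>k\<ge>n0. \<forall>n\<ge>n0.
  (\<integral>\<^sup>+x. ennreal (\<bar>w (r k) i x - w (r n) i x\<bar> powr (2 * p)) * indicator (ball 0 1) x \<partial>lborel) <= ennreal e"
 proof (rule local_compactness[of w "%n i. weak_grad (w n i)" A "2 * p" P B])
  show "L2_gradient (w n i) (weak_grad (w n i))" for n i by (rule H1_D(1)[OF L(1)])
  show "(LINT x|lborel. (norm (weak_grad (w n i) x))^2) <= A" for n i using A by (simp add: dirichlet_def)
  show "integrable lborel (%x. \<bar>w n i x\<bar> powr P)" for n i using C(2)[OF L(1)] LqD(2) by blast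
 qed (use p P B in auto)
 have sub: "(%n. X (r n)) \<longlonglongrightarrow> l" if "X \<longlonglongrightarrow> l" for X :: "nat => real" and l
  using LIMSEQ_subseq_LIMSEQ[OF that r] by (simp add: o_def)
 have lb: "c i <= dirichlet u" if "u \<in> natural_constraint p (\<mu> i)" for i and u :: "real ^ 'n => real"
  unfolding c_def by (rule limit_level_le[OF that])
 have "\<exists>W. W \<in> natural_constraint p (\<mu> i) \<and> dirichlet W = c i \<and>
  (%n. dirichlet (%x. w (r n) i x - W x)) \<longlonglongrightarrow> 0 \<and> (%n. wmass (%_. 1) (2 * p) (%x. w (r n) i x - W x)) \<longlonglongrightarrow> 0 \<and>
  ((\<forall>n. AE x in lborel. 0 <= w (r n) i x) --> (AE x in lborel. 0 <= W x))" for i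
 proof (rule minimizing_sequence_converges[OF N p(1) m lb L(3) wE[of "r n" for n]])
  have k: "dirichlet u > 0" if "u \<in> E_space p" "qmass p (\<mu> i) u > 0" for u :: "real ^ 'n => real"
   by (rule dirichlet_lower_bound[OF N p m[of i]]) (use that in blast)
  show "dirichlet (%x. (w (r k) i x + w (r n) i x) / 2) > 0" if "qmass p (\<mu> i) (%x. (w (r k) i x + w (r n) i x) / 2) > 0" for k n
   using E_space_lincomb[OF wE[of "r k" i] wE[of "r n" i] _ N, of "1/2" "1/2"] p k[OF _ that] by (simp add: add_divide_distrib)
  show "(%n. dirichlet (w (r n) i)) \<longlonglongrightarrow> c i" by (rule sub[OF L(4)])
  show "dirichlet (w (r n) i) <= qmass p (\<mu> i) (w (r n) i)" for n by (rule L(2))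
  show "(LINT x|lborel. \<bar>w (r n) i x\<bar> powr (2 * real CARD('n) / (real CARD('n) - 2))) <= B" for n
   using B by (simp add: P_def)
  fix e :: real assume e: "e > 0"
  have "wmass (indicator (ball 0 1)) (2 * p) (%x. w (r k) i x - w (r n) i x) <= e"
   if le: "(\<integral>\<^sup>+x. ennreal (\<bar>w (r k) i x - w (r n) i x\<bar> powr (2 * p)) * indicator (ball 0 1) x \<partial>lborel) <= ennreal e" for k n
  proof -
   have h: "(%x. w (r k) i x - w (r n) i x) \<in> Lq (2 * p)"
    using Lq_lincomb[OF E_spaceD(2)[OF wE] E_spaceD(2)[OF wE], of 1 "r k" i "-1" "r n" i] p by simp
   have i: "integrable lborel (%x. indicator (ball 0 1) x * \<bar>w (r k) i x - w (r n) i x\<bar> powr (2 * p))"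
    by (rule wmass_integrable[OF indicator_weight h]) auto
   have "ennreal (wmass (indicator (ball 0 1)) (2 * p) (%x. w (r k) i x - w (r n) i x))
     = (\<integral>\<^sup>+x. ennreal (indicator (ball 0 1) x * \<bar>w (r k) i x - w (r n) i x\<bar> powr (2 * p)) \<partial>lborel)"
    unfolding wmass_def by (rule nn_integral_eq_integral[OF i, symmetric]) simp
   also have "... = (\<integral>\<^sup>+x. ennreal (\<bar>w (r k) i x - w (r n) i x\<bar> powr (2 * p)) * indicator (ball 0 1) x \<partial>lborel)"
    by (intro nn_integral_cong) (simp add: indicator_def)
   also note le
   finally show ?thesis using e by (simp add: ennreal_le_iff)
  qed
  then show "\<exists>n0. \<forall>k\<ge>n0. \<forall>n\<ge>n0. wmass (indicator (ball 0 1)) (2 * p) (%x. w (r k) i x - w (r n) i x) <= e"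
   using loc[OF e, of i] by meson
 qed (assumption+, (intro exI conjI; assumption))
 from choice[OF allI[OF this]] obtain W where W': "\<forall>i. W i \<in> natural_constraint p (\<mu> i) \<and> dirichlet (W i) = c i \<and>
  (%n. dirichlet (%x. w (r n) i x - W i x)) \<longlonglongrightarrow> 0 \<and> (%n. wmass (%_. 1) (2 * p) (%x. w (r n) i x - W i x)) \<longlonglongrightarrow> 0 \<and>
  ((\<forall>n. AE x in lborel. 0 <= w (r n) i x) --> (AE x in lborel. 0 <= W i x))"
  by (rule exE)
 note W = W'[THEN spec, THEN conjunct1] W'[THEN spec, THEN conjunct2, THEN conjunct1]
  W'[THEN spec, THEN conjunct2, THEN conjunct2, THEN conjunct1]
  W'[THEN spec, THEN conjunct2, THEN conjunct2, THEN conjunct2, THEN conjunct1]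
  W'[THEN spec, THEN conjunct2, THEN conjunct2, THEN conjunct2, THEN conjunct2, THEN mp]
 have WE: "W i \<in> E_space p" and Wnt: "nontrivial (W i)" for i using W(1)[of i] by (auto simp: natural_constraint_def)
 have W0: "AE x in lborel. 0 <= W i x" for i
  by (rule W(5)) (unfold w_def, intro allI AE_nonneg_resc H1_D(5)[OF vH] assms(11) e)
 have conv: "tendsto_in_E p (%n. w_resc (r n) i) (W i)" for i
  unfolding w_eq by (rule tendsto_in_E_I[OF wE WE p(1) W(3,4)])
 have least: "least_energy_limit p (\<mu> i) (W i)" for i
  by (rule minimizer_least_energy[OF lb L(3) p(1) m N W(1,2)])
 have pos: "AE x in lborel. 0 < W i x" for i
  by (rule strong_maximum_principle[OF N p(1) m WE W0 Wnt]) (rule minimizer_Euler_Lagrange[OF lb L(3) p(1) m N W(1,2)])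
 have er: "(%n. eps (r n)) \<longlonglongrightarrow> 0" by (rule sub[OF e0])
 have E: "(%n. (LINT x:cball (y i) \<delta>|lborel. ((norm (weak_grad (v (r n) i) x))^2 + (v (r n) i x)^2))
     / (LINT x|lborel. ((norm (weak_grad (v (r n) i) x))^2 + (v (r n) i x)^2))) \<longlonglongrightarrow> 1" if \<delta>: "\<delta> > 0" for \<delta> i
 proof -
  \<comment> \<open>Numerator and denominator are multiplied by the same \<open>resc_factor\<close>,
    so the concentration ratio may be computed for the rescaled functions.\<close>
  have "wenergy 1 (indicator (cball (y i) \<delta>)) (v n i) / wenergy 1 (%_. 1) (v n i)
    = wenergy (eps n) (indicator (cball 0 (\<delta> / eps n))) (w n i) / wenergy (eps n) (%_. 1) (w n i)" for n
   unfolding w_def cball_resc[OF e, of \<delta> n "y i"]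
   by (intro ratio_scale[OF wenergy_resc wenergy_resc resc_factor_pos] vH e p(1) indicator_weight(1) borel_measurable_const cball_borel)
  then show ?thesis
   using energy_concentration[OF L(1) E_spaceD(1)[OF WE] W(3) e er \<delta> sub[OF L(5)]] L(3) W(2)
   by (simp add: wenergy_def set_lebesgue_integral_def)
 qed
 have M: "(%n. (LINT x:cball (y i) \<delta>|lborel. \<bar>v (r n) i x\<bar> powr (2 * p))
     / (LINT x|lborel. \<bar>v (r n) i x\<bar> powr (2 * p))) \<longlonglongrightarrow> 1" if \<delta>: "\<delta> > 0" for \<delta> i
 proof -
  have "wmass (indicator (cball (y i) \<delta>)) (2 * p) (v n i) / wmass (%_. 1) (2 * p) (v n i)
    = wmass (indicator (cball 0 (\<delta> / eps n))) (2 * p) (w n i) / wmass (%_. 1) (2 * p) (w n i)" for n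
   unfolding w_def cball_resc[OF e, of \<delta> n "y i"]
   by (intro ratio_scale[OF wmass_resc wmass_resc resc_factor_pos] H1_D(5)[OF vH] e p(1) indicator_weight(1) borel_measurable_const cball_borel)
  then show ?thesis
   using mass_concentration[OF E_spaceD(2)[OF wE] E_spaceD(2)[OF WE] _ W(4) e er \<delta> Wnt] p
   by (simp add: wmass_def set_lebesgue_integral_def)
 qed
 show ?thesis using r conv least pos E M by blast
qed

end
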